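(* Let $\ell>0$, let $(u,\mu)\in\mathcal{D}_{\mathrm{per}}$ and let $a\in\mathbb{R}$. Let $\sigma_+$ and $\sigma_-$ be the periodic and the antiperiodic spectrum of the differential equation $-f''+\frac14 f=z\,\omega f+z^2\upsilon f$ associated with $(u,\mu)$. Fix a choice of sign (upper signs for the periodic case, lower signs for the antiperiodic case) and suppose that $\sigma_\pm\subseteq(0,\infty)$. Then for every $\lambda\in\sigma_\pm$ one has $$\frac{1}{\lambda}\le\frac{\sinh(\ell/2)}{\cosh(\ell/2)\mp1}\int_a^{a+\ell}u(x)\,dx.$$
   Context: Borel measures on $\mathbb{R}$ are assumed finite on compact sets. Fix $\ell>0$. $H^1_{\mathrm{loc}}(\mathbb{R})$ is the space of locally absolutely continuous functions with locally square integrable derivative, and $H^1_{\mathrm{c}}(\mathbb{R})$ the subspace of those with compact support. $\mathcal{D}_{\mathrm{per}}$ is the set of all pairs $(u,\mu)$ such that $u$ is an $\ell$-periodic real-valued function in $H^1_{\mathrm{loc}}(\mathbb{R})$ and $\mu$ is an $\ell$-periodic non-negative Borel measure on $\mathbb{R}$ with $\mu(B)\ge\int_B u(x)^2+u'(x)^2\,dx$ for every Borel set $B\subseteq\mathbb{R}$. With $(u,\mu)$ one associates the distribution $\omega(h)=\int_{\mathbb{R}}u h\,dx+\int_{\mathbb{R}}u'h'\,dx$, $h\in H^1_{\mathrm{c}}(\mathbb{R})$ (i.e. $\omega=u-u''$), and the $\ell$-periodic non-negative Borel measure $\upsilon$ given by $\mu(B)=\int_B u(x)^2+u'(x)^2\,dx+\upsilon(B)$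 for all Borel sets $B$. For $z\in\mathbb{C}$, a solution of $$-f''+\tfrac14 f=z\,\omega f+z^2\upsilon f\qquad(\mathrm{E})$$ is a (complex-valued) function $f\in H^1_{\mathrm{loc}}(\mathbb{R})$ with $\int_{\mathbb{R}}f'h'\,dx+\frac14\int_{\mathbb{R}}fh\,dx=z\,\omega(fh)+z^2\int_{\mathbb{R}}fh\,d\upsilon$ for all $h\in H^1_{\mathrm{c}}(\mathbb{R})$. For each solution $f$ there is a unique left-continuous function $f^{[1]}$ (the quasi-derivative) with $f^{[1]}=f'-zu'f$ almost everywhere. The periodic spectrum $\sigma_+$ (resp. antiperiodic spectrum $\sigma_-$) is the set of $z\in\mathbb{C}$ for which (E) has a nontrivial solution $f$ with $(f(a),f^{[1]}(a))=\pm(f(a+\ell),f^{[1]}(a+\ell))$, with sign $+$ (resp. $-$). These spectra do not depend on the base point $a$, and they consist of non-zero real numbers. *)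

theory Defs
  imports "HOL-Analysis.Analysis"
begin

definition abs_cont_on :: "real \<Rightarrow> real \<Rightarrow> (real \<Rightarrow> 'a::real_normed_vector) \<Rightarrow> bool" where
  "abs_cont_on a b f \<longleftrightarrow>
    (\<forall>\<epsilon>>0. \<exists>\<delta>>0. \<forall>(n::nat) s t.
       (\<forall>i<n. a \<le> s i \<and> s i \<le> t i \<and> t i \<le> b) \<and>
       disjoint_family_on (\<lambda>i. {s i<..<t i}) {..<n} \<and>
       (\<Sum>i<n. t i - s i) < \<delta> \<longrightarrow>
       (\<Sum>i<n. norm (f (t i) - f (s i))) < \<epsilon>)"

(* A locally absolutely continuous function is differentiable almost everywhere, so the
   arbitrary value of vector_derivative at the remaining points does not matter: it is only
   used under integrals or almost everywhere with respect to Lebesgue measure. *)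
abbreviation vderiv :: "(real \<Rightarrow> 'a::real_normed_vector) \<Rightarrow> real \<Rightarrow> 'a" where
  "vderiv f x \<equiv> vector_derivative f (at x)"

definition H1_loc :: "(real \<Rightarrow> 'a::real_normed_vector) set" where
  "H1_loc = {f. \<forall>a b. abs_cont_on a b f \<and>
                set_integrable lebesgue {a..b} (\<lambda>x. (norm (vderiv f x))\<^sup>2)}"

definition H1_c :: "(real \<Rightarrow> 'a::real_normed_vector) set" where
  "H1_c = {h \<in> H1_loc. compact (closure {x. h x \<noteq> 0})}"

definition borel_measure :: "real measure \<Rightarrow> bool" where
  "borel_measure \<mu> \<longleftrightarrow> sets \<mu> = sets borel \<and> (\<forall>K. compact K \<longrightarrow> emeasure \<mu> K < \<infinity>)"

definition energy :: "(real \<Rightarrow> real) \<Rightarrow> real set \<Rightarrow> ennreal" where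
  "energy u B = (\<integral>\<^sup>+x\<in>B. ennreal ((u x)\<^sup>2 + (vderiv u x)\<^sup>2) \<partial>lebesgue)"

definition D_per :: "real \<Rightarrow> ((real \<Rightarrow> real) \<times> real measure) set" where
  "D_per l = {(u, \<mu>).
     u \<in> H1_loc \<and> (\<forall>x. u (x + l) = u x) \<and>
     borel_measure \<mu> \<and> (\<forall>B\<in>sets borel. emeasure \<mu> ((\<lambda>x. x + l) ` B) = emeasure \<mu> B) \<and>
     (\<forall>B\<in>sets borel. energy u B \<le> emeasure \<mu> B)}"

definition omega :: "(real \<Rightarrow> real) \<Rightarrow> (real \<Rightarrow> complex) \<Rightarrow> complex" where
  "omega u h = (LINT x|lebesgue. of_real (u x) * h x)
             + (LINT x|lebesgue. of_real (vderiv u x) * vderiv h x)"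

definition upsilon :: "(real \<Rightarrow> real) \<Rightarrow> real measure \<Rightarrow> real measure" where
  "upsilon u \<mu> = (THE \<upsilon>. borel_measure \<upsilon> \<and>
     (\<forall>B\<in>sets borel. emeasure \<mu> B = energy u B + emeasure \<upsilon> B))"

definition is_solution ::
  "(real \<Rightarrow> real) \<Rightarrow> real measure \<Rightarrow> complex \<Rightarrow> (real \<Rightarrow> complex) \<Rightarrow> bool" where
  "is_solution u \<mu> z f \<longleftrightarrow> f \<in> H1_loc \<and>
     (\<forall>h\<in>H1_c. (LINT x|lebesgue. vderiv f x * vderiv h x) + 1/4 * (LINT x|lebesgue. f x * h x)
        = z * omega u (\<lambda>x. f x * h x) + z\<^sup>2 * (LINT x|upsilon u \<mu>. f x * h x))"

definition quasi_deriv ::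
  "(real \<Rightarrow> real) \<Rightarrow> complex \<Rightarrow> (real \<Rightarrow> complex) \<Rightarrow> real \<Rightarrow> complex" where
  "quasi_deriv u z f = (THE g. (\<forall>x. continuous (at_left x) g) \<and>
     (AE x in lebesgue. g x = vderiv f x - z * of_real (vderiv u x) * f x))"

(* The sign s is 1 for the periodic and -1 for the antiperiodic spectrum; a is the base point. *)
definition spectrum_pm ::
  "real \<Rightarrow> real \<Rightarrow> real \<Rightarrow> (real \<Rightarrow> real) \<Rightarrow> real measure \<Rightarrow> complex set" where
  "spectrum_pm s a l u \<mu> = {z. \<exists>f. is_solution u \<mu> z f \<and> (\<exists>x. f x \<noteq> 0) \<and>
     f a = of_real s * f (a + l) \<and>
     quasi_deriv u z f a = of_real s * quasi_deriv u z f (a + l)}"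

lemma abs_cont_on_imp_continuous_on:
  assumes "abs_cont_on a b f"
  shows "continuous_on {a..b} f"
proof (unfold continuous_on_iff, intro ballI allI impI)
  fix x and e :: real assume x: "x \<in> {a..b}" and e: "e > 0"
  obtain d where d: "d > 0" and
    D: "\<forall>(n::nat) s t. (\<forall>i<n. a \<le> s i \<and> s i \<le> t i \<and> t i \<le> b) \<and>
       disjoint_family_on (\<lambda>i. {s i<..<t i}) {..<n} \<and>
       (\<Sum>i<n. t i - s i) < d \<longrightarrow> (\<Sum>i<n. norm (f (t i) - f (s i))) < e"
    using mp[OF spec[OF assms[unfolded abs_cont_on_def]] e] by (elim exE conjE)
  have "dist (f y) (f x) < e" if y: "y \<in> {a..b}" "dist y x < d" for y
  proof -
    have "(\<Sum>i<1::nat. norm (f (max x y) - f (min x y))) < e"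
    proof (rule D[THEN spec, THEN spec, THEN spec, THEN mp], intro conjI)
      show "disjoint_family_on (\<lambda>i. {min x y<..<max x y}) {..<1::nat}"
        by (simp add: disjoint_family_on_def)
      show "(\<Sum>i<1::nat. max x y - min x y) < d"
        using y(2) by (simp add: dist_real_def max_def min_def abs_if split: if_splits)
    qed (use x y in simp)
    then show ?thesis
      by (cases "x \<le> y") (simp_all add: dist_norm max_def min_def norm_minus_commute)
  qed
  then show "\<exists>d>0. \<forall>x'\<in>{a..b}. dist x' x < d \<longrightarrow> dist (f x') (f x) < e"
    using d by blast
qed

lemma H1_loc_continuous:
  assumes "f \<in> H1_loc"
  shows "continuous_on UNIV f"
proof -
  have "isCont f x" for x
  proof (rule continuous_on_interior)
    have "abs_cont_on (x - 1) (x + 1) f"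
      using assms unfolding H1_loc_def by blast
    then show "continuous_on {x - 1..x + 1} f"
      by (rule abs_cont_on_imp_continuous_on)
  qed simp
  then show ?thesis by (simp add: continuous_at_imp_continuous_on)
qed

lemma H1_loc_sq_deriv_measurable:
  assumes "f \<in> H1_loc"
  shows "(\<lambda>x. (norm (vderiv f x))\<^sup>2) \<in> borel_measurable lebesgue"
proof -
  let ?g = "\<lambda>x. (norm (vderiv f x))\<^sup>2"
  have m: "(\<lambda>x. indicator {-real n..real n} x *\<^sub>R ?g x) \<in> borel_measurable lebesgue" for n
    using assms by (auto simp: H1_loc_def set_integrable_def)
  show ?thesis
  proof (rule borel_measurable_LIMSEQ_real[OF _ m])
    fix x :: real
    obtain N where N: "\<bar>x\<bar> \<le> real N" using real_arch_simple by blast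
    have "eventually (\<lambda>n. indicator {-real n..real n} x *\<^sub>R ?g x = ?g x) sequentially"
      using eventually_ge_at_top[of N] by eventually_elim (use N in \<open>auto simp: indicator_def\<close>)
    then show "(\<lambda>n. indicator {-real n..real n} x *\<^sub>R ?g x) \<longlonglongrightarrow> ?g x"
      by (rule tendsto_eventually)
  qed
qed

lemma Un_Icc_real: "(\<Union>n. {-real n..real n}) = UNIV"
proof -
  have "\<exists>n. x \<in> {-real n..real n}" for x
  proof -
    obtain n where "\<bar>x\<bar> \<le> real n" using real_arch_simple by blast
    then have "x \<in> {-real n..real n}" by auto
    then show ?thesis by blast
  qed
  then show ?thesis by blast
qed

lemma upsilon_unique:
  assumes mu: "borel_measure \<mu>"
    and 1: "borel_measure \<upsilon>1" "\<And>B. B \<in> sets borel \<Longrightarrow> emeasure \<mu> B = energy u B + emeasure \<upsilon>1 B"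
    and 2: "borel_measure \<upsilon>2" "\<And>B. B \<in> sets borel \<Longrightarrow> emeasure \<mu> B = energy u B + emeasure \<upsilon>2 B"
  shows "\<upsilon>1 = \<upsilon>2"
proof (rule measure_eqI_generator_eq[where E = "range (\<lambda>(c, d). {c..d::real})" and \<Omega> = UNIV
      and A = "\<lambda>n. {-real n..real n}"])
  show "Int_stable (range (\<lambda>(c, d). {c..d::real}))"
    by (auto simp: Int_stable_def)
  have s: "sets borel = sigma_sets UNIV (range (\<lambda>(c, d). {c..d::real}))"
    by (subst borel_eq_atLeastAtMost) (simp add: sets_measure_of)
  then show "sets \<upsilon>1 = sigma_sets UNIV (range (\<lambda>(c, d). {c..d::real}))"
    "sets \<upsilon>2 = sigma_sets UNIV (range (\<lambda>(c, d). {c..d::real}))"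
    using 1(1) 2(1) by (auto simp: borel_measure_def)
  show "emeasure \<upsilon>1 X = emeasure \<upsilon>2 X" if "X \<in> range (\<lambda>(c, d). {c..d::real})" for X
  proof -
    from that have X: "X \<in> sets borel" "compact X" by auto
    with mu have "emeasure \<mu> X < \<infinity>" by (auto simp: borel_measure_def)
    then have "energy u X < \<infinity>" "energy u X + emeasure \<upsilon>1 X = energy u X + emeasure \<upsilon>2 X"
      using 1(2)[OF X(1)] 2(2)[OF X(1)] by (auto simp: less_top)
    then show ?thesis by (auto simp: ennreal_add_left_cancel less_top)
  qed
  show "(\<Union>n. {-real n..real n}) = UNIV"
    by (rule Un_Icc_real)
  show "emeasure \<upsilon>1 {-real n..real n} \<noteq> \<infinity>" for n
  proof -
    have "emeasure \<upsilon>1 {-real n..real n} < \<infinity>"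
      using 1(1) compact_Icc unfolding borel_measure_def by blast
    then show ?thesis by simp
  qed
qed auto

lemma upsilon_exists:
  assumes "(u, \<mu>) \<in> D_per l"
  shows "\<exists>\<upsilon>. borel_measure \<upsilon> \<and> (\<forall>B\<in>sets borel. emeasure \<mu> B = energy u B + emeasure \<upsilon> B)"
proof -
  from assms have u: "u \<in> H1_loc" and mu: "borel_measure \<mu>"
    and le: "\<And>B. B \<in> sets borel \<Longrightarrow> energy u B \<le> emeasure \<mu> B"
    by (auto simp: D_per_def)
  from mu have sets [measurable_cong, simp]: "sets \<mu> = sets borel" by (simp add: borel_measure_def)
  then have space [simp]: "space \<mu> = UNIV" by (metis sets_eq_imp_space_eq space_borel)
  have fin: "emeasure \<mu> {-real n..real n} < \<infinity>" for n
    using mu by (auto simp: borel_measure_def)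
  have cover: "(\<Union>n. {-real n..real n}) = UNIV"
    by (rule Un_Icc_real)
  interpret sigma_finite_measure \<mu>
  proof
    show "\<exists>A. countable A \<and> A \<subseteq> sets \<mu> \<and> \<Union>A = space \<mu> \<and> (\<forall>a\<in>A. emeasure \<mu> a \<noteq> \<infinity>)"
      using cover fin by (intro exI[of _ "range (\<lambda>n. {-real n..real n})"]) (auto simp: less_top)
  qed
  define w where "w = (\<lambda>x. ennreal ((u x)\<^sup>2 + (vderiv u x)\<^sup>2))"
  have "u \<in> borel_measurable borel"
    using H1_loc_continuous[OF u] by (rule borel_measurable_continuous_onI)
  then have "u \<in> borel_measurable lebesgue"
    by (simp add: measurable_completion)
  moreover have "(\<lambda>x. (vderiv u x)\<^sup>2) \<in> borel_measurable lebesgue"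
    using H1_loc_sq_deriv_measurable[OF u] by simp
  ultimately have w: "w \<in> borel_measurable lebesgue"
    unfolding w_def by measurable
  define \<nu> where "\<nu> = distr (density lebesgue w) borel (\<lambda>x. x)"
  have id: "(\<lambda>x. x) \<in> measurable (density lebesgue w) borel"
    by (auto simp: measurable_def)
  have nu: "emeasure \<nu> B = energy u B" if "B \<in> sets borel" for B
  proof -
    have "emeasure \<nu> B = emeasure (density lebesgue w) B"
      unfolding \<nu>_def using emeasure_distr[OF id that] by simp
    also have "\<dots> = energy u B"
      using that w by (subst emeasure_density) (auto simp: energy_def w_def)
    finally show ?thesis .
  qed
  have "absolutely_continuous \<mu> \<nu>"
    using le by (auto simp: absolutely_continuous_def null_sets_def \<nu>_def[symmetric] nu)
      (auto simp: \<nu>_def nu[unfolded \<nu>_def] dest: le)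
  then obtain g where g [measurable]: "g \<in> borel_measurable \<mu>" and dens: "density \<mu> g = \<nu>"
    using Radon_Nikodym[of \<nu>] by (auto simp: \<nu>_def)
  have nu_g: "energy u B = (\<integral>\<^sup>+x\<in>B. g x \<partial>\<mu>)" if "B \<in> sets borel" for B
    using nu[OF that] that by (simp add: dens[symmetric] emeasure_density)
  have "AE x in \<mu>. \<forall>n. x \<in> {-real n..real n} \<longrightarrow> g x \<le> 1"
  proof (subst AE_all_countable, intro allI)
    fix n
    define A where "A = {x \<in> space \<mu>. x \<in> {-real n..real n} \<and> g x > 1}"
    have A [measurable]: "A \<in> sets \<mu>" unfolding A_def by measurable
    have Afin: "emeasure \<mu> A < \<infinity>"
    proof (rule le_less_trans)
      show "emeasure \<mu> A \<le> emeasure \<mu> {-real n..real n}"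
        by (rule emeasure_mono) (auto simp: A_def)
    qed (rule fin)
    have "emeasure \<mu> A + (\<integral>\<^sup>+x. (g x - 1) * indicator A x \<partial>\<mu>)
        = (\<integral>\<^sup>+x. indicator A x + (g x - 1) * indicator A x \<partial>\<mu>)"
      by (subst nn_integral_add) (use A in auto)
    also have "\<dots> = (\<integral>\<^sup>+x\<in>A. g x \<partial>\<mu>)"
      by (intro nn_integral_cong) (auto simp: A_def indicator_def add_diff_inverse_ennreal)
    also have "\<dots> \<le> emeasure \<mu> A"
      using nu_g[of A] le[of A] A by simp
    finally have "emeasure \<mu> A + (\<integral>\<^sup>+x. (g x - 1) * indicator A x \<partial>\<mu>) \<le> emeasure \<mu> A + 0" by simp
    then have "(\<integral>\<^sup>+x. (g x - 1) * indicator A x \<partial>\<mu>) = 0"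
      using Afin by (subst (asm) ennreal_add_left_cancel_le) auto
    then have "AE x in \<mu>. (g x - 1) * indicator A x = 0"
      by (subst (asm) nn_integral_0_iff_AE) auto
    then show "AE x in \<mu>. x \<in> {-real n..real n} \<longrightarrow> g x \<le> 1"
      by eventually_elim
        (auto simp: A_def indicator_def diff_eq_0_iff_ennreal split: if_splits dest: leI)
  qed
  then have g1: "AE x in \<mu>. g x \<le> 1"
    by eventually_elim (use cover in blast)
  define \<upsilon> where "\<upsilon> = density \<mu> (\<lambda>x. 1 - g x)"
  have eq: "emeasure \<mu> B = energy u B + emeasure \<upsilon> B" if B: "B \<in> sets borel" for B
  proof -
    have [measurable]: "B \<in> sets \<mu>" using B by simp
    have "energy u B + emeasure \<upsilon> B = (\<integral>\<^sup>+x. g x * indicator B x + (1 - g x) * indicator B x \<partial>\<mu>)"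
      using B by (subst nn_integral_add) (auto simp: nu_g \<upsilon>_def emeasure_density)
    also have "\<dots> = (\<integral>\<^sup>+x. indicator B x \<partial>\<mu>)"
      using g1 by (intro nn_integral_cong_AE, eventually_elim)
        (auto simp: indicator_def add_diff_inverse_ennreal)
    finally show ?thesis using B by simp
  qed
  have "borel_measure \<upsilon>"
    unfolding borel_measure_def
  proof (intro conjI allI impI)
    show "sets \<upsilon> = sets borel" by (simp add: \<upsilon>_def)
    fix K :: "real set" assume K: "compact K"
    then have "emeasure \<upsilon> K \<le> emeasure \<mu> K" using eq[of K] by (simp add: borel_compact)
    also have "\<dots> < \<infinity>" using mu K by (auto simp: borel_measure_def)
    finally show "emeasure \<upsilon> K < \<infinity>" .
  qed
  with eq show ?thesis by blast
qed

lemma upsilon: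
  assumes "(u, \<mu>) \<in> D_per l"
  shows "borel_measure (upsilon u \<mu>)"
    and "B \<in> sets borel \<Longrightarrow> emeasure \<mu> B = energy u B + emeasure (upsilon u \<mu>) B"
proof -
  have mu: "borel_measure \<mu>" using assms by (auto simp: D_per_def)
  obtain v where v: "borel_measure v"
      "\<forall>B\<in>sets borel. emeasure \<mu> B = energy u B + emeasure v B"
    using upsilon_exists[OF assms] by blast
  have "borel_measure (upsilon u \<mu>) \<and>
      (\<forall>B\<in>sets borel. emeasure \<mu> B = energy u B + emeasure (upsilon u \<mu>) B)"
    unfolding upsilon_def
  proof (rule theI[of _ v])
    show "x = v" if "borel_measure x \<and> (\<forall>B\<in>sets borel. emeasure \<mu> B = energy u B + emeasure x B)" for x
      by (rule upsilon_unique[OF mu, of _ u]) (use that v in auto)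
  qed (use v in simp)
  then show "borel_measure (upsilon u \<mu>)"
    and "B \<in> sets borel \<Longrightarrow> emeasure \<mu> B = energy u B + emeasure (upsilon u \<mu>) B" by auto
qed

end

theory Submission
  imports Defs "HOL-Complex_Analysis.Great_Picard"
begin

text \<open>The problem has the same real eigenvalues on real functions, with the space \<open>P\<close> of real \<open>H\<^sup>1\<close>
  functions satisfying \<open>f (x + l) = s * f x\<close> and the form
  \<open>Q z f = \<integral>f'\<^sup>2 + f\<^sup>2/4 - z * \<omega>(f\<^sup>2) - z\<^sup>2 * \<integral>f\<^sup>2 d\<upsilon>\<close> over one period. If \<open>Q (-t)\<close> is negative
  somewhere on \<open>P\<close> for some \<open>t > 0\<close>, then at the infimum of such \<open>t\<close> a minimising sequence converges,
  by Arzela-Ascoli, to a nonzero null vector of a nonnegative form, that is, to an eigenfunction for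
  the eigenvalue \<open>-t \<le> 0\<close>. So if all eigenvalues are positive, then \<open>Q (-t) \<ge> 0\<close> for all \<open>t \<ge> 0\<close>, and
  \<open>t \<rightarrow> \<infinity>\<close> yields \<open>\<integral>f\<^sup>2 d\<upsilon> = 0\<close> and \<open>\<omega>(f\<^sup>2) \<ge> 0\<close> on \<open>P\<close>. Let \<open>f\<close> be an eigenfunction for \<open>z > 0\<close>
  and \<open>M = sup f\<^sup>2\<close>. Since \<open>M - f\<^sup>2\<close> is, up to regularisation, a sum of squares from \<open>P\<close>,
  \<open>\<integral>f'\<^sup>2 + f\<^sup>2/4 = z * \<omega>(f\<^sup>2) \<le> z * M * \<integral>u\<close>. The sharp Sobolev inequality bounds \<open>M\<close> by
  \<open>sinh (l/2) / (cosh (l/2) - s)\<close> times the left-hand side, which is the claim.\<close>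

subsection \<open>Absolutely continuous functions\<close>

text \<open>The constant sinh (l/2) / (cosh (l/2) - s) is the diagonal value of the Green function
  of -f'' + f/4 under f (x + l) = s f x, that is, the sum of s^k exp (-|k| l/2) over all integers k;
  hence its appearance in the sharp Sobolev inequality. The spectrum only compares \<open>f\<close>
  and its quasi-derivative at \<open>a\<close> and \<open>a + l\<close>. Membership in
  \<open>P\<close> follows because f (x + l) - s f x solves the equation with zero initial data, so
  unique solvability is required, although \<upsilon> may have atoms. Derivatives enter as pointwise
  values that are meaningful only almost everywhere. Differentiability almost everywhere and the
  fundamental theorem of calculus are therefore derived from the epsilon-delta form of absolute
  continuity. Convergence of the minimising sequence is strong: form and energy differ by terms that
  are small on uniformly small functions of bounded energy, so the parallelogram law makes the
  sequence Cauchy in energy, and the limit cannot vanish. Since only real z matter, real and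
  imaginary parts of a solution are solutions themselves.\<close>

lemma sum_division_telescope:
  fixes f :: "real \<Rightarrow> 'a::real_normed_vector"
  assumes "a \<le> b" and D: "D division_of {a..b}"
  shows "(\<Sum>K\<in>D. f (Sup K) - f (Inf K)) = f b - f a"
proof -
  have D': "D division_of cbox a b" using D by simp
  have K: "\<exists>p q. p \<le> q \<and> K = {p..q} \<and> K \<subseteq> {a..b}" if "K \<in> D" for K
    using division_ofD(2,3,4)[OF D that] by (metis atLeastatMost_empty' box_real(2) not_le)
  have inf: "Inf K \<in> K" if "K \<in> D" for K using K[OF that] by auto
  let ?p = "(\<lambda>K. (Inf K, K)) ` D"
  have t: "?p tagged_division_of {a..b}"
  proof (rule tagged_division_ofI)
    show "finite ?p" using D by auto
  next
    fix x M assume xm: "(x, M) \<in> ?p"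
    then have M: "M \<in> D" "x = Inf M" by auto
    then show "x \<in> M" using inf by simp
    show "M \<subseteq> {a..b}" "\<exists>a b. M = cbox a b"
      using K[OF M(1)] unfolding cbox_interval by blast+
  next
    fix x1 K1 x2 K2 assume "(x1, K1) \<in> ?p" "(x2, K2) \<in> ?p" "(x1, K1) \<noteq> (x2, K2)"
    then show "interior K1 \<inter> interior K2 = {}" using division_ofD(5)[OF D] by auto
  next
    show "\<Union> {K. \<exists>x. (x, K) \<in> ?p} = {a..b}"
      unfolding division_ofD(6)[OF D, symmetric] by blast
  qed
  have "(\<Sum>K\<in>D. f (Sup K) - f (Inf K)) = (\<Sum>(x,K)\<in>?p. f (Sup K) - f (Inf K))"
    by (subst sum.reindex) (simp_all add: inj_on_def)
  also have "\<dots> = f b - f a"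
    using additive_tagged_division_1[OF assms(1) t] .
  finally show ?thesis .
qed

lemma division_intervalD:
  fixes a b :: real
  assumes "D division_of {a..b}" "K \<in> D"
  obtains p q where "K = {p..q}" "p \<le> q" "a \<le> p" "q \<le> b" "Inf K = p" "Sup K = q"
proof -
  obtain p q where pq: "K = cbox p q" using division_ofD(4)[OF assms] by auto
  moreover have "K \<noteq> {}" "K \<subseteq> {a..b}" using division_ofD(2,3)[OF assms] by auto
  ultimately show ?thesis using that[of p q] by auto
qed

text \<open>The disjoint intervals of \<open>C\<close> extend to a division of [p, q]. For monotone
  \<open>G\<close> the added pieces have nonnegative increments, and the sum over the whole division
  telescopes.\<close>

lemma sum_increments_le:
  fixes G :: "real \<Rightarrow> real"
  assumes fin: "finite C"
    and C: "\<And>i. i \<in> C \<Longrightarrow> fst i < snd i \<and> {fst i..snd i} \<subseteq> {p..q}"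
    and disj: "pairwise (\<lambda>i j. disjnt {fst i..snd i} {fst j..snd j}) C"
    and mono: "\<And>x y. p \<le> x \<Longrightarrow> x \<le> y \<Longrightarrow> y \<le> q \<Longrightarrow> G x \<le> G y"
    and "p \<le> q"
  shows "(\<Sum>i\<in>C. G (snd i) - G (fst i)) \<le> G q - G p"
proof -
  let ?I = "\<lambda>i. {fst i..snd i::real}"
  have inj: "inj_on ?I C"
    using C by (force intro!: inj_onI simp: prod_eq_iff Icc_eq_Icc)
  have "(?I ` C) division_of \<Union>(?I ` C)"
    unfolding division_of_def
  proof (intro conjI ballI impI)
    fix K1 K2 assume "K1 \<in> ?I ` C" "K2 \<in> ?I ` C" "K1 \<noteq> K2"
    then have "disjnt K1 K2" using disj by (auto simp: pairwise_def)
    then show "interior K1 \<inter> interior K2 = {}"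
      using interior_subset by (fastforce simp: disjnt_def)
  next
    fix K assume K: "K \<in> ?I ` C"
    then show "K \<subseteq> \<Union> (?I ` C)" by blast
    show "K \<noteq> {}" using K C by force
    show "\<exists>a b. K = cbox a b" using K by auto
  qed (use fin in auto)
  moreover have "\<Union>(?I ` C) \<subseteq> cbox p q" using C by fastforce
  ultimately obtain D where sub: "?I ` C \<subseteq> D" and D: "D division_of cbox p q"
    by (rule partial_division_extend_interval)
  then have D': "D division_of {p..q}" by simp
  have nn: "0 \<le> G (Sup K) - G (Inf K)" if "K \<in> D" for K
    using division_intervalD[OF D' that] mono by (metis diff_ge_0_iff_ge)
  have "(\<Sum>i\<in>C. G (snd i) - G (fst i)) = (\<Sum>i\<in>C. G (Sup (?I i)) - G (Inf (?I i)))"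
    using C by (intro sum.cong) (auto simp: less_imp_le)
  also have "\<dots> = (\<Sum>K\<in>?I ` C. G (Sup K) - G (Inf K))"
    by (subst sum.reindex[OF inj]) simp
  also have "\<dots> \<le> (\<Sum>K\<in>D. G (Sup K) - G (Inf K))"
    using sub D nn by (intro sum_mono2) auto
  also have "\<dots> = G q - G p"
    by (rule sum_division_telescope[OF \<open>p \<le> q\<close> D'])
  finally show ?thesis .
qed

section \<open>Almost everywhere differentiability via the Vitali covering theorem\<close>

text \<open>Vitali covering yields countably many disjoint admissible intervals that cover
  \<open>E\<close> up to a null set; their union is controlled through its finite subfamilies, to
  which \<open>bound\<close> applies. The intervals need only contain the point rather than be
  centred at it, which suits slopes over straddling intervals.\<close>

lemma Vitali_measure_bound:
  fixes E :: "real set"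
  assumes cover: "\<And>x d. x \<in> E \<Longrightarrow> d > 0 \<Longrightarrow> \<exists>s t. s \<le> x \<and> x \<le> t \<and> s < t \<and> t - s < d \<and> P s t"
    and bound: "\<And>C. finite C \<Longrightarrow> (\<And>i. i \<in> C \<Longrightarrow> fst i < snd i \<and> P (fst i) (snd i)) \<Longrightarrow>
        pairwise (\<lambda>i j. disjnt {fst i..snd i} {fst j..snd j}) C \<Longrightarrow> (\<Sum>i\<in>C. snd i - fst i) \<le> B"
  shows "\<exists>T. E \<subseteq> T \<and> T \<in> lmeasurable \<and> measure lebesgue T \<le> B"
proof -
  define K where "K = {i. fst i < snd i \<and> P (fst i) (snd i)}"
  let ?m = "\<lambda>i::real\<times>real. (fst i + snd i) / 2" and ?r = "\<lambda>i::real\<times>real. (snd i - fst i) / 2"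
  have cb: "cball (?m i) (?r i) = {fst i..snd i}" if "fst i < snd i" for i
    by (auto simp: cball_eq_atLeastAtMost field_simps)
  obtain C where C: "countable C" "C \<subseteq> K"
     "pairwise (\<lambda>i j. disjnt (cball (?m i) (?r i)) (cball (?m j) (?r j))) C"
     "negligible (E - (\<Union>i\<in>C. cball (?m i) (?r i)))"
  proof (rule Vitali_covering_theorem_cballs[of K ?r E ?m])
    fix x and d :: real assume "x \<in> E" "0 < d"
    then obtain s t where st: "s \<le> x" "x \<le> t" "s < t" "t - s < d" "P s t" using cover by blast
    then have "(s, t) \<in> K \<and> x \<in> cball (?m (s, t)) (?r (s, t)) \<and> ?r (s, t) < d"
      using cb[of "(s, t)"] by (auto simp: K_def)
    then show "\<exists>i. i \<in> K \<and> x \<in> cball (?m i) (?r i) \<and> ?r i < d" by blast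
  qed (auto simp: K_def)
  have ms: "measure lebesgue (\<Union>i\<in>C'. cball (?m i) (?r i)) \<le> B" if C': "C' \<subseteq> C" "finite C'" for C'
  proof -
    have K': "\<And>i. i \<in> C' \<Longrightarrow> fst i < snd i \<and> P (fst i) (snd i)" using C C' by (auto simp: K_def)
    have "pairwise (\<lambda>i j. disjnt {fst i..snd i} {fst j..snd j}) C'"
      using pairwise_subset[OF C(3) C'(1)] K' by (auto simp: pairwise_def cb)
    then have B: "(\<Sum>i\<in>C'. snd i - fst i) \<le> B"
      using bound[OF C'(2) K'] by blast
    have "measure lebesgue (\<Union>i\<in>C'. cball (?m i) (?r i)) \<le> (\<Sum>i\<in>C'. measure lebesgue (cball (?m i) (?r i)))"
      by (rule measure_UNION_le) (use C' in auto)
    also have "\<dots> = (\<Sum>i\<in>C'. snd i - fst i)"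
      using K' by (intro sum.cong) (auto simp: cb less_imp_le)
    finally show ?thesis using B by simp
  qed
  let ?U = "\<Union>i\<in>C. cball (?m i) (?r i)"
  have 1: "?U \<in> lmeasurable" by (rule fmeasurable_UN_bound[OF C(1) _ ms]) auto
  have 2: "measure lebesgue ?U \<le> B" by (rule measure_UN_bound[OF C(1) _ ms]) auto
  have nl: "E - ?U \<in> lmeasurable" "measure lebesgue (E - ?U) = 0"
    using C(4) negligible_imp_measurable negligible_imp_measure0 by blast+
  have "measure lebesgue (?U \<union> (E - ?U)) \<le> B"
    using measure_Un_le[of ?U lebesgue "E - ?U"] 1 2 nl by (auto dest: fmeasurableD)
  moreover have "?U \<union> (E - ?U) \<in> lmeasurable" using 1 nl(1) by (rule fmeasurable.Un)
  ultimately show ?thesis by (intro exI[of _ "?U \<union> (E - ?U)"]) blast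
qed

text \<open>\<open>W\<close> is the total variation of \<open>f\<close> on [a, x]. Adjoining one
  more interval to a division gives the first property; the second says that a single division
  nearly attains the variation over [a, b].\<close>

lemma variation_function_exists:
  fixes f :: "real \<Rightarrow> real"
  assumes "a \<le> b"
    and bnd: "\<And>x D. a \<le> x \<Longrightarrow> x \<le> b \<Longrightarrow> D division_of {a..x} \<Longrightarrow> (\<Sum>K\<in>D. \<bar>f (Sup K) - f (Inf K)\<bar>) \<le> B"
  obtains W where "\<And>x y. a \<le> x \<Longrightarrow> x \<le> y \<Longrightarrow> y \<le> b \<Longrightarrow> \<bar>f y - f x\<bar> \<le> W y - W x"
    and "\<And>e. e > 0 \<Longrightarrow> \<exists>D. D division_of {a..b} \<and> W b - W a - e < (\<Sum>K\<in>D. \<bar>f (Sup K) - f (Inf K)\<bar>)"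
proof -
  let ?v = "\<lambda>D. \<Sum>K\<in>D. \<bar>f (Sup K) - f (Inf K)\<bar>"
  define S where "S x = {?v D | D. D division_of {a..x}}" for x
  have bdd: "bdd_above (S x)" if "a \<le> x" "x \<le> b" for x
    using bnd[OF that] by (auto simp: S_def bdd_above_def)
  have ne: "S x \<noteq> {}" if "a \<le> x" for x
  proof -
    have "{{a..x}} division_of {a..x}" using division_of_self[of a x] that by simp
    then show ?thesis by (auto simp: S_def)
  qed
  define W where "W x = Sup (S x)" for x
  have 1: "\<bar>f y - f x\<bar> \<le> W y - W x" if xy: "a \<le> x" "x \<le> y" "y \<le> b" for x y
  proof (cases "x = y")
    case False
    have "r \<le> W y - \<bar>f y - f x\<bar>" if "r \<in> S x" for r
    proof -
      from that obtain D where D: "D division_of {a..x}" and r: "r = ?v D" by (auto simp: S_def)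
      have Dn: "{x..y} \<notin> D"
        using division_ofD(2)[OF D] xy False by (metis atLeastAtMost_iff less_eq_real_def order.antisym subset_iff)
      have "D \<union> {{x..y}} division_of {a..x} \<union> {x..y}"
      proof (rule division_disjoint_union[OF D])
        show "{{x..y}} division_of {x..y}" using division_of_self[of x y] xy by simp
        show "interior {a..x} \<inter> interior {x..y} = {}" by auto
      qed
      moreover have "{a..x} \<union> {x..y} = {a..y}" using xy by auto
      ultimately have "?v (D \<union> {{x..y}}) \<in> S y" unfolding S_def by (metis (mono_tags, lifting) mem_Collect_eq)
      then have "?v (D \<union> {{x..y}}) \<le> W y"
        unfolding W_def using bdd[of y] xy by (intro cSup_upper) auto
      moreover have "?v (D \<union> {{x..y}}) = r + \<bar>f y - f x\<bar>"
        using Dn D r xy by (subst sum.union_disjoint) auto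
      ultimately show ?thesis by simp
    qed
    then have "W x \<le> W y - \<bar>f y - f x\<bar>"
      unfolding W_def[of x] using ne[OF xy(1)] by (intro cSup_least) auto
    then show ?thesis by simp
  qed simp
  have 2: "\<exists>D. D division_of {a..b} \<and> W b - W a - e < ?v D" if "e > 0" for e
  proof -
    \<comment> \<open>A division with sum above \<open>W b - e\<close> is enough, since subtracting
      the nonnegative \<open>W a\<close> only lowers the bar.\<close>
    have "0 \<le> W a"
    proof -
      obtain r where r: "r \<in> S a" using ne by blast
      then have "0 \<le> r" by (auto simp: S_def intro: sum_nonneg)
      also have "r \<le> W a" unfolding W_def using bdd[of a] r assms(1) by (intro cSup_upper) auto
      finally show ?thesis .
    qed
    moreover have "\<exists>r\<in>S b. W b - e < r"
      using less_cSupD[OF ne[OF assms(1)], of "W b - e"] that by (auto simp: W_def)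
    ultimately show ?thesis unfolding S_def by (smt (verit, ccfv_SIG) mem_Collect_eq)
  qed
  show ?thesis by (rule that[OF 1 2])
qed

text \<open>A division \<open>D\<close> that nearly attains the variation leaves little room for
  movement against the overall direction of a piece. Where \<open>f\<close> rises over a piece, an
  interval of slope at most -c raises the monotone function W - f by at least c times its length;
  where \<open>f\<close> falls, W + f plays this role. Over all pieces these functions rise by
  \<open>W b - W a\<close> minus the sum over \<open>D\<close>, which is less than
  \<open>c * e\<close>. As points of \<open>E\<close> see both kinds of slopes, the intervals of the
  adverse direction always form a Vitali cover.\<close>

lemma negligible_two_sided_slopes:
  fixes f W :: "real \<Rightarrow> real"
  assumes "a < b" "c > 0"
    and W: "\<And>x y. a \<le> x \<Longrightarrow> x \<le> y \<Longrightarrow> y \<le> b \<Longrightarrow> \<bar>f y - f x\<bar> \<le> W y - W x"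
    and WD: "\<And>e. e > 0 \<Longrightarrow> \<exists>D. D division_of {a..b} \<and> W b - W a - e < (\<Sum>K\<in>D. \<bar>f (Sup K) - f (Inf K)\<bar>)"
    and up: "\<And>x d. x \<in> E \<Longrightarrow> d > 0 \<Longrightarrow> \<exists>s t. s \<le> x \<and> x \<le> t \<and> s < t \<and> t - s < d \<and> f t - f s \<ge> c * (t - s)"
    and dn: "\<And>x d. x \<in> E \<Longrightarrow> d > 0 \<Longrightarrow> \<exists>s t. s \<le> x \<and> x \<le> t \<and> s < t \<and> t - s < d \<and> f t - f s \<le> - c * (t - s)"
  shows "negligible (E \<inter> {a..b})"
  unfolding negligible_outer_le
proof (intro allI impI)
  fix e :: real assume "e > 0"
  then obtain D where D: "D division_of {a..b}"
    and De: "W b - W a - c * e < (\<Sum>K\<in>D. \<bar>f (Sup K) - f (Inf K)\<bar>)"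
    using WD[of "c * e"] \<open>c > 0\<close> by auto
  have fD: "finite D" using D by auto
  define \<sigma> where "\<sigma> K = (if f (Inf K) \<le> f (Sup K) then 1 else -1 :: real)" for K
  define P where "P s t \<longleftrightarrow> (\<exists>K\<in>D. {s..t} \<subseteq> K \<and> \<sigma> K * (f t - f s) \<le> - c * (t - s))" for s t
  \<comment> \<open>The finitely many division points are discarded, so that short intervals around
    the remaining points stay inside one piece.\<close>
  define N where "N = (\<Union>K\<in>D. {Inf K, Sup K})"
  have "\<exists>T. E \<inter> {a..b} - N \<subseteq> T \<and> T \<in> lmeasurable \<and> measure lebesgue T \<le> e"
  proof (rule Vitali_measure_bound[where P = P])
    fix x and d :: real assume x: "x \<in> E \<inter> {a..b} - N" and "d > 0"
    have "x \<in> \<Union>D" using x division_ofD(6)[OF D] by simp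
    then obtain K where K: "K \<in> D" "x \<in> K" by blast
    obtain p q where pq: "K = {p..q}" "p \<le> q" "Inf K = p" "Sup K = q"
      using division_intervalD[OF D K(1)] by metis
    have "p < x" "x < q" using x K pq by (auto simp: N_def order.order_iff_strict)
    then have d': "0 < min d (min (x - p) (q - x))" using \<open>d > 0\<close> by auto
    obtain s t where st: "s \<le> x" "x \<le> t" "s < t" "t - s < min d (min (x - p) (q - x))"
        "\<sigma> K * (f t - f s) \<le> - c * (t - s)"
      using up[OF _ d', of x] dn[OF _ d', of x] x unfolding \<sigma>_def
      by (cases "f (Inf K) \<le> f (Sup K)") force+
    have "{s..t} \<subseteq> K" using st pq by auto
    then have "P s t" using st K by (auto simp: P_def)
    then show "\<exists>s t. s \<le> x \<and> x \<le> t \<and> s < t \<and> t - s < d \<and> P s t" using st by auto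
  next
    fix C assume C: "finite C" "\<And>i. i \<in> C \<Longrightarrow> fst i < snd i \<and> P (fst i) (snd i)"
      "pairwise (\<lambda>i j. disjnt {fst i..snd i} {fst j..snd j}) C"
    obtain \<kappa> where \<kappa>: "\<And>i. i \<in> C \<Longrightarrow> \<kappa> i \<in> D \<and> {fst i..snd i} \<subseteq> \<kappa> i \<and>
        \<sigma> (\<kappa> i) * (f (snd i) - f (fst i)) \<le> - c * (snd i - fst i)"
      using C(2) unfolding P_def by metis
    have inner: "(\<Sum>i\<in>{i\<in>C. \<kappa> i = K}. c * (snd i - fst i))
        \<le> (W (Sup K) - W (Inf K)) - \<bar>f (Sup K) - f (Inf K)\<bar>" if K: "K \<in> D" for K
    proof -
      obtain p q where pq: "K = {p..q}" "p \<le> q" "a \<le> p" "q \<le> b" "Inf K = p" "Sup K = q"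
        using division_intervalD[OF D K] by metis
      let ?G = "\<lambda>x. W x - \<sigma> K * f x"
      have "(\<Sum>i\<in>{i\<in>C. \<kappa> i = K}. c * (snd i - fst i)) \<le> (\<Sum>i\<in>{i\<in>C. \<kappa> i = K}. ?G (snd i) - ?G (fst i))"
      proof (rule sum_mono)
        fix i assume "i \<in> {i\<in>C. \<kappa> i = K}"
        then have i: "i \<in> C" "\<kappa> i = K" by auto
        have "fst i \<in> K" "snd i \<in> K" using \<kappa>[OF i(1)] C(2)[OF i(1)] i by auto
        then have "a \<le> fst i" "snd i \<le> b" using pq by auto
        then have "\<bar>f (snd i) - f (fst i)\<bar> \<le> W (snd i) - W (fst i)"
          using W[of "fst i" "snd i"] C(2)[OF i(1)] by auto
        then have "0 \<le> W (snd i) - W (fst i)" by linarith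
        then show "c * (snd i - fst i) \<le> ?G (snd i) - ?G (fst i)"
          using \<kappa>[OF i(1)] i by (simp add: algebra_simps)
      qed
      also have "\<dots> \<le> ?G q - ?G p"
      proof (rule sum_increments_le)
        show "finite {i \<in> C. \<kappa> i = K}" using C by simp
        show "fst i < snd i \<and> {fst i..snd i} \<subseteq> {p..q}" if "i \<in> {i \<in> C. \<kappa> i = K}" for i
          using that C(2)[of i] \<kappa>[of i] pq by auto
        show "pairwise (\<lambda>i j. disjnt {fst i..snd i} {fst j..snd j}) {i \<in> C. \<kappa> i = K}"
          using C(3) by (auto simp: pairwise_def)
        fix x y assume "p \<le> x" "x \<le> y" "y \<le> q"
        then have "\<bar>f y - f x\<bar> \<le> W y - W x" using W pq by auto
        then show "?G x \<le> ?G y" by (auto simp: \<sigma>_def abs_le_iff)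
      qed (use pq in auto)
      also have "\<dots> = (W (Sup K) - W (Inf K)) - \<bar>f (Sup K) - f (Inf K)\<bar>"
        using pq by (auto simp: \<sigma>_def)
      finally show ?thesis .
    qed
    have "c * (\<Sum>i\<in>C. snd i - fst i) = (\<Sum>i\<in>C. c * (snd i - fst i))" by (simp add: sum_distrib_left)
    also have "\<dots> = (\<Sum>K\<in>D. \<Sum>i\<in>{i\<in>C. \<kappa> i = K}. c * (snd i - fst i))"
      using \<kappa> by (intro sum.group[symmetric] C fD) auto
    also have "\<dots> \<le> (\<Sum>K\<in>D. (W (Sup K) - W (Inf K)) - \<bar>f (Sup K) - f (Inf K)\<bar>)"
      by (rule sum_mono) (rule inner)
    also have "\<dots> = W b - W a - (\<Sum>K\<in>D. \<bar>f (Sup K) - f (Inf K)\<bar>)"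
      using sum_division_telescope[OF _ D, of W] \<open>a < b\<close> by (simp add: sum_subtractf)
    also have "\<dots> \<le> c * e" using De by simp
    finally show "(\<Sum>i\<in>C. snd i - fst i) \<le> e" using \<open>c > 0\<close> by simp
  qed
  then obtain T where T: "E \<inter> {a..b} - N \<subseteq> T" "T \<in> lmeasurable" "measure lebesgue T \<le> e" by blast
  have N: "negligible N" unfolding N_def using fD by (intro negligible_finite) auto
  then have "T \<union> N \<in> lmeasurable" "measure lebesgue (T \<union> N) \<le> e"
    using T measure_Un_le[of T lebesgue N] negligible_imp_measurable[OF N] negligible_imp_measure0[OF N]
    by (auto dest: fmeasurableD)
  then show "\<exists>T. E \<inter> {a..b} \<subseteq> T \<and> T \<in> lmeasurable \<and> measure lebesgue T \<le> e"
    using T by (intro exI[of _ "T \<union> N"]) auto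
qed

text \<open>Disjoint intervals whose slopes are at least \<open>M\<close> in absolute value have
  total length at most the variation divided by \<open>M\<close>. The choice
  \<open>M = V / e\<close> makes this at most \<open>e\<close>; the 1 added in \<open>V\<close>
  keeps \<open>M\<close> positive when the variation is 0.\<close>

lemma negligible_unbounded_slopes:
  fixes f W :: "real \<Rightarrow> real"
  assumes "a < b"
    and W: "\<And>x y. a \<le> x \<Longrightarrow> x \<le> y \<Longrightarrow> y \<le> b \<Longrightarrow> \<bar>f y - f x\<bar> \<le> W y - W x"
    and E: "\<And>x d M. x \<in> E \<Longrightarrow> d > 0 \<Longrightarrow> \<exists>s t. s \<le> x \<and> x \<le> t \<and> s < t \<and> t - s < d \<and> \<bar>f t - f s\<bar> \<ge> M * (t - s)"
  shows "negligible (E \<inter> {a<..<b})"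
  unfolding negligible_outer_le
proof (intro allI impI)
  fix e :: real assume "e > 0"
  define V where "V = \<bar>W b - W a\<bar> + 1"
  define M where "M = V / e"
  have M: "M > 0" using \<open>e > 0\<close> by (simp add: M_def V_def)
  show "\<exists>T. E \<inter> {a<..<b} \<subseteq> T \<and> T \<in> lmeasurable \<and> measure lebesgue T \<le> e"
  proof (rule Vitali_measure_bound[where P = "\<lambda>s t. {s..t} \<subseteq> {a..b} \<and> \<bar>f t - f s\<bar> \<ge> M * (t - s)"])
    fix x and d :: real assume x: "x \<in> E \<inter> {a<..<b}" "d > 0"
    then have "0 < min d (min (x - a) (b - x))" by auto
    then obtain s t where "s \<le> x" "x \<le> t" "s < t" "t - s < min d (min (x - a) (b - x))" "\<bar>f t - f s\<bar> \<ge> M * (t - s)"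
      using E[of x] x by blast
    then show "\<exists>s t. s \<le> x \<and> x \<le> t \<and> s < t \<and> t - s < d \<and> {s..t} \<subseteq> {a..b} \<and> \<bar>f t - f s\<bar> \<ge> M * (t - s)"
      by (intro exI[of _ s] exI[of _ t]) auto
  next
    fix C assume C: "finite C" "\<And>i. i \<in> C \<Longrightarrow> fst i < snd i \<and> {fst i..snd i} \<subseteq> {a..b} \<and>
        \<bar>f (snd i) - f (fst i)\<bar> \<ge> M * (snd i - fst i)"
      "pairwise (\<lambda>i j. disjnt {fst i..snd i} {fst j..snd j}) C"
    have "M * (\<Sum>i\<in>C. snd i - fst i) = (\<Sum>i\<in>C. M * (snd i - fst i))" by (simp add: sum_distrib_left)
    also have "\<dots> \<le> (\<Sum>i\<in>C. W (snd i) - W (fst i))"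
    proof (rule sum_mono)
      fix i assume i: "i \<in> C"
      then have "a \<le> fst i" "snd i \<le> b" using C(2)[OF i] by auto
      then show "M * (snd i - fst i) \<le> W (snd i) - W (fst i)"
        using W[of "fst i" "snd i"] C(2)[OF i] by fastforce
    qed
    also have "\<dots> \<le> W b - W a"
    proof (rule sum_increments_le[OF C(1) _ C(3)])
      show "fst i < snd i \<and> {fst i..snd i} \<subseteq> {a..b}" if "i \<in> C" for i using C(2)[OF that] by simp
      show "W x \<le> W y" if "a \<le> x" "x \<le> y" "y \<le> b" for x y using W[OF that] by linarith
    qed (use \<open>a < b\<close> in simp)
    also have "\<dots> \<le> M * e" using \<open>e > 0\<close> by (simp add: M_def V_def)
    finally show "(\<Sum>i\<in>C. snd i - fst i) \<le> e" using M by simp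
  qed
qed

text \<open>The definition numbers the intervals by natural numbers. With an arbitrary finite index
  set, the pieces of a division or the tagged pieces can serve as their own indices.\<close>

lemma abs_cont_on_finite:
  fixes f :: "real \<Rightarrow> 'a::real_normed_vector"
  assumes ac: "abs_cont_on a b f" and e: "e > 0"
  shows "\<exists>\<delta>>0. \<forall>C S T. finite C \<longrightarrow> (\<forall>i\<in>C. a \<le> S i \<and> S i \<le> T i \<and> T i \<le> b) \<longrightarrow>
      disjoint_family_on (\<lambda>i. {S i<..<T i}) C \<longrightarrow> (\<Sum>i\<in>C. T i - S i) < \<delta> \<longrightarrow>
      (\<Sum>i\<in>(C::'i set). norm (f (T i) - f (S i))) < e"
proof -
  obtain \<delta> where \<delta>: "\<delta> > 0" and
    D: "\<forall>(n::nat) s t. (\<forall>i<n. a \<le> s i \<and> s i \<le> t i \<and> t i \<le> b) \<and>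
       disjoint_family_on (\<lambda>i. {s i<..<t i}) {..<n} \<and>
       (\<Sum>i<n. t i - s i) < \<delta> \<longrightarrow> (\<Sum>i<n. norm (f (t i) - f (s i))) < e"
    using mp[OF spec[OF ac[unfolded abs_cont_on_def]] e] by (elim exE conjE)
  show ?thesis
  proof (intro exI[of _ \<delta>] conjI allI impI \<delta>)
    fix C :: "'i set" and S T
    assume C: "finite C" "\<forall>i\<in>C. a \<le> S i \<and> S i \<le> T i \<and> T i \<le> b"
      "disjoint_family_on (\<lambda>i. {S i<..<T i}) C" "(\<Sum>i\<in>C. T i - S i) < \<delta>"
    obtain h where h: "bij_betw h {0..<card C} C" using ex_bij_betw_nat_finite[OF C(1)] by blast
    have h': "bij_betw h {..<card C} C" using h by (simp add: atLeast0LessThan)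
    have hC: "h i \<in> C" if "i < card C" for i using h' that by (auto simp: bij_betw_def)
    have hi: "inj_on h {..<card C}" using h' by (auto simp: bij_betw_def)
    have "(\<Sum>i<card C. norm (f (T (h i)) - f (S (h i)))) < e"
    proof (rule D[THEN spec, THEN spec, THEN spec, THEN mp, of "card C" "S \<circ> h" "T \<circ> h", unfolded o_def], intro conjI)
      show "\<forall>i<card C. a \<le> S (h i) \<and> S (h i) \<le> T (h i) \<and> T (h i) \<le> b" using C(2) hC by blast
      show "disjoint_family_on (\<lambda>i. {S (h i)<..<T (h i)}) {..<card C}"
        unfolding disjoint_family_on_def
      proof (intro ballI impI)
        fix m n assume mn: "m \<in> {..<card C}" "n \<in> {..<card C}" "m \<noteq> n"
        then have "h m \<noteq> h n" using hi by (auto dest: inj_onD)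
        then show "{S (h m)<..<T (h m)} \<inter> {S (h n)<..<T (h n)} = {}"
          using C(3) hC mn unfolding disjoint_family_on_def by blast
      qed
      show "(\<Sum>i<card C. T (h i) - S (h i)) < \<delta>"
        using C(4) sum.reindex_bij_betw[OF h', of "\<lambda>i. T i - S i"] by simp
    qed
    then show "(\<Sum>i\<in>C. norm (f (T i) - f (S i))) < e"
      using sum.reindex_bij_betw[OF h', of "\<lambda>i. norm (f (T i) - f (S i))"] by simp
  qed
qed

text \<open>\<open>P\<close> holds on arbitrarily short intervals that contain \<open>x\<close>,
  possibly as an endpoint. Slopes over such intervals replace the Dini derivatives: there is one
  upper and one lower limit instead of four.\<close>

definition small_around :: "real \<Rightarrow> (real \<Rightarrow> real \<Rightarrow> bool) \<Rightarrow> bool" where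
  "small_around x P \<longleftrightarrow> (\<forall>d>0. \<exists>s t. s \<le> x \<and> x \<le> t \<and> s < t \<and> t - s < d \<and> P s t)"

text \<open>\<open>L\<close> is the upper limit of the straddling slopes, finite by
  \<open>bdd\<close>. If slopes below \<open>L - e\<close> occurred arbitrarily close to
  \<open>x\<close>, two rationals p < q below \<open>L\<close> would violate \<open>sep\<close> with
  centre (p + q)/2 and half-width (q - p)/2. Hence all straddling slopes tend to \<open>L\<close>,
  among them the difference quotients at \<open>x\<close>.\<close>

lemma differentiable_of_slopes:
  fixes f :: "real \<Rightarrow> real"
  assumes bdd: "\<not> (\<forall>M. small_around x (\<lambda>s t. \<bar>f t - f s\<bar> \<ge> M * (t - s)))"
    and sep: "\<And>r c. r \<in> \<rat> \<Longrightarrow> c \<in> \<rat> \<Longrightarrow> c > 0 \<Longrightarrow>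
      \<not> (small_around x (\<lambda>s t. f t - f s \<ge> (r + c) * (t - s)) \<and> small_around x (\<lambda>s t. f t - f s \<le> (r - c) * (t - s)))"
  shows "f differentiable at x"
proof -
  have small_around_mono: "small_around x Q" if "small_around x P" "\<And>s t. s < t \<Longrightarrow> P s t \<Longrightarrow> Q s t" for P Q
    using that unfolding small_around_def by meson
  have not_near: "\<exists>d>0. \<forall>s t. s \<le> x \<longrightarrow> x \<le> t \<longrightarrow> s < t \<longrightarrow> t - s < d \<longrightarrow> \<not> P s t" if "\<not> small_around x P" for P
    using that unfolding small_around_def by blast
  define S where "S = {\<alpha>. small_around x (\<lambda>s t. f t - f s \<ge> \<alpha> * (t - s))}"
  obtain M d0 where M: "d0 > 0" "\<And>s t. s \<le> x \<Longrightarrow> x \<le> t \<Longrightarrow> s < t \<Longrightarrow> t - s < d0 \<Longrightarrow> \<bar>f t - f s\<bar> < M * (t - s)"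
    using bdd unfolding small_around_def by (metis not_le)
  have small_around_all: "small_around x P" if "\<And>s t. s \<le> x \<Longrightarrow> x \<le> t \<Longrightarrow> s < t \<Longrightarrow> t - s < d0 \<Longrightarrow> P s t" for P
    unfolding small_around_def
  proof (intro allI impI)
    fix d :: real assume "d > 0"
    then show "\<exists>s t. s \<le> x \<and> x \<le> t \<and> s < t \<and> t - s < d \<and> P s t"
      using that[of x "x + min d d0 / 2"] M(1) by (intro exI[of _ x] exI[of _ "x + min d d0 / 2"]) auto
  qed
  \<comment> \<open>Nonemptiness of \<open>S\<close>, so that its supremum is meaningful.\<close>
  have "-M \<in> S" unfolding S_def using M(2) by (auto intro!: small_around_all) (smt (verit))
  have S_le: "\<alpha> \<le> M" if \<alpha>: "\<alpha> \<in> S" for \<alpha>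
  proof -
    obtain s t where st: "s \<le> x" "x \<le> t" "s < t" "t - s < d0" "f t - f s \<ge> \<alpha> * (t - s)"
      using \<alpha>[unfolded S_def small_around_def mem_Collect_eq, rule_format, OF M(1)] by auto
    then have "\<alpha> * (t - s) \<le> M * (t - s)" using M(2)[of s t] by linarith
    then show ?thesis using st by simp
  qed
  define L where "L = Sup S"
  have bdd': "bdd_above S" using S_le by (rule bdd_aboveI)
  have "(f has_real_derivative L) (at x)"
    unfolding has_field_derivative_iff LIM_eq
  proof (intro allI impI)
    fix e :: real assume "e > 0"
    have "L + e / 2 \<notin> S"
    proof
      assume "L + e / 2 \<in> S"
      then have "L + e / 2 \<le> L" unfolding L_def using bdd' by (rule cSup_upper)
      then show False using \<open>e > 0\<close> by simp
    qed
    then have "\<not> small_around x (\<lambda>s t. f t - f s \<ge> (L + e / 2) * (t - s))" by (simp add: S_def)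
    from not_near[OF this] obtain d1 where d10: "d1 > 0" and d11: "\<forall>s t. s \<le> x \<longrightarrow> x \<le> t \<longrightarrow> s < t \<longrightarrow> t - s < d1 \<longrightarrow> \<not> (f t - f s \<ge> (L + e / 2) * (t - s))"
      by (elim exE conjE)
    note d1 = d10 d11[rule_format, unfolded not_le]
    obtain \<beta> where \<beta>: "\<beta> \<in> S" "L - e / 2 < \<beta>"
      using less_cSupD[of S "L - e / 2"] \<open>-M \<in> S\<close> \<open>e > 0\<close> by (auto simp: L_def)
    obtain p where p: "p \<in> \<rat>" "L - e < p" "p < L - e / 2" using Rats_dense_in_real[of "L - e" "L - e / 2"] \<open>e > 0\<close> by auto
    obtain q where q: "q \<in> \<rat>" "L - e / 2 < q" "q < \<beta>" using Rats_dense_in_real[of "L - e / 2" \<beta>] \<beta> by auto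
    have "small_around x (\<lambda>s t. f t - f s \<ge> ((p + q) / 2 + (q - p) / 2) * (t - s))"
    proof (rule small_around_mono)
      show "small_around x (\<lambda>s t. f t - f s \<ge> \<beta> * (t - s))" using \<beta> by (simp add: S_def)
      fix s t :: real assume st: "s < t" "\<beta> * (t - s) \<le> f t - f s"
      have "((p + q) / 2 + (q - p) / 2) * (t - s) = q * (t - s)" by (simp add: field_simps)
      also have "\<dots> \<le> \<beta> * (t - s)" using st q by (intro mult_right_mono) auto
      finally show "((p + q) / 2 + (q - p) / 2) * (t - s) \<le> f t - f s" using st(2) by linarith
    qed
    then have "\<not> small_around x (\<lambda>s t. f t - f s \<le> ((p + q) / 2 - (q - p) / 2) * (t - s))"
      using sep[of "(p + q) / 2" "(q - p) / 2"] p q by auto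
    moreover have "(p + q) / 2 - (q - p) / 2 = p" by (simp add: field_simps)
    ultimately have "\<not> small_around x (\<lambda>s t. f t - f s \<le> p * (t - s))" by simp
    from not_near[OF this] obtain d2 where d20: "d2 > 0" and d21: "\<forall>s t. s \<le> x \<longrightarrow> x \<le> t \<longrightarrow> s < t \<longrightarrow> t - s < d2 \<longrightarrow> \<not> (f t - f s \<le> p * (t - s))"
      by (elim exE conjE)
    note d2 = d20 d21[rule_format, unfolded not_le]
    show "\<exists>d>0. \<forall>y. y \<noteq> x \<and> norm (y - x) < d \<longrightarrow> norm ((f y - f x) / (y - x) - L) < e"
    proof (intro exI[of _ "min d1 d2"] conjI allI impI)
      fix y assume y: "y \<noteq> x \<and> norm (y - x) < min d1 d2"
      define s t where "s = min x y" and "t = max x y"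
      have st: "s \<le> x" "x \<le> t" "s < t" "t - s < d1" "t - s < d2" using y by (auto simp: s_def t_def)
      have eq: "(f y - f x) / (y - x) = (f t - f s) / (t - s)"
        by (cases "x \<le> y") (auto simp: s_def t_def min_def max_def field_simps)
      have "(f t - f s) / (t - s) < L + e / 2" using d1(2)[OF st(1-4)] st by (simp add: divide_less_eq)
      moreover have "p < (f t - f s) / (t - s)" using d2(2)[OF st(1-3,5)] st by (simp add: less_divide_eq)
      ultimately show "norm ((f y - f x) / (y - x) - L) < e"
        unfolding eq using p \<open>e > 0\<close> by (simp add: abs_less_iff)
    qed (use d1 d2 in auto)
  qed
  then show ?thesis by (auto simp: real_differentiable_def)
qed

text \<open>All divisions of an interval shorter than \<delta> have total length below \<delta>, so
  absolute continuity bounds the variation over that interval.\<close>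

lemma abs_cont_on_division_bound:
  fixes f :: "real \<Rightarrow> real"
  assumes ac: "abs_cont_on a b f" and e: "e > 0"
  shows "\<exists>\<delta>>0. \<forall>p q D. a \<le> p \<longrightarrow> p \<le> q \<longrightarrow> q \<le> b \<longrightarrow> q - p < \<delta> \<longrightarrow> D division_of {p..q} \<longrightarrow>
      (\<Sum>K\<in>D. \<bar>f (Sup K) - f (Inf K)\<bar>) < e"
proof -
  obtain \<delta> where \<delta>0: "\<delta> > 0" and \<delta>1: "\<forall>C S T. finite C \<longrightarrow>
      (\<forall>i\<in>C. a \<le> S i \<and> S i \<le> T i \<and> T i \<le> b) \<longrightarrow>
      disjoint_family_on (\<lambda>i. {S i<..<T i}) C \<longrightarrow> (\<Sum>i\<in>C. T i - S i) < \<delta> \<longrightarrow>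
      (\<Sum>i\<in>(C::(real set) set). norm (f (T i) - f (S i))) < e"
    using abs_cont_on_finite[OF ac e, where ?'i = "real set"] by (elim exE conjE)
  note \<delta> = \<delta>0 \<delta>1[rule_format]
  show ?thesis
  proof (intro exI[of _ \<delta>] conjI allI impI \<delta>(1))
    fix p q D assume pq: "a \<le> p" "p \<le> q" "q \<le> b" "q - p < \<delta>" and D: "D division_of {p..q}"
    have "(\<Sum>K\<in>D. norm (f (Sup K) - f (Inf K))) < e"
    proof (rule \<delta>(2))
      show "finite D" using D by auto
      show "a \<le> Inf K \<and> Inf K \<le> Sup K \<and> Sup K \<le> b" if "K \<in> D" for K
        using division_intervalD[OF D that] pq by (metis order.trans)
      show "disjoint_family_on (\<lambda>K. {Inf K<..<Sup K}) D"
        unfolding disjoint_family_on_def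
      proof (intro ballI impI)
        fix K1 K2 assume K: "K1 \<in> D" "K2 \<in> D" "K1 \<noteq> K2"
        have "interior K = {Inf K<..<Sup K}" if "K \<in> D" for K
          using division_intervalD[OF D that] interior_atLeastAtMost_real by metis
        then show "{Inf K1<..<Sup K1} \<inter> {Inf K2<..<Sup K2} = {}"
          using division_ofD(5)[OF D K] K by metis
      qed
      show "(\<Sum>K\<in>D. Sup K - Inf K) < \<delta>"
        using sum_division_telescope[OF pq(2) D, of "\<lambda>x. x"] pq by simp
    qed
    then show "(\<Sum>K\<in>D. \<bar>f (Sup K) - f (Inf K)\<bar>) < e" by simp
  qed
qed

text \<open>Where differentiability fails, the slopes are unbounded, or for some rational r and c >
  0 slopes above r + c and slopes below r - c both occur arbitrarily close to the point. This gives
  countably many exceptional sets, each of them null.\<close>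

lemma abs_cont_on_AE_differentiable_short:
  fixes f :: "real \<Rightarrow> real"
  assumes "a < b"
    and bnd: "\<And>x D. a \<le> x \<Longrightarrow> x \<le> b \<Longrightarrow> D division_of {a..x} \<Longrightarrow> (\<Sum>K\<in>D. \<bar>f (Sup K) - f (Inf K)\<bar>) \<le> B"
  shows "negligible {x\<in>{a<..<b}. \<not> f differentiable at x}"
proof -
  define U where "U = {x. \<forall>M. small_around x (\<lambda>s t. \<bar>f t - f s\<bar> \<ge> M * (t - s))}"
  define E where "E = (\<lambda>(r, c). {x. small_around x (\<lambda>s t. f t - f s \<ge> (r + c) * (t - s)) \<and> small_around x (\<lambda>s t. f t - f s \<le> (r - c) * (t - s))})"
  define I where "I = {(r::real, c). r \<in> \<rat> \<and> c \<in> \<rat> \<and> (c::real) > 0}"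
  have ab: "a \<le> b" using assms(1) by simp
  have 1: "negligible (U \<inter> {a<..<b})"
  proof (rule variation_function_exists[OF ab bnd])
    fix W assume "\<And>x y. a \<le> x \<Longrightarrow> x \<le> y \<Longrightarrow> y \<le> b \<Longrightarrow> \<bar>f y - f x\<bar> \<le> W y - W x"
    then show ?thesis
      by (rule negligible_unbounded_slopes[OF assms(1)]) (auto simp: U_def small_around_def)
  qed
  have 2: "negligible (E i \<inter> {a..b})" if "i \<in> I" for i
  proof -
    obtain r c where i: "i = (r, c)" and c: "c > 0" using \<open>i \<in> I\<close> by (auto simp: I_def)
    \<comment> \<open>Subtracting the line of slope r turns the two levels into c and -c, and raises
      the variation by at most |r| (b - a).\<close>
    let ?f = "\<lambda>x. f x - r * x"
    have bnd': "(\<Sum>K\<in>D. \<bar>?f (Sup K) - ?f (Inf K)\<bar>) \<le> B + \<bar>r\<bar> * (b - a)"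
      if x: "a \<le> x" "x \<le> b" and D: "D division_of {a..x}" for x D
    proof -
      have "(\<Sum>K\<in>D. \<bar>?f (Sup K) - ?f (Inf K)\<bar>) \<le> (\<Sum>K\<in>D. \<bar>f (Sup K) - f (Inf K)\<bar> + \<bar>r\<bar> * (Sup K - Inf K))"
      proof (rule sum_mono)
        fix K assume "K \<in> D"
        then have "Inf K \<le> Sup K" using division_intervalD[OF D] by metis
        then have "\<bar>r * (Sup K - Inf K)\<bar> = \<bar>r\<bar> * (Sup K - Inf K)" by (simp add: abs_mult)
        then show "\<bar>?f (Sup K) - ?f (Inf K)\<bar> \<le> \<bar>f (Sup K) - f (Inf K)\<bar> + \<bar>r\<bar> * (Sup K - Inf K)"
          unfolding right_diff_distrib by linarith
      qed
      also have "\<dots> = (\<Sum>K\<in>D. \<bar>f (Sup K) - f (Inf K)\<bar>) + \<bar>r\<bar> * (x - a)"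
        using sum_division_telescope[OF x(1) D, of "\<lambda>x. x"] by (simp add: sum.distrib flip: sum_distrib_left)
      also have "\<dots> \<le> B + \<bar>r\<bar> * (b - a)"
        using bnd[OF x D] x by (intro add_mono mult_left_mono) auto
      finally show ?thesis .
    qed
    show ?thesis
    proof (rule variation_function_exists[OF ab bnd'])
      fix W
      assume W: "\<And>x y. a \<le> x \<Longrightarrow> x \<le> y \<Longrightarrow> y \<le> b \<Longrightarrow> \<bar>?f y - ?f x\<bar> \<le> W y - W x"
        and WD: "\<And>e. e > 0 \<Longrightarrow> \<exists>D. D division_of {a..b} \<and> W b - W a - e < (\<Sum>K\<in>D. \<bar>?f (Sup K) - ?f (Inf K)\<bar>)"
      show ?thesis
      proof (rule negligible_two_sided_slopes[OF assms(1) c W WD])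
        fix x d :: real assume xd: "x \<in> E i" "d > 0"
        then obtain s t where st: "s \<le> x" "x \<le> t" "s < t" "t - s < d" "(r + c) * (t - s) \<le> f t - f s"
          unfolding E_def i small_around_def by blast
        then show "\<exists>s t. s \<le> x \<and> x \<le> t \<and> s < t \<and> t - s < d \<and> c * (t - s) \<le> ?f t - ?f s"
          by (intro exI[of _ s] exI[of _ t]) (auto simp: algebra_simps)
        obtain s t where st: "s \<le> x" "x \<le> t" "s < t" "t - s < d" "(r - c) * (t - s) \<ge> f t - f s"
          using xd unfolding E_def i small_around_def by blast
        then show "\<exists>s t. s \<le> x \<and> x \<le> t \<and> s < t \<and> t - s < d \<and> ?f t - ?f s \<le> - c * (t - s)"
          by (intro exI[of _ s] exI[of _ t]) (auto simp: algebra_simps)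
      qed
    qed
  qed
  have "I = \<rat> \<times> (\<rat> \<inter> {0<..})" by (auto simp: I_def)
  then have "countable I" by (auto intro: countable_rat)
  then have "negligible (\<Union>i\<in>I. E i \<inter> {a..b})" using 2 by (intro negligible_countable_Union) auto
  then have "negligible (U \<inter> {a<..<b} \<union> (\<Union>i\<in>I. E i \<inter> {a..b}))" using 1 by (rule negligible_Un[rotated])
  then show ?thesis
  proof (rule negligible_subset)
    show "{x\<in>{a<..<b}. \<not> f differentiable at x} \<subseteq> U \<inter> {a<..<b} \<union> (\<Union>i\<in>I. E i \<inter> {a..b})"
    proof
      fix x assume x: "x \<in> {x\<in>{a<..<b}. \<not> f differentiable at x}"
      have "f differentiable at x" if U: "x \<notin> U" and E: "\<And>i. i \<in> I \<Longrightarrow> x \<notin> E i"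
      proof (rule differentiable_of_slopes)
        show "\<not> (\<forall>M. small_around x (\<lambda>s t. M * (t - s) \<le> \<bar>f t - f s\<bar>))" using U by (simp add: U_def)
        show "\<not> (small_around x (\<lambda>s t. (r + c) * (t - s) \<le> f t - f s) \<and> small_around x (\<lambda>s t. f t - f s \<le> (r - c) * (t - s)))"
          if "r \<in> \<rat>" "c \<in> \<rat>" "0 < c" for r c
          using E[of "(r, c)"] that by (simp add: I_def E_def)
      qed
      then show "x \<in> U \<inter> {a<..<b} \<union> (\<Union>i\<in>I. E i \<inter> {a..b})" using x by auto
    qed
  qed
qed

text \<open>The variation is bounded by 1 on intervals shorter than \<delta>. Countably many such
  intervals with rational ends cover (a, b), so variations never have to be added up over a long
  interval.\<close>

lemma abs_cont_on_AE_differentiable: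
  fixes f :: "real \<Rightarrow> real"
  assumes ac: "abs_cont_on a b f"
  shows "negligible {x\<in>{a<..<b}. \<not> f differentiable at x}"
proof -
  obtain \<delta> where \<delta>0: "\<delta> > 0" and \<delta>1: "\<forall>p q D. a \<le> p \<longrightarrow> p \<le> q \<longrightarrow> q \<le> b \<longrightarrow> q - p < \<delta> \<longrightarrow> D division_of {p..q} \<longrightarrow>
      (\<Sum>K\<in>D. \<bar>f (Sup K) - f (Inf K)\<bar>) < 1"
    using abs_cont_on_division_bound[OF ac zero_less_one] by (elim exE conjE)
  note \<delta> = \<delta>0 \<delta>1[rule_format]
  let ?N = "{x\<in>{a<..<b}. \<not> f differentiable at x}"
  have short: "negligible {x\<in>{p<..<q}. \<not> f differentiable at x}" if "a \<le> p" "p < q" "q \<le> b" "q - p < \<delta>" for p q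
  proof (rule abs_cont_on_AE_differentiable_short[where B = 1])
    show "(\<Sum>K\<in>D. \<bar>f (Sup K) - f (Inf K)\<bar>) \<le> 1" if "p \<le> x" "x \<le> q" "D division_of {p..x}" for x D
      using \<delta>(2)[of p x D] that \<open>a \<le> p\<close> \<open>q \<le> b\<close> \<open>q - p < \<delta>\<close> by auto
  qed (use that in auto)
  define J where "J = {(p, q). p \<in> \<rat> \<and> q \<in> \<rat> \<and> a \<le> p \<and> p < q \<and> q \<le> b \<and> q - p < \<delta>}"
  have "J \<subseteq> \<rat> \<times> \<rat>" by (auto simp: J_def)
  then have cJ: "countable J" by (rule countable_subset) (auto intro: countable_rat)
  have "negligible (\<Union>i\<in>J. {x\<in>{fst i<..<snd i}. \<not> f differentiable at x})"
    using cJ short by (intro negligible_countable_Union) (auto simp: J_def)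
  then show ?thesis
  proof (rule negligible_subset)
    show "?N \<subseteq> (\<Union>i\<in>J. {x\<in>{fst i<..<snd i}. \<not> f differentiable at x})"
    proof
      fix x assume x: "x \<in> ?N"
      obtain p where p: "p \<in> \<rat>" "max a (x - \<delta> / 2) < p" "p < x"
        using Rats_dense_in_real[of "max a (x - \<delta> / 2)" x] x \<delta>(1) by auto
      obtain q where q: "q \<in> \<rat>" "x < q" "q < min b (x + \<delta> / 2)"
        using Rats_dense_in_real[of x "min b (x + \<delta> / 2)"] x \<delta>(1) by auto
      have "(p, q) \<in> J" using p q by (auto simp: J_def)
      then show "x \<in> (\<Union>i\<in>J. {x\<in>{fst i<..<snd i}. \<not> f differentiable at x})" using x p q by force
    qed
  qed
qed

section \<open>Fundamental theorem of calculus for absolutely continuous functions\<close>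

text \<open>The gauge treats two kinds of tags. Pieces tagged off \<open>N\<close> obey the straddle
  estimate of differentiability. Pieces tagged in \<open>N\<close> lie in an open set of measure
  below \<delta>, so absolute continuity makes the sum of their increments small.\<close>

lemma abs_cont_on_has_integral:
  fixes f :: "real \<Rightarrow> 'a::euclidean_space"
  assumes ac: "abs_cont_on a b f" and "a \<le> b" and N: "negligible N"
    and g: "\<And>x. x \<in> {a..b} - N \<Longrightarrow> (f has_vector_derivative g x) (at x within {a..b})"
  shows "(g has_integral f b - f a) {a..b}"
proof (rule has_integral_spike[OF N])
  \<comment> \<open>With the value 0 on \<open>N\<close>, a piece tagged there contributes nothing
    but the increment of \<open>f\<close>.\<close>
  let ?g = "\<lambda>x. if x \<in> N then 0 else g x"
  show "g x = ?g x" if "x \<in> {a..b} - N" for x using that by simp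
  show "(?g has_integral f b - f a) {a..b}"
    unfolding has_integral_real
  proof (intro allI impI)
    fix e :: real assume "e > 0"
    define \<epsilon> where "\<epsilon> = e / (2 * (b - a + 1))"
    have \<epsilon>: "\<epsilon> > 0" "\<epsilon> * (b - a) < e / 2" using \<open>e > 0\<close> \<open>a \<le> b\<close> by (auto simp: \<epsilon>_def field_simps)
    obtain \<delta> where \<delta>0: "\<delta> > 0" and \<delta>1: "\<forall>C S T. finite C \<longrightarrow>
      (\<forall>i\<in>C. a \<le> S i \<and> S i \<le> T i \<and> T i \<le> b) \<longrightarrow>
      disjoint_family_on (\<lambda>i. {S i<..<T i}) C \<longrightarrow> (\<Sum>i\<in>C. T i - S i) < \<delta> \<longrightarrow>
      (\<Sum>i\<in>(C::(real \<times> real set) set). norm (f (T i) - f (S i))) < e / 2"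
    using abs_cont_on_finite[OF ac half_gt_zero[OF \<open>e > 0\<close>], where ?'i = "real \<times> real set"] by (elim exE conjE)
  note \<delta> = \<delta>0 \<delta>1[rule_format]
    have Ns: "N \<in> null_sets lebesgue" using N by (simp add: negligible_iff_null_sets)
    then obtain T where T: "open T" "N \<subseteq> T" "T - N \<in> lmeasurable" "emeasure lebesgue (T - N) < ennreal \<delta>"
      using sets_lebesgue_outer_open[of N \<delta>] \<delta>(1) by auto
    have "emeasure lebesgue T \<le> emeasure lebesgue (T - N) + emeasure lebesgue N"
    proof -
      have "emeasure lebesgue ((T - N) \<union> N) \<le> emeasure lebesgue (T - N) + emeasure lebesgue N"
        by (rule emeasure_subadditive) (use T Ns in auto)
      moreover have "(T - N) \<union> N = T" using T by auto
      ultimately show ?thesis by simp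
    qed
    then have Tm: "emeasure lebesgue T < ennreal \<delta>" using T Ns by (auto simp: null_sets_def)
    have "\<exists>d>0. (x \<in> N \<longrightarrow> ball x d \<subseteq> T) \<and>
        (x \<in> {a..b} - N \<longrightarrow> (\<forall>y\<in>{a..b}. norm (y - x) < d \<longrightarrow> norm (f y - f x - (y - x) *\<^sub>R g x) \<le> \<epsilon> * norm (y - x)))" for x
    proof (cases "x \<in> N")
      case True
      then show ?thesis using T openE by blast
    next
      case False
      then show ?thesis
        using g[of x] \<epsilon>(1) unfolding has_vector_derivative_def has_derivative_within_alt
        by (cases "x \<in> {a..b}") (auto intro: exI[of _ "1::real"])
    qed
    then obtain d where d: "\<And>x. d x > 0" "\<And>x. x \<in> N \<Longrightarrow> ball x (d x) \<subseteq> T"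
      "\<And>x y. x \<in> {a..b} - N \<Longrightarrow> y \<in> {a..b} \<Longrightarrow> norm (y - x) < d x \<Longrightarrow> norm (f y - f x - (y - x) *\<^sub>R g x) \<le> \<epsilon> * norm (y - x)"
      by metis
    show "\<exists>\<gamma>. gauge \<gamma> \<and> (\<forall>D. D tagged_division_of {a..b} \<and> \<gamma> fine D \<longrightarrow>
        norm ((\<Sum>(x,k)\<in>D. measure lborel k *\<^sub>R ?g x) - (f b - f a)) < e)"
    proof (intro exI[of _ "\<lambda>x. ball x (d x)"] conjI allI impI)
      show "gauge (\<lambda>x. ball x (d x))" using d(1) by (simp add: gauge_def)
      fix D assume D: "D tagged_division_of {a..b} \<and> (\<lambda>x. ball x (d x)) fine D"
      then have td: "D tagged_division_of {a..b}" and fine: "(\<lambda>x. ball x (d x)) fine D" by auto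
      have fin: "finite D" using td by auto
      have K: "\<exists>u v. K = {u..v} \<and> u \<le> x \<and> x \<le> v \<and> a \<le> u \<and> v \<le> b \<and> Inf K = u \<and> Sup K = v \<and> measure lborel K = v - u
          \<and> {u..v} \<subseteq> ball x (d x)"
        if xK: "(x, K) \<in> D" for x K
      proof -
        obtain u v where uv: "K = cbox u v" using tagged_division_ofD(4)[OF td xK] by auto
        moreover have "x \<in> K" "K \<subseteq> {a..b}" using tagged_division_ofD(2,3)[OF td xK] by auto
        moreover have "K \<subseteq> ball x (d x)" using fine xK by (auto simp: fine_def)
        ultimately show ?thesis by (intro exI[of _ u] exI[of _ v]) auto
      qed
      have disj: "disjoint_family_on (\<lambda>i. {Inf (snd i)<..<Sup (snd i)}) D"
        unfolding disjoint_family_on_def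
      proof (intro ballI impI)
        fix i j assume ij: "i \<in> D" "j \<in> D" "i \<noteq> j"
        obtain x1 K1 x2 K2 where eq: "i = (x1, K1)" "j = (x2, K2)" by (cases i, cases j) auto
        have "interior M = {Inf M<..<Sup M}" if "(x, M) \<in> D" for x M
          using K[OF that] interior_atLeastAtMost_real by metis
        then have "interior K1 = {Inf K1<..<Sup K1}" "interior K2 = {Inf K2<..<Sup K2}"
          using ij eq by auto
        then show "{Inf (snd i)<..<Sup (snd i)} \<inter> {Inf (snd j)<..<Sup (snd j)} = {}"
          using tagged_division_ofD(5)[OF td, of x1 K1 x2 K2] ij eq by simp
      qed
      let ?D1 = "{i\<in>D. fst i \<in> N}" and ?D2 = "{i\<in>D. fst i \<notin> N}"
      let ?\<Delta> = "\<lambda>i. f (Sup (snd i)) - f (Inf (snd i))"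
      have fe: "emeasure lborel {p<..<q::real} \<noteq> top" for p q
        using emeasure_bounded_finite[of "{p<..<q}"] by (simp add: less_top)
      have len: "(\<Sum>i\<in>?D1. Sup (snd i) - Inf (snd i)) < \<delta>"
      proof -
        have "(\<Sum>i\<in>?D1. Sup (snd i) - Inf (snd i)) = (\<Sum>i\<in>?D1. measure lebesgue {Inf (snd i)<..<Sup (snd i)})"
        proof (intro sum.cong refl)
          fix i assume "i \<in> ?D1"
          then have "(fst i, snd i) \<in> D" by simp
          then show "Sup (snd i) - Inf (snd i) = measure lebesgue {Inf (snd i)<..<Sup (snd i)}"
            using K[of "fst i" "snd i"] by auto
        qed
        also have "\<dots> = measure lebesgue (\<Union>i\<in>?D1. {Inf (snd i)<..<Sup (snd i)})"
          using disj fin by (intro measure_finite_Union[symmetric]) (auto simp: disjoint_family_on_def fe)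
        also have "\<dots> \<le> measure lebesgue T"
        proof (rule measure_mono_fmeasurable)
          show "T \<in> lmeasurable" using T(1) Tm by (intro fmeasurableI) (auto intro: order.strict_trans)
          show "(\<Union>i\<in>?D1. {Inf (snd i)<..<Sup (snd i)}) \<subseteq> T"
          proof
            fix y assume "y \<in> (\<Union>i\<in>?D1. {Inf (snd i)<..<Sup (snd i)})"
            then obtain x M where "(x, M) \<in> D" "x \<in> N" "y \<in> {Inf M<..<Sup M}" by auto
            then show "y \<in> T" using K[of x M] d(2)[of x] by fastforce
          qed
        qed (use fin in auto)
        also have "\<dots> < \<delta>"
        proof -
          have "emeasure lebesgue T = ennreal (measure lebesgue T)"
            by (rule emeasure_eq_ennreal_measure) (use Tm in auto)
          then show ?thesis using Tm by (simp add: ennreal_less_iff)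
        qed
        finally show ?thesis .
      qed
      have s1: "(\<Sum>i\<in>?D1. norm (?\<Delta> i)) < e / 2"
      proof (rule \<delta>(2)[OF _ _ _ len])
        show "a \<le> Inf (snd i) \<and> Inf (snd i) \<le> Sup (snd i) \<and> Sup (snd i) \<le> b" if "i \<in> ?D1" for i
          using that K[of "fst i" "snd i"] by auto
        show "disjoint_family_on (\<lambda>i. {Inf (snd i)<..<Sup (snd i)}) ?D1"
          using disj by (auto simp: disjoint_family_on_def)
      qed (use fin in auto)
      have "(\<Sum>i\<in>?D2. norm (measure lborel (snd i) *\<^sub>R g (fst i) - ?\<Delta> i)) \<le> (\<Sum>i\<in>?D2. \<epsilon> * measure lborel (snd i))"
      proof (rule sum_mono)
        fix i assume i: "i \<in> ?D2"
        obtain x M where xM: "i = (x, M)" by (cases i)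
        obtain u v where uv: "M = {u..v}" "u \<le> x" "x \<le> v" "a \<le> u" "v \<le> b" "Inf M = u" "Sup M = v" "measure lborel M = v - u"
          "{u..v} \<subseteq> ball x (d x)" using K[of x M] i xM by auto
        have x: "x \<in> {a..b} - N" using i xM uv by auto
        have "u \<in> ball x (d x)" "v \<in> ball x (d x)" using uv(2,3) by (auto intro!: subsetD[OF uv(9)] simp del: mem_ball)
        then have "dist x u < d x" "dist x v < d x" by simp_all
        then have "norm (f v - f x - (v - x) *\<^sub>R g x) \<le> \<epsilon> * norm (v - x)" "norm (f u - f x - (u - x) *\<^sub>R g x) \<le> \<epsilon> * norm (u - x)"
          using d(3)[OF x, of v] d(3)[OF x, of u] uv by (auto simp: dist_real_def)
        \<comment> \<open>The tag lies between u and v, so the first-order errors at both ends add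
          up to at most \<epsilon> times the length of the piece.\<close>
        moreover have "norm (measure lborel M *\<^sub>R g x - (f v - f u)) \<le> norm (f v - f x - (v - x) *\<^sub>R g x) + norm (f u - f x - (u - x) *\<^sub>R g x)"
        proof -
          have "measure lborel M *\<^sub>R g x - (f v - f u) = (f u - f x - (u - x) *\<^sub>R g x) - (f v - f x - (v - x) *\<^sub>R g x)"
            using uv by (simp add: algebra_simps)
          then show ?thesis using norm_triangle_ineq4[of "f u - f x - (u - x) *\<^sub>R g x" "f v - f x - (v - x) *\<^sub>R g x"]
            by (simp only: add.commute)
        qed
        moreover have "\<epsilon> * norm (v - x) + \<epsilon> * norm (u - x) = \<epsilon> * measure lborel M" using uv by (simp add: algebra_simps)
        ultimately show "norm (measure lborel (snd i) *\<^sub>R g (fst i) - ?\<Delta> i) \<le> \<epsilon> * measure lborel (snd i)"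
          using xM uv by simp
      qed
      also have "\<dots> \<le> (\<Sum>i\<in>D. \<epsilon> * measure lborel (snd i))"
        using fin \<epsilon> by (intro sum_mono2 mult_nonneg_nonneg) auto
      also have "\<dots> = \<epsilon> * (b - a)"
        using additive_content_tagged_division[of D a b] td \<open>a \<le> b\<close>
        by (simp add: case_prod_beta flip: sum_distrib_left)
      also have "\<dots> < e / 2" by (rule \<epsilon>)
      finally have s2: "(\<Sum>i\<in>?D2. norm (measure lborel (snd i) *\<^sub>R g (fst i) - ?\<Delta> i)) < e / 2" .
      have "(\<Sum>(x,k)\<in>D. measure lborel k *\<^sub>R ?g x) - (f b - f a) = (\<Sum>i\<in>D. measure lborel (snd i) *\<^sub>R ?g (fst i) - ?\<Delta> i)"
        using additive_tagged_division_1[OF \<open>a \<le> b\<close> td, of f] by (simp add: case_prod_beta sum_subtractf)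
      also have "\<dots> = (\<Sum>i\<in>?D1. measure lborel (snd i) *\<^sub>R ?g (fst i) - ?\<Delta> i) + (\<Sum>i\<in>?D2. measure lborel (snd i) *\<^sub>R ?g (fst i) - ?\<Delta> i)"
        using fin by (subst sum.union_disjoint[symmetric]) (auto intro!: sum.cong)
      finally have eq: "(\<Sum>(x,k)\<in>D. measure lborel k *\<^sub>R ?g x) - (f b - f a)
          = (\<Sum>i\<in>?D1. measure lborel (snd i) *\<^sub>R ?g (fst i) - ?\<Delta> i) + (\<Sum>i\<in>?D2. measure lborel (snd i) *\<^sub>R ?g (fst i) - ?\<Delta> i)" .
      have n1: "norm (\<Sum>i\<in>?D1. measure lborel (snd i) *\<^sub>R ?g (fst i) - ?\<Delta> i) \<le> (\<Sum>i\<in>?D1. norm (?\<Delta> i))"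
        by (intro order.trans[OF norm_sum] sum_mono) (auto simp: norm_minus_commute)
      have n2: "norm (\<Sum>i\<in>?D2. measure lborel (snd i) *\<^sub>R ?g (fst i) - ?\<Delta> i)
          \<le> (\<Sum>i\<in>?D2. norm (measure lborel (snd i) *\<^sub>R g (fst i) - ?\<Delta> i))"
        by (intro order.trans[OF norm_sum] sum_mono) auto
      show "norm ((\<Sum>(x,k)\<in>D. measure lborel k *\<^sub>R ?g x) - (f b - f a)) < e"
        unfolding eq
        by (rule le_less_trans[OF norm_triangle_ineq le_less_trans[OF add_mono[OF n1 n2]
              less_le_trans[OF add_strict_mono[OF s1 s2]]]]) simp
    qed
  qed
qed

section \<open>Locally absolutely continuous functions\<close>

text \<open>One estimate behind all closure properties: the increments of sums, products, Lipschitz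
  images and real or imaginary parts are controlled by those of at most two absolutely continuous
  functions.\<close>

lemma abs_cont_on_dominated:
  fixes f :: "real \<Rightarrow> 'a::real_normed_vector" and g :: "real \<Rightarrow> 'b::real_normed_vector"
    and h :: "real \<Rightarrow> 'c::real_normed_vector"
  assumes f: "abs_cont_on a b f" and g: "abs_cont_on a b g"
    and le: "\<And>x y. x \<in> {a..b} \<Longrightarrow> y \<in> {a..b} \<Longrightarrow>
      norm (h y - h x) \<le> C * (norm (f y - f x) + norm (g y - g x))"
  shows "abs_cont_on a b h"
  unfolding abs_cont_on_def
proof (intro allI impI)
  fix e :: real assume "e > 0"
  \<comment> \<open>Using |C| + 1 in place of \<open>C\<close> gives a positive factor, by which
    strict inequalities may be multiplied and divided.\<close>
  define e' where "e' = e / (2 * (\<bar>C\<bar> + 1))"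
  have e': "e' > 0" using \<open>e > 0\<close> by (simp add: e'_def)
  have "K * (e / (2 * K) + e / (2 * K)) = e" if "K > 0" for K :: real using that by (simp add: field_simps)
  from this[of "\<bar>C\<bar> + 1"] have CC: "(\<bar>C\<bar> + 1) * (e' + e') = e" by (simp add: e'_def)
  obtain d1 where d1: "d1 > 0" and
    D1: "\<forall>(n::nat) s t. (\<forall>i<n. a \<le> s i \<and> s i \<le> t i \<and> t i \<le> b) \<and>
       disjoint_family_on (\<lambda>i. {s i<..<t i}) {..<n} \<and>
       (\<Sum>i<n. t i - s i) < d1 \<longrightarrow> (\<Sum>i<n. norm (f (t i) - f (s i))) < e'"
    using mp[OF spec[OF f[unfolded abs_cont_on_def]] e'] by (elim exE conjE)
  obtain d2 where d2: "d2 > 0" and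
    D2: "\<forall>(n::nat) s t. (\<forall>i<n. a \<le> s i \<and> s i \<le> t i \<and> t i \<le> b) \<and>
       disjoint_family_on (\<lambda>i. {s i<..<t i}) {..<n} \<and>
       (\<Sum>i<n. t i - s i) < d2 \<longrightarrow> (\<Sum>i<n. norm (g (t i) - g (s i))) < e'"
    using mp[OF spec[OF g[unfolded abs_cont_on_def]] e'] by (elim exE conjE)
  show "\<exists>\<delta>>0. \<forall>(n::nat) s t. (\<forall>i<n. a \<le> s i \<and> s i \<le> t i \<and> t i \<le> b) \<and>
       disjoint_family_on (\<lambda>i. {s i<..<t i}) {..<n} \<and>
       (\<Sum>i<n. t i - s i) < \<delta> \<longrightarrow> (\<Sum>i<n. norm (h (t i) - h (s i))) < e"
  proof (intro exI[of _ "min d1 d2"] conjI allI impI)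
    fix n :: nat and s t
    assume A: "(\<forall>i<n. a \<le> s i \<and> s i \<le> t i \<and> t i \<le> b) \<and>
       disjoint_family_on (\<lambda>i. {s i<..<t i}) {..<n} \<and> (\<Sum>i<n. t i - s i) < min d1 d2"
    have "(\<Sum>i<n. norm (h (t i) - h (s i)))
        \<le> (\<Sum>i<n. (\<bar>C\<bar> + 1) * (norm (f (t i) - f (s i)) + norm (g (t i) - g (s i))))"
    proof (rule sum_mono)
      fix i assume "i \<in> {..<n}"
      then have "s i \<in> {a..b}" "t i \<in> {a..b}" using A by force+
      then have "norm (h (t i) - h (s i)) \<le> C * (norm (f (t i) - f (s i)) + norm (g (t i) - g (s i)))"
        by (rule le)
      also have "\<dots> \<le> (\<bar>C\<bar> + 1) * (norm (f (t i) - f (s i)) + norm (g (t i) - g (s i)))"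
        by (intro mult_right_mono) auto
      finally show "norm (h (t i) - h (s i)) \<le> (\<bar>C\<bar> + 1) * (norm (f (t i) - f (s i)) + norm (g (t i) - g (s i)))" .
    qed
    also have "\<dots> = (\<bar>C\<bar> + 1) * ((\<Sum>i<n. norm (f (t i) - f (s i))) + (\<Sum>i<n. norm (g (t i) - g (s i))))"
      by (simp add: sum.distrib flip: sum_distrib_left)
    also have "\<dots> < (\<bar>C\<bar> + 1) * (e' + e')"
      using A by (intro mult_strict_left_mono add_strict_mono D1[rule_format] D2[rule_format]) auto
    finally show "(\<Sum>i<n. norm (h (t i) - h (s i))) < e" using CC by simp
  qed (use d1 d2 in auto)
qed

lemma abs_cont_on_ident: "abs_cont_on a b (\<lambda>x::real. x)"
  unfolding abs_cont_on_def
proof (intro allI impI)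
  fix e :: real assume "e > 0"
  then show "\<exists>\<delta>>0. \<forall>(n::nat) s t. (\<forall>i<n. a \<le> s i \<and> s i \<le> t i \<and> t i \<le> b) \<and>
       disjoint_family_on (\<lambda>i. {s i<..<t i}) {..<n} \<and>
       (\<Sum>i<n. t i - s i) < \<delta> \<longrightarrow> (\<Sum>i<n. norm (t i - s i :: real)) < e"
    by (intro exI[of _ e]) auto
qed

lemma continuous_bounded_Icc:
  fixes f :: "real \<Rightarrow> 'a::real_normed_vector"
  assumes "continuous_on {a..b} f"
  obtains B where "B \<ge> 0" "\<And>x. x \<in> {a..b} \<Longrightarrow> norm (f x) \<le> B"
proof -
  have "bounded (f ` {a..b})"
    using assms by (intro compact_imp_bounded compact_continuous_image) auto
  then obtain B where "\<forall>x\<in>{a..b}. norm (f x) \<le> B" by (auto simp: bounded_iff)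
  then show ?thesis using that[of "max B 0"] by fastforce
qed

definition AC_loc :: "(real \<Rightarrow> 'a::real_normed_vector) set" where
  "AC_loc = {f. \<forall>a b. abs_cont_on a b f}"

lemma AC_loc_continuous: "f \<in> AC_loc \<Longrightarrow> continuous_on S f"
proof -
  assume f: "f \<in> AC_loc"
  have "isCont f x" for x
  proof (rule continuous_on_interior)
    have "abs_cont_on (x - 1) (x + 1) f" using f unfolding AC_loc_def by blast
    then show "continuous_on {x - 1..x + 1} f" by (rule abs_cont_on_imp_continuous_on)
  qed simp
  then show ?thesis by (simp add: continuous_at_imp_continuous_on)
qed

lemma AC_loc_bounded:
  assumes "f \<in> AC_loc"
  obtains B where "B \<ge> 0" "\<And>x. x \<in> {a..b} \<Longrightarrow> norm (f x) \<le> B"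
  using continuous_bounded_Icc[OF AC_loc_continuous[OF assms]] by blast

lemma AC_loc_dominated:
  assumes "f \<in> AC_loc" "g \<in> AC_loc"
    and "\<And>a b. \<exists>C. \<forall>x\<in>{a..b}. \<forall>y\<in>{a..b}. norm (h y - h x) \<le> C * (norm (f y - f x) + norm (g y - g x))"
  shows "h \<in> AC_loc"
  unfolding AC_loc_def
proof (intro CollectI allI)
  fix a b
  obtain C where "\<forall>x\<in>{a..b}. \<forall>y\<in>{a..b}. norm (h y - h x) \<le> C * (norm (f y - f x) + norm (g y - g x))"
    using assms(3) by blast
  then show "abs_cont_on a b h"
    using assms(1,2) by (intro abs_cont_on_dominated[of a b f g h C]) (auto simp: AC_loc_def)
qed

lemma AC_loc_AE_differentiable:
  fixes f :: "real \<Rightarrow> real"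
  assumes "f \<in> AC_loc"
  shows "AE x in lebesgue. (f has_real_derivative vderiv f x) (at x)"
proof -
  have "negligible {x\<in>{-real n<..<real n}. \<not> f differentiable at x}" for n
    by (rule abs_cont_on_AE_differentiable) (use assms in \<open>simp add: AC_loc_def\<close>)
  then have "negligible (\<Union>n::nat. {x\<in>{-real n<..<real n}. \<not> f differentiable at x})"
    by (intro negligible_countable_Union) auto
  moreover have "{x. \<not> f differentiable at x} \<subseteq> (\<Union>n::nat. {x\<in>{-real n<..<real n}. \<not> f differentiable at x})"
  proof
    fix x assume x: "x \<in> {x. \<not> f differentiable at x}"
    obtain n where "\<bar>x\<bar> < real n" using reals_Archimedean2 by blast
    then show "x \<in> (\<Union>n::nat. {x\<in>{-real n<..<real n}. \<not> f differentiable at x})"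
      using x by (intro UN_I[of n]) auto
  qed
  ultimately have "AE x in lebesgue. f differentiable at x"
    unfolding eventually_ae_filter_negligible by blast
  then show ?thesis
    by eventually_elim (simp add: has_real_derivative_iff_has_vector_derivative vector_derivative_works)
qed

lemma AC_loc_has_integral:
  fixes f :: "real \<Rightarrow> real"
  assumes "f \<in> AC_loc" "a \<le> b"
  shows "(vderiv f has_integral f b - f a) {a..b}"
proof -
  obtain N where N: "negligible N" "{x. \<not> (f has_real_derivative vderiv f x) (at x)} \<subseteq> N"
    using AC_loc_AE_differentiable[OF assms(1)] unfolding eventually_ae_filter_negligible by blast
  show ?thesis
  proof (rule abs_cont_on_has_integral[OF _ assms(2) N(1)])
    show "abs_cont_on a b f" using assms by (simp add: AC_loc_def)
    show "(f has_vector_derivative vderiv f x) (at x within {a..b})" if "x \<in> {a..b} - N" for x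
    proof -
      have "(f has_real_derivative vderiv f x) (at x)" using that N by auto
      then show ?thesis
        unfolding has_real_derivative_iff_has_vector_derivative by (rule has_vector_derivative_at_within)
    qed
  qed
qed

lemma borel_measurable_lebesgue_local:
  fixes g :: "real \<Rightarrow> real"
  assumes m: "\<And>n::nat. (\<lambda>x. indicator {-real n..real n} x *\<^sub>R g x) \<in> borel_measurable lebesgue"
  shows "g \<in> borel_measurable lebesgue"
proof (rule borel_measurable_LIMSEQ_real[OF _ m])
  fix x :: real
  obtain N where N: "\<bar>x\<bar> \<le> real N" using real_arch_simple by blast
  have "eventually (\<lambda>n. indicator {-real n..real n} x *\<^sub>R g x = g x) sequentially"
    using eventually_ge_at_top[of N] by eventually_elim (use N in \<open>auto simp: indicator_def\<close>)
  then show "(\<lambda>n. indicator {-real n..real n} x *\<^sub>R g x) \<longlonglongrightarrow> g x"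
    by (rule tendsto_eventually)
qed

text \<open>Measurability is obtained from the integral: a function possessing a Henstock-Kurzweil
  integral over an interval is Lebesgue measurable there.\<close>

lemma AC_loc_vderiv_measurable:
  fixes f :: "real \<Rightarrow> real"
  assumes "f \<in> AC_loc"
  shows "vderiv f \<in> borel_measurable lebesgue"
proof (rule borel_measurable_lebesgue_local)
  fix n :: nat
  show "(\<lambda>x. indicator {-real n..real n} x *\<^sub>R vderiv f x) \<in> borel_measurable lebesgue"
    by (rule has_integral_implies_lebesgue_measurable[OF AC_loc_has_integral[OF assms]]) simp
qed

section \<open>Locally square integrable functions\<close>

definition L2_loc :: "(real \<Rightarrow> real) set" where
  "L2_loc = {g. g \<in> borel_measurable lebesgue \<and> (\<forall>a b. set_integrable lebesgue {a..b} (\<lambda>x. (g x)\<^sup>2))}"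

lemma L2_loc_measurable [measurable_dest]: "g \<in> L2_loc \<Longrightarrow> g \<in> borel_measurable lebesgue"
  by (simp add: L2_loc_def)

lemma L2_loc_square: "g \<in> L2_loc \<Longrightarrow> set_integrable lebesgue {a..b} (\<lambda>x. (g x)\<^sup>2)"
  by (simp add: L2_loc_def)

lemma set_integrable_dominated:
  fixes f g :: "real \<Rightarrow> real"
  assumes "set_integrable lebesgue A f" "g \<in> borel_measurable lebesgue" "A \<in> sets lebesgue"
    and "AE x in lebesgue. x \<in> A \<longrightarrow> \<bar>g x\<bar> \<le> f x"
  shows "set_integrable lebesgue A g"
proof (rule set_integrable_bound[OF assms(1)])
  show "set_borel_measurable lebesgue A g"
    using assms(2,3) unfolding set_borel_measurable_def by measurable
  show "AE x in lebesgue. x \<in> A \<longrightarrow> norm (g x) \<le> norm (f x)"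
    using assms(4) by eventually_elim auto
qed

lemma L2_loc_mult_integrable:
  assumes "g \<in> L2_loc" "h \<in> L2_loc"
  shows "set_integrable lebesgue {a..b} (\<lambda>x. g x * h x)"
proof (rule set_integrable_dominated)
  show "set_integrable lebesgue {a..b} (\<lambda>x. (g x)\<^sup>2 + (h x)\<^sup>2)"
    using assms by (intro set_integral_add L2_loc_square)
  have "\<bar>g x * h x\<bar> \<le> (g x)\<^sup>2 + (h x)\<^sup>2" for x
  proof -
    have "0 \<le> (\<bar>g x\<bar> - \<bar>h x\<bar>)\<^sup>2" by simp
    then have "2 * (\<bar>g x\<bar> * \<bar>h x\<bar>) \<le> (g x)\<^sup>2 + (h x)\<^sup>2" by (simp add: power2_diff)
    moreover have "0 \<le> \<bar>g x\<bar> * \<bar>h x\<bar>" by simp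
    ultimately show ?thesis unfolding abs_mult by linarith
  qed
  then show "AE x in lebesgue. x \<in> {a..b} \<longrightarrow> \<bar>g x * h x\<bar> \<le> (g x)\<^sup>2 + (h x)\<^sup>2" by simp
  show "(\<lambda>x. g x * h x) \<in> borel_measurable lebesgue" using assms by measurable
qed simp

lemma borel_imp_lebesgue_measurable: "f \<in> borel_measurable borel \<Longrightarrow> f \<in> borel_measurable lebesgue"
  by (simp add: measurable_completion)

lemma continuous_L2_loc:
  assumes "continuous_on UNIV f"
  shows "f \<in> L2_loc"
  unfolding L2_loc_def
proof (intro CollectI conjI allI)
  show "f \<in> borel_measurable lebesgue"
    using assms by (intro borel_imp_lebesgue_measurable borel_measurable_continuous_onI)
  show "set_integrable lebesgue {a..b} (\<lambda>x. (f x)\<^sup>2)" for a b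
  proof -
    have "continuous_on {a..b} (\<lambda>x. (f x)\<^sup>2)"
      using assms by (intro continuous_intros) (auto intro: continuous_on_subset)
    then show ?thesis
      using absolutely_integrable_continuous[of a b "\<lambda>x. (f x)\<^sup>2"] by simp
  qed
qed

lemma L2_loc_integrable: "g \<in> L2_loc \<Longrightarrow> set_integrable lebesgue {a..b} g"
  using L2_loc_mult_integrable[of g "\<lambda>_. 1" a b] continuous_L2_loc[of "\<lambda>_. 1"] by simp

lemma L2_loc_add:
  assumes "g \<in> L2_loc" "h \<in> L2_loc"
  shows "(\<lambda>x. g x + h x) \<in> L2_loc"
  unfolding L2_loc_def
proof (intro CollectI conjI allI)
  show "(\<lambda>x. g x + h x) \<in> borel_measurable lebesgue" using assms by measurable
  fix a b
  have "set_integrable lebesgue {a..b} (\<lambda>x. (g x)\<^sup>2 + (h x)\<^sup>2 + 2 * (g x * h x))"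
    using assms by (intro set_integral_add set_integrable_mult_right L2_loc_square L2_loc_mult_integrable)
  then show "set_integrable lebesgue {a..b} (\<lambda>x. (g x + h x)\<^sup>2)"
    by (simp add: power2_sum mult.assoc)
qed

lemma L2_loc_cont_mult:
  assumes "continuous_on UNIV f" "g \<in> L2_loc"
  shows "(\<lambda>x. f x * g x) \<in> L2_loc"
  unfolding L2_loc_def
proof (intro CollectI conjI allI)
  show m: "(\<lambda>x. f x * g x) \<in> borel_measurable lebesgue"
    using assms continuous_L2_loc[OF assms(1)] by measurable
  fix a b
  obtain B where B: "\<And>x. x \<in> {a..b} \<Longrightarrow> norm (f x) \<le> B"
    using continuous_bounded_Icc continuous_on_subset[OF assms(1)] by (metis subset_UNIV)
  show "set_integrable lebesgue {a..b} (\<lambda>x. (f x * g x)\<^sup>2)"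
  proof (rule set_integrable_dominated)
    show "set_integrable lebesgue {a..b} (\<lambda>x. B\<^sup>2 * (g x)\<^sup>2)"
      using assms by (intro set_integrable_mult_right L2_loc_square)
    show "(\<lambda>x. (f x * g x)\<^sup>2) \<in> borel_measurable lebesgue" using m by measurable
    have "(f x)\<^sup>2 \<le> B\<^sup>2" if "x \<in> {a..b}" for x
      using B[OF that] by (simp add: abs_le_square_iff[symmetric])
    then show "AE x in lebesgue. x \<in> {a..b} \<longrightarrow> \<bar>(f x * g x)\<^sup>2\<bar> \<le> B\<^sup>2 * (g x)\<^sup>2"
      by (intro AE_I2) (auto simp: power_mult_distrib intro!: mult_right_mono)
  qed simp
qed

lemma L2_loc_cmult: "g \<in> L2_loc \<Longrightarrow> (\<lambda>x. c * g x) \<in> L2_loc"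
  by (rule L2_loc_cont_mult) auto

lemma L2_loc_diff: "g \<in> L2_loc \<Longrightarrow> h \<in> L2_loc \<Longrightarrow> (\<lambda>x. g x - h x) \<in> L2_loc"
  using L2_loc_add[of g "\<lambda>x. -1 * h x"] L2_loc_cmult[of h "-1"] by simp

lemma L2_loc_dominated:
  assumes "g \<in> L2_loc" "h \<in> borel_measurable lebesgue" "AE x in lebesgue. \<bar>h x\<bar> \<le> \<bar>g x\<bar>"
  shows "h \<in> L2_loc"
  unfolding L2_loc_def
proof (intro CollectI conjI allI assms(2))
  fix a b
  show "set_integrable lebesgue {a..b} (\<lambda>x. (h x)\<^sup>2)"
  proof (rule set_integrable_dominated[OF L2_loc_square[OF assms(1)]])
    show "AE x in lebesgue. x \<in> {a..b} \<longrightarrow> \<bar>(h x)\<^sup>2\<bar> \<le> (g x)\<^sup>2"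
      using assms(3) by eventually_elim (simp add: abs_le_square_iff)
    show "(\<lambda>x. (h x)\<^sup>2) \<in> borel_measurable lebesgue" using assms(2) by measurable
  qed simp
qed

subsection \<open>Real-valued $H^1$ functions\<close>

text \<open>\<open>H1_loc\<close> speaks only of the square of the derivative; measurability of the
  derivative itself is a consequence of absolute continuity.\<close>

lemma H1_real_iff: "(f :: real \<Rightarrow> real) \<in> H1_loc \<longleftrightarrow> f \<in> AC_loc \<and> vderiv f \<in> L2_loc"
  using AC_loc_vderiv_measurable[of f] by (auto simp: H1_loc_def AC_loc_def L2_loc_def)

lemma H1_AC: "f \<in> H1_loc \<Longrightarrow> f \<in> AC_loc"
  by (auto simp: H1_loc_def AC_loc_def)

lemma H1_L2: "(f :: real \<Rightarrow> real) \<in> H1_loc \<Longrightarrow> f \<in> L2_loc"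
  by (intro continuous_L2_loc H1_loc_continuous)

lemma H1_vderiv_L2: "(f :: real \<Rightarrow> real) \<in> H1_loc \<Longrightarrow> vderiv f \<in> L2_loc"
  by (simp add: H1_real_iff)

lemma H1_AE_deriv: "(f :: real \<Rightarrow> real) \<in> H1_loc \<Longrightarrow> AE x in lebesgue. (f has_real_derivative vderiv f x) (at x)"
  by (intro AC_loc_AE_differentiable H1_AC)

lemma H1_FTC:
  fixes f :: "real \<Rightarrow> real"
  assumes "f \<in> H1_loc" "a \<le> b"
  shows "(LINT x:{a..b}|lebesgue. vderiv f x) = f b - f a"
  using set_lebesgue_integral_eq_integral(2)[OF L2_loc_integrable[OF H1_vderiv_L2[OF assms(1)], of a b]]
    AC_loc_has_integral[OF H1_AC[OF assms(1)] assms(2)] by (simp add: integral_unique)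

lemma H1_realI:
  fixes f :: "real \<Rightarrow> real"
  assumes "f \<in> AC_loc" "g \<in> L2_loc" "AE x in lebesgue. \<bar>vderiv f x\<bar> \<le> \<bar>g x\<bar>"
  shows "f \<in> H1_loc"
  unfolding H1_real_iff using assms AC_loc_vderiv_measurable L2_loc_dominated by blast

lemma vderiv_eqI: "(f has_real_derivative D) (at x) \<Longrightarrow> vderiv f x = D"
  by (simp add: has_real_derivative_iff_has_vector_derivative vector_derivative_at)

lemma AC_loc_lipschitz:
  fixes f :: "real \<Rightarrow> real"
  assumes "\<And>x y. \<bar>f x - f y\<bar> \<le> L * \<bar>x - y\<bar>"
  shows "f \<in> AC_loc"
proof (rule AC_loc_dominated[of "\<lambda>x. x" "\<lambda>x. x"])
  show "(\<lambda>x::real. x) \<in> AC_loc" by (simp add: AC_loc_def abs_cont_on_ident)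
  then show "(\<lambda>x::real. x) \<in> AC_loc" .
  have "norm (f y - f x) \<le> L / 2 * (norm (y - x) + norm (y - x))" for x y
    using assms[of y x] by simp
  then show "\<exists>C. \<forall>x\<in>{a..b}. \<forall>y\<in>{a..b}. norm (f y - f x) \<le> C * (norm (y - x) + norm (y - x))" for a b
    by blast
qed

lemma H1_lipschitz:
  fixes f :: "real \<Rightarrow> real"
  assumes lip: "\<And>x y. \<bar>f x - f y\<bar> \<le> L * \<bar>x - y\<bar>"
  shows "f \<in> H1_loc"
proof (rule H1_realI[OF AC_loc_lipschitz[OF lip], of "\<lambda>_. L"])
  show "(\<lambda>_. L) \<in> L2_loc" by (rule continuous_L2_loc) simp
  show "AE x in lebesgue. \<bar>vderiv f x\<bar> \<le> \<bar>L\<bar>"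
    using AC_loc_AE_differentiable[OF AC_loc_lipschitz[OF lip]]
  proof eventually_elim
    case (elim x)
    then have "((\<lambda>h. (f (x + h) - f x) / h) \<longlongrightarrow> vderiv f x) (at 0)" by (simp add: DERIV_def)
    then have "((\<lambda>h. \<bar>(f (x + h) - f x) / h\<bar>) \<longlongrightarrow> \<bar>vderiv f x\<bar>) (at 0)" by (rule tendsto_rabs)
    then show ?case
    proof (rule tendsto_upperbound)
      show "\<forall>\<^sub>F h in at 0. \<bar>(f (x + h) - f x) / h\<bar> \<le> \<bar>L\<bar>"
        unfolding eventually_at_filter
      proof (intro always_eventually allI impI)
        fix h :: real assume "h \<noteq> 0"
        have "\<bar>f (x + h) - f x\<bar> \<le> L * \<bar>h\<bar>" using lip[of "x + h" x] by simp
        also have "\<dots> \<le> \<bar>L\<bar> * \<bar>h\<bar>" by (rule mult_right_mono) auto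
        finally have "\<bar>f (x + h) - f x\<bar> \<le> \<bar>L\<bar> * \<bar>h\<bar>" .
        then show "\<bar>(f (x + h) - f x) / h\<bar> \<le> \<bar>L\<bar>" using \<open>h \<noteq> 0\<close> by (simp add: divide_le_eq)
      qed
    qed simp
  qed
qed

lemma H1_const: "(\<lambda>_. c :: real) \<in> H1_loc"
  by (rule H1_lipschitz[of _ 0]) simp

lemma H1_add:
  fixes f g :: "real \<Rightarrow> real"
  assumes f: "f \<in> H1_loc" and g: "g \<in> H1_loc"
  shows "(\<lambda>x. f x + g x) \<in> H1_loc"
    and "AE x in lebesgue. vderiv (\<lambda>x. f x + g x) x = vderiv f x + vderiv g x"
proof -
  show v: "AE x in lebesgue. vderiv (\<lambda>x. f x + g x) x = vderiv f x + vderiv g x"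
    using H1_AE_deriv[OF f] H1_AE_deriv[OF g]
    by eventually_elim (auto intro!: vderiv_eqI derivative_eq_intros)
  show "(\<lambda>x. f x + g x) \<in> H1_loc"
  proof (rule H1_realI)
    show "(\<lambda>x. f x + g x) \<in> AC_loc"
    proof (rule AC_loc_dominated[OF H1_AC[OF f] H1_AC[OF g]])
      have "norm (f y + g y - (f x + g x)) \<le> 1 * (norm (f y - f x) + norm (g y - g x))" for x y by simp
      then show "\<exists>C. \<forall>x\<in>{a..b}. \<forall>y\<in>{a..b}. norm (f y + g y - (f x + g x)) \<le> C * (norm (f y - f x) + norm (g y - g x))" for a b
        by blast
    qed
    show "(\<lambda>x. vderiv f x + vderiv g x) \<in> L2_loc" using f g by (intro L2_loc_add H1_vderiv_L2)
    show "AE x in lebesgue. \<bar>vderiv (\<lambda>x. f x + g x) x\<bar> \<le> \<bar>vderiv f x + vderiv g x\<bar>"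
      using v by eventually_elim simp
  qed
qed

lemma H1_mult:
  fixes f g :: "real \<Rightarrow> real"
  assumes f: "f \<in> H1_loc" and g: "g \<in> H1_loc"
  shows "(\<lambda>x. f x * g x) \<in> H1_loc"
    and "AE x in lebesgue. vderiv (\<lambda>x. f x * g x) x = f x * vderiv g x + g x * vderiv f x"
proof -
  show v: "AE x in lebesgue. vderiv (\<lambda>x. f x * g x) x = f x * vderiv g x + g x * vderiv f x"
    using H1_AE_deriv[OF f] H1_AE_deriv[OF g]
    by eventually_elim (auto intro!: vderiv_eqI derivative_eq_intros)
  show "(\<lambda>x. f x * g x) \<in> H1_loc"
  proof (rule H1_realI)
    show "(\<lambda>x. f x * g x) \<in> AC_loc"
    proof (rule AC_loc_dominated[OF H1_AC[OF f] H1_AC[OF g]])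
      fix a b
      obtain A where A: "A \<ge> 0" "\<And>x. x \<in> {a..b} \<Longrightarrow> norm (f x) \<le> A" using AC_loc_bounded[OF H1_AC[OF f]] by blast
      obtain B where B: "B \<ge> 0" "\<And>x. x \<in> {a..b} \<Longrightarrow> norm (g x) \<le> B" using AC_loc_bounded[OF H1_AC[OF g]] by blast
      have "norm (f y * g y - f x * g x) \<le> (A + B) * (norm (f y - f x) + norm (g y - g x))"
        if "x \<in> {a..b}" "y \<in> {a..b}" for x y
      proof -
        have "f y * g y - f x * g x = f y * (g y - g x) + g x * (f y - f x)" by (simp add: algebra_simps)
        then have "norm (f y * g y - f x * g x) \<le> norm (f y) * norm (g y - g x) + norm (g x) * norm (f y - f x)"
          using norm_triangle_ineq[of "f y * (g y - g x)" "g x * (f y - f x)"] by (simp add: abs_mult)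
        also have "\<dots> \<le> (A + B) * norm (g y - g x) + (A + B) * norm (f y - f x)"
          using A(2)[OF that(2)] B(2)[OF that(1)] A(1) B(1) by (intro add_mono mult_right_mono) auto
        finally show ?thesis by (simp add: algebra_simps)
      qed
      then show "\<exists>C. \<forall>x\<in>{a..b}. \<forall>y\<in>{a..b}. norm (f y * g y - f x * g x) \<le> C * (norm (f y - f x) + norm (g y - g x))"
        by blast
    qed
    show "(\<lambda>x. f x * vderiv g x + g x * vderiv f x) \<in> L2_loc"
      using f g by (intro L2_loc_add L2_loc_cont_mult H1_vderiv_L2 H1_loc_continuous)
    show "AE x in lebesgue. \<bar>vderiv (\<lambda>x. f x * g x) x\<bar> \<le> \<bar>f x * vderiv g x + g x * vderiv f x\<bar>"
      using v by eventually_elim simp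
  qed
qed

lemma H1_cmult:
  fixes f :: "real \<Rightarrow> real"
  assumes f: "f \<in> H1_loc"
  shows "(\<lambda>x. c * f x) \<in> H1_loc"
    and "AE x in lebesgue. vderiv (\<lambda>x. c * f x) x = c * vderiv f x"
proof -
  show "(\<lambda>x. c * f x) \<in> H1_loc" by (rule H1_mult(1)[OF H1_const f])
  show "AE x in lebesgue. vderiv (\<lambda>x. c * f x) x = c * vderiv f x"
    using H1_AE_deriv[OF f] by eventually_elim (auto intro!: vderiv_eqI derivative_eq_intros)
qed

lemma H1_diff:
  fixes f g :: "real \<Rightarrow> real"
  assumes f: "f \<in> H1_loc" and g: "g \<in> H1_loc"
  shows "(\<lambda>x. f x - g x) \<in> H1_loc"
    and "AE x in lebesgue. vderiv (\<lambda>x. f x - g x) x = vderiv f x - vderiv g x"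
proof -
  show "(\<lambda>x. f x - g x) \<in> H1_loc" using H1_add(1)[OF f H1_cmult(1)[OF g, of "-1"]] by simp
  show "AE x in lebesgue. vderiv (\<lambda>x. f x - g x) x = vderiv f x - vderiv g x"
    using H1_AE_deriv[OF f] H1_AE_deriv[OF g]
    by eventually_elim (auto intro!: vderiv_eqI derivative_eq_intros)
qed

text \<open>The conditions on \<open>\<phi>\<close> are imposed only at values of \<open>f\<close>,
  so that the square root can be composed with functions bounded away from 0.\<close>

lemma H1_compose:
  fixes f \<phi> \<phi>' :: "real \<Rightarrow> real"
  assumes f: "f \<in> H1_loc"
    and lip: "\<And>x y. \<bar>\<phi> (f x) - \<phi> (f y)\<bar> \<le> L * \<bar>f x - f y\<bar>"
    and d: "\<And>x. (\<phi> has_real_derivative \<phi>' (f x)) (at (f x))"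
    and c: "continuous_on UNIV (\<lambda>x. \<phi>' (f x))"
  shows "(\<lambda>x. \<phi> (f x)) \<in> H1_loc"
    and "AE x in lebesgue. vderiv (\<lambda>x. \<phi> (f x)) x = \<phi>' (f x) * vderiv f x"
proof -
  show v: "AE x in lebesgue. vderiv (\<lambda>x. \<phi> (f x)) x = \<phi>' (f x) * vderiv f x"
    using H1_AE_deriv[OF f] by eventually_elim (intro vderiv_eqI DERIV_chain2[where g = f, OF d])
  show "(\<lambda>x. \<phi> (f x)) \<in> H1_loc"
  proof (rule H1_realI)
    show "(\<lambda>x. \<phi> (f x)) \<in> AC_loc"
    proof (rule AC_loc_dominated[OF H1_AC[OF f] H1_AC[OF f]])
      have "norm (\<phi> (f y) - \<phi> (f x)) \<le> L / 2 * (norm (f y - f x) + norm (f y - f x))" for x y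
        using lip[of y x] by simp
      then show "\<exists>C. \<forall>x\<in>{a..b}. \<forall>y\<in>{a..b}. norm (\<phi> (f y) - \<phi> (f x)) \<le> C * (norm (f y - f x) + norm (f y - f x))" for a b
        by blast
    qed
    show "(\<lambda>x. \<phi>' (f x) * vderiv f x) \<in> L2_loc" by (intro L2_loc_cont_mult c H1_vderiv_L2 f)
    show "AE x in lebesgue. \<bar>vderiv (\<lambda>x. \<phi> (f x)) x\<bar> \<le> \<bar>\<phi>' (f x) * vderiv f x\<bar>"
      using v by eventually_elim simp
  qed
qed

lemma H1_sum:
  fixes f :: "'i \<Rightarrow> real \<Rightarrow> real"
  assumes "\<And>i. i \<in> A \<Longrightarrow> f i \<in> H1_loc"
  shows "(\<lambda>x. \<Sum>i\<in>A. f i x) \<in> H1_loc"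
  using assms
proof (induction A rule: infinite_finite_induct)
  case (insert i A)
  then show ?case using H1_add(1)[of "f i" "\<lambda>x. \<Sum>i\<in>A. f i x"] by simp
qed (simp_all add: H1_const)

lemma vderiv_local:
  assumes "open S" "x \<in> S" "\<And>y. y \<in> S \<Longrightarrow> f y = g y"
  shows "vderiv f x = vderiv g x"
proof -
  have "(f has_vector_derivative D) (at x) \<longleftrightarrow> (g has_vector_derivative D) (at x)" for D
    using has_vector_derivative_transform_within_open[OF _ assms(1,2)] assms(3) by metis
  then show ?thesis by (simp add: vector_derivative_def)
qed

text \<open>Meant for periodised functions, which agree with a finite sum on every bounded interval
  but not globally.\<close>

lemma H1_local:
  fixes f :: "real \<Rightarrow> real"
  assumes "\<And>n::nat. \<exists>g\<in>H1_loc. \<forall>x\<in>{-real n<..<real n}. f x = g x"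
  shows "f \<in> H1_loc"
  unfolding H1_loc_def
proof (intro CollectI allI conjI)
  fix a b
  obtain n where n: "\<bar>a\<bar> + \<bar>b\<bar> < real n" using reals_Archimedean2 by blast
  obtain g where g: "g \<in> H1_loc" "\<And>x. x \<in> {-real n<..<real n} \<Longrightarrow> f x = g x" using assms[of n] by blast
  have sub: "{a..b} \<subseteq> {-real n<..<real n}" using n by auto
  have ab: "abs_cont_on a b g" using H1_AC[OF g(1)] by (simp add: AC_loc_def)
  show "abs_cont_on a b f"
  proof (rule abs_cont_on_dominated[OF ab ab])
    show "norm (f y - f x) \<le> 1 * (norm (g y - g x) + norm (g y - g x))" if "x \<in> {a..b}" "y \<in> {a..b}" for x y
    proof -
      have "x \<in> {-real n<..<real n}" "y \<in> {-real n<..<real n}" using sub that by blast+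
      then show ?thesis using g(2) by simp
    qed
  qed
  have "vderiv f x = vderiv g x" if "x \<in> {a..b}" for x
    using sub that g(2) by (intro vderiv_local[of "{-real n<..<real n}"]) auto
  moreover have "set_integrable lebesgue {a..b} (\<lambda>x. (norm (vderiv g x))\<^sup>2)"
    using g(1) by (simp add: H1_loc_def)
  ultimately show "set_integrable lebesgue {a..b} (\<lambda>x. (norm (vderiv f x))\<^sup>2)"
    by (subst set_integrable_cong[OF refl refl, of _ _ "\<lambda>x. (norm (vderiv g x))\<^sup>2"]) auto
qed

section \<open>Translations\<close>

text \<open>This holds at every point, differentiable or not, because the same numbers are
  derivatives on both sides.\<close>

lemma vderiv_shift:
  fixes f :: "real \<Rightarrow> real"
  shows "vderiv (\<lambda>x. f (x + c)) x = vderiv f (x + c)"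
  by (simp add: vector_derivative_def DERIV_shift flip: has_real_derivative_iff_has_vector_derivative)

lemma lebesgue_shift_measurable [measurable]: "(\<lambda>x::real. x + c) \<in> measurable lebesgue lebesgue"
  using lebesgue_affine_measurable[of "\<lambda>_::real. 1" c] by (simp add: add.commute)

lemma lebesgue_shift: "distr lebesgue lebesgue (\<lambda>x::real. x + c) = lebesgue"
  using lebesgue_real_affine[of 1 c] by (simp add: add.commute density_1)

lemma AE_lebesgue_shift:
  assumes "AE x in lebesgue. P x"
  shows "AE x in lebesgue. P (x + c :: real)"
  by (rule AE_distrD[of "\<lambda>x. x + c" lebesgue lebesgue]) (rule lebesgue_shift_measurable, subst lebesgue_shift, rule assms)

lemma lebesgue_integral_shift:
  fixes f :: "real \<Rightarrow> 'a::euclidean_space"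
  shows "(LINT x|lebesgue. f (x + c)) = (LINT x|lebesgue. f x)"
  using lebesgue_integral_real_affine[of 1 f c] by (simp add: add.commute)

lemma lebesgue_integrable_shift:
  fixes f :: "real \<Rightarrow> 'a::euclidean_space"
  shows "integrable lebesgue (\<lambda>x. f (x + c)) \<longleftrightarrow> integrable lebesgue f"
  using lebesgue_integrable_real_affine_iff[of 1 f c] by (simp add: add.commute)

lemma L2_loc_shift:
  assumes "g \<in> L2_loc"
  shows "(\<lambda>x. g (x + c)) \<in> L2_loc"
  unfolding L2_loc_def
proof (intro CollectI conjI allI)
  show "(\<lambda>x. g (x + c)) \<in> borel_measurable lebesgue"
    by (rule measurable_compose[OF lebesgue_shift_measurable L2_loc_measurable[OF assms]])
  fix a b
  have "integrable lebesgue (\<lambda>x. indicator {a + c..b + c} (x + c) *\<^sub>R (g (x + c))\<^sup>2)"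
    using L2_loc_square[OF assms, of "a + c" "b + c"]
      lebesgue_integrable_shift[of "\<lambda>x. indicator {a + c..b + c} x *\<^sub>R (g x)\<^sup>2" c]
    by (simp add: set_integrable_def)
  moreover have "indicator {a + c..b + c} (x + c) = (indicator {a..b} x :: real)" for x by (auto simp: indicator_def)
  ultimately show "set_integrable lebesgue {a..b} (\<lambda>x. (g (x + c))\<^sup>2)"
    by (simp add: set_integrable_def)
qed

lemma H1_shift:
  fixes f :: "real \<Rightarrow> real"
  assumes f: "f \<in> H1_loc"
  shows "(\<lambda>x. f (x + c)) \<in> H1_loc"
proof (rule H1_realI)
  show "(\<lambda>x. vderiv f (x + c)) \<in> L2_loc" using f by (intro L2_loc_shift H1_vderiv_L2)
  show "AE x in lebesgue. \<bar>vderiv (\<lambda>x. f (x + c)) x\<bar> \<le> \<bar>vderiv f (x + c)\<bar>" by (simp add: vderiv_shift)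
  show "(\<lambda>x. f (x + c)) \<in> AC_loc"
    unfolding AC_loc_def abs_cont_on_def
  proof (intro CollectI allI impI)
    fix a b e :: real assume e: "e > 0"
    have "abs_cont_on (a + c) (b + c) f" using H1_AC[OF f] by (simp add: AC_loc_def)
    from mp[OF spec[OF this[unfolded abs_cont_on_def]] e] obtain d where d: "d > 0" and
      D: "\<forall>(n::nat) s t. (\<forall>i<n. a + c \<le> s i \<and> s i \<le> t i \<and> t i \<le> b + c) \<and>
         disjoint_family_on (\<lambda>i. {s i<..<t i}) {..<n} \<and>
         (\<Sum>i<n. t i - s i) < d \<longrightarrow> (\<Sum>i<n. norm (f (t i) - f (s i))) < e"
      by (elim exE conjE)
    show "\<exists>\<delta>>0. \<forall>(n::nat) s t. (\<forall>i<n. a \<le> s i \<and> s i \<le> t i \<and> t i \<le> b) \<and>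
         disjoint_family_on (\<lambda>i. {s i<..<t i}) {..<n} \<and>
         (\<Sum>i<n. t i - s i) < \<delta> \<longrightarrow> (\<Sum>i<n. norm (f (t i + c) - f (s i + c))) < e"
    proof (intro exI[of _ d] conjI allI impI d)
      fix n :: nat and s t
      assume A: "(\<forall>i<n. a \<le> s i \<and> s i \<le> t i \<and> t i \<le> b) \<and>
         disjoint_family_on (\<lambda>i. {s i<..<t i}) {..<n} \<and> (\<Sum>i<n. t i - s i) < d"
      show "(\<Sum>i<n. norm (f (t i + c) - f (s i + c))) < e"
      proof (rule D[THEN spec, THEN spec, THEN spec, THEN mp, of n "\<lambda>i. s i + c" "\<lambda>i. t i + c"], intro conjI)
        show "disjoint_family_on (\<lambda>i. {s i + c<..<t i + c}) {..<n}"
          unfolding disjoint_family_on_def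
        proof (intro ballI impI)
          fix i j assume ij: "i \<in> {..<n}" "j \<in> {..<n}" "i \<noteq> j"
          then have "{s i<..<t i} \<inter> {s j<..<t j} = {}" using A by (auto simp: disjoint_family_on_def)
          then have "x - c \<notin> {s i<..<t i} \<inter> {s j<..<t j}" for x by blast
          then show "{s i + c<..<t i + c} \<inter> {s j + c<..<t j + c} = {}" by (fastforce simp: algebra_simps)
        qed
      qed (use A in auto)
    qed
  qed
qed

subsection \<open>Quasi-derivatives\<close>

lemma borel_measureD:
  assumes "borel_measure m"
  shows "sets m = sets borel" "space m = UNIV" "emeasure m {a..b} < \<infinity>"
proof -
  show s: "sets m = sets borel" using assms by (simp add: borel_measure_def)
  show "space m = UNIV" using sets_eq_imp_space_eq[OF s] by simp
  show "emeasure m {a..b} < \<infinity>" using assms compact_Icc unfolding borel_measure_def by blast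
qed

lemma borel_measure_integrable:
  fixes f :: "real \<Rightarrow> real"
  assumes m: "borel_measure m" and f: "continuous_on UNIV f" and A: "A \<in> sets borel" "A \<subseteq> {a..b}"
  shows "set_integrable m A f"
proof -
  obtain B where B: "\<And>x. x \<in> {a..b} \<Longrightarrow> norm (f x) \<le> B"
    using continuous_bounded_Icc continuous_on_subset[OF f] by (metis subset_UNIV)
  have "integrable m (\<lambda>x. indicator A x *\<^sub>R f x)"
  proof (rule integrableI_bounded_set_indicator)
    show "A \<in> sets m" using A borel_measureD(1)[OF m] by simp
    show "f \<in> borel_measurable m"
      using borel_measurable_continuous_onI[OF f] borel_measureD(1)[OF m] measurable_cong_sets by blast
    have "emeasure m A \<le> emeasure m {a..b}"
      using A borel_measureD(1)[OF m] by (intro emeasure_mono) auto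
    then show "emeasure m A < \<infinity>" using borel_measureD(3)[OF m, of a b] by simp
    show "AE x in m. x \<in> A \<longrightarrow> norm (f x) \<le> B" using B A by (intro AE_I2) blast
  qed
  then show ?thesis by (simp add: set_integrable_def)
qed

text \<open>The centre is removed because the measure may charge it; the punctured intervals shrink
  to the empty set.\<close>

lemma set_integral_shrink:
  fixes F :: "real \<Rightarrow> real"
  assumes F: "set_integrable m {x - 1..x + 1} F" and s: "sets borel \<subseteq> sets m"
  shows "(\<lambda>n. LINT s:{x - inverse (real (Suc n))..x + inverse (real (Suc n))} - {x}|m. F s) \<longlonglongrightarrow> 0"
proof -
  let ?J = "\<lambda>n. {x - inverse (real (Suc n))..x + inverse (real (Suc n))} - {x}"
  have J: "?J n \<in> sets m" for n using s by auto
  have i1: "inverse (real (Suc n)) \<le> 1" for n by (simp add: inverse_le_1_iff)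
  have "(\<lambda>n. LINT s|m. indicator (?J n) s *\<^sub>R F s) \<longlonglongrightarrow> (LINT s|m. 0)"
  proof (rule integral_dominated_convergence[where w = "\<lambda>s. norm (indicator {x - 1..x + 1} s *\<^sub>R F s)"])
    show "integrable m (\<lambda>s. norm (indicator {x - 1..x + 1} s *\<^sub>R F s))"
      using F unfolding set_integrable_def by (rule integrable_norm)
    show "(\<lambda>s. indicator (?J n) s *\<^sub>R F s) \<in> borel_measurable m" for n
    proof -
      have "set_integrable m (?J n) F"
        by (rule set_integrable_subset[OF F J]) (use i1[of n] in auto)
      then show ?thesis by (simp add: set_integrable_def)
    qed
    show "AE s in m. (\<lambda>n. indicator (?J n) s *\<^sub>R F s) \<longlonglongrightarrow> 0"
    proof (rule AE_I2, rule tendsto_eventually)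
      fix s
      show "\<forall>\<^sub>F n in sequentially. indicator (?J n) s *\<^sub>R F s = 0"
      proof (cases "s = x")
        case False
        then have "eventually (\<lambda>n. inverse (real (Suc n)) < \<bar>s - x\<bar>) sequentially"
          using order_tendstoD(2)[OF LIMSEQ_inverse_real_of_nat, of "\<bar>s - x\<bar>"] by simp
        then show ?thesis by eventually_elim (auto simp: indicator_def)
      qed simp
    qed
    show "AE s in m. norm (indicator (?J n) s *\<^sub>R F s) \<le> norm (indicator {x - 1..x + 1} s *\<^sub>R F s)" for n
      using i1[of n] by (intro AE_I2) (auto simp: indicator_def)
  qed simp
  then show ?thesis by (simp add: set_lebesgue_integral_def)
qed

text \<open>Primitive of \<open>F dm\<close>, normalised at 0 and left-continuous even where \<open>m\<close> has atoms.\<close>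

definition primitive :: "real measure \<Rightarrow> (real \<Rightarrow> real) \<Rightarrow> real \<Rightarrow> real" where
  "primitive m F y = (LINT s|m. (indicator {0..<y} s - indicator {y..<0} s) * F s)"

lemma primitive_diff:
  assumes F: "\<And>a b. set_integrable m {a..b} F" and s: "sets borel \<subseteq> sets m" and xy: "x \<le> y"
  shows "primitive m F y - primitive m F x = (LINT s:{x..<y}|m. F s)"
proof -
  have i: "integrable m (\<lambda>s. indicator {a..<b} s * F s)" for a b
  proof -
    have "set_integrable m {a..<b} F"
      by (rule set_integrable_subset[OF F[of a b]]) (use s in auto)
    then show ?thesis by (simp add: set_integrable_def)
  qed
  have i2: "integrable m (\<lambda>s. (indicator {0..<y} s - indicator {y..<0} s) * F s)" for y
    unfolding left_diff_distrib by (intro Bochner_Integration.integrable_diff i)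
  have "primitive m F y - primitive m F x = (LINT s|m. (indicator {0..<y} s - indicator {y..<0} s) * F s - (indicator {0..<x} s - indicator {x..<0} s) * F s)"
    unfolding primitive_def using i2 by (subst Bochner_Integration.integral_diff) auto
  also have "\<dots> = (LINT s:{x..<y}|m. F s)"
    unfolding set_lebesgue_integral_def using xy
    by (intro Bochner_Integration.integral_cong) (auto simp: indicator_def)
  finally show ?thesis .
qed

lemma primitive_left_continuous:
  assumes F: "\<And>a b. set_integrable m {a..b} F" and s: "sets borel \<subseteq> sets m"
  shows "continuous (at_left y) (primitive m F)"
  unfolding continuous_within
proof (rule tendsto_at_left_sequentially[of "y - 1"])
  fix S :: "nat \<Rightarrow> real" assume S: "\<And>n. S n < y" "\<And>n. y - 1 < S n" "incseq S" "S \<longlonglongrightarrow> y"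
  have "(\<lambda>n. LINT t|m. indicator {S n..<y} t *\<^sub>R F t) \<longlonglongrightarrow> (LINT t|m. 0)"
  proof (rule integral_dominated_convergence[where w = "\<lambda>t. norm (indicator {y - 1..y} t *\<^sub>R F t)"])
    show "integrable m (\<lambda>t. norm (indicator {y - 1..y} t *\<^sub>R F t))"
      using F unfolding set_integrable_def by (rule integrable_norm)
    show "(\<lambda>t. indicator {S n..<y} t *\<^sub>R F t) \<in> borel_measurable m" for n
    proof -
      have "set_integrable m {S n..<y} F"
        by (rule set_integrable_subset[OF F[of "S n" y]]) (use s in auto)
      then show ?thesis by (simp add: set_integrable_def)
    qed
    show "AE t in m. (\<lambda>n. indicator {S n..<y} t *\<^sub>R F t) \<longlonglongrightarrow> 0"
    proof (rule AE_I2, rule tendsto_eventually)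
      fix t
      show "\<forall>\<^sub>F n in sequentially. indicator {S n..<y} t *\<^sub>R F t = 0"
      proof (cases "t < y")
        case True
        from order_tendstoD(1)[OF S(4) True] show ?thesis by eventually_elim auto
      qed simp
    qed
    show "AE t in m. norm (indicator {S n..<y} t *\<^sub>R F t) \<le> norm (indicator {y - 1..y} t *\<^sub>R F t)" for n
      using S(2)[of n] by (intro AE_I2) (auto simp: indicator_def)
  qed simp
  then have "(\<lambda>n. primitive m F y - primitive m F (S n)) \<longlonglongrightarrow> 0"
    using S(1) primitive_diff[OF F s] by (simp add: set_lebesgue_integral_def less_imp_le)
  then show "(\<lambda>n. primitive m F (S n)) \<longlonglongrightarrow> primitive m F y"
    using tendsto_diff[OF tendsto_const[of "primitive m F y"]] by fastforce
qed simp

section \<open>The weak equation as a first-order system\<close>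

text \<open>With \<omega>(f h) expanded by the product rule and sorted by h' and h, the equation
  reads flux' = source - z^2 f \<upsilon> in the sense of distributions. The quasi-derivative is the
  left-continuous representative of \<open>flux\<close>.\<close>

definition flux :: "(real \<Rightarrow> real) \<Rightarrow> real \<Rightarrow> (real \<Rightarrow> real) \<Rightarrow> real \<Rightarrow> real" where
  "flux u z f x = vderiv f x - z * (f x * vderiv u x)"

definition source :: "(real \<Rightarrow> real) \<Rightarrow> real \<Rightarrow> (real \<Rightarrow> real) \<Rightarrow> real \<Rightarrow> real" where
  "source u z f x = f x / 4 - z * (u x * f x + vderiv u x * vderiv f x)"

definition real_solution :: "(real \<Rightarrow> real) \<Rightarrow> real measure \<Rightarrow> real \<Rightarrow> (real \<Rightarrow> real) \<Rightarrow> bool" where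
  "real_solution u \<upsilon> z f \<longleftrightarrow> f \<in> H1_loc \<and>
     (\<forall>h\<in>H1_c. (LINT x|lebesgue. flux u z f x * vderiv h x + source u z f x * h x)
        = z\<^sup>2 * (LINT x|\<upsilon>. f x * h x))"

lemma flux_L2:
  assumes "u \<in> H1_loc" "f \<in> H1_loc"
  shows "flux u z f \<in> L2_loc"
  unfolding flux_def[abs_def] using assms
  by (intro L2_loc_diff L2_loc_cmult L2_loc_cont_mult H1_vderiv_L2 H1_loc_continuous)

lemma source_integrable:
  assumes "u \<in> H1_loc" "f \<in> H1_loc"
  shows "set_integrable lebesgue {a..b} (source u z f)"
proof -
  have "set_integrable lebesgue {a..b} (\<lambda>x. 1/4 * f x - z * (u x * f x + vderiv u x * vderiv f x))"
    using assms by (intro set_integral_diff set_integral_add set_integrable_mult_right L2_loc_mult_integrable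
        L2_loc_integrable H1_L2 H1_vderiv_L2)
  then show ?thesis by (simp add: source_def[abs_def])
qed

lemma source_measurable:
  assumes "u \<in> H1_loc" "f \<in> H1_loc"
  shows "source u z f \<in> borel_measurable lebesgue"
proof -
  note [measurable] = L2_loc_measurable[OF H1_L2[OF assms(1)]] L2_loc_measurable[OF H1_L2[OF assms(2)]]
    L2_loc_measurable[OF H1_vderiv_L2[OF assms(1)]] L2_loc_measurable[OF H1_vderiv_L2[OF assms(2)]]
  show ?thesis unfolding source_def[abs_def] by measurable
qed

text \<open>A continuous approximation of the indicator of [c, \<infinity>) that rises to the left
  of \<open>c\<close>. Placing the slope on this side makes differences of ramps tend to the
  indicator of [x, y) even at atoms, and makes left mean values of \<open>flux\<close> appear, in
  accordance with left-continuity.\<close>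

definition ramp :: "real \<Rightarrow> real \<Rightarrow> real \<Rightarrow> real" where
  "ramp d c w = max 0 (min 1 ((w - c + d) / d))"

lemma ramp_H1:
  assumes "d > 0"
  shows "ramp d c \<in> H1_loc"
proof (rule H1_lipschitz[of _ "1 / d"])
  fix x y
  have "\<bar>ramp d c x - ramp d c y\<bar> \<le> \<bar>(x - c + d) / d - (y - c + d) / d\<bar>"
    unfolding ramp_def by linarith
  also have "\<dots> = 1 / d * \<bar>x - y\<bar>" using assms by (simp flip: diff_divide_distrib)
  finally show "\<bar>ramp d c x - ramp d c y\<bar> \<le> 1 / d * \<bar>x - y\<bar>" .
qed

lemma ramp_vderiv:
  assumes "d > 0"
  shows "AE x in lebesgue. vderiv (ramp d c) x = 1 / d * indicator {c - d..c} x"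
  unfolding eventually_ae_filter_negligible
proof (intro exI[of _ "{c - d, c}"] conjI subsetI)
  fix x assume x: "x \<in> {x. vderiv (ramp d c) x \<noteq> 1 / d * indicator {c - d..c} x}"
  show "x \<in> {c - d, c}"
  proof (rule ccontr)
    assume nx: "x \<notin> {c - d, c}"
    consider "x < c - d" | "c - d < x" "x < c" | "c < x" using nx by fastforce
    then have "vderiv (ramp d c) x = 1 / d * indicator {c - d..c} x"
    proof cases
      case 1
      have "ramp d c w = 0" if "w < c - d" for w
      proof -
        have "(w - c + d) / d < 0" using that assms by (simp add: divide_less_0_iff)
        then show ?thesis by (simp add: ramp_def)
      qed
      then have "vderiv (ramp d c) x = vderiv (\<lambda>_. 0) x"
        using 1 by (intro vderiv_local[of "{..<c - d}"]) auto
      then show ?thesis using 1 by (simp add: vderiv_eqI)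
    next
      case 2
      have "vderiv (ramp d c) x = vderiv (\<lambda>w. (w - c + d) / d) x"
        using 2 assms by (intro vderiv_local[of "{c - d<..<c}"]) (auto simp: ramp_def field_simps)
      also have "\<dots> = 1 / d" using assms by (intro vderiv_eqI) (auto intro!: derivative_eq_intros)
      finally show ?thesis using 2 by simp
    next
      case 3
      have "vderiv (ramp d c) x = vderiv (\<lambda>_. 1) x"
        using 3 assms by (intro vderiv_local[of "{c<..}"]) (auto simp: ramp_def field_simps)
      then show ?thesis using 3 by (simp add: vderiv_eqI)
    qed
    then show False using x by simp
  qed
qed simp

lemma ramp_bounds: "0 \<le> ramp d c w" "ramp d c w \<le> 1"
  by (auto simp: ramp_def)

lemma ramp_diff_bounds:
  assumes "d > 0" "x \<le> y"
  shows "0 \<le> ramp d x w - ramp d y w" "ramp d x w - ramp d y w \<le> 1" "w \<notin> {x - d..y} \<Longrightarrow> ramp d x w - ramp d y w = 0"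
proof -
  have "(w - y + d) / d \<le> (w - x + d) / d" using assms by (simp add: divide_right_mono)
  then show "0 \<le> ramp d x w - ramp d y w" unfolding ramp_def by linarith
  show "ramp d x w - ramp d y w \<le> 1" using ramp_bounds[of d x w] ramp_bounds[of d y w] by linarith
  assume "w \<notin> {x - d..y}"
  then consider "w < x - d" | "y < w" by fastforce
  then show "ramp d x w - ramp d y w = 0"
  proof cases
    case 1
    then have "(w - x + d) / d < 0" "(w - y + d) / d < 0" using assms by (auto simp: divide_less_0_iff)
    then show ?thesis by (simp add: ramp_def)
  next
    case 2
    then have "1 \<le> (w - x + d) / d" "1 \<le> (w - y + d) / d" using assms by (auto simp: le_divide_eq)
    then show ?thesis by (simp add: ramp_def)
  qed
qed

lemma H1_c_realI:
  fixes h :: "real \<Rightarrow> real"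
  assumes "h \<in> H1_loc" "\<And>x. x \<notin> {a..b} \<Longrightarrow> h x = 0"
  shows "h \<in> H1_c"
proof -
  have "{x. h x \<noteq> 0} \<subseteq> {a..b}" using assms(2) by blast
  then have "closure {x. h x \<noteq> 0} \<subseteq> {a..b}" by (intro closure_minimal) auto
  then have "compact (closure {x. h x \<noteq> 0})"
    by (metis closed_closure compact_Icc compact_Int_closed inf.absorb_iff2)
  then show ?thesis using assms(1) by (simp add: H1_c_def)
qed

text \<open>Convergence at every point, not merely almost everywhere for Lebesgue measure, because
  the limit is also taken under \<upsilon>.\<close>

lemma ramp_tendsto:
  assumes d: "d \<longlonglongrightarrow> 0" "\<And>n. d n > 0"
  shows "(\<lambda>n. ramp (d n) c w) \<longlonglongrightarrow> indicator {c..} w"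
proof (cases "c \<le> w")
  case True
  have "ramp (d n) c w = 1" for n using True d(2)[of n] by (simp add: ramp_def le_divide_eq)
  then show ?thesis using True by simp
next
  case False
  then have "eventually (\<lambda>n. d n < c - w) sequentially" using order_tendstoD(2)[OF d(1), of "c - w"] by simp
  then have "eventually (\<lambda>n. ramp (d n) c w = indicator {c..} w) sequentially"
  proof eventually_elim
    case (elim n)
    then have "(w - c + d n) / d n < 0" using d(2)[of n] by (simp add: divide_less_0_iff)
    then show ?case using False by (simp add: ramp_def)
  qed
  then show ?thesis by (rule tendsto_eventually)
qed

lemma ramp_dct:
  fixes F :: "real \<Rightarrow> real"
  assumes F: "\<And>a b. set_integrable m {a..b} F" "F \<in> borel_measurable m" and s: "sets borel \<subseteq> sets m"
    and d: "d \<longlonglongrightarrow> 0" "\<And>n. d n > 0" "\<And>n. d n \<le> 1" and xy: "x \<le> y"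
  shows "(\<lambda>n. LINT w|m. F w * (ramp (d n) x w - ramp (d n) y w)) \<longlonglongrightarrow> (LINT w:{x..<y}|m. F w)"
  unfolding set_lebesgue_integral_def
proof (rule integral_dominated_convergence[where w = "\<lambda>t. norm (indicator {x - 1..y} t *\<^sub>R F t)"])
  have m: "g \<in> borel_measurable m" if "g \<in> borel_measurable borel" for g :: "real \<Rightarrow> real"
  proof (rule measurableI)
    show "g -` A \<inter> space m \<in> sets m" if "A \<in> sets borel" for A
    proof -
      have "g -` A \<in> sets borel" using measurable_sets[OF \<open>g \<in> borel_measurable borel\<close> that] by simp
      then have "g -` A \<in> sets m" using s by blast
      then show ?thesis by auto
    qed
  qed simp
  have rm: "ramp d c \<in> borel_measurable m" for d c
    by (rule m) (simp add: ramp_def[abs_def])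
  have im: "(indicator A :: real \<Rightarrow> real) \<in> borel_measurable m" if "A \<in> sets borel" for A
    using that by (intro m) simp
  show "(\<lambda>t. indicator {x..<y} t *\<^sub>R F t) \<in> borel_measurable m"
    using F(2) im[of "{x..<y}"] by simp
  show "(\<lambda>w. F w * (ramp (d n) x w - ramp (d n) y w)) \<in> borel_measurable m" for n
    using F(2) rm by simp
  show "integrable m (\<lambda>t. norm (indicator {x - 1..y} t *\<^sub>R F t))"
    using F(1) unfolding set_integrable_def by (rule integrable_norm)
  show "AE w in m. (\<lambda>n. F w * (ramp (d n) x w - ramp (d n) y w)) \<longlonglongrightarrow> indicator {x..<y} w *\<^sub>R F w"
  proof (rule AE_I2)
    fix w
    have "(\<lambda>n. F w * (ramp (d n) x w - ramp (d n) y w)) \<longlonglongrightarrow> F w * (indicator {x..} w - indicator {y..} w)"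
      by (intro tendsto_intros ramp_tendsto d)
    moreover have "F w * (indicator {x..} w - indicator {y..} w) = indicator {x..<y} w *\<^sub>R F w"
      using xy by (auto simp: indicator_def)
    ultimately show "(\<lambda>n. F w * (ramp (d n) x w - ramp (d n) y w)) \<longlonglongrightarrow> indicator {x..<y} w *\<^sub>R F w" by simp
  qed
  show "AE w in m. norm (F w * (ramp (d n) x w - ramp (d n) y w)) \<le> norm (indicator {x - 1..y} w *\<^sub>R F w)" for n
  proof (rule AE_I2)
    fix w
    note b = ramp_diff_bounds[OF d(2)[of n] xy, of w]
    show "norm (F w * (ramp (d n) x w - ramp (d n) y w)) \<le> norm (indicator {x - 1..y} w *\<^sub>R F w)"
    proof (cases "w \<in> {x - d n..y}")
      case True
      then have "w \<in> {x - 1..y}" using d(3)[of n] by auto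
      then show ?thesis using b(1,2) mult_left_mono[of "ramp (d n) x w - ramp (d n) y w" 1 "\<bar>F w\<bar>"] by (simp add: abs_mult)
    qed (use b in simp)
  qed
qed

text \<open>The test function is \<open>ramp d x - ramp d y\<close>. Its derivative is 1/d on
  [x - d, x] minus 1/d on [y - d, y], whence the two mean values, while the function itself
  approximates the indicator of [x, y).\<close>

lemma real_solution_ramp:
  assumes u: "u \<in> H1_loc" and f: "real_solution u \<upsilon> z f" and d: "d > 0" and xy: "x \<le> y"
  shows "(LINT s:{x - d..x}|lebesgue. flux u z f s) / d - (LINT s:{y - d..y}|lebesgue. flux u z f s) / d
     + (LINT w|lebesgue. source u z f w * (ramp d x w - ramp d y w))
     = z\<^sup>2 * (LINT w|\<upsilon>. f w * (ramp d x w - ramp d y w))"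
proof -
  have fH: "f \<in> H1_loc" using f by (simp add: real_solution_def)
  let ?h = "\<lambda>w. ramp d x w - ramp d y w"
  have hH: "?h \<in> H1_loc" and hv: "AE w in lebesgue. vderiv ?h w = vderiv (ramp d x) w - vderiv (ramp d y) w"
    using H1_diff[OF ramp_H1[OF d] ramp_H1[OF d]] by blast+
  have "?h \<in> H1_c" by (rule H1_c_realI[OF hH ramp_diff_bounds(3)[OF d xy]])
  then have eq: "(LINT w|lebesgue. flux u z f w * vderiv ?h w + source u z f w * ?h w) = z\<^sup>2 * (LINT w|\<upsilon>. f w * ?h w)"
    using f by (simp add: real_solution_def)
  note fl = flux_L2[OF u fH, of z]
  let ?g = "\<lambda>w. 1 / d * (indicator {x - d..x} w *\<^sub>R flux u z f w) - 1 / d * (indicator {y - d..y} w *\<^sub>R flux u z f w)"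
  have ae: "AE w in lebesgue. flux u z f w * vderiv ?h w = ?g w"
    using hv ramp_vderiv[OF d, of x] ramp_vderiv[OF d, of y]
  proof eventually_elim
    case (elim w)
    show ?case unfolding elim by (simp add: algebra_simps)
  qed
  have ii: "integrable lebesgue (\<lambda>w. indicator {a..b} w *\<^sub>R flux u z f w)" for a b
    using L2_loc_integrable[OF fl, of a b] by (simp add: set_integrable_def)
  have gi: "integrable lebesgue ?g" by (intro Bochner_Integration.integrable_diff integrable_mult_right ii)
  have hm: "vderiv ?h \<in> borel_measurable lebesgue" using H1_vderiv_L2[OF hH] by (rule L2_loc_measurable)
  have fm: "(\<lambda>w. flux u z f w * vderiv ?h w) \<in> borel_measurable lebesgue" using hm fl by measurable
  have i1: "integrable lebesgue (\<lambda>w. flux u z f w * vderiv ?h w)"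
    using integrable_cong_AE[THEN iffD2, OF fm _ ae gi] gi by blast
  have l1: "(LINT w|lebesgue. flux u z f w * vderiv ?h w) = (LINT s:{x - d..x}|lebesgue. flux u z f s) / d - (LINT s:{y - d..y}|lebesgue. flux u z f s) / d"
  proof -
    have "(LINT w|lebesgue. flux u z f w * vderiv ?h w) = (LINT w|lebesgue. ?g w)"
      using gi by (intro integral_cong_AE fm ae) blast
    also have "\<dots> = (LINT s:{x - d..x}|lebesgue. flux u z f s) / d - (LINT s:{y - d..y}|lebesgue. flux u z f s) / d"
      using ii by (subst Bochner_Integration.integral_diff) (auto simp: set_lebesgue_integral_def)
    finally show ?thesis .
  qed
  have i2: "integrable lebesgue (\<lambda>w. source u z f w * ?h w)"
  proof (rule Bochner_Integration.integrable_bound)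
    show "integrable lebesgue (\<lambda>w. indicator {x - d..y} w *\<^sub>R source u z f w)"
      using source_integrable[OF u fH] by (simp add: set_integrable_def)
    show "(\<lambda>w. source u z f w * ?h w) \<in> borel_measurable lebesgue"
      using source_measurable[OF u fH] L2_loc_measurable[OF H1_L2[OF hH]] by measurable
    show "AE w in lebesgue. norm (source u z f w * ?h w) \<le> norm (indicator {x - d..y} w *\<^sub>R source u z f w)"
    proof (rule AE_I2)
      fix w
      show "norm (source u z f w * ?h w) \<le> norm (indicator {x - d..y} w *\<^sub>R source u z f w)"
      proof (cases "w \<in> {x - d..y}")
        case True
        then show ?thesis using ramp_diff_bounds(1,2)[OF d xy, of w] mult_left_mono[of "?h w" 1 "\<bar>source u z f w\<bar>"] by (simp add: abs_mult)
      qed (use ramp_diff_bounds(3)[OF d xy, of w] in simp)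
    qed
  qed
  show ?thesis using eq by (simp add: Bochner_Integration.integral_add[OF i1 i2] l1)
qed

text \<open>The mean value of \<open>f u'\<close> over \<open>[x - d, x]\<close> is compared with \<open>f x\<close> times the difference quotient
  of \<open>u\<close>: the error is controlled because \<open>f\<close> is differentiable at \<open>x\<close>.\<close>

lemma flux_left_mean:
  assumes u: "u \<in> H1_loc" and f: "f \<in> H1_loc"
    and du: "(u has_real_derivative vderiv u x) (at x)" and df: "(f has_real_derivative vderiv f x) (at x)"
  shows "((\<lambda>d. (LINT s:{x - d..x}|lebesgue. flux u z f s) / d) \<longlongrightarrow> flux u z f x) (at_right 0)"
proof -
  let ?U = "\<lambda>d. LINT s:{x - d..x}|lebesgue. \<bar>vderiv u s\<bar>"
  have uL: "vderiv u \<in> L2_loc" using u by (rule H1_vderiv_L2)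
  have uai: "set_integrable lebesgue {a..b} (\<lambda>s. \<bar>vderiv u s\<bar>)" for a b
    by (intro set_integrable_abs L2_loc_integrable uL)
  have "continuous_on UNIV f" using f by (rule H1_loc_continuous)
  then have fuL: "(\<lambda>s. f s * vderiv u s) \<in> L2_loc" by (intro L2_loc_cont_mult uL)
  have ev: "((\<lambda>d. (g x - g (x - d)) / d) \<longlongrightarrow> D) (at_right 0)" if "(g has_real_derivative D) (at x)" for g D
  proof -
    have "((\<lambda>h. (g (x + h) - g x) / h) \<longlongrightarrow> D) (at_left 0)"
      using that unfolding DERIV_def by (rule tendsto_mono[OF at_le, rotated]) simp
    then have "((\<lambda>h. (g (x + - h) - g x) / - h) \<longlongrightarrow> D) (at_right 0)"
      unfolding at_left_minus[of "0::real"] by (simp add: filterlim_filtermap)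
    then show ?thesis
      by (rule tendsto_cong[THEN iffD1, rotated]) (auto intro!: always_eventually simp: diff_divide_distrib)
  qed
  obtain C d0 where C: "d0 > 0" "\<And>s. \<bar>s - x\<bar> < d0 \<Longrightarrow> \<bar>f s - f x\<bar> \<le> C * \<bar>s - x\<bar>" "C \<ge> 0"
  proof -
    have "\<forall>e>0. \<exists>d>0. \<forall>y\<in>UNIV. norm (y - x) < d \<longrightarrow> norm (f y - f x - vderiv f x * (y - x)) \<le> e * norm (y - x)"
      using df unfolding has_field_derivative_def has_derivative_within_alt by (rule conjunct2)
    from this[rule_format, OF zero_less_one]
    obtain d where d: "d > 0" "\<And>y. norm (y - x) < d \<Longrightarrow> norm (f y - f x - vderiv f x * (y - x)) \<le> norm (y - x)" by auto
    have "\<bar>f s - f x\<bar> \<le> (\<bar>vderiv f x\<bar> + 1) * \<bar>s - x\<bar>" if "\<bar>s - x\<bar> < d" for s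
    proof -
      have "\<bar>f s - f x\<bar> \<le> \<bar>f s - f x - vderiv f x * (s - x)\<bar> + \<bar>vderiv f x * (s - x)\<bar>" by linarith
      also have "\<dots> \<le> \<bar>s - x\<bar> + \<bar>vderiv f x\<bar> * \<bar>s - x\<bar>" using d(2)[of s] that by (simp add: abs_mult)
      finally show ?thesis by (simp add: algebra_simps)
    qed
    then show ?thesis using that[of d "\<bar>vderiv f x\<bar> + 1"] d(1) by auto
  qed
  have U0: "(?U \<longlongrightarrow> 0) (at_right 0)"
  proof (rule tendsto_at_right_sequentially[of _ 1])
    fix S :: "nat \<Rightarrow> real" assume S: "\<And>n. 0 < S n" "\<And>n. S n < 1" "decseq S" "S \<longlonglongrightarrow> 0"
    have "(\<lambda>n. LINT t|lebesgue. indicator {x - S n..x} t *\<^sub>R \<bar>vderiv u t\<bar>) \<longlonglongrightarrow> (LINT t|(lebesgue::real measure). (0::real))"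
    proof (rule integral_dominated_convergence[where w = "\<lambda>t. norm (indicator {x - 1..x} t *\<^sub>R \<bar>vderiv u t\<bar>)"])
      show "integrable lebesgue (\<lambda>t. norm (indicator {x - 1..x} t *\<^sub>R \<bar>vderiv u t\<bar>))"
        using uai unfolding set_integrable_def by (rule integrable_norm)
      show "(\<lambda>t. indicator {x - S n..x} t *\<^sub>R \<bar>vderiv u t\<bar>) \<in> borel_measurable lebesgue" for n
        using uai[of "x - S n" x] by (auto simp: set_integrable_def)
      have "AE t in lebesgue. t \<noteq> x"
        unfolding eventually_ae_filter_negligible by (intro exI[of _ "{x}"]) auto
      then show "AE t in lebesgue. (\<lambda>n. indicator {x - S n..x} t *\<^sub>R \<bar>vderiv u t\<bar>) \<longlonglongrightarrow> 0"
      proof eventually_elim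
        case (elim t)
        show ?case
        proof (cases "t < x")
          case True
          then have "eventually (\<lambda>n. S n < x - t) sequentially" using order_tendstoD(2)[OF S(4), of "x - t"] by simp
          then have "eventually (\<lambda>n. indicator {x - S n..x} t *\<^sub>R \<bar>vderiv u t\<bar> = 0) sequentially"
            by eventually_elim auto
          then show ?thesis by (rule tendsto_eventually)
        qed (use elim in simp)
      qed
      show "AE t in lebesgue. norm (indicator {x - S n..x} t *\<^sub>R \<bar>vderiv u t\<bar>) \<le> norm (indicator {x - 1..x} t *\<^sub>R \<bar>vderiv u t\<bar>)" for n
        using S(2)[of n] by (intro AE_I2) (auto simp: indicator_def)
    qed simp
    then show "(\<lambda>n. ?U (S n)) \<longlonglongrightarrow> 0" by (simp add: set_lebesgue_integral_def)
  qed simp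
  let ?R = "\<lambda>d. (LINT s:{x - d..x}|lebesgue. f s * vderiv u s) / d - f x * ((u x - u (x - d)) / d)"
  \<comment> \<open>The bound |f s - f x| \<le> C d absorbs the division by d; what remains is the
    integral of |u'| over a shrinking interval.\<close>
  have R0: "(?R \<longlongrightarrow> 0) (at_right 0)"
  proof (rule Lim_null_comparison)
    show "((\<lambda>d. C * ?U d) \<longlongrightarrow> 0) (at_right 0)" using tendsto_mult_right_zero[OF U0] .
    show "\<forall>\<^sub>F d in at_right 0. norm (?R d) \<le> C * ?U d"
      unfolding eventually_at_right_field
    proof (intro exI[of _ d0] conjI allI impI C)
      fix d assume d: "0 < d" "d < d0"
      have "u x - u (x - d) = (LINT s:{x - d..x}|lebesgue. vderiv u s)"
        using H1_FTC[OF u, of "x - d" x] d by simp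
      then have "?R d = (LINT s:{x - d..x}|lebesgue. (f s - f x) * vderiv u s) / d"
        using L2_loc_integrable[OF fuL, of "x - d" x] L2_loc_integrable[OF uL, of "x - d" x]
        by (simp add: left_diff_distrib diff_divide_distrib)
      moreover have "\<bar>LINT s:{x - d..x}|lebesgue. (f s - f x) * vderiv u s\<bar> \<le> (LINT s:{x - d..x}|lebesgue. (C * d) * \<bar>vderiv u s\<bar>)"
      proof -
        have i: "set_integrable lebesgue {x - d..x} (\<lambda>s. (f s - f x) * vderiv u s)"
          using L2_loc_integrable[OF fuL, of "x - d" x] L2_loc_integrable[OF uL, of "x - d" x]
          by (simp add: left_diff_distrib)
        have "\<bar>LINT s:{x - d..x}|lebesgue. (f s - f x) * vderiv u s\<bar> \<le> (LINT s:{x - d..x}|lebesgue. \<bar>(f s - f x) * vderiv u s\<bar>)"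
          using set_integral_norm_bound[OF i] by simp
        also have "\<dots> \<le> (LINT s:{x - d..x}|lebesgue. (C * d) * \<bar>vderiv u s\<bar>)"
        proof (rule set_integral_mono)
          show "set_integrable lebesgue {x - d..x} (\<lambda>s. \<bar>(f s - f x) * vderiv u s\<bar>)" using i by (rule set_integrable_abs)
          show "set_integrable lebesgue {x - d..x} (\<lambda>s. (C * d) * \<bar>vderiv u s\<bar>)" by (intro set_integrable_mult_right uai)
          fix s assume s: "s \<in> {x - d..x}"
          have "\<bar>f s - f x\<bar> \<le> C * \<bar>s - x\<bar>" using s d by (intro C(2)) auto
          also have "\<dots> \<le> C * d" using s C(3) by (intro mult_left_mono) auto
          finally show "\<bar>(f s - f x) * vderiv u s\<bar> \<le> (C * d) * \<bar>vderiv u s\<bar>" by (simp add: abs_mult mult_right_mono)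
        qed
        finally show ?thesis .
      qed
      ultimately show "norm (?R d) \<le> C * ?U d" using d by (simp add: divide_le_eq abs_divide mult.commute mult.left_commute)
    qed
  qed
  have "((\<lambda>d. (f x - f (x - d)) / d - z * (?R d + f x * ((u x - u (x - d)) / d))) \<longlongrightarrow> vderiv f x - z * (0 + f x * vderiv u x)) (at_right 0)"
    by (intro tendsto_intros R0 ev du df)
  then have L: "((\<lambda>d. (f x - f (x - d)) / d - z * (?R d + f x * ((u x - u (x - d)) / d))) \<longlongrightarrow> flux u z f x) (at_right 0)"
    by (simp add: flux_def)
  show ?thesis
  proof (rule tendsto_cong[THEN iffD1, OF _ L])
    show "\<forall>\<^sub>F d in at_right 0. (f x - f (x - d)) / d - z * (?R d + f x * ((u x - u (x - d)) / d)) = (LINT s:{x - d..x}|lebesgue. flux u z f s) / d"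
      unfolding eventually_at_right_field
    proof (intro exI[of _ 1] conjI allI impI)
      fix d :: real assume d: "0 < d" "d < 1"
      have "f x - f (x - d) = (LINT s:{x - d..x}|lebesgue. vderiv f s)"
        using H1_FTC[OF f, of "x - d" x] d by simp
      then show "(f x - f (x - d)) / d - z * (?R d + f x * ((u x - u (x - d)) / d)) = (LINT s:{x - d..x}|lebesgue. flux u z f s) / d"
        using L2_loc_integrable[OF fuL, of "x - d" x] L2_loc_integrable[OF H1_vderiv_L2[OF f], of "x - d" x]
        by (simp add: flux_def[abs_def] diff_divide_distrib)
    qed simp
  qed
qed

text \<open>As the ramps steepen, the tested equation shows that between any two points of
  \<open>G\<close> the increment of \<open>flux\<close> is the one prescribed by the primitives.
  Since \<open>G\<close> has full measure, a single point \<open>x0\<close> of it fixes the additive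
  constant of \<open>\<gamma>\<close>, and the primitives are left-continuous everywhere.\<close>

lemma quasi_derivative_exists:
  assumes u: "u \<in> H1_loc" and \<upsilon>: "borel_measure \<upsilon>" and f: "real_solution u \<upsilon> z f"
  obtains \<gamma> where "\<And>x. continuous (at_left x) \<gamma>" "AE x in lebesgue. \<gamma> x = flux u z f x"
    "\<And>x y. x \<le> y \<Longrightarrow> \<gamma> y - \<gamma> x = (LINT s:{x..<y}|lebesgue. source u z f s) - z\<^sup>2 * (LINT s:{x..<y}|\<upsilon>. f s)"
proof -
  have fH: "f \<in> H1_loc" using f by (simp add: real_solution_def)
  define G where "G = {x. (u has_real_derivative vderiv u x) (at x) \<and> (f has_real_derivative vderiv f x) (at x)}"
  have aeG: "AE x in lebesgue. x \<in> G"
    using H1_AE_deriv[OF u] H1_AE_deriv[OF fH] by eventually_elim (simp add: G_def)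
  have "\<exists>x0. x0 \<in> G"
  proof (rule ccontr)
    assume "\<not> ?thesis"
    then have "UNIV = {x. x \<notin> G}" by auto
    then have "negligible (UNIV :: real set)"
      using aeG negligible_subset unfolding eventually_ae_filter_negligible by metis
    then show False by simp
  qed
  then obtain x0 where x0: "x0 \<in> G" by blast
  note si = source_integrable[OF u fH, where z = z]
  have fc: "continuous_on UNIV f" using fH by (rule H1_loc_continuous)
  have fi: "set_integrable \<upsilon> {a..b} f" for a b by (rule borel_measure_integrable[OF \<upsilon> fc]) auto
  have fm: "f \<in> borel_measurable \<upsilon>"
    using borel_measurable_continuous_onI[OF fc] borel_measureD(1)[OF \<upsilon>] measurable_cong_sets by blast
  have sl: "sets borel \<subseteq> sets lebesgue" by auto
  have su: "sets borel \<subseteq> sets \<upsilon>" using borel_measureD(1)[OF \<upsilon>] by simp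
  let ?T = "\<lambda>y. primitive lebesgue (source u z f) y - z\<^sup>2 * primitive \<upsilon> f y"
  have T: "?T y - ?T x = (LINT s:{x..<y}|lebesgue. source u z f s) - z\<^sup>2 * (LINT s:{x..<y}|\<upsilon>. f s)" if "x \<le> y" for x y
  proof -
    have "?T y - ?T x = (primitive lebesgue (source u z f) y - primitive lebesgue (source u z f) x) - z\<^sup>2 * (primitive \<upsilon> f y - primitive \<upsilon> f x)"
      by (simp add: algebra_simps)
    then show ?thesis using primitive_diff[OF si sl that] primitive_diff[OF fi su that] by simp
  qed
  have key: "flux u z f y - flux u z f x = ?T y - ?T x" if xy: "x \<le> y" and G: "x \<in> G" "y \<in> G" for x y
  proof -
    define d where "d n = inverse (real (Suc n))" for n
    have d: "d \<longlonglongrightarrow> 0" "\<And>n. d n > 0" "\<And>n. d n \<le> 1"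
      unfolding d_def using LIMSEQ_inverse_real_of_nat by (auto simp: inverse_le_1_iff)
    have dr: "filterlim d (at_right 0) sequentially"
      using d(1,2) by (intro filterlim_at_withinI always_eventually) auto
    have m: "(\<lambda>n. (LINT s:{w - d n..w}|lebesgue. flux u z f s) / d n) \<longlonglongrightarrow> flux u z f w" if "w \<in> G" for w
      using filterlim_compose[OF flux_left_mean[OF u fH, of w z] dr] that by (simp add: G_def)
    have "(\<lambda>n. (LINT s:{x - d n..x}|lebesgue. flux u z f s) / d n - (LINT s:{y - d n..y}|lebesgue. flux u z f s) / d n
       + (LINT w|lebesgue. source u z f w * (ramp (d n) x w - ramp (d n) y w)))
       \<longlonglongrightarrow> flux u z f x - flux u z f y + (LINT s:{x..<y}|lebesgue. source u z f s)"
      by (intro tendsto_intros m G ramp_dct[OF si source_measurable[OF u fH] sl d xy])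
    moreover have "(\<lambda>n. (LINT s:{x - d n..x}|lebesgue. flux u z f s) / d n - (LINT s:{y - d n..y}|lebesgue. flux u z f s) / d n
       + (LINT w|lebesgue. source u z f w * (ramp (d n) x w - ramp (d n) y w)))
       \<longlonglongrightarrow> z\<^sup>2 * (LINT s:{x..<y}|\<upsilon>. f s)"
      unfolding real_solution_ramp[OF u f d(2) xy]
      by (intro tendsto_intros ramp_dct[OF fi fm su d xy])
    ultimately have "flux u z f x - flux u z f y + (LINT s:{x..<y}|lebesgue. source u z f s) = z\<^sup>2 * (LINT s:{x..<y}|\<upsilon>. f s)"
      by (rule LIMSEQ_unique)
    then show ?thesis using T[OF xy] by simp
  qed
  define \<gamma> where "\<gamma> y = flux u z f x0 - ?T x0 + ?T y" for y
  show ?thesis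
  proof (rule that[of \<gamma>])
    show "continuous (at_left x) \<gamma>" for x
      unfolding \<gamma>_def[abs_def]
      by (intro continuous_intros primitive_left_continuous si fi sl su)
    show "AE x in lebesgue. \<gamma> x = flux u z f x"
      using aeG
    proof eventually_elim
      case (elim x)
      then show ?case using key[OF _ x0, of x] key[OF _ _ x0, of x] by (cases "x \<le> x0") (auto simp: \<gamma>_def)
    qed
    show "\<gamma> y - \<gamma> x = (LINT s:{x..<y}|lebesgue. source u z f s) - z\<^sup>2 * (LINT s:{x..<y}|\<upsilon>. f s)" if "x \<le> y" for x y
      using T[OF that] by (simp add: \<gamma>_def)
  qed
qed

subsection \<open>Unique solvability of the initial value problem\<close>

lemma AE_lebesgue_neq: "AE s in lebesgue. s \<noteq> (x::real)"
  unfolding eventually_ae_filter_negligible by (intro exI[of _ "{x}"]) auto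

text \<open>A point at which the integrand vanishes may be dropped even if the measure has an atom
  there; without it the bound becomes small on short intervals.\<close>

lemma set_integral_abs_le:
  fixes g :: "real \<Rightarrow> real"
  assumes g: "set_integrable m B g" and sets: "A \<in> sets m" "B - {x} \<in> sets m" and sub: "A \<subseteq> B"
    and x: "AE s in m. s = x \<longrightarrow> g s = 0"
  shows "\<bar>LINT s:A|m. g s\<bar> \<le> (LINT s:B - {x}|m. \<bar>g s\<bar>)"
proof -
  have gA: "set_integrable m A g" by (rule set_integrable_subset[OF g sets(1) sub])
  have gB: "set_integrable m (B - {x}) (\<lambda>s. \<bar>g s\<bar>)"
    by (intro set_integrable_abs set_integrable_subset[OF g sets(2)]) auto
  have "\<bar>LINT s:A|m. g s\<bar> \<le> (LINT s:A|m. \<bar>g s\<bar>)" using set_integral_norm_bound[OF gA] by simp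
  also have "\<dots> \<le> (LINT s:B - {x}|m. \<bar>g s\<bar>)"
    unfolding set_lebesgue_integral_def
  proof (rule integral_mono_AE)
    show "AE s in m. indicator A s *\<^sub>R \<bar>g s\<bar> \<le> indicator (B - {x}) s *\<^sub>R \<bar>g s\<bar>"
      using x by eventually_elim (use sub in \<open>auto simp: indicator_def\<close>)
  qed (use set_integrable_abs[OF gA] gB in \<open>simp_all add: set_integrable_def\<close>)
  finally show ?thesis .
qed

text \<open>A contraction estimate on a short interval. An atom of \<upsilon> at \<open>x\<close>
  would prevent smallness, but \<open>f x = 0\<close> cancels its contribution, so all integrals run
  over the punctured interval. The radius is chosen before the point \<open>z0\<close> with zero
  data; thus the lemma applies at a limit \<open>x\<close> of such points, where
  \<open>\<gamma>\<close>, being only left-continuous, is not yet known to vanish.\<close>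

lemma solution_locally_unique:
  assumes u: "u \<in> H1_loc" and \<upsilon>: "borel_measure \<upsilon>" and f: "real_solution u \<upsilon> z f"
    and \<gamma>1: "AE x in lebesgue. \<gamma> x = flux u z f x"
    and \<gamma>2: "\<And>x y. x \<le> y \<Longrightarrow> \<gamma> y - \<gamma> x = (LINT s:{x..<y}|lebesgue. source u z f s) - z\<^sup>2 * (LINT s:{x..<y}|\<upsilon>. f s)"
    and fx: "f x = 0"
  shows "\<exists>e>0. \<forall>z0. \<bar>z0 - x\<bar> \<le> e \<longrightarrow> f z0 = 0 \<longrightarrow> \<gamma> z0 = 0 \<longrightarrow> (\<forall>y. \<bar>y - x\<bar> \<le> e \<longrightarrow> f y = 0 \<and> \<gamma> y = 0)"
proof -
  have fH: "f \<in> H1_loc" using f by (simp add: real_solution_def)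
  have uL: "vderiv u \<in> L2_loc" using u by (rule H1_vderiv_L2)
  have u'i: "set_integrable lebesgue {a..b} (\<lambda>s. \<bar>vderiv u s\<bar>)" for a b
    by (intro set_integrable_abs L2_loc_integrable uL)
  have u'2i: "set_integrable lebesgue {a..b} (\<lambda>s. (vderiv u s)\<^sup>2)" for a b
    by (intro L2_loc_square uL)
  have ui: "set_integrable lebesgue {a..b} (\<lambda>s. \<bar>u s\<bar>)" for a b
    by (intro set_integrable_abs L2_loc_integrable H1_L2 u)
  have ci: "set_integrable lebesgue {a..b} (\<lambda>s. c)" for a b c :: real
    by (intro L2_loc_integrable continuous_L2_loc) auto
  have cu: "set_integrable \<upsilon> A (\<lambda>s. c)" if "A \<in> sets borel" "A \<subseteq> {a..b}" for a b c :: real and A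
    by (rule borel_measure_integrable[OF \<upsilon> _ that]) auto
  have sl: "sets borel \<subseteq> sets lebesgue" by auto
  have su: "sets borel \<subseteq> sets \<upsilon>" using borel_measureD(1)[OF \<upsilon>] by simp
  define i where "i n = inverse (real (Suc n))" for n
  have i0: "i n > 0" for n by (simp add: i_def)
  define a1 where "a1 n = (LINT s:{x - i n..x + i n} - {x}|lebesgue. \<bar>vderiv u s\<bar>)" for n
  define a2 where "a2 n = (LINT s:{x - i n..x + i n} - {x}|lebesgue. (vderiv u s)\<^sup>2)" for n
  define a3 where "a3 n = (LINT s:{x - i n..x + i n} - {x}|lebesgue. \<bar>u s\<bar>)" for n
  define b where "b n = (LINT s:{x - i n..x + i n} - {x}|lebesgue. 1::real)" for n
  define m where "m n = (LINT s:{x - i n..x + i n} - {x}|\<upsilon>. 1::real)" for n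
  have lims: "a1 \<longlonglongrightarrow> 0" "a2 \<longlonglongrightarrow> 0" "a3 \<longlonglongrightarrow> 0" "b \<longlonglongrightarrow> 0" "m \<longlonglongrightarrow> 0"
    unfolding a1_def a2_def a3_def b_def m_def i_def
    by (intro set_integral_shrink u'i u'2i ui ci cu sl su; auto)+
  have "(\<lambda>n. b n / 4 + \<bar>z\<bar> * a3 n + z\<^sup>2 * a2 n + z\<^sup>2 * m n) \<longlonglongrightarrow> 0 / 4 + \<bar>z\<bar> * 0 + z\<^sup>2 * 0 + z\<^sup>2 * 0"
    by (intro tendsto_intros lims) simp
  then have e1: "eventually (\<lambda>n. b n / 4 + \<bar>z\<bar> * a3 n + z\<^sup>2 * a2 n + z\<^sup>2 * m n < 1/16) sequentially"
    by (intro order_tendstoD(2)) auto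
  have "(\<lambda>n. \<bar>z\<bar> * a1 n) \<longlonglongrightarrow> \<bar>z\<bar> * 0" by (intro tendsto_intros lims)
  then have e2: "eventually (\<lambda>n. \<bar>z\<bar> * a1 n < 1/2) sequentially" by (intro order_tendstoD(2)) auto
  have e3: "eventually (\<lambda>n. b n < 1) sequentially" by (rule order_tendstoD(2)[OF lims(4)]) simp
  \<comment> \<open>With these bounds \<Gamma> \<le> M/16 + \<Gamma>/2, hence \<Gamma> \<le> M/8,
    and further M \<le> M/8 + M/2, which forces M = 0.\<close>
  obtain n where n: "b n / 4 + \<bar>z\<bar> * a3 n + z\<^sup>2 * a2 n + z\<^sup>2 * m n < 1/16" "\<bar>z\<bar> * a1 n < 1/2" "b n < 1"
    using eventually_happens'[OF _ eventually_conj[OF e1 eventually_conj[OF e2 e3]]] by auto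
  define S where "S = {x - i n..x + i n}"
  have S: "S - {x} \<in> sets borel" "S - {x} \<subseteq> {x - i n..x + i n}" "S - {x} \<in> sets lebesgue" by (auto simp: S_def)
  have yS: "y \<in> S \<longleftrightarrow> \<bar>y - x\<bar> \<le> i n" for y by (auto simp: S_def abs_le_iff)
  have sJ: "set_integrable lebesgue (S - {x}) g" if "\<And>a b. set_integrable lebesgue {a..b} g" for g :: "real \<Rightarrow> real"
    by (rule set_integrable_subset[OF that S(3,2)])
  have a_n: "(LINT s:S - {x}|lebesgue. \<bar>vderiv u s\<bar>) = a1 n" "(LINT s:S - {x}|lebesgue. (vderiv u s)\<^sup>2) = a2 n"
    "(LINT s:S - {x}|lebesgue. \<bar>u s\<bar>) = a3 n" "(LINT s:S - {x}|lebesgue. 1) = b n" "(LINT s:S - {x}|\<upsilon>. 1) = m n"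
    by (simp_all add: S_def a1_def a2_def a3_def b_def m_def)
  have bn0: "0 \<le> b n"
    unfolding b_def set_lebesgue_integral_def by (intro integral_nonneg_AE) auto
  have fc: "continuous_on UNIV f" using fH by (rule H1_loc_continuous)
  obtain mx where mx: "mx \<in> S" "\<And>y. y \<in> S \<Longrightarrow> \<bar>f y\<bar> \<le> \<bar>f mx\<bar>"
  proof -
    have "\<exists>w\<in>S. \<forall>y\<in>S. \<bar>f y\<bar> \<le> \<bar>f w\<bar>"
      using i0[of n] by (intro continuous_attains_sup) (auto simp: S_def intro!: continuous_intros continuous_on_subset[OF fc])
    then show ?thesis using that by blast
  qed
  define M where "M = \<bar>f mx\<bar>"
  have M: "\<And>y. y \<in> S \<Longrightarrow> \<bar>f y\<bar> \<le> M" "M \<ge> 0" using mx by (auto simp: M_def)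
  have "f y = 0 \<and> \<gamma> y = 0" if z0: "\<bar>z0 - x\<bar> \<le> i n" "f z0 = 0" "\<gamma> z0 = 0" and y: "\<bar>y - x\<bar> \<le> i n" for z0 y
  proof -
    define \<rho> where "\<rho> = (LINT s:S - {x}|lebesgue. \<bar>source u z f s\<bar>)"
    \<comment> \<open>A bound for the increments of \<open>\<gamma>\<close> inside the interval,
      hence for \<open>\<gamma>\<close> itself, which vanishes at \<open>z0\<close>.\<close>
    define \<Gamma> where "\<Gamma> = \<rho> + z\<^sup>2 * (M * m n)"
    have inc: "\<bar>\<gamma> q - \<gamma> p\<bar> \<le> \<Gamma>" if pq: "p \<le> q" "p \<in> S" "q \<in> S" for p q
    proof -
      have sub: "{p..<q} \<subseteq> S" using pq by (auto simp: S_def)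
      have aex: "AE s in lebesgue. s = x \<longrightarrow> source u z f s = 0"
        using AE_lebesgue_neq[of x] by eventually_elim simp
      have 1: "\<bar>LINT s:{p..<q}|lebesgue. source u z f s\<bar> \<le> \<rho>"
        unfolding \<rho>_def
        by (rule set_integral_abs_le[OF _ _ S(3) sub aex]) (auto simp: S_def intro!: source_integrable u fH)
      have "\<bar>LINT s:{p..<q}|\<upsilon>. f s\<bar> \<le> (LINT s:S - {x}|\<upsilon>. \<bar>f s\<bar>)"
        by (rule set_integral_abs_le[OF _ _ _ sub])
          (use S su fx in \<open>auto simp: S_def intro!: borel_measure_integrable[OF \<upsilon> fc]\<close>)
      also have "\<dots> \<le> (LINT s:S - {x}|\<upsilon>. M * 1)"
        by (rule set_integral_mono) (use M S in \<open>auto intro!: set_integrable_abs borel_measure_integrable[OF \<upsilon> fc] cu\<close>)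
      also have "\<dots> = M * m n" by (simp only: set_integral_mult_right a_n)
      finally have 2: "\<bar>LINT s:{p..<q}|\<upsilon>. f s\<bar> \<le> M * m n" .
      have "\<bar>\<gamma> q - \<gamma> p\<bar> \<le> \<bar>LINT s:{p..<q}|lebesgue. source u z f s\<bar> + \<bar>z\<^sup>2 * (LINT s:{p..<q}|\<upsilon>. f s)\<bar>"
        unfolding \<gamma>2[OF pq(1)] by linarith
      also have "\<dots> \<le> \<rho> + z\<^sup>2 * (M * m n)"
        using 1 2 by (intro add_mono) (auto simp: abs_mult intro!: mult_left_mono)
      finally show ?thesis by (simp add: \<Gamma>_def)
    qed
    have z0S: "z0 \<in> S" using z0 yS by simp
    have \<gamma>le: "\<bar>\<gamma> s\<bar> \<le> \<Gamma>" if "s \<in> S" for s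
      using inc[of s z0] inc[of z0 s] that z0S z0(3) by (cases "s \<le> z0") auto
    have \<Gamma>0: "\<Gamma> \<ge> 0" using \<gamma>le[OF z0S] by simp
    have f'le: "AE s in lebesgue. s \<in> S \<longrightarrow> \<bar>vderiv f s\<bar> \<le> \<Gamma> + \<bar>z\<bar> * M * \<bar>vderiv u s\<bar>"
      using \<gamma>1
    proof eventually_elim
      case (elim s)
      show ?case
      proof
        assume s: "s \<in> S"
        have "vderiv f s = \<gamma> s + z * (f s * vderiv u s)" using elim by (simp add: flux_def)
        then have "\<bar>vderiv f s\<bar> \<le> \<bar>\<gamma> s\<bar> + \<bar>z\<bar> * (\<bar>f s\<bar> * \<bar>vderiv u s\<bar>)"
          using abs_triangle_ineq[of "\<gamma> s" "z * (f s * vderiv u s)"] by (simp add: abs_mult)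
        also have "\<dots> \<le> \<Gamma> + \<bar>z\<bar> * (M * \<bar>vderiv u s\<bar>)"
          using \<gamma>le[OF s] M(1)[OF s] by (intro add_mono mult_left_mono mult_right_mono) auto
        finally show "\<bar>vderiv f s\<bar> \<le> \<Gamma> + \<bar>z\<bar> * M * \<bar>vderiv u s\<bar>" by (simp add: mult.assoc)
      qed
    qed
    have "\<rho> \<le> (LINT s:S - {x}|lebesgue. M / 4 * 1 + \<bar>z\<bar> * M * \<bar>u s\<bar> + \<bar>z\<bar> * \<Gamma> * \<bar>vderiv u s\<bar> + z\<^sup>2 * M * (vderiv u s)\<^sup>2)"
      unfolding \<rho>_def
    proof (rule set_integral_mono_AE)
      show "set_integrable lebesgue (S - {x}) (\<lambda>s. \<bar>source u z f s\<bar>)"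
        by (intro set_integrable_abs sJ source_integrable u fH)
      show "set_integrable lebesgue (S - {x}) (\<lambda>s. M / 4 * 1 + \<bar>z\<bar> * M * \<bar>u s\<bar> + \<bar>z\<bar> * \<Gamma> * \<bar>vderiv u s\<bar> + z\<^sup>2 * M * (vderiv u s)\<^sup>2)"
        by (intro sJ set_integral_add set_integrable_mult_right u'i u'2i ui ci)
      show "AE s\<in>S - {x} in lebesgue. \<bar>source u z f s\<bar> \<le> M / 4 * 1 + \<bar>z\<bar> * M * \<bar>u s\<bar> + \<bar>z\<bar> * \<Gamma> * \<bar>vderiv u s\<bar> + z\<^sup>2 * M * (vderiv u s)\<^sup>2"
        using f'le
      proof eventually_elim
        case (elim s)
        show ?case
        proof
          assume "s \<in> S - {x}"
          then have s: "s \<in> S" by simp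
          have "\<bar>source u z f s\<bar> \<le> \<bar>f s\<bar> / 4 + \<bar>z\<bar> * (\<bar>u s\<bar> * \<bar>f s\<bar> + \<bar>vderiv u s\<bar> * \<bar>vderiv f s\<bar>)"
          proof -
            have "\<bar>source u z f s\<bar> \<le> \<bar>f s / 4\<bar> + \<bar>z * (u s * f s + vderiv u s * vderiv f s)\<bar>"
              unfolding source_def by linarith
            also have "\<dots> \<le> \<bar>f s\<bar> / 4 + \<bar>z\<bar> * (\<bar>u s\<bar> * \<bar>f s\<bar> + \<bar>vderiv u s\<bar> * \<bar>vderiv f s\<bar>)"
              using abs_triangle_ineq[of "u s * f s" "vderiv u s * vderiv f s"]
              unfolding abs_mult[of z] by (intro add_mono mult_left_mono) (auto simp: abs_mult)
            finally show ?thesis .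
          qed
          also have "\<dots> \<le> M / 4 + \<bar>z\<bar> * (\<bar>u s\<bar> * M + \<bar>vderiv u s\<bar> * (\<Gamma> + \<bar>z\<bar> * M * \<bar>vderiv u s\<bar>))"
            using M(1)[OF s] elim s by (intro add_mono mult_left_mono) auto
          also have "\<dots> = M / 4 * 1 + \<bar>z\<bar> * M * \<bar>u s\<bar> + \<bar>z\<bar> * \<Gamma> * \<bar>vderiv u s\<bar> + z\<^sup>2 * M * (vderiv u s)\<^sup>2"
          proof -
            have "z\<^sup>2 * (vderiv u s)\<^sup>2 = \<bar>z\<bar> * \<bar>z\<bar> * (\<bar>vderiv u s\<bar> * \<bar>vderiv u s\<bar>)"
              by (simp add: power2_eq_square)
            then have "z\<^sup>2 * M * (vderiv u s)\<^sup>2 = M * (\<bar>z\<bar> * \<bar>z\<bar> * (\<bar>vderiv u s\<bar> * \<bar>vderiv u s\<bar>))"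
              by (simp add: mult.commute mult.left_commute)
            then show ?thesis by (simp only: distrib_left mult_1_right ac_simps)
          qed
          finally show "\<bar>source u z f s\<bar> \<le> M / 4 * 1 + \<bar>z\<bar> * M * \<bar>u s\<bar> + \<bar>z\<bar> * \<Gamma> * \<bar>vderiv u s\<bar> + z\<^sup>2 * M * (vderiv u s)\<^sup>2" .
        qed
      qed
    qed
    also have "\<dots> = M / 4 * b n + \<bar>z\<bar> * M * a3 n + \<bar>z\<bar> * \<Gamma> * a1 n + z\<^sup>2 * M * a2 n"
    proof -
      note I = sJ[OF u'i] sJ[OF u'2i] sJ[OF ui] sJ[OF ci]
      show ?thesis
        by (subst set_integral_add set_integral_add(2), (intro set_integral_add set_integrable_mult_right I)+)+
          (simp only: set_integral_mult_right a_n)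
    qed
    finally have "\<Gamma> \<le> M * (b n / 4 + \<bar>z\<bar> * a3 n + z\<^sup>2 * a2 n + z\<^sup>2 * m n) + (\<bar>z\<bar> * a1 n) * \<Gamma>"
      by (simp add: \<Gamma>_def algebra_simps)
    also have "\<dots> \<le> M * (1/16) + 1/2 * \<Gamma>"
      using n M(2) \<Gamma>0 by (intro add_mono mult_left_mono mult_right_mono) auto
    finally have \<Gamma>M: "\<Gamma> \<le> M / 8" by simp
    have fle: "\<bar>f q - f p\<bar> \<le> \<Gamma> * b n + \<bar>z\<bar> * M * a1 n" if pq: "p \<le> q" "p \<in> S" "q \<in> S" for p q
    proof -
      have sub: "{p..q} \<subseteq> S" using pq by (auto simp: S_def)
      have aex: "AE s in lebesgue. s = x \<longrightarrow> vderiv f s = 0"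
        using AE_lebesgue_neq[of x] by eventually_elim simp
      have "\<bar>f q - f p\<bar> = \<bar>LINT s:{p..q}|lebesgue. vderiv f s\<bar>" using H1_FTC[OF fH pq(1)] by simp
      also have "\<dots> \<le> (LINT s:S - {x}|lebesgue. \<bar>vderiv f s\<bar>)"
        by (rule set_integral_abs_le[OF _ _ S(3) sub aex]) (auto simp: S_def intro!: L2_loc_integrable H1_vderiv_L2 fH)
      also have "\<dots> \<le> (LINT s:S - {x}|lebesgue. \<Gamma> * 1 + \<bar>z\<bar> * M * \<bar>vderiv u s\<bar>)"
      proof (rule set_integral_mono_AE)
        show "set_integrable lebesgue (S - {x}) (\<lambda>s. \<bar>vderiv f s\<bar>)"
          by (intro set_integrable_abs sJ L2_loc_integrable H1_vderiv_L2 fH)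
        show "set_integrable lebesgue (S - {x}) (\<lambda>s. \<Gamma> * 1 + \<bar>z\<bar> * M * \<bar>vderiv u s\<bar>)"
          by (intro sJ set_integral_add set_integrable_mult_right u'i ci)
        show "AE s\<in>S - {x} in lebesgue. \<bar>vderiv f s\<bar> \<le> \<Gamma> * 1 + \<bar>z\<bar> * M * \<bar>vderiv u s\<bar>"
          using f'le by eventually_elim simp
      qed
      also have "\<dots> = \<Gamma> * b n + \<bar>z\<bar> * M * a1 n"
        by (subst set_integral_add(2), (intro set_integrable_mult_right sJ[OF u'i] sJ[OF ci])+)
          (simp only: set_integral_mult_right a_n)
      finally show ?thesis .
    qed
    have "M \<le> \<Gamma> * b n + \<bar>z\<bar> * M * a1 n"
      using fle[of mx z0] fle[of z0 mx] mx(1) z0S z0(2) by (cases "mx \<le> z0") (auto simp: M_def)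
    also have "\<dots> \<le> M / 8 * 1 + M * (1/2)"
    proof (intro add_mono)
      show "\<Gamma> * b n \<le> M / 8 * 1" using \<Gamma>M \<Gamma>0 n bn0 M(2) by (intro mult_mono) auto
      have "M * (\<bar>z\<bar> * a1 n) \<le> M * (1/2)" using n M(2) by (intro mult_left_mono) auto
      then show "\<bar>z\<bar> * M * a1 n \<le> M * (1/2)" by (simp only: ac_simps)
    qed
    finally have M0: "M = 0" using M(2) by simp
    then have "\<Gamma> = 0" using \<Gamma>M \<Gamma>0 by simp
    then show ?thesis using M0 M(1)[of y] \<gamma>le[of y] y yS by simp
  qed
  then show ?thesis using i0[of n] by blast
qed

text \<open>The common zeros of \<open>f\<close> and \<open>\<gamma>\<close> form an open and closed
  set. For closedness only \<open>f\<close> passes to the limit; local uniqueness, started from a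
  nearby zero, supplies the value of \<open>\<gamma>\<close>.\<close>

lemma solution_unique:
  assumes u: "u \<in> H1_loc" and \<upsilon>: "borel_measure \<upsilon>" and f: "real_solution u \<upsilon> z f"
    and \<gamma>1: "AE x in lebesgue. \<gamma> x = flux u z f x"
    and \<gamma>2: "\<And>x y. x \<le> y \<Longrightarrow> \<gamma> y - \<gamma> x = (LINT s:{x..<y}|lebesgue. source u z f s) - z\<^sup>2 * (LINT s:{x..<y}|\<upsilon>. f s)"
    and c: "f c = 0" "\<gamma> c = 0"
  shows "f x = 0"
proof -
  note loc = solution_locally_unique[OF u \<upsilon> f \<gamma>1 \<gamma>2]
  define Z where "Z = {x. f x = 0 \<and> \<gamma> x = 0}"
  have "open Z"
    unfolding open_dist
  proof
    fix x assume x: "x \<in> Z"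
    obtain e where e: "e > 0" "\<And>z0 y. \<bar>z0 - x\<bar> \<le> e \<Longrightarrow> f z0 = 0 \<Longrightarrow> \<gamma> z0 = 0 \<Longrightarrow> \<bar>y - x\<bar> \<le> e \<Longrightarrow> f y = 0 \<and> \<gamma> y = 0"
      using loc[of x] x unfolding Z_def by blast
    have "y \<in> Z" if "dist y x < e" for y
      using e(2)[of x y] that e(1) x by (simp add: Z_def dist_real_def)
    then show "\<exists>e>0. \<forall>y. dist y x < e \<longrightarrow> y \<in> Z" using e(1) by blast
  qed
  moreover have "closed Z"
    unfolding closed_sequential_limits
  proof (intro allI impI, elim conjE)
    fix w x assume w: "\<forall>n. w n \<in> Z" "w \<longlonglongrightarrow> x"
    have "isCont f x"
      using f H1_loc_continuous[of f] by (auto simp: real_solution_def continuous_on_eq_continuous_at)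
    then have "(\<lambda>n. f (w n)) \<longlonglongrightarrow> f x" using w(2) by (rule isCont_tendsto_compose)
    moreover have "(\<lambda>n. f (w n)) = (\<lambda>n. 0)" using w(1) by (auto simp: Z_def)
    ultimately have "f x = 0" using LIMSEQ_unique[OF _ tendsto_const] by metis
    then obtain e where e: "e > 0" "\<And>z0 y. \<bar>z0 - x\<bar> \<le> e \<Longrightarrow> f z0 = 0 \<Longrightarrow> \<gamma> z0 = 0 \<Longrightarrow> \<bar>y - x\<bar> \<le> e \<Longrightarrow> f y = 0 \<and> \<gamma> y = 0"
      using loc[of x] by blast
    obtain n where "dist (w n) x < e" using w(2) e(1) unfolding lim_sequentially by blast
    then show "x \<in> Z" using e(2)[of "w n" x] w(1) e(1) by (auto simp: Z_def dist_real_def)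
  qed
  ultimately have "Z = UNIV" using clopen[of Z] c by (auto simp: Z_def)
  then show ?thesis by (auto simp: Z_def)
qed

subsection \<open>Quadratic forms on one period\<close>

lemma set_integral_sum:
  fixes g :: "'i \<Rightarrow> 'a \<Rightarrow> real"
  assumes "\<And>k. set_integrable m A (g k)"
  shows "(\<Sum>k\<in>K. LINT x:A|m. g k x) = (LINT x:A|m. (\<Sum>k\<in>K. g k x))"
proof -
  have "(\<Sum>k\<in>K. LINT x|m. indicator A x *\<^sub>R g k x) = (LINT x|m. (\<Sum>k\<in>K. indicator A x *\<^sub>R g k x))"
    using assms by (intro Bochner_Integration.integral_sum[symmetric]) (simp add: set_integrable_def)
  also have "\<dots> = (LINT x|m. indicator A x *\<^sub>R (\<Sum>k\<in>K. g k x))"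
    by (simp only: scaleR_sum_right)
  finally show ?thesis by (simp only: set_lebesgue_integral_def)
qed

text \<open>s^k for integer exponents k, where s is 1 or -1.\<close>

definition sgpow :: "real \<Rightarrow> int \<Rightarrow> real" where
  "sgpow s k = (if even k then 1 else s)"

text \<open>The sign s is a parameter, so that the periodic and the antiperiodic case are treated
  together; \<upsilon> enters as a measure of its own, detached from the measure it is split off
  from.\<close>

locale periodic_data =
  fixes u :: "real \<Rightarrow> real" and \<upsilon> :: "real measure" and l s a :: real
  assumes l: "l > 0" and u: "u \<in> H1_loc" and u_per: "\<And>x. u (x + l) = u x"
    and \<upsilon>: "borel_measure \<upsilon>"
    and \<upsilon>_per: "\<And>B. B \<in> sets borel \<Longrightarrow> emeasure \<upsilon> ((\<lambda>x. x + l) ` B) = emeasure \<upsilon> B"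
    and s: "s = 1 \<or> s = -1"
begin

abbreviation "I0 \<equiv> {a..<a + l}"

lemma ss: "s * s = 1" using s by auto

lemma sgpow_simps [simp]: "sgpow s 0 = 1" "sgpow s (k + 1) = s * sgpow s k" "sgpow s k * sgpow s k = 1"
    "\<bar>sgpow s k\<bar> = 1" "sgpow s (-1) = s"
  using s by (auto simp: sgpow_def)

lemma sgpow_mult_self: "sgpow s k * (sgpow s k * x) = x"
  by (simp flip: mult.assoc)

lemma shift_int:
  assumes "\<And>x. f (x + l) = s * f x"
  shows "f (x + of_int k * l) = sgpow s k * f x"
proof (induction k arbitrary: x rule: int_induct[of _ 0])
  case base
  then show ?case by simp
next
  case (step1 k)
  have "f (x + of_int (k + 1) * l) = f ((x + of_int k * l) + l)" by (simp add: algebra_simps)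
  also have "\<dots> = s * f (x + of_int k * l)" by (rule assms)
  finally show ?case using step1 by simp
next
  case (step2 k)
  have "f (x + of_int k * l) = f ((x + of_int (k - 1) * l) + l)" by (simp add: algebra_simps)
  also have "\<dots> = s * f (x + of_int (k - 1) * l)" by (rule assms)
  finally have "s * f (x + of_int (k - 1) * l) = sgpow s k * f x" using step2(2)[of x] by simp
  then have "s * (s * f (x + of_int (k - 1) * l)) = s * sgpow s k * f x" by simp
  moreover have "s * sgpow s k = sgpow s (k - 1)"
    using s by (auto simp: sgpow_def)
  ultimately show ?case using ss by (simp flip: mult.assoc)
qed

lemma u_shift_int: "u (x + of_int k * l) = u x"
proof (induction k arbitrary: x rule: int_induct[of _ 0])
  case (step1 k)
  have "u (x + of_int (k + 1) * l) = u ((x + of_int k * l) + l)" by (simp add: algebra_simps)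
  then show ?case using step1 u_per by simp
next
  case (step2 k)
  have "u (x + of_int k * l) = u ((x + of_int (k - 1) * l) + l)" by (simp add: algebra_simps)
  then show ?case using step2 u_per by simp
qed simp

definition P :: "(real \<Rightarrow> real) set" where
  "P = {f \<in> H1_loc. \<forall>x. f (x + l) = s * f x}"

lemma P_H1: "f \<in> P \<Longrightarrow> f \<in> H1_loc" by (simp add: P_def)

lemma P_shift: "f \<in> P \<Longrightarrow> f (x + of_int k * l) = sgpow s k * f x"
  by (rule shift_int) (simp add: P_def)

lemma P_vderiv_shift:
  assumes "f \<in> P"
  shows "AE x in lebesgue. vderiv f (x + of_int k * l) = sgpow s k * vderiv f x"
proof -
  have "vderiv f (x + of_int k * l) = vderiv (\<lambda>x. sgpow s k * f x) x" for x
    using vderiv_shift[of f "of_int k * l" x] P_shift[OF assms] by simp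
  then show ?thesis using H1_cmult(2)[OF P_H1[OF assms], of "sgpow s k"] by simp
qed

lemma u_vderiv_shift: "vderiv u (x + of_int k * l) = vderiv u x"
  using vderiv_shift[of u "of_int k * l" x] u_shift_int by simp

lemma sets_\<upsilon> [measurable_cong, simp]: "sets \<upsilon> = sets borel" and space_\<upsilon> [simp]: "space \<upsilon> = UNIV"
  using borel_measureD[OF \<upsilon>] by auto

lemma \<upsilon>_shift_int: "B \<in> sets borel \<Longrightarrow> emeasure \<upsilon> ((\<lambda>x. x + of_int k * l) -` B) = emeasure \<upsilon> B"
proof (induction k arbitrary: B rule: int_induct[of _ 0])
  case base
  then show ?case by simp
next
  have meas: "(\<lambda>x. x + c) -` B \<in> sets borel" if "B \<in> sets borel" for c :: real and B
    using measurable_sets_borel[OF _ that, of "\<lambda>x. x + c"] by simp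
  have 1: "emeasure \<upsilon> ((\<lambda>x. x + l) -` B) = emeasure \<upsilon> B" if "B \<in> sets borel" for B
  proof -
    have "(\<lambda>x. x + l) ` ((\<lambda>x. x + l) -` B) = B"
    proof
      show "B \<subseteq> (\<lambda>x. x + l) ` ((\<lambda>x. x + l) -` B)"
      proof
        fix x assume "x \<in> B"
        then show "x \<in> (\<lambda>x. x + l) ` ((\<lambda>x. x + l) -` B)" by (intro image_eqI[of _ _ "x - l"]) auto
      qed
    qed auto
    then show ?thesis using \<upsilon>_per[OF meas[OF that, of l]] by simp
  qed
  {
    case (step1 k)
    have "(\<lambda>x. x + of_int (k + 1) * l) -` B = (\<lambda>x. x + l) -` ((\<lambda>x. x + of_int k * l) -` B)"
      by (auto simp: algebra_simps)
    then show ?case using 1[OF meas[OF step1(3)]] step1 by simp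
  next
    case (step2 k)
    have "(\<lambda>x. x + of_int k * l) -` B = (\<lambda>x. x + l) -` ((\<lambda>x. x + of_int (k - 1) * l) -` B)"
      by (auto simp: algebra_simps)
    then have "emeasure \<upsilon> ((\<lambda>x. x + of_int (k - 1) * l) -` B) = emeasure \<upsilon> ((\<lambda>x. x + of_int k * l) -` B)"
      using 1[OF meas[OF step2(3), of "of_int (k - 1) * l"]] by (simp only:)
    then show ?case using step2(2)[OF step2(3)] by (simp only:)
  }
qed

lemma \<upsilon>_distr: "distr \<upsilon> \<upsilon> (\<lambda>x. x + of_int k * l) = \<upsilon>"
proof (rule measure_eqI)
  fix A assume "A \<in> sets (distr \<upsilon> \<upsilon> (\<lambda>x. x + of_int k * l))"
  then have A: "A \<in> sets borel" by simp
  have "emeasure (distr \<upsilon> \<upsilon> (\<lambda>x. x + of_int k * l)) A = emeasure \<upsilon> ((\<lambda>x. x + of_int k * l) -` A \<inter> space \<upsilon>)"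
    by (rule emeasure_distr) (use A in simp_all)
  then show "emeasure (distr \<upsilon> \<upsilon> (\<lambda>x. x + of_int k * l)) A = emeasure \<upsilon> A"
    using \<upsilon>_shift_int[OF A] by simp
qed simp

section \<open>Unfolding integrals over the line to one period\<close>

text \<open>Stated through integrals, so that Lebesgue measure and \<upsilon>, which live on
  different \<sigma>-algebras, can be unfolded by the same lemma.\<close>

definition shift_invariant :: "real measure \<Rightarrow> bool" where
  "shift_invariant m \<longleftrightarrow> sets borel \<subseteq> sets m \<and> (\<forall>k::int. \<forall>g::real\<Rightarrow>real. integrable m g \<longrightarrow>
     integrable m (\<lambda>x. g (x + of_int k * l)) \<and> (LINT x|m. g (x + of_int k * l)) = (LINT x|m. g x))"

lemma shift_invariant_lebesgue: "shift_invariant lebesgue"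
  unfolding shift_invariant_def by (auto simp: lebesgue_integrable_shift lebesgue_integral_shift)

lemma shift_invariant_\<upsilon>: "shift_invariant \<upsilon>"
  unfolding shift_invariant_def
proof (intro conjI allI impI)
  show "sets borel \<subseteq> sets \<upsilon>" by simp
  fix k :: int and g :: "real \<Rightarrow> real" assume g: "integrable \<upsilon> g"
  have m: "(\<lambda>x. x + of_int k * l) \<in> measurable \<upsilon> \<upsilon>" by simp
  show "integrable \<upsilon> (\<lambda>x. g (x + of_int k * l))"
    using integrable_distr[OF m, of g] g \<upsilon>_distr by simp
  show "(LINT x|\<upsilon>. g (x + of_int k * l)) = (LINT x|\<upsilon>. g x)"
    using integral_distr[OF m, of g] borel_measurable_integrable[OF g] \<upsilon>_distr by simp
qed

text \<open>Exactly one cell contains a given point, the one indexed by the floor of (x - a) / l;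
  inside the window this index lies in the range of summation.\<close>

lemma sum_indicator_cells:
  fixes N :: nat
  assumes "x \<notin> {a - N * l..<a + N * l} \<Longrightarrow> c = 0"
  shows "(\<Sum>k\<in>{- int N..<int N}. indicator {a + of_int k * l..<a + of_int k * l + l} x * c) = (c::real)"
proof (cases "x \<in> {a - N * l..<a + N * l}")
  case True
  define k0 where "k0 = \<lfloor>(x - a) / l\<rfloor>"
  have cell: "x \<in> {a + of_int k * l..<a + of_int k * l + l} \<longleftrightarrow> k = k0" for k
  proof -
    have "x \<in> {a + of_int k * l..<a + of_int k * l + l} \<longleftrightarrow> of_int k \<le> (x - a) / l \<and> (x - a) / l < of_int k + 1"
      using l by (auto simp: le_divide_eq divide_less_eq algebra_simps)
    also have "\<dots> \<longleftrightarrow> k = k0" unfolding k0_def by linarith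
    finally show ?thesis .
  qed
  have "- real N \<le> (x - a) / l" "(x - a) / l < real N"
    using True l by (auto simp: le_divide_eq divide_less_eq algebra_simps)
  then have k0: "k0 \<in> {- int N..<int N}" unfolding k0_def by (auto simp: le_floor_iff floor_less_iff)
  have "(\<Sum>k\<in>{- int N..<int N}. indicator {a + of_int k * l..<a + of_int k * l + l} x * c)
      = (\<Sum>k\<in>{- int N..<int N}. if k = k0 then c else 0)"
    by (intro sum.cong refl) (simp only: indicator_def cell, simp)
  then show ?thesis using k0 by simp
qed (use assms in simp)

text \<open>The line is cut into cells, and each cell is translated back to the base cell by
  invariance of the measure.\<close>

lemma integral_periodize:
  fixes N :: nat and g :: "real \<Rightarrow> real"
  assumes m: "shift_invariant m" and g: "integrable m g"
    and supp: "\<And>x. x \<notin> {a - N * l..<a + N * l} \<Longrightarrow> g x = 0"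
  shows "(LINT x|m. g x) = (\<Sum>k\<in>{- int N..<int N}. LINT x:I0|m. g (x + of_int k * l))"
    and "set_integrable m I0 (\<lambda>x. g (x + of_int k * l))"
proof -
  let ?C = "\<lambda>k::int. {a + of_int k * l..<a + of_int k * l + l}"
  have sets: "{p..<q} \<in> sets m" for p q :: real using m by (auto simp: shift_invariant_def)
  have gi: "integrable m (\<lambda>x. indicator (?C k) x * g x)" for k
    using integrable_mult_indicator[OF sets g] by simp
  have ind: "indicator (?C k) (x + of_int k * l) = (indicator I0 x :: real)" for k x
    by (auto simp: indicator_def)
  have gk: "integrable m (\<lambda>x. indicator I0 x * g (x + of_int k * l))"
    "(LINT x|m. indicator I0 x * g (x + of_int k * l)) = (LINT x|m. indicator (?C k) x * g x)" for k
  proof -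
    have "integrable m (\<lambda>x. indicator (?C k) (x + of_int k * l) * g (x + of_int k * l)) \<and>
        (LINT x|m. indicator (?C k) (x + of_int k * l) * g (x + of_int k * l)) = (LINT x|m. indicator (?C k) x * g x)"
      using m gi[of k] unfolding shift_invariant_def by blast
    then show "integrable m (\<lambda>x. indicator I0 x * g (x + of_int k * l))"
      "(LINT x|m. indicator I0 x * g (x + of_int k * l)) = (LINT x|m. indicator (?C k) x * g x)"
      by (simp_all only: ind)
  qed
  have "(LINT x|m. g x) = (LINT x|m. (\<Sum>k\<in>{- int N..<int N}. indicator (?C k) x * g x))"
  proof -
    have "(\<Sum>k\<in>{- int N..<int N}. indicator (?C k) x * g x) = g x" for x
      by (rule sum_indicator_cells[OF supp])
    then show ?thesis by (simp only:)
  qed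
  also have "\<dots> = (\<Sum>k\<in>{- int N..<int N}. LINT x|m. indicator (?C k) x * g x)"
    using gi by (intro Bochner_Integration.integral_sum) auto
  finally show "(LINT x|m. g x) = (\<Sum>k\<in>{- int N..<int N}. LINT x:I0|m. g (x + of_int k * l))"
    by (simp add: gk set_lebesgue_integral_def)
  show "set_integrable m I0 (\<lambda>x. g (x + of_int k * l))"
    using gk(1)[of k] by (simp add: set_integrable_def)
qed

lemma I0_integrable: "(\<And>p q. set_integrable lebesgue {p..q} g) \<Longrightarrow> set_integrable lebesgue I0 (g :: real \<Rightarrow> real)"
  by (rule set_integrable_subset[of _ "{a..a + l}"]) auto

lemma I0_\<upsilon>_integrable: "continuous_on UNIV g \<Longrightarrow> set_integrable \<upsilon> I0 (g :: real \<Rightarrow> real)"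
  by (rule borel_measure_integrable[OF \<upsilon>, of _ _ a "a + l"]) auto

text \<open>The weak equation tested over one period; its diagonal is the quadratic form Q.\<close>

definition form :: "real \<Rightarrow> (real \<Rightarrow> real) \<Rightarrow> (real \<Rightarrow> real) \<Rightarrow> real" where
  "form z f h = (LINT x:I0|lebesgue. flux u z f x * vderiv h x + source u z f x * h x) - z\<^sup>2 * (LINT x:I0|\<upsilon>. f x * h x)"

lemma source_cont_mult_integrable:
  assumes f: "f \<in> H1_loc" and h: "h \<in> H1_loc"
  shows "set_integrable lebesgue {p..q} (\<lambda>x. source u z f x * h x)"
proof -
  obtain B where B: "B \<ge> 0" "\<And>x. x \<in> {p..q} \<Longrightarrow> norm (h x) \<le> B" using AC_loc_bounded[OF H1_AC[OF h]] by blast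
  show ?thesis
  proof (rule set_integrable_dominated)
    show "set_integrable lebesgue {p..q} (\<lambda>x. B * \<bar>source u z f x\<bar>)"
      by (intro set_integrable_mult_right set_integrable_abs source_integrable u f)
    show "(\<lambda>x. source u z f x * h x) \<in> borel_measurable lebesgue"
      using source_measurable[OF u f] L2_loc_measurable[OF H1_L2[OF h]] by measurable
    show "AE x in lebesgue. x \<in> {p..q} \<longrightarrow> \<bar>source u z f x * h x\<bar> \<le> B * \<bar>source u z f x\<bar>"
      using B by (intro AE_I2) (auto simp: abs_mult mult.commute intro!: mult_right_mono)
  qed simp
qed

lemma form_integrable:
  assumes f: "f \<in> H1_loc" and h: "h \<in> H1_loc"
  shows "set_integrable lebesgue {p..q} (\<lambda>x. flux u z f x * vderiv h x + source u z f x * h x)"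
  by (intro set_integral_add source_cont_mult_integrable L2_loc_mult_integrable flux_L2 H1_vderiv_L2 u f h)

lemma integrable_of_support:
  fixes g :: "real \<Rightarrow> real"
  assumes "set_integrable m {p..q} g" "\<And>x. x \<notin> {p..q} \<Longrightarrow> g x = 0"
  shows "integrable m g"
proof -
  have "(\<lambda>x. indicator {p..q} x *\<^sub>R g x) = g" using assms(2) by (force simp: indicator_def)
  then show ?thesis using assms(1) by (simp add: set_integrable_def)
qed

lemma vderiv_zero_outside:
  assumes "\<And>x. x \<notin> {p..q} \<Longrightarrow> h x = (0::real)" "x \<notin> {p..q}"
  shows "vderiv h x = 0"
proof -
  have "vderiv h x = vderiv (\<lambda>_. 0) x"
    by (rule vderiv_local[of "- {p..q}"]) (use assms in auto)
  then show ?thesis by (simp add: vderiv_eqI)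
qed

text \<open>Under translation by k periods, flux and source of a function in \<open>P\<close> pick
  up the factor s^k, which can be moved onto the test function. Testing with h over the line thus
  equals testing over one period with the signed periodisation of h. \<open>H\<close> is prescribed
  on the base cell only.\<close>

lemma form_periodize:
  fixes N :: nat
  assumes f: "f \<in> P" and h: "h \<in> H1_loc" and supp: "\<And>x. x \<notin> {a - N * l<..<a + N * l} \<Longrightarrow> h x = 0"
    and H: "H \<in> H1_loc" "\<And>x. x \<in> I0 \<Longrightarrow> H x = (\<Sum>k\<in>{- int N..<int N}. sgpow s k * h (x + of_int k * l))"
  shows "(LINT x|lebesgue. flux u z f x * vderiv h x + source u z f x * h x) - z\<^sup>2 * (LINT x|\<upsilon>. f x * h x) = form z f H"
proof -
  let ?K = "{- int N..<int N}"
  have fH: "f \<in> H1_loc" using f by (rule P_H1)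
  have supp': "h x = 0" if "x \<notin> {a - N * l..<a + N * l}" for x using supp that by auto
  have suppc: "h x = 0" if "x \<notin> {a - N * l..a + N * l}" for x using supp that by auto
  let ?g = "\<lambda>x. flux u z f x * vderiv h x + source u z f x * h x"
  have out: "?g x = 0" if "x \<notin> {a - N * l..a + N * l}" for x
    using suppc[OF that] vderiv_zero_outside[OF suppc that] by simp
  have gi: "integrable lebesgue ?g"
    by (rule integrable_of_support[OF form_integrable[OF fH h] out])
  \<comment> \<open>At the right end of the window h vanishes, but \<open>vderiv h\<close> is
    unspecified if h is not differentiable there. Resetting this single point makes the support fit
    the half-open window.\<close>
  let ?g1 = "\<lambda>x. if x = a + N * l then 0 else ?g x"
  have ae1: "AE x in lebesgue. ?g x = ?g1 x"
    using AE_lebesgue_neq[of "a + N * l"] by eventually_elim simp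
  have g1m: "?g1 \<in> borel_measurable lebesgue"
    using borel_measurable_integrable[OF gi] by (intro measurable_If) auto
  have g1i: "integrable lebesgue ?g1" using gi ae1 g1m integrable_cong_AE[of ?g lebesgue ?g1] borel_measurable_integrable[OF gi] by blast
  have g1s: "?g1 x = 0" if "x \<notin> {a - N * l..<a + N * l}" for x
    using out[of x] that by auto
  have "(LINT x|lebesgue. ?g x) = (LINT x|lebesgue. ?g1 x)"
    by (rule integral_cong_AE[OF borel_measurable_integrable[OF gi] g1m ae1])
  also have "\<dots> = (\<Sum>k\<in>?K. LINT x:I0|lebesgue. ?g1 (x + of_int k * l))"
    by (rule integral_periodize(1)[OF shift_invariant_lebesgue g1i g1s])
  also have "\<dots> = (LINT x:I0|lebesgue. (\<Sum>k\<in>?K. ?g1 (x + of_int k * l)))"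
    using integral_periodize(2)[OF shift_invariant_lebesgue g1i g1s]
    by (rule set_integral_sum)
  also have "\<dots> = (LINT x:I0|lebesgue. flux u z f x * vderiv H x + source u z f x * H x)"
  proof (rule set_lebesgue_integral_cong_AE)
    have "AE x in lebesgue. \<forall>k\<in>?K. vderiv f (x + of_int k * l) = sgpow s k * vderiv f x"
      by (intro AE_finite_allI P_vderiv_shift f) simp
    moreover have "AE x in lebesgue. \<forall>k\<in>?K. ((\<lambda>x. sgpow s k * h (x + of_int k * l)) has_real_derivative sgpow s k * vderiv h (x + of_int k * l)) (at x)"
    proof (intro AE_finite_allI)
      fix k
      show "AE x in lebesgue. ((\<lambda>x. sgpow s k * h (x + of_int k * l)) has_real_derivative sgpow s k * vderiv h (x + of_int k * l)) (at x)"
        using AE_lebesgue_shift[OF H1_AE_deriv[OF h], of "of_int k * l"]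
        by eventually_elim (intro DERIV_cmult, simp add: DERIV_shift)
    qed simp
    moreover have "AE x in lebesgue. \<forall>k\<in>?K. ?g1 (x + of_int k * l) = ?g (x + of_int k * l)"
    proof (intro AE_finite_allI)
      fix k
      show "AE x in lebesgue. ?g1 (x + of_int k * l) = ?g (x + of_int k * l)"
        using AE_lebesgue_shift[OF ae1, of "of_int k * l"] by eventually_elim simp
    qed simp
    ultimately show "AE x\<in>I0 in lebesgue. (\<Sum>k\<in>?K. ?g1 (x + of_int k * l)) = flux u z f x * vderiv H x + source u z f x * H x"
      using AE_lebesgue_neq[of a]
    proof eventually_elim
      case (elim x)
      show ?case
      proof
        assume x: "x \<in> I0"
        then have x': "x \<in> {a<..<a + l}" using elim by auto
        have "vderiv H x = vderiv (\<lambda>x. \<Sum>k\<in>?K. sgpow s k * h (x + of_int k * l)) x"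
          by (rule vderiv_local[of "{a<..<a + l}"]) (use x' H(2) in auto)
        also have "\<dots> = (\<Sum>k\<in>?K. sgpow s k * vderiv h (x + of_int k * l))"
          using elim by (intro vderiv_eqI DERIV_sum) auto
        finally have vH: "vderiv H x = (\<Sum>k\<in>?K. sgpow s k * vderiv h (x + of_int k * l))" .
        have "?g1 (x + of_int k * l) = flux u z f x * (sgpow s k * vderiv h (x + of_int k * l)) + source u z f x * (sgpow s k * h (x + of_int k * l))"
          if "k \<in> ?K" for k
        proof -
          have "?g1 (x + of_int k * l) = ?g (x + of_int k * l)" using elim that by blast
          also have "\<dots> = flux u z f x * (sgpow s k * vderiv h (x + of_int k * l)) + source u z f x * (sgpow s k * h (x + of_int k * l))"
          proof -
            have 1: "vderiv f (x + of_int k * l) = sgpow s k * vderiv f x" using elim that by blast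
            have "flux u z f (x + of_int k * l) = sgpow s k * flux u z f x"
              unfolding flux_def 1 u_vderiv_shift P_shift[OF f] by (simp add: algebra_simps)
            moreover have "source u z f (x + of_int k * l) = sgpow s k * source u z f x"
              unfolding source_def 1 u_vderiv_shift P_shift[OF f] u_shift_int by (simp add: algebra_simps)
            ultimately show ?thesis by (simp add: mult_ac)
          qed
          finally show ?thesis .
        qed
        then have "(\<Sum>k\<in>?K. ?g1 (x + of_int k * l)) = (\<Sum>k\<in>?K. flux u z f x * (sgpow s k * vderiv h (x + of_int k * l)) + source u z f x * (sgpow s k * h (x + of_int k * l)))"
          by (intro sum.cong refl)
        also have "\<dots> = flux u z f x * vderiv H x + source u z f x * H x"
          unfolding vH H(2)[OF x] by (simp only: sum.distrib sum_distrib_left)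
        finally show "(\<Sum>k\<in>?K. ?g1 (x + of_int k * l)) = flux u z f x * vderiv H x + source u z f x * H x" .
      qed
    qed
    have "(\<lambda>x. ?g1 (x + c)) \<in> borel_measurable lebesgue" for c
      by (rule measurable_compose[OF lebesgue_shift_measurable g1m])
    then show "(\<lambda>x. \<Sum>k\<in>?K. ?g1 (x + of_int k * l)) \<in> borel_measurable lebesgue"
      by (intro borel_measurable_sum)
    show "(\<lambda>x. flux u z f x * vderiv H x + source u z f x * H x) \<in> borel_measurable lebesgue"
      using L2_loc_measurable[OF flux_L2[OF u fH]] L2_loc_measurable[OF H1_vderiv_L2[OF H(1)]]
        source_measurable[OF u fH] L2_loc_measurable[OF H1_L2[OF H(1)]] by measurable
  qed simp
  finally have 1: "(LINT x|lebesgue. ?g x) = (LINT x:I0|lebesgue. flux u z f x * vderiv H x + source u z f x * H x)" .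
  have fhc: "continuous_on UNIV (\<lambda>x. f x * h x)"
    by (intro continuous_intros H1_loc_continuous fH h)
  have fhi: "integrable \<upsilon> (\<lambda>x. f x * h x)"
  proof (rule integrable_of_support)
    show "set_integrable \<upsilon> {a - N * l..a + N * l} (\<lambda>x. f x * h x)"
      by (rule borel_measure_integrable[OF \<upsilon> fhc]) auto
  qed (simp add: suppc)
  have fhs: "f x * h x = 0" if "x \<notin> {a - N * l..<a + N * l}" for x using supp'[OF that] by simp
  have "(LINT x|\<upsilon>. f x * h x) = (\<Sum>k\<in>?K. LINT x:I0|\<upsilon>. f (x + of_int k * l) * h (x + of_int k * l))"
    by (rule integral_periodize(1)[OF shift_invariant_\<upsilon> fhi fhs])
  also have "\<dots> = (LINT x:I0|\<upsilon>. (\<Sum>k\<in>?K. f (x + of_int k * l) * h (x + of_int k * l)))"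
  proof -
    have "set_integrable \<upsilon> I0 (\<lambda>x. f (x + of_int k * l) * h (x + of_int k * l))" for k
      by (rule integral_periodize(2)[OF shift_invariant_\<upsilon> fhi fhs])
    then show ?thesis by (rule set_integral_sum)
  qed
  also have "\<dots> = (LINT x:I0|\<upsilon>. f x * H x)"
  proof (rule set_lebesgue_integral_cong)
    show "\<forall>x. x \<in> I0 \<longrightarrow> (\<Sum>k\<in>?K. f (x + of_int k * l) * h (x + of_int k * l)) = f x * H x"
      using H(2) P_shift[OF f] by (simp add: sum_distrib_left mult_ac)
  qed simp
  finally show ?thesis using 1 by (simp add: form_def)
qed

text \<open>Signed periodisation. Summing over the nonzero terms only makes the index set finite for
  functions of bounded support, without fixing a range that would depend on x.\<close>

definition perz :: "(real \<Rightarrow> real) \<Rightarrow> real \<Rightarrow> real" where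
  "perz h x = (\<Sum>k | h (x + of_int k * l) \<noteq> 0. sgpow s k * h (x + of_int k * l))"

lemma perz_finite_sum:
  assumes "finite A" "\<And>k. k \<notin> A \<Longrightarrow> h (x + of_int k * l) = 0"
  shows "perz h x = (\<Sum>k\<in>A. sgpow s k * h (x + of_int k * l))"
  unfolding perz_def using assms by (intro sum.mono_neutral_left) auto

lemma perz_P:
  assumes h: "h \<in> H1_loc" and supp: "\<And>x. \<bar>x\<bar> \<ge> R \<Longrightarrow> h x = 0"
  shows "perz h \<in> P"
  unfolding P_def
proof (intro CollectI conjI allI)
  show "perz h \<in> H1_loc"
  proof (rule H1_local)
    fix n :: nat
    define K where "K = \<lceil>(R + real n) / l\<rceil>"
    let ?g = "\<lambda>x. \<Sum>k\<in>{-K..K}. sgpow s k * h (x + of_int k * l)"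
    have "?g \<in> H1_loc" by (intro H1_sum H1_cmult(1) H1_shift h)
    moreover have "perz h x = ?g x" if x: "x \<in> {-real n<..<real n}" for x
    proof (rule perz_finite_sum)
      fix k assume "k \<notin> {-K..K}"
      then have "K < \<bar>k\<bar>" by auto
      then have "(R + real n) / l \<le> \<bar>of_int k\<bar>" unfolding K_def by linarith
      then have "R + real n \<le> \<bar>of_int k\<bar> * l" using l by (simp add: divide_le_eq)
      also have "\<bar>of_int k\<bar> * l = \<bar>of_int k * l\<bar>" using l by (simp add: abs_mult)
      finally have "R \<le> \<bar>x + of_int k * l\<bar>" using x by auto
      then show "h (x + of_int k * l) = 0" by (rule supp)
    qed simp
    ultimately show "\<exists>g\<in>H1_loc. \<forall>x\<in>{-real n<..<real n}. perz h x = g x"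
      by (intro bexI[of _ ?g] ballI)
  qed
  fix x
  have "perz h (x + l) = (\<Sum>k | h (x + of_int k * l) \<noteq> 0. s * (sgpow s k * h (x + of_int k * l)))"
    unfolding perz_def
  proof (rule sum.reindex_bij_witness[of _ "\<lambda>k. k - 1" "\<lambda>k. k + 1"])
    fix k assume "k \<in> {k. h (x + l + of_int k * l) \<noteq> 0}"
    then show "k + 1 \<in> {k. h (x + of_int k * l) \<noteq> 0}" by (simp add: algebra_simps)
    show "s * (sgpow s (k + 1) * h (x + of_int (k + 1) * l)) = sgpow s k * h (x + l + of_int k * l)"
    proof -
      have "s * (sgpow s (k + 1) * y) = sgpow s k * y" for y using s by (auto simp: sgpow_def)
      then show ?thesis by (simp add: algebra_simps)
    qed
  next
    fix k assume "k \<in> {k. h (x + of_int k * l) \<noteq> 0}"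
    then show "k - 1 \<in> {k. h (x + l + of_int k * l) \<noteq> 0}" by (simp add: algebra_simps)
  qed auto
  then show "perz h (x + l) = s * perz h x" by (simp add: perz_def sum_distrib_left)
qed

text \<open>Testing with h over the line amounts to testing with \<open>perz h\<close>, an element
  of \<open>P\<close>, over one period.\<close>

lemma real_solutionI:
  assumes f: "f \<in> P" and eq: "\<And>h. h \<in> P \<Longrightarrow> form z f h = 0"
  shows "real_solution u \<upsilon> z f"
  unfolding real_solution_def
proof (intro conjI ballI P_H1[OF f])
  fix h :: "real \<Rightarrow> real" assume "h \<in> H1_c"
  then have h: "h \<in> H1_loc" and "compact (closure {x. h x \<noteq> 0})" by (auto simp: H1_c_def)
  then have "bounded {x. h x \<noteq> 0}"
    by (intro bounded_subset[OF compact_imp_bounded closure_subset])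
  then obtain R0 where R0: "\<And>x. h x \<noteq> 0 \<Longrightarrow> \<bar>x\<bar> \<le> R0" by (auto simp: bounded_iff)
  define R where "R = R0 + 1"
  have R: "h x = 0" if "\<bar>x\<bar> \<ge> R" for x using R0[of x] that by (force simp: R_def)
  obtain N :: nat where N: "(R + \<bar>a\<bar>) / l + 1 \<le> real N" using real_arch_simple by blast
  then have N': "R + \<bar>a\<bar> + l \<le> N * l" using l by (simp add: field_simps)
  have supp: "h x = 0" if "x \<notin> {a - N * l<..<a + N * l}" for x
    using that N' l by (intro R) auto
  have "(LINT x|lebesgue. flux u z f x * vderiv h x + source u z f x * h x) - z\<^sup>2 * (LINT x|\<upsilon>. f x * h x) = form z f (perz h)"
  proof (rule form_periodize[OF f h supp])
    show "perz h \<in> H1_loc" using perz_P[OF h R] by (rule P_H1)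
    fix x assume x: "x \<in> I0"
    show "perz h x = (\<Sum>k\<in>{- int N..<int N}. sgpow s k * h (x + of_int k * l))"
    proof (rule perz_finite_sum)
      fix k assume "k \<notin> {- int N..<int N}"
      then have "k \<le> - int N - 1 \<or> int N \<le> k" by auto
      then have "real_of_int k \<le> - real N - 1 \<or> real N \<le> real_of_int k" by linarith
      then have "of_int k * l \<le> (- real N - 1) * l \<or> real N * l \<le> of_int k * l"
        using l by (meson less_imp_le mult_right_mono)
      then have "of_int k * l \<le> - (real N * l) - l \<or> real N * l \<le> of_int k * l" by (simp only: left_diff_distrib mult_minus_left mult_1)
      then have "x + of_int k * l \<notin> {a - N * l<..<a + N * l}" using x
        unfolding greaterThanLessThan_iff atLeastLessThan_iff by linarith
      then show "h (x + of_int k * l) = 0" by (rule supp)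
    qed simp
  qed
  then show "(LINT x|lebesgue. flux u z f x * vderiv h x + source u z f x * h x) = z\<^sup>2 * (LINT x|\<upsilon>. f x * h x)"
    using eq[OF perz_P[OF h R]] by simp
qed

text \<open>The tent \<psi> on [a - l, a + l] satisfies \<psi> x + \<psi> (x - l) = 1 on the base
  cell. Hence H \<psi> is a test function of compact support whose signed periodisation is
  \<open>H\<close> again.\<close>

lemma real_solutionD:
  assumes f: "f \<in> P" "real_solution u \<upsilon> z f" and H: "H \<in> P"
  shows "form z f H = 0"
proof -
  define \<psi> where "\<psi> x = max 0 (1 - \<bar>x - a\<bar> / l)" for x
  have \<psi>: "\<psi> \<in> H1_loc"
  proof (rule H1_lipschitz[of _ "1 / l"])
    fix x y
    have "\<bar>\<psi> x - \<psi> y\<bar> \<le> \<bar>\<bar>x - a\<bar> / l - \<bar>y - a\<bar> / l\<bar>" unfolding \<psi>_def by linarith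
    also have "\<dots> = \<bar>\<bar>x - a\<bar> - \<bar>y - a\<bar>\<bar> / l" using l by (simp flip: diff_divide_distrib)
    also have "\<dots> \<le> \<bar>x - y\<bar> / l" using l by (intro divide_right_mono) linarith+
    finally show "\<bar>\<psi> x - \<psi> y\<bar> \<le> 1 / l * \<bar>x - y\<bar>" by simp
  qed
  have \<psi>0: "\<psi> x = 0" if "x \<notin> {a - l<..<a + l}" for x
  proof -
    have "\<bar>x - a\<bar> \<ge> l" using that by auto
    then have "\<bar>x - a\<bar> / l \<ge> 1" using l by (simp add: le_divide_eq)
    then show ?thesis by (simp add: \<psi>_def)
  qed
  have \<psi>1: "\<psi> x + \<psi> (x - l) = 1" if "x \<in> I0" for x
  proof -
    have "\<psi> x = 1 - (x - a) / l" using that l by (simp add: \<psi>_def field_simps)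
    moreover have "\<psi> (x - l) = 1 - (a + l - x) / l" using that l by (simp add: \<psi>_def field_simps abs_if)
    moreover have "(x - a) / l + (a + l - x) / l = 1" using l by (simp flip: add_divide_distrib)
    ultimately show ?thesis by linarith
  qed
  let ?h = "\<lambda>x. H x * \<psi> x"
  have h: "?h \<in> H1_loc" by (rule H1_mult(1)[OF P_H1[OF H] \<psi>])
  have "?h \<in> H1_c" by (rule H1_c_realI[OF h, of "a - l" "a + l"]) (use \<psi>0 in auto)
  then have "(LINT x|lebesgue. flux u z f x * vderiv ?h x + source u z f x * ?h x) - z\<^sup>2 * (LINT x|\<upsilon>. f x * ?h x) = 0"
    using f(2) by (simp add: real_solution_def)
  moreover have "(LINT x|lebesgue. flux u z f x * vderiv ?h x + source u z f x * ?h x) - z\<^sup>2 * (LINT x|\<upsilon>. f x * ?h x) = form z f H"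
  proof (rule form_periodize[OF f(1) h, where N = 1])
    show "?h x = 0" if "x \<notin> {a - real 1 * l<..<a + real 1 * l}" for x using \<psi>0[of x] that by simp
    fix x assume x: "x \<in> I0"
    have K: "{- int 1..<int 1} = {-1, 0}" by auto
    have "H (x - l) = s * H x" using P_shift[OF H, of x "-1"] by simp
    then have "(\<Sum>k\<in>{- int 1..<int 1}. sgpow s k * ?h (x + of_int k * l)) = s * s * H x * \<psi> (x - l) + H x * \<psi> x"
      unfolding K by simp
    also have "\<dots> = H x * (\<psi> x + \<psi> (x - l))" using ss by (simp add: algebra_simps)
    finally show "H x = (\<Sum>k\<in>{- int 1..<int 1}. sgpow s k * ?h (x + of_int k * l))" using \<psi>1[OF x] by simp
  qed (rule P_H1[OF H])
  ultimately show ?thesis by simp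
qed

end

lemma H1_C1:
  fixes f f' :: "real \<Rightarrow> real"
  assumes d: "\<And>x. (f has_real_derivative f' x) (at x)" and c: "continuous_on UNIV f'"
  shows "f \<in> H1_loc" and "vderiv f x = f' x"
proof -
  show v: "vderiv f x = f' x" for x using d by (rule vderiv_eqI)
  show "f \<in> H1_loc"
  proof (rule H1_realI)
    show "f' \<in> L2_loc" using c by (rule continuous_L2_loc)
    show "AE x in lebesgue. \<bar>vderiv f x\<bar> \<le> \<bar>f' x\<bar>" by (simp add: v)
    have id: "(\<lambda>x::real. x) \<in> AC_loc" by (simp add: AC_loc_def abs_cont_on_ident)
    show "f \<in> AC_loc"
    proof (rule AC_loc_dominated[OF id id])
      fix p q :: real
      obtain B where B: "B \<ge> 0" "\<And>x. x \<in> {p..q} \<Longrightarrow> norm (f' x) \<le> B"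
        using continuous_bounded_Icc continuous_on_subset[OF c] by (metis subset_UNIV)
      have "norm (f y - f x) \<le> B * (norm (y - x) + norm (y - x))" if "x \<in> {p..q}" "y \<in> {p..q}" for x y
      proof -
        have "norm (f y - f x) \<le> B * norm (y - x)"
          by (rule field_differentiable_bound[of "{p..q}" f f' B y x])
            (use that B d in \<open>auto intro: has_field_derivative_at_within\<close>)
        also have "\<dots> \<le> B * (norm (y - x) + norm (y - x))" using B(1) by (intro mult_left_mono) auto
        finally show ?thesis .
      qed
      then show "\<exists>C. \<forall>x\<in>{p..q}. \<forall>y\<in>{p..q}. norm (f y - f x) \<le> C * (norm (y - x) + norm (y - x))" by blast
    qed
  qed
qed

section \<open>The parts of the form and the sharp Sobolev inequality\<close>

context periodic_data
begin

definition energy_form :: "(real \<Rightarrow> real) \<Rightarrow> (real \<Rightarrow> real) \<Rightarrow> real" where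
  "energy_form f h = (LINT x:I0|lebesgue. vderiv f x * vderiv h x + 1/4 * (f x * h x))"

text \<open>\<omega>(f h) over one period with the derivative of the product written out, so that
  bilinearity is visible in the integrand.\<close>

definition omega_form :: "(real \<Rightarrow> real) \<Rightarrow> (real \<Rightarrow> real) \<Rightarrow> real" where
  "omega_form f h = (LINT x:I0|lebesgue. u x * (f x * h x) + vderiv u x * (f x * vderiv h x + h x * vderiv f x))"

definition upsilon_form :: "(real \<Rightarrow> real) \<Rightarrow> (real \<Rightarrow> real) \<Rightarrow> real" where
  "upsilon_form f h = (LINT x:I0|\<upsilon>. f x * h x)"

lemma energy_integrable:
  fixes f h :: "real \<Rightarrow> real"
  assumes "f \<in> H1_loc" "h \<in> H1_loc"
  shows "set_integrable lebesgue {p..q} (\<lambda>x. vderiv f x * vderiv h x + 1/4 * (f x * h x))"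
  using assms by (intro set_integral_add set_integrable_mult_right L2_loc_mult_integrable H1_L2 H1_vderiv_L2)

lemma omega_integrable:
  assumes "f \<in> H1_loc" "h \<in> H1_loc"
  shows "set_integrable lebesgue {p..q} (\<lambda>x. u x * (f x * h x) + vderiv u x * (f x * vderiv h x + h x * vderiv f x))"
  using assms by (intro set_integral_add L2_loc_mult_integrable L2_loc_add L2_loc_cont_mult H1_vderiv_L2 H1_L2 H1_loc_continuous u)

lemma form_eq:
  assumes "f \<in> H1_loc" "h \<in> H1_loc"
  shows "form z f h = energy_form f h - z * omega_form f h - z\<^sup>2 * upsilon_form f h"
proof -
  have "(LINT x:I0|lebesgue. flux u z f x * vderiv h x + source u z f x * h x)
    = (LINT x:I0|lebesgue. (vderiv f x * vderiv h x + 1/4 * (f x * h x))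
        - z * (u x * (f x * h x) + vderiv u x * (f x * vderiv h x + h x * vderiv f x)))"
    by (rule arg_cong[where f = "set_lebesgue_integral lebesgue I0"]) (auto simp: flux_def source_def algebra_simps)
  also have "\<dots> = energy_form f h - z * omega_form f h"
    unfolding energy_form_def omega_form_def
    by (subst set_integral_diff(2)[OF I0_integrable[OF energy_integrable[OF assms]]
          set_integrable_mult_right[OF I0_integrable[OF omega_integrable[OF assms]]]]) simp
  finally show ?thesis by (simp add: form_def upsilon_form_def)
qed

lemma form_sym: "f \<in> H1_loc \<Longrightarrow> h \<in> H1_loc \<Longrightarrow> form z f h = form z h f"
  by (simp add: form_eq energy_form_def omega_form_def upsilon_form_def mult.commute add.commute)

lemma form_add_cmult:
  assumes f: "f \<in> H1_loc" and g: "g \<in> H1_loc" and h: "h \<in> H1_loc"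
  shows "form z (\<lambda>x. f x + c * g x) h = form z f h + c * form z g h"
proof -
  let ?k = "\<lambda>x. f x + c * g x"
  have k: "?k \<in> H1_loc" by (intro H1_add H1_cmult f g)
  have vk: "AE x in lebesgue. vderiv ?k x = vderiv f x + c * vderiv g x"
    using H1_add(2)[OF f H1_cmult(1)[OF g, of c]] H1_cmult(2)[OF g, of c] by eventually_elim simp
  let ?L = "\<lambda>f x. flux u z f x * vderiv h x + source u z f x * h x"
  have i: "set_integrable lebesgue I0 (?L f)" if "f \<in> H1_loc" for f
    by (intro I0_integrable form_integrable that h)
  have m: "?L f \<in> borel_measurable lebesgue" if "f \<in> H1_loc" for f
    using L2_loc_measurable[OF flux_L2[OF u that]] L2_loc_measurable[OF H1_vderiv_L2[OF h]]
        source_measurable[OF u that] L2_loc_measurable[OF H1_L2[OF h]] by measurable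
  have ig: "set_integrable lebesgue I0 (\<lambda>x. c * ?L g x)" by (rule set_integrable_mult_right) (rule i[OF g])
  have "(LINT x:I0|lebesgue. ?L ?k x) = (LINT x:I0|lebesgue. ?L f x + c * ?L g x)"
  proof (rule set_lebesgue_integral_cong_AE)
    show "AE x\<in>I0 in lebesgue. ?L ?k x = ?L f x + c * ?L g x"
      using vk
    proof eventually_elim
      case (elim x)
      have 1: "flux u z ?k x = flux u z f x + c * flux u z g x"
        unfolding flux_def elim by algebra
      have 2: "source u z ?k x = source u z f x + c * source u z g x"
        unfolding source_def elim by algebra
      show ?case unfolding 1 2 by algebra
    qed
    show "(\<lambda>x. ?L f x + c * ?L g x) \<in> borel_measurable lebesgue" using m[OF f] m[OF g] by measurable
  qed (use m[OF k] in auto)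
  also have "\<dots> = (LINT x:I0|lebesgue. ?L f x) + c * (LINT x:I0|lebesgue. ?L g x)"
    by (simp only: set_integral_add(2)[OF i[OF f] ig] set_integral_mult_right)
  finally have 1: "(LINT x:I0|lebesgue. ?L ?k x) = (LINT x:I0|lebesgue. ?L f x) + c * (LINT x:I0|lebesgue. ?L g x)" .
  have fi: "set_integrable \<upsilon> I0 (\<lambda>x. f x * h x)" and ig: "set_integrable \<upsilon> I0 (\<lambda>x. g x * h x)"
    by (intro I0_\<upsilon>_integrable continuous_on_mult H1_loc_continuous f g h)+
  have ig': "set_integrable \<upsilon> I0 (\<lambda>x. c * (g x * h x))" by (rule set_integrable_mult_right) (rule ig)
  have "(LINT x:I0|\<upsilon>. ?k x * h x) = (LINT x:I0|\<upsilon>. f x * h x + c * (g x * h x))"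
    by (simp only: distrib_right mult.assoc)
  also have "\<dots> = (LINT x:I0|\<upsilon>. f x * h x) + c * (LINT x:I0|\<upsilon>. g x * h x)"
    by (simp only: set_integral_add(2)[OF fi ig'] set_integral_mult_right)
  finally have 2: "(LINT x:I0|\<upsilon>. ?k x * h x) = (LINT x:I0|\<upsilon>. f x * h x) + c * (LINT x:I0|\<upsilon>. g x * h x)" .
  show ?thesis unfolding form_def 1 2 by algebra
qed

lemma form_square:
  assumes f: "f \<in> H1_loc" and g: "g \<in> H1_loc"
  shows "form z (\<lambda>x. f x + c * g x) (\<lambda>x. f x + c * g x) = form z f f + 2 * c * form z f g + c\<^sup>2 * form z g g"
proof -
  let ?k = "\<lambda>x. f x + c * g x"
  have k: "?k \<in> H1_loc" by (intro H1_add H1_cmult f g)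
  have 1: "form z ?k ?k = form z f ?k + c * form z g ?k" by (rule form_add_cmult[OF f g k])
  have 2: "form z f ?k = form z f f + c * form z g f"
    unfolding form_sym[OF f k] by (rule form_add_cmult[OF f g f])
  have 3: "form z g ?k = form z f g + c * form z g g"
    unfolding form_sym[OF g k] by (rule form_add_cmult[OF f g g])
  have 4: "form z g f = form z f g" by (rule form_sym[OF g f])
  show ?thesis unfolding 1 2 3 4 by (simp add: algebra_simps power2_eq_square)
qed

lemma energy_eq_form: "f \<in> H1_loc \<Longrightarrow> h \<in> H1_loc \<Longrightarrow> energy_form f h = form 0 f h"
  by (simp add: form_eq)

lemma energy_ge_deriv:
  assumes f: "f \<in> H1_loc"
  shows "(LINT x:I0|lebesgue. (vderiv f x)\<^sup>2) \<le> energy_form f f" "0 \<le> (LINT x:I0|lebesgue. (vderiv f x)\<^sup>2)"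
proof -
  show "(LINT x:I0|lebesgue. (vderiv f x)\<^sup>2) \<le> energy_form f f"
    unfolding energy_form_def
    by (rule set_integral_mono[OF I0_integrable[OF L2_loc_square[OF H1_vderiv_L2[OF f]]]
          I0_integrable[OF energy_integrable[OF f f]]]) (simp add: power2_eq_square)
  show "0 \<le> (LINT x:I0|lebesgue. (vderiv f x)\<^sup>2)"
    unfolding set_lebesgue_integral_def by (intro integral_nonneg_AE) auto
qed

lemma energy_nonneg: "f \<in> H1_loc \<Longrightarrow> 0 \<le> energy_form f f"
  using energy_ge_deriv[of f] by linarith

text \<open>Every term carries a factor \<open>M\<close>, so \<omega>(f^2) is small for uniformly
  small \<open>f\<close> of bounded energy. This expresses that the \<omega> part is compact
  relative to the energy; the bound for the \<upsilon> part below has the same purpose.\<close>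

lemma omega_form_bound:
  assumes f: "f \<in> H1_loc" and M: "M \<ge> 0" "\<And>x. x \<in> I0 \<Longrightarrow> \<bar>f x\<bar> \<le> M"
  shows "\<bar>omega_form f f\<bar> \<le> M\<^sup>2 * (LINT x:I0|lebesgue. \<bar>u x\<bar>)
      + 2 * M * ((LINT x:I0|lebesgue. (vderiv u x)\<^sup>2) + energy_form f f)"
proof -
  have i: "set_integrable lebesgue I0 (\<lambda>x. u x * (f x * f x) + vderiv u x * (f x * vderiv f x + f x * vderiv f x))"
    by (intro I0_integrable omega_integrable f)
  have iu: "set_integrable lebesgue I0 (\<lambda>x. \<bar>u x\<bar>)"
    by (intro set_integrable_abs I0_integrable L2_loc_integrable H1_L2 u)
  have iu': "set_integrable lebesgue I0 (\<lambda>x. (vderiv u x)\<^sup>2)" "set_integrable lebesgue I0 (\<lambda>x. (vderiv f x)\<^sup>2)"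
    by (intro I0_integrable L2_loc_square H1_vderiv_L2 u f)+
  have "\<bar>omega_form f f\<bar> \<le> (LINT x:I0|lebesgue. \<bar>u x * (f x * f x) + vderiv u x * (f x * vderiv f x + f x * vderiv f x)\<bar>)"
    unfolding omega_form_def using set_integral_norm_bound[OF i] by simp
  also have "\<dots> \<le> (LINT x:I0|lebesgue. M\<^sup>2 * \<bar>u x\<bar> + 2 * M * ((vderiv u x)\<^sup>2 + (vderiv f x)\<^sup>2))"
  proof (rule set_integral_mono)
    show "set_integrable lebesgue I0 (\<lambda>x. \<bar>u x * (f x * f x) + vderiv u x * (f x * vderiv f x + f x * vderiv f x)\<bar>)"
      by (rule set_integrable_abs[OF i])
    show "set_integrable lebesgue I0 (\<lambda>x. M\<^sup>2 * \<bar>u x\<bar> + 2 * M * ((vderiv u x)\<^sup>2 + (vderiv f x)\<^sup>2))"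
      by (intro set_integral_add set_integrable_mult_right iu iu')
    fix x assume x: "x \<in> I0"
    have 1: "\<bar>u x * (f x * f x)\<bar> \<le> M\<^sup>2 * \<bar>u x\<bar>"
    proof -
      have "\<bar>f x\<bar> * \<bar>f x\<bar> \<le> M * M" using M(2)[OF x] M(1) by (intro mult_mono) auto
      then have "\<bar>u x\<bar> * (\<bar>f x\<bar> * \<bar>f x\<bar>) \<le> \<bar>u x\<bar> * (M * M)" by (rule mult_left_mono) simp
      then show ?thesis by (simp add: abs_mult power2_eq_square mult_ac)
    qed
    have 2: "\<bar>vderiv u x * vderiv f x\<bar> \<le> (vderiv u x)\<^sup>2 + (vderiv f x)\<^sup>2"
    proof -
      have "0 \<le> (\<bar>vderiv u x\<bar> - \<bar>vderiv f x\<bar>)\<^sup>2" by simp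
      then have "2 * (\<bar>vderiv u x\<bar> * \<bar>vderiv f x\<bar>) \<le> (vderiv u x)\<^sup>2 + (vderiv f x)\<^sup>2" by (simp add: power2_diff)
      moreover have "0 \<le> \<bar>vderiv u x\<bar> * \<bar>vderiv f x\<bar>" by simp
      ultimately show ?thesis unfolding abs_mult by linarith
    qed
    have 3: "\<bar>vderiv u x * (f x * vderiv f x + f x * vderiv f x)\<bar> \<le> 2 * (M * ((vderiv u x)\<^sup>2 + (vderiv f x)\<^sup>2))"
    proof -
    have "\<bar>vderiv u x * (f x * vderiv f x + f x * vderiv f x)\<bar> = 2 * (\<bar>f x\<bar> * \<bar>vderiv u x * vderiv f x\<bar>)"
      by (simp add: abs_mult algebra_simps flip: mult_2)
    also have "\<dots> \<le> 2 * (M * ((vderiv u x)\<^sup>2 + (vderiv f x)\<^sup>2))"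
      using M(2)[OF x] M(1) 2 by (intro mult_left_mono mult_mono) auto
    finally show ?thesis .
    qed
    have "\<bar>u x * (f x * f x) + vderiv u x * (f x * vderiv f x + f x * vderiv f x)\<bar>
        \<le> \<bar>u x * (f x * f x)\<bar> + \<bar>vderiv u x * (f x * vderiv f x + f x * vderiv f x)\<bar>"
      by (rule abs_triangle_ineq)
    also have "\<dots> \<le> M\<^sup>2 * \<bar>u x\<bar> + 2 * (M * ((vderiv u x)\<^sup>2 + (vderiv f x)\<^sup>2))"
      by (rule add_mono[OF 1 3])
    finally show "\<bar>u x * (f x * f x) + vderiv u x * (f x * vderiv f x + f x * vderiv f x)\<bar>
        \<le> M\<^sup>2 * \<bar>u x\<bar> + 2 * M * ((vderiv u x)\<^sup>2 + (vderiv f x)\<^sup>2)"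
      by (simp only: mult.assoc)
  qed
  also have "\<dots> = M\<^sup>2 * (LINT x:I0|lebesgue. \<bar>u x\<bar>) + 2 * M * ((LINT x:I0|lebesgue. (vderiv u x)\<^sup>2) + (LINT x:I0|lebesgue. (vderiv f x)\<^sup>2))"
    by (simp only: set_integral_add(2)[OF set_integrable_mult_right[OF iu] set_integrable_mult_right[OF set_integral_add(1)[OF iu']]]
        set_integral_add(2)[OF iu'] set_integral_mult_right)
  also have "\<dots> \<le> M\<^sup>2 * (LINT x:I0|lebesgue. \<bar>u x\<bar>) + 2 * M * ((LINT x:I0|lebesgue. (vderiv u x)\<^sup>2) + energy_form f f)"
    using energy_ge_deriv(1)[OF f] M(1) by (intro add_left_mono mult_left_mono) auto
  finally show ?thesis .
qed

lemma upsilon_form_bound: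
  assumes f: "f \<in> H1_loc" and M: "M \<ge> 0" "\<And>x. x \<in> I0 \<Longrightarrow> \<bar>f x\<bar> \<le> M"
  shows "0 \<le> upsilon_form f f" "upsilon_form f f \<le> M\<^sup>2 * (LINT x:I0|\<upsilon>. 1)"
proof -
  show "0 \<le> upsilon_form f f"
    unfolding upsilon_form_def set_lebesgue_integral_def by (intro integral_nonneg_AE) auto
  have "upsilon_form f f \<le> (LINT x:I0|\<upsilon>. M\<^sup>2 * 1)"
    unfolding upsilon_form_def
  proof (rule set_integral_mono)
    show "set_integrable \<upsilon> I0 (\<lambda>x. f x * f x)" by (intro I0_\<upsilon>_integrable continuous_intros H1_loc_continuous f)
    show "set_integrable \<upsilon> I0 (\<lambda>x. M\<^sup>2 * 1)" by (intro I0_\<upsilon>_integrable) auto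
    fix x assume "x \<in> I0"
    then have "\<bar>f x\<bar> * \<bar>f x\<bar> \<le> M * M" using M by (intro mult_mono) auto
    then show "f x * f x \<le> M\<^sup>2 * 1" by (simp add: power2_eq_square)
  qed
  then show "upsilon_form f f \<le> M\<^sup>2 * (LINT x:I0|\<upsilon>. 1)" by (simp only: set_integral_mult_right)
qed

definition Csob :: real where "Csob = sinh (l/2) / (cosh (l/2) - s)"

lemma Csob_pos: "Csob > 0" "cosh (l/2) - s > 0"
proof -
  have "cosh (l/2) > 1"
  proof -
    have "sinh (l/2) > 0" using l by simp
    then have "1 < 1 + (sinh (l/2))\<^sup>2" by simp
    then have "1 < (cosh (l/2))\<^sup>2" using hyperbolic_pythagoras[of "l/2"] by linarith
    then show ?thesis using cosh_real_pos[of "l/2"] power_le_one[of "cosh (l/2)" 2] by (metis less_imp_le not_le)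
  qed
  then show "cosh (l/2) - s > 0" using s by auto
  then show "Csob > 0" using l by (simp add: Csob_def)
qed

text \<open>Completing the square: \<open>(f' - c k')\<^sup>2 + (f - c k)\<^sup>2 / 4 \<ge> 0\<close> with \<open>k'' = k / 4\<close>.\<close>

lemma energy_lower_bound:
  fixes k k' :: "real \<Rightarrow> real" and c :: real
  assumes f: "f \<in> H1_loc" and k: "\<And>x. (k has_real_derivative k' x) (at x)"
    and k': "\<And>x. (k' has_real_derivative k x / 4) (at x)" and pq: "p \<le> q"
  defines "\<psi> \<equiv> \<lambda>x. 2 * c * (f x * k' x) - c\<^sup>2 * (k x * k' x)"
  shows "\<psi> q - \<psi> p \<le> (LINT x:{p..q}|lebesgue. vderiv f x * vderiv f x + 1/4 * (f x * f x))"
proof -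
  have ck: "continuous_on UNIV k" by (rule DERIV_continuous_on) (rule k)
  have ck': "continuous_on UNIV k'" by (rule DERIV_continuous_on) (rule k')
  have kH: "k \<in> H1_loc" by (rule H1_C1(1)[OF k ck'])
  have kH': "k' \<in> H1_loc" by (rule H1_C1(1)[OF k']) (intro continuous_on_divide ck continuous_on_const, simp)
  have \<psi>: "\<psi> \<in> H1_loc" unfolding \<psi>_def by (intro H1_diff H1_cmult H1_mult f kH kH')
  have "\<psi> q - \<psi> p = (LINT x:{p..q}|lebesgue. vderiv \<psi> x)" using H1_FTC[OF \<psi> pq] by simp
  also have "\<dots> \<le> (LINT x:{p..q}|lebesgue. vderiv f x * vderiv f x + 1/4 * (f x * f x))"
  proof (rule set_integral_mono_AE)
    show "set_integrable lebesgue {p..q} (vderiv \<psi>)" by (intro L2_loc_integrable H1_vderiv_L2 \<psi>)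
    show "set_integrable lebesgue {p..q} (\<lambda>x. vderiv f x * vderiv f x + 1/4 * (f x * f x))"
      by (intro energy_integrable f)
    show "AE x\<in>{p..q} in lebesgue. vderiv \<psi> x \<le> vderiv f x * vderiv f x + 1/4 * (f x * f x)"
      using H1_AE_deriv[OF f]
    proof eventually_elim
      case (elim x)
      have "(\<psi> has_real_derivative 2 * c * (f x * (k x / 4) + vderiv f x * k' x) - c\<^sup>2 * (k x * (k x / 4) + k' x * k' x)) (at x)"
        unfolding \<psi>_def by (auto intro!: derivative_eq_intros elim k k' simp: algebra_simps)
      then have v: "vderiv \<psi> x = 2 * c * (f x * (k x / 4) + vderiv f x * k' x) - c\<^sup>2 * (k x * (k x / 4) + k' x * k' x)"
        by (rule vderiv_eqI)
      have "0 \<le> (vderiv f x - c * k' x)\<^sup>2 + 1/4 * (f x - c * k x)\<^sup>2" by simp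
      also have "\<dots> = vderiv f x * vderiv f x + 1/4 * (f x * f x) - vderiv \<psi> x"
        unfolding v by (simp add: power2_eq_square algebra_simps)
      finally show ?case by simp
    qed
  qed
  finally show ?thesis .
qed

text \<open>\<open>k1\<close> and \<open>k2\<close> are the branches of the Green function with pole
  \<open>x\<close>, to the left and to the right of it. Both equal \<open>Csob\<close> at
  \<open>x\<close>, the derivative jumps from 1/2 to -1/2 there, and at the ends of the period the
  branches match up to the factor s, so that the boundary terms at \<open>a\<close> and
  \<open>a + l\<close> cancel.\<close>

lemma sobolev:
  assumes f: "f \<in> H1_loc" and fs: "f (a + l) = s * f a" and x: "x \<in> I0"
  shows "(f x)\<^sup>2 \<le> Csob * energy_form f f"
proof -
  define D where "D = cosh (l/2) - s"
  have D: "D > 0" using Csob_pos by (simp add: D_def)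
  define k1 where "k1 y = (sinh ((y - x + l) / 2) + s * sinh ((x - y) / 2)) / D" for y
  define k1' where "k1' y = (cosh ((y - x + l) / 2) / 2 - s * cosh ((x - y) / 2) / 2) / D" for y
  define k2 where "k2 y = (sinh ((l - (y - x)) / 2) + s * sinh ((y - x) / 2)) / D" for y
  define k2' where "k2' y = (- cosh ((l - (y - x)) / 2) / 2 + s * cosh ((y - x) / 2) / 2) / D" for y
  have k1: "(k1 has_real_derivative k1' y) (at y)" and k1': "(k1' has_real_derivative k1 y / 4) (at y)"
    and k2: "(k2 has_real_derivative k2' y) (at y)" and k2': "(k2' has_real_derivative k2 y / 4) (at y)" for y
    unfolding k1_def k1'_def k2_def k2'_def using D by (auto intro!: derivative_eq_intros simp: field_simps)
  have v: "k1 x = Csob" "k2 x = Csob" "k1' x = 1/2" "k2' x = - 1/2"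
    "k1 a = s * k2 (a + l)" "k1' a = s * k2' (a + l)"
  proof -
    show "k1 x = Csob" "k2 x = Csob" by (simp_all add: k1_def k2_def Csob_def D_def)
    have "cosh (l/2) / 2 - s / 2 = D / 2" by (simp add: D_def diff_divide_distrib)
    then show "k1' x = 1/2" using D by (simp add: k1'_def)
    have "- cosh (l/2) / 2 + s / 2 = - D / 2" by (simp add: D_def diff_divide_distrib)
    then show "k2' x = - 1/2" using D by (simp add: k2'_def)
    show "k1 a = s * k2 (a + l)" using s by (auto simp: k1_def k2_def algebra_simps)
    show "k1' a = s * k2' (a + l)" using s by (auto simp: k1'_def k2'_def algebra_simps diff_divide_distrib add_divide_distrib)
  qed
  \<comment> \<open>The maximiser of 2 c f(x) - c^2 \<open>Csob\<close>, which is what the boundary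
    terms at the pole add up to.\<close>
  define c where "c = f x / Csob"
  let ?E = "\<lambda>x. vderiv f x * vderiv f x + 1/4 * (f x * f x)"
  have "(2 * c * (f x * k1' x) - c\<^sup>2 * (k1 x * k1' x)) - (2 * c * (f a * k1' a) - c\<^sup>2 * (k1 a * k1' a)) \<le> (LINT x:{a..x}|lebesgue. ?E x)"
    by (rule energy_lower_bound[OF f k1 k1']) (use x in simp)
  moreover have "(2 * c * (f (a + l) * k2' (a + l)) - c\<^sup>2 * (k2 (a + l) * k2' (a + l))) - (2 * c * (f x * k2' x) - c\<^sup>2 * (k2 x * k2' x)) \<le> (LINT x:{x..a + l}|lebesgue. ?E x)"
    by (rule energy_lower_bound[OF f k2 k2']) (use x in simp)
  moreover have "(LINT x:{a..x}|lebesgue. ?E x) + (LINT x:{x..a + l}|lebesgue. ?E x) = energy_form f f"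
  proof -
    have "(LINT x:{a..x} \<union> {x..a + l}|lebesgue. ?E x) = (LINT x:{a..x}|lebesgue. ?E x) + (LINT x:{x..a + l}|lebesgue. ?E x)"
      using AE_lebesgue_neq[of x]
      by (intro set_integral_Un_AE energy_integrable f) (auto elim: eventually_mono)
    moreover have "(LINT x:{a..x} \<union> {x..a + l}|lebesgue. ?E x) = energy_form f f"
      unfolding energy_form_def
    proof (rule set_integral_cong_set)
      have mE: "?E \<in> borel_measurable lebesgue"
        using L2_loc_measurable[OF H1_L2[OF f]] L2_loc_measurable[OF H1_vderiv_L2[OF f]] by measurable
      show "set_borel_measurable lebesgue I0 ?E" "set_borel_measurable lebesgue ({a..x} \<union> {x..a + l}) ?E"
        unfolding set_borel_measurable_def by (intro borel_measurable_scaleR borel_measurable_indicator mE; simp)+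
      show "AE y in lebesgue. y \<in> I0 \<longleftrightarrow> y \<in> {a..x} \<union> {x..a + l}"
        using AE_lebesgue_neq[of "a + l"] by eventually_elim (use x in auto)
    qed
    ultimately show ?thesis by simp
  qed
  moreover have "2 * c * (f (a + l) * k2' (a + l)) - c\<^sup>2 * (k2 (a + l) * k2' (a + l)) = 2 * c * (f a * k1' a) - c\<^sup>2 * (k1 a * k1' a)"
    unfolding v(5,6) fs using s by auto
  ultimately have "2 * c * f x - c\<^sup>2 * Csob \<le> energy_form f f"
    unfolding v by (simp add: algebra_simps)
  moreover have "2 * c * f x - c\<^sup>2 * Csob = (f x)\<^sup>2 / Csob"
    using Csob_pos(1) by (simp add: c_def power2_eq_square field_simps)
  ultimately show ?thesis using Csob_pos(1) by (simp add: divide_le_eq mult.commute)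
qed

lemma P_abs_shift: "f \<in> P \<Longrightarrow> \<bar>f (x + of_int k * l)\<bar> = \<bar>f x\<bar>"
  by (simp add: P_shift abs_mult)

lemma shift_to_I0:
  obtains k :: int where "x + of_int k * l \<in> I0"
proof -
  define j where "j = \<lfloor>(x - a) / l\<rfloor>"
  have "of_int j \<le> (x - a) / l" "(x - a) / l < of_int j + 1" unfolding j_def by linarith+
  then have "of_int j * l \<le> x - a" "x - a < (of_int j + 1) * l" using l by (simp_all add: le_divide_eq divide_less_eq)
  then have "x + of_int (- j) * l \<in> I0" by (simp add: algebra_simps)
  then show ?thesis by (rule that)
qed

lemma sobolev_P:
  assumes f: "f \<in> P"
  shows "(f x)\<^sup>2 \<le> Csob * energy_form f f"
proof -
  obtain k where k: "x + of_int k * l \<in> I0" by (rule shift_to_I0)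
  have "(f (x + of_int k * l))\<^sup>2 \<le> Csob * energy_form f f"
    using f by (intro sobolev k P_H1) (simp_all add: P_def)
  then show ?thesis using P_abs_shift[OF f, of x k] by (metis power2_abs)
qed

end

subsection \<open>Existence of nonpositive eigenvalues\<close>

lemma indicator_mono_real: "A \<subseteq> B \<Longrightarrow> (indicator A x :: real) \<le> indicator B x"
  by (auto simp: indicator_def)

lemma lebesgue_integral_interval_ends:
  fixes F :: "real \<Rightarrow> real"
  assumes F: "F \<in> borel_measurable lebesgue"
    and A: "A \<in> sets lebesgue" "B \<in> sets lebesgue" and d: "A \<union> {x, y} = B \<union> {x, y}"
  shows "(LINT s:A|lebesgue. F s) = (LINT s:B|lebesgue. F s)"
proof (rule set_integral_cong_set)
  show "set_borel_measurable lebesgue A F" "set_borel_measurable lebesgue B F"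
    unfolding set_borel_measurable_def using F A by (intro borel_measurable_scaleR borel_measurable_indicator; simp)+
  show "AE s in lebesgue. s \<in> B \<longleftrightarrow> s \<in> A"
    using AE_lebesgue_neq[of x] AE_lebesgue_neq[of y]
  proof eventually_elim
    case (elim s)
    then show ?case using d by blast
  qed
qed

text \<open>Cauchy-Schwarz, read off from the nonnegative integral of (f' - m)^2, where
  \<open>m\<close> is the mean slope.\<close>

lemma H1_increment_square:
  fixes f :: "real \<Rightarrow> real"
  assumes f: "f \<in> H1_loc" and xy: "x \<le> y"
  shows "(f y - f x)\<^sup>2 \<le> (y - x) * (LINT s:{x..y}|lebesgue. (vderiv f s)\<^sup>2)"
proof (cases "x = y")
  case False
  then have d: "y - x > 0" using xy by simp
  define m where "m = (f y - f x) / (y - x)"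
  define E where "E = (LINT s:{x..y}|lebesgue. (vderiv f s)\<^sup>2)"
  have L: "vderiv f \<in> L2_loc" using f by (rule H1_vderiv_L2)
  have i1: "set_integrable lebesgue {x..y} (\<lambda>s. (vderiv f s)\<^sup>2)" by (rule L2_loc_square[OF L])
  have i2: "set_integrable lebesgue {x..y} (\<lambda>s. (- 2 * m) * vderiv f s)"
    by (rule set_integrable_mult_right) (rule L2_loc_integrable[OF L])
  have i3: "set_integrable lebesgue {x..y} (\<lambda>s. m\<^sup>2)"
    by (intro L2_loc_integrable continuous_L2_loc) auto
  have "0 \<le> (LINT s:{x..y}|lebesgue. (vderiv f s - m)\<^sup>2)"
    unfolding set_lebesgue_integral_def by (intro integral_nonneg_AE) auto
  also have "(LINT s:{x..y}|lebesgue. (vderiv f s - m)\<^sup>2) = (LINT s:{x..y}|lebesgue. ((vderiv f s)\<^sup>2 + (- 2 * m) * vderiv f s) + m\<^sup>2)"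
    by (rule arg_cong[where f = "set_lebesgue_integral lebesgue {x..y}"]) (auto simp: power2_diff)
  also have "\<dots> = E + (- 2 * m) * (f y - f x) + (LINT s:{x..y}|lebesgue. m\<^sup>2)"
    unfolding E_def
    by (simp only: set_integral_add(2)[OF set_integral_add(1)[OF i1 i2] i3] set_integral_add(2)[OF i1 i2] set_integral_mult_right H1_FTC[OF f xy])
  also have "(LINT s:{x..y}|lebesgue. m\<^sup>2) = m\<^sup>2 * (y - x)"
    using xy by (simp add: set_lebesgue_integral_def)
  finally have "2 * m * (f y - f x) - m\<^sup>2 * (y - x) \<le> E" by simp
  moreover have m: "f y - f x = m * (y - x)" using d by (simp add: m_def)
  have "2 * m * (f y - f x) - m\<^sup>2 * (y - x) = m\<^sup>2 * (y - x)" unfolding m by algebra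
  moreover have "(f y - f x)\<^sup>2 = (y - x) * (m\<^sup>2 * (y - x))" unfolding m by algebra
  ultimately show ?thesis using d by (simp add: E_def mult_left_mono)
qed simp

text \<open>The Fatou lemma in terms of real integrals. The uniform bound also yields integrability
  of the limit, which is not known beforehand.\<close>

lemma set_integral_Fatou:
  fixes w :: "nat \<Rightarrow> real \<Rightarrow> real"
  assumes A: "A \<in> sets lebesgue"
    and w: "\<And>n. w n \<in> borel_measurable lebesgue" "\<And>n x. 0 \<le> w n x" "\<And>n. set_integrable lebesgue A (w n)"
      "\<And>n. (LINT x:A|lebesgue. w n x) \<le> B"
    and v: "v \<in> borel_measurable lebesgue" "\<And>x. 0 \<le> v x"
    and lim: "AE x in lebesgue. (\<lambda>n. w n x) \<longlonglongrightarrow> v x"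
  shows "set_integrable lebesgue A v" "(LINT x:A|lebesgue. v x) \<le> B"
proof -
  let ?w = "\<lambda>n x. ennreal (indicator A x *\<^sub>R w n x)" and ?v = "\<lambda>x. ennreal (indicator A x *\<^sub>R v x)"
  have wm: "(\<lambda>x. indicator A x *\<^sub>R w n x) \<in> borel_measurable lebesgue" for n
    by (intro borel_measurable_scaleR borel_measurable_indicator A w)
  have vm: "(\<lambda>x. indicator A x *\<^sub>R v x) \<in> borel_measurable lebesgue"
    by (intro borel_measurable_scaleR borel_measurable_indicator A v)
  have wB: "integral\<^sup>N lebesgue (?w n) \<le> ennreal B" for n
  proof -
    have "integral\<^sup>N lebesgue (?w n) = ennreal (LINT x|lebesgue. indicator A x *\<^sub>R w n x)"
      using w(3)[of n] w(2) by (intro nn_integral_eq_integral AE_I2) (auto simp: set_integrable_def)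
    also have "\<dots> \<le> ennreal B" using w(4)[of n] by (intro ennreal_leI) (simp add: set_lebesgue_integral_def)
    finally show ?thesis .
  qed
  have "integral\<^sup>N lebesgue ?v = (\<integral>\<^sup>+x. liminf (\<lambda>n. ?w n x) \<partial>lebesgue)"
  proof (rule nn_integral_cong_AE)
    show "AE x in lebesgue. ?v x = liminf (\<lambda>n. ?w n x)"
      using lim
    proof eventually_elim
      case (elim x)
      have "(\<lambda>n. ?w n x) \<longlonglongrightarrow> ?v x" by (intro tendsto_ennrealI tendsto_scaleR tendsto_const elim)
      then show ?case by (rule lim_imp_Liminf[OF sequentially_bot, symmetric])
    qed
  qed
  also have "\<dots> \<le> liminf (\<lambda>n. integral\<^sup>N lebesgue (?w n))"
    by (rule nn_integral_liminf) (use wm in measurable)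
  also have "\<dots> \<le> ennreal B"
    by (rule Liminf_le) (intro always_eventually allI wB | simp)+
  finally have le: "integral\<^sup>N lebesgue ?v \<le> ennreal B" .
  have B: "0 \<le> B"
  proof -
    have "0 \<le> (LINT x:A|lebesgue. w 0 x)"
      unfolding set_lebesgue_integral_def using w(2) by (intro integral_nonneg_AE AE_I2) auto
    then show ?thesis using w(4)[of 0] by linarith
  qed
  have int: "integrable lebesgue (\<lambda>x. indicator A x *\<^sub>R v x)"
    by (rule integrableI_nonneg[OF vm]) (use v(2) le in \<open>auto intro: le_less_trans\<close>)
  then show "set_integrable lebesgue A v" by (simp add: set_integrable_def)
  have "ennreal (LINT x|lebesgue. indicator A x *\<^sub>R v x) = integral\<^sup>N lebesgue ?v"
    using v(2) by (intro nn_integral_eq_integral[symmetric] int AE_I2) auto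
  then have "ennreal (LINT x|lebesgue. indicator A x *\<^sub>R v x) \<le> ennreal B" using le by simp
  then show "(LINT x:A|lebesgue. v x) \<le> B" using B by (simp add: set_lebesgue_integral_def)
qed

section \<open>Lower semicontinuity of the energy\<close>

context periodic_data
begin

text \<open>The distribution function of the Dirichlet energy; it turns estimates of local energy
  into increments of a monotone function.\<close>

definition cumulative :: "(real \<Rightarrow> real) \<Rightarrow> real \<Rightarrow> real" where
  "cumulative f = primitive lebesgue (\<lambda>s. (vderiv f s)\<^sup>2)"

abbreviation "dirichlet f \<equiv> (LINT x:I0|lebesgue. (vderiv f x)\<^sup>2)"

lemma cumulative_diff:
  assumes f: "f \<in> H1_loc" and xy: "x \<le> y"
  shows "cumulative f y - cumulative f x = (LINT s:{x..<y}|lebesgue. (vderiv f s)\<^sup>2)"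
  unfolding cumulative_def
  by (rule primitive_diff[OF L2_loc_square[OF H1_vderiv_L2[OF f]] _ xy]) auto

lemma square_vderiv_measurable:
  fixes f :: "real \<Rightarrow> real"
  assumes "f \<in> H1_loc"
  shows "(\<lambda>s. (vderiv f s)\<^sup>2) \<in> borel_measurable lebesgue"
  using L2_loc_measurable[OF H1_vderiv_L2[OF assms]] by measurable

lemma cumulative_increment_square:
  assumes f: "f \<in> H1_loc" and xy: "x \<le> y"
  shows "(f y - f x)\<^sup>2 \<le> (y - x) * (cumulative f y - cumulative f x)"
proof -
  have "(LINT s:{x..y}|lebesgue. (vderiv f s)\<^sup>2) = (LINT s:{x..<y}|lebesgue. (vderiv f s)\<^sup>2)"
    by (rule lebesgue_integral_interval_ends[OF square_vderiv_measurable[OF f], of _ _ x y]) auto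
  then show ?thesis using H1_increment_square[OF f xy] cumulative_diff[OF f xy] by simp
qed

lemma cumulative_mono:
  assumes f: "f \<in> H1_loc"
  shows "mono (cumulative f)"
proof (rule monoI)
  fix x y :: real assume "x \<le> y"
  then have "cumulative f y - cumulative f x = (LINT s:{x..<y}|lebesgue. (vderiv f s)\<^sup>2)" by (rule cumulative_diff[OF f])
  moreover have "0 \<le> (LINT s:{x..<y}|lebesgue. (vderiv f s)\<^sup>2)"
    unfolding set_lebesgue_integral_def by (intro integral_nonneg_AE) auto
  ultimately show "cumulative f x \<le> cumulative f y" by linarith
qed

text \<open>Squaring removes the sign s, so f'^2 is periodic almost everywhere and each period
  carries the same Dirichlet energy.\<close>

lemma cumulative_period:
  assumes f: "f \<in> P"
  shows "cumulative f (x + l) = cumulative f x + dirichlet f"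
proof -
  have fH: "f \<in> H1_loc" using f by (rule P_H1)
  have shift: "cumulative f (y + l) - cumulative f (x + l) = cumulative f y - cumulative f x" if "x \<le> y" for x y
  proof -
    have "cumulative f (y + l) - cumulative f (x + l) = (LINT s|lebesgue. indicator {x + l..<y + l} s *\<^sub>R (vderiv f s)\<^sup>2)"
      using cumulative_diff[OF fH, of "x + l" "y + l"] that by (simp add: set_lebesgue_integral_def)
    also have "\<dots> = (LINT s|lebesgue. indicator {x + l..<y + l} (s + l) *\<^sub>R (vderiv f (s + l))\<^sup>2)"
      by (rule lebesgue_integral_shift[symmetric])
    also have "\<dots> = (LINT s|lebesgue. indicator {x..<y} s *\<^sub>R (vderiv f s)\<^sup>2)"
    proof (rule integral_cong_AE)
      show "AE s in lebesgue. indicator {x + l..<y + l} (s + l) *\<^sub>R (vderiv f (s + l))\<^sup>2 = indicator {x..<y} s *\<^sub>R (vderiv f s)\<^sup>2"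
        using P_vderiv_shift[OF f, of 1]
      proof eventually_elim
        case (elim r)
        have "(vderiv f (r + l))\<^sup>2 = (vderiv f r)\<^sup>2"
          using elim s by (auto simp: sgpow_def)
        then show ?case by (simp add: indicator_def)
      qed
      have m: "(\<lambda>s. indicator A s *\<^sub>R (vderiv f s)\<^sup>2) \<in> borel_measurable lebesgue" if "A \<in> sets lebesgue" for A
        by (intro borel_measurable_scaleR borel_measurable_indicator that square_vderiv_measurable fH)
      show "(\<lambda>s. indicator {x..<y} s *\<^sub>R (vderiv f s)\<^sup>2) \<in> borel_measurable lebesgue" by (rule m) simp
      show "(\<lambda>s. indicator {x + l..<y + l} (s + l) *\<^sub>R (vderiv f (s + l))\<^sup>2) \<in> borel_measurable lebesgue"
        using measurable_compose[OF lebesgue_shift_measurable m[of "{x + l..<y + l}"], of l] by simp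
    qed
    also have "\<dots> = cumulative f y - cumulative f x"
      using cumulative_diff[OF fH that] by (simp add: set_lebesgue_integral_def)
    finally show ?thesis .
  qed
  have "cumulative f (a + l) - cumulative f a = dirichlet f" by (rule cumulative_diff[OF fH]) (use l in simp)
  then show ?thesis using shift[of x a] shift[of a x] by (cases "x \<le> a") auto
qed

lemma cumulative_integrable:
  assumes f: "f \<in> H1_loc"
  shows "set_integrable lebesgue {p..q} (cumulative f)"
proof (rule set_integrable_dominated)
  have "cumulative f \<in> borel_measurable borel" by (rule borel_measurable_mono[OF cumulative_mono[OF f]])
  then show "cumulative f \<in> borel_measurable lebesgue" by (rule borel_imp_lebesgue_measurable)
  show "set_integrable lebesgue {p..q} (\<lambda>x. \<bar>cumulative f p\<bar> + \<bar>cumulative f q\<bar>)"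
    by (intro L2_loc_integrable continuous_L2_loc) auto
  have "\<bar>cumulative f x\<bar> \<le> \<bar>cumulative f p\<bar> + \<bar>cumulative f q\<bar>" if "x \<in> {p..q}" for x
    using monoD[OF cumulative_mono[OF f], of p x] monoD[OF cumulative_mono[OF f], of x q] that by auto
  then show "AE x in lebesgue. x \<in> {p..q} \<longrightarrow> \<bar>cumulative f x\<bar> \<le> \<bar>cumulative f p\<bar> + \<bar>cumulative f q\<bar>" by simp
qed simp

text \<open>By Cauchy-Schwarz the squared increment of \<open>f\<close> is at most d times the
  increment of its cumulative energy. Integrated over a period, the latter cancels except on a strip
  of length d, where exactly one Dirichlet energy is gained. This replaces an exchange of the order
  of integration.\<close>

lemma difference_quotient_contraction:
  assumes f: "f \<in> P" and d: "0 < d" "d \<le> l"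
  shows "(LINT x:I0|lebesgue. (f (x + d) - f x)\<^sup>2) \<le> d\<^sup>2 * dirichlet f"
proof -
  have fH: "f \<in> H1_loc" using f by (rule P_H1)
  let ?G = "cumulative f"
  have Gi: "set_integrable lebesgue {p..<q} ?G" for p q
    by (rule set_integrable_subset[OF cumulative_integrable[OF fH, of p q]]) auto
  have sh: "(LINT x:{p..<q}|lebesgue. ?G (x + c)) = (LINT x:{p + c..<q + c}|lebesgue. ?G x)"
       "set_integrable lebesgue {p..<q} (\<lambda>x. ?G (x + c))" for p q c
  proof -
    have e: "indicator {p + c..<q + c} (x + c) = (indicator {p..<q} x :: real)" for x by (simp add: indicator_def)
    show "(LINT x:{p..<q}|lebesgue. ?G (x + c)) = (LINT x:{p + c..<q + c}|lebesgue. ?G x)"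
      using lebesgue_integral_shift[of "\<lambda>x. indicator {p + c..<q + c} x *\<^sub>R ?G x" c]
      unfolding set_lebesgue_integral_def e .
    show "set_integrable lebesgue {p..<q} (\<lambda>x. ?G (x + c))"
      using lebesgue_integrable_shift[of "\<lambda>x. indicator {p + c..<q + c} x *\<^sub>R ?G x" c] Gi[of "p + c" "q + c"]
      unfolding set_integrable_def e by blast
  qed
  have I1: "I0 = {a..<a + d} \<union> {a + d..<a + l}" and I2: "{a + d..<a + l + d} = {a + d..<a + l} \<union> {a + l..<a + l + d}"
    using d by auto
  have cst: "set_integrable lebesgue {a..<a + d} (\<lambda>x. dirichlet f)"
    by (rule set_integrable_subset[of _ "{a..a + d}"]) (auto intro!: L2_loc_integrable continuous_L2_loc)
  have "(LINT x:I0|lebesgue. ?G (x + d)) = (LINT x:{a + d..<a + l}|lebesgue. ?G x) + (LINT x:{a + l..<a + l + d}|lebesgue. ?G x)"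
    unfolding sh(1) I2 by (rule set_integral_Un) (auto intro!: Gi)
  also have "(LINT x:{a + l..<a + l + d}|lebesgue. ?G x) = (LINT x:{a..<a + d}|lebesgue. ?G x + dirichlet f)"
    using sh(1)[of a "a + d" l] cumulative_period[OF f] by (simp add: add.commute add.left_commute)
  also have "\<dots> = (LINT x:{a..<a + d}|lebesgue. ?G x) + (LINT x:{a..<a + d}|lebesgue. dirichlet f)"
    by (rule set_integral_add(2)[OF Gi cst])
  also have "(LINT x:{a..<a + d}|lebesgue. dirichlet f) = d * dirichlet f"
    using d by (simp add: set_lebesgue_integral_def)
  finally have 1: "(LINT x:I0|lebesgue. ?G (x + d)) = (LINT x:{a + d..<a + l}|lebesgue. ?G x) + ((LINT x:{a..<a + d}|lebesgue. ?G x) + d * dirichlet f)" .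
  have 2: "(LINT x:I0|lebesgue. ?G x) = (LINT x:{a..<a + d}|lebesgue. ?G x) + (LINT x:{a + d..<a + l}|lebesgue. ?G x)"
    unfolding I1 by (rule set_integral_Un) (auto intro!: Gi)
  have "(LINT x:I0|lebesgue. (f (x + d) - f x)\<^sup>2) \<le> (LINT x:I0|lebesgue. d * (?G (x + d) - ?G x))"
  proof (rule set_integral_mono)
    show "set_integrable lebesgue I0 (\<lambda>x. (f (x + d) - f x)\<^sup>2)"
      by (intro I0_integrable L2_loc_square H1_L2 H1_diff H1_shift fH)
    show "set_integrable lebesgue I0 (\<lambda>x. d * (?G (x + d) - ?G x))"
      by (intro set_integrable_mult_right set_integral_diff(1) sh Gi)
    show "(f (x + d) - f x)\<^sup>2 \<le> d * (?G (x + d) - ?G x)" for x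
      using cumulative_increment_square[OF fH, of x "x + d"] d by simp
  qed
  also have "\<dots> = d * ((LINT x:I0|lebesgue. ?G (x + d)) - (LINT x:I0|lebesgue. ?G x))"
    by (simp only: set_integral_mult_right set_integral_diff(2)[OF sh(2) Gi])
  also have "\<dots> = d\<^sup>2 * dirichlet f" unfolding 1 2 by (simp add: power2_eq_square)
  finally show ?thesis .
qed

lemma cumulative_bound:
  assumes f: "f \<in> P" and n: "q \<le> p + real n * l"
  shows "cumulative f q - cumulative f p \<le> real n * dirichlet f"
proof -
  have "cumulative f (p + real n * l) = cumulative f p + real n * dirichlet f" for n
  proof (induction n)
    case (Suc n)
    have "cumulative f (p + real (Suc n) * l) = cumulative f ((p + real n * l) + l)" by (simp add: algebra_simps)
    also have "\<dots> = cumulative f (p + real n * l) + dirichlet f" by (rule cumulative_period[OF f])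
    finally show ?case using Suc by (simp add: algebra_simps)
  qed simp
  then show ?thesis using monoD[OF cumulative_mono[OF P_H1[OF f]] n] by simp
qed

text \<open>The Young inequality with weight \<eta>, applied to |D| \<le> sqrt (\<delta> E).\<close>

lemma abs_le_of_square_le:
  fixes d D \<delta> E \<eta> :: real
  assumes "D\<^sup>2 \<le> \<delta> * E" "\<delta> \<ge> 0" "E \<ge> 0" "\<eta> > 0"
  shows "\<bar>D\<bar> \<le> \<eta> * E + \<delta> / (4 * \<eta>)"
proof (rule power2_le_imp_le)
  have "0 \<le> (\<eta> * E - \<delta> / (4 * \<eta>))\<^sup>2" by simp
  also have "\<dots> = (\<eta> * E + \<delta> / (4 * \<eta>))\<^sup>2 - \<delta> * E" using assms(4) by (simp add: power2_eq_square field_simps)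
  finally show "\<bar>D\<bar>\<^sup>2 \<le> (\<eta> * E + \<delta> / (4 * \<eta>))\<^sup>2" using assms(1) by simp
qed (use assms in simp)

text \<open>A common bound on the Dirichlet energies makes the family equi-absolutely continuous.
  For a given system of intervals the estimate concerns a finite sum, so it survives the pointwise
  limit.\<close>

lemma AC_of_bounded_limit:
  assumes g: "\<And>m. g m \<in> P" and B: "\<And>m::nat. dirichlet (g m) \<le> B" and lim: "\<And>x. (\<lambda>m. g m x) \<longlonglongrightarrow> G x"
  shows "G \<in> AC_loc"
  unfolding AC_loc_def abs_cont_on_def
proof (intro CollectI allI impI)
  fix p q e :: real assume e: "e > 0"
  obtain k :: nat where k: "(q - p) / l \<le> real k" using real_arch_simple by blast
  then have k': "q \<le> p + real k * l" using l by (simp add: divide_le_eq)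
  define B' where "B' = real k * \<bar>B\<bar> + 1"
  have B': "B' > 0" by (simp add: B'_def add_nonneg_pos)
  \<comment> \<open>Weight in the Young inequality: the energy over [p, q], at most that of
    \<open>k\<close> periods, contributes at most e/4, and total length below
    \<open>e * \<eta>\<close> contributes at most another e/4.\<close>
  define \<eta> where "\<eta> = e / (4 * B')"
  have \<eta>: "\<eta> > 0" using e B' by (simp add: \<eta>_def)
  show "\<exists>\<delta>>0. \<forall>(n::nat) s t. (\<forall>i<n. p \<le> s i \<and> s i \<le> t i \<and> t i \<le> q) \<and>
       disjoint_family_on (\<lambda>i. {s i<..<t i}) {..<n} \<and>
       (\<Sum>i<n. t i - s i) < \<delta> \<longrightarrow> (\<Sum>i<n. norm (G (t i) - G (s i))) < e"
  proof (intro exI[of _ "e * \<eta>"] conjI allI impI)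
    fix n :: nat and s t
    assume A: "(\<forall>i<n. p \<le> s i \<and> s i \<le> t i \<and> t i \<le> q) \<and>
       disjoint_family_on (\<lambda>i. {s i<..<t i}) {..<n} \<and> (\<Sum>i<n. t i - s i) < e * \<eta>"
    have bound: "(\<Sum>i<n. norm (g m (t i) - g m (s i))) \<le> e / 2" for m
    proof -
      have gH: "g m \<in> H1_loc" using g by (rule P_H1)
      let ?D = "\<lambda>s. (vderiv (g m) s)\<^sup>2"
      let ?E = "\<lambda>i. LINT x:{s i<..<t i}|lebesgue. ?D x"
      have iE: "integrable lebesgue (\<lambda>x. indicator {s i<..<t i} x *\<^sub>R ?D x)" for i
      proof -
        have "set_integrable lebesgue {s i<..<t i} ?D"
          by (rule set_integrable_subset[OF L2_loc_square[OF H1_vderiv_L2[OF gH], of "s i" "t i"]]) auto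
        then show ?thesis by (simp only: set_integrable_def)
      qed
      have "(\<Sum>i<n. norm (g m (t i) - g m (s i))) \<le> (\<Sum>i<n. \<eta> * ?E i + (t i - s i) / (4 * \<eta>))"
      proof (rule sum_mono)
        fix i assume "i \<in> {..<n}"
        then have st: "s i \<le> t i" using A by auto
        have "(LINT x:{s i..t i}|lebesgue. ?D x) = ?E i"
          by (rule lebesgue_integral_interval_ends[OF square_vderiv_measurable[OF gH], of _ _ "s i" "t i"]) (use st in auto)
        then have "(g m (t i) - g m (s i))\<^sup>2 \<le> (t i - s i) * ?E i"
          using H1_increment_square[OF gH st] by simp
        moreover have "0 \<le> ?E i" unfolding set_lebesgue_integral_def by (intro integral_nonneg_AE) auto
        ultimately show "norm (g m (t i) - g m (s i)) \<le> \<eta> * ?E i + (t i - s i) / (4 * \<eta>)"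
          using st \<eta> by (simp only: real_norm_def) (intro abs_le_of_square_le, auto)
      qed
      also have "\<dots> = \<eta> * (\<Sum>i<n. ?E i) + (\<Sum>i<n. t i - s i) / (4 * \<eta>)"
        by (simp only: sum.distrib sum_distrib_left sum_divide_distrib)
      also have "(\<Sum>i<n. ?E i) \<le> real k * B"
      proof (cases "p \<le> q")
        case True
        have "(\<Sum>i<n. ?E i) = (LINT x|lebesgue. (\<Sum>i<n. indicator {s i<..<t i} x *\<^sub>R ?D x))"
          unfolding set_lebesgue_integral_def by (rule Bochner_Integration.integral_sum[symmetric]) (rule iE)
        also have "\<dots> \<le> (LINT x|lebesgue. indicator {p..<q} x *\<^sub>R ?D x)"
        proof (rule integral_mono_AE)
          show "integrable lebesgue (\<lambda>x. \<Sum>i<n. indicator {s i<..<t i} x *\<^sub>R ?D x)"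
            by (intro Bochner_Integration.integrable_sum iE)
          show "integrable lebesgue (\<lambda>x. indicator {p..<q} x *\<^sub>R ?D x)"
          proof -
            have "set_integrable lebesgue {p..<q} ?D"
              by (rule set_integrable_subset[OF L2_loc_square[OF H1_vderiv_L2[OF gH], of p q]]) auto
            then show ?thesis by (simp only: set_integrable_def)
          qed
          show "AE x in lebesgue. (\<Sum>i<n. indicator {s i<..<t i} x *\<^sub>R ?D x) \<le> indicator {p..<q} x *\<^sub>R ?D x"
          proof (rule AE_I2)
            fix x
            have "(\<Sum>i<n. indicator {s i<..<t i} x :: real) = indicator (\<Union>i<n. {s i<..<t i}) x"
              using A by (subst indicator_UN_disjoint) auto
            also have "\<dots> \<le> indicator {p..<q} x"
            proof -
              have "(\<Union>i<n. {s i<..<t i}) \<subseteq> {p..<q}" using A by fastforce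
              then show ?thesis by (rule indicator_mono_real)
            qed
            finally have "(\<Sum>i<n. indicator {s i<..<t i} x) * ?D x \<le> indicator {p..<q} x * ?D x"
              by (rule mult_right_mono) simp
            then show "(\<Sum>i<n. indicator {s i<..<t i} x *\<^sub>R ?D x) \<le> indicator {p..<q} x *\<^sub>R ?D x"
              by (simp only: real_scaleR_def sum_distrib_right)
          qed
        qed
        also have "\<dots> = cumulative (g m) q - cumulative (g m) p"
          using cumulative_diff[OF gH True] by (simp add: set_lebesgue_integral_def)
        also have "\<dots> \<le> real k * dirichlet (g m)" by (rule cumulative_bound[OF g k'])
        also have "\<dots> \<le> real k * B" using B by (intro mult_left_mono) auto
        finally show ?thesis .
      next
        case False
        \<comment> \<open>With q < p no interval can satisfy the constraints, so the system is
          empty.\<close>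
        then have "n = 0" using A by (metis gr0I order.trans)
        moreover have "0 \<le> B" using B[of m] energy_ge_deriv(2)[OF gH] by linarith
        ultimately show ?thesis by simp
      qed
      also have "\<eta> * (real k * B) \<le> e / 4"
      proof -
        have "real k * B \<le> real k * \<bar>B\<bar>" by (intro mult_left_mono) auto
        then have "\<eta> * (real k * B) \<le> \<eta> * B'" using \<eta> by (intro mult_left_mono) (auto simp: B'_def)
        also have "\<dots> = e / 4" using B' by (simp add: \<eta>_def)
        finally show ?thesis .
      qed
      also have "(\<Sum>i<n. t i - s i) / (4 * \<eta>) \<le> e / 4"
      proof -
        have "(\<Sum>i<n. t i - s i) \<le> e * \<eta>" using A by linarith
        then show ?thesis using \<eta> by (simp add: divide_le_eq)
      qed
      finally show ?thesis using \<eta> by simp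
    qed
    have "(\<lambda>m. \<Sum>i<n. norm (g m (t i) - g m (s i))) \<longlonglongrightarrow> (\<Sum>i<n. norm (G (t i) - G (s i)))"
      by (intro tendsto_intros lim)
    then have "(\<Sum>i<n. norm (G (t i) - G (s i))) \<le> e / 2"
      by (rule tendsto_upperbound) (intro always_eventually allI bound | simp)+
    then show "(\<Sum>i<n. norm (G (t i) - G (s i))) < e" using e by simp
  qed (use e \<eta> in simp)
qed

text \<open>Energy estimates control a single period, whereas \<open>L2_loc\<close> refers to all
  bounded intervals; finitely many cells cover such an interval.\<close>

lemma set_integrable_of_period:
  fixes F :: "real \<Rightarrow> real"
  assumes F: "set_integrable lebesgue I0 F" and m: "F \<in> borel_measurable lebesgue"
    and per: "\<And>k::int. AE x in lebesgue. F (x + of_int k * l) = F x"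
  shows "set_integrable lebesgue {p..q} F"
proof -
  let ?C = "\<lambda>k::int. {a + of_int k * l..<a + of_int k * l + l}"
  have C: "set_integrable lebesgue (?C k) F" for k
  proof -
    have "integrable lebesgue (\<lambda>x. indicator (?C k) (x + of_int k * l) *\<^sub>R F (x + of_int k * l))"
    proof (rule integrable_cong_AE[THEN iffD2])
      show "integrable lebesgue (\<lambda>x. indicator I0 x *\<^sub>R F x)" using F by (simp add: set_integrable_def)
      then show "(\<lambda>x. indicator I0 x *\<^sub>R F x) \<in> borel_measurable lebesgue" by simp
      have "(\<lambda>x. indicator (?C k) x *\<^sub>R F x) \<in> borel_measurable lebesgue"
        by (intro borel_measurable_scaleR borel_measurable_indicator m) simp
      then show "(\<lambda>x. indicator (?C k) (x + of_int k * l) *\<^sub>R F (x + of_int k * l)) \<in> borel_measurable lebesgue"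
        by (rule measurable_compose[OF lebesgue_shift_measurable])
      show "AE x in lebesgue. indicator (?C k) (x + of_int k * l) *\<^sub>R F (x + of_int k * l) = indicator I0 x *\<^sub>R F x"
        using per[of k] by eventually_elim (auto simp: indicator_def)
    qed
    then show ?thesis
      using lebesgue_integrable_shift[of "\<lambda>x. indicator (?C k) x *\<^sub>R F x" "of_int k * l"] by (simp add: set_integrable_def)
  qed
  let ?K = "{\<lfloor>(p - a) / l\<rfloor>..\<lfloor>(q - a) / l\<rfloor>}"
  have "set_integrable lebesgue (\<Union>k\<in>?K. ?C k) F"
    by (rule set_integrable_UN) (auto intro: C)
  then show ?thesis
  proof (rule set_integrable_subset)
    show "{p..q} \<subseteq> (\<Union>k\<in>?K. ?C k)"
    proof
      fix x assume x: "x \<in> {p..q}"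
      define j where "j = \<lfloor>(x - a) / l\<rfloor>"
      have "of_int j \<le> (x - a) / l" "(x - a) / l < of_int j + 1" unfolding j_def by linarith+
      then have "x \<in> ?C j" using l by (simp add: le_divide_eq divide_less_eq algebra_simps)
      moreover have "j \<in> ?K" unfolding j_def using x l by (auto intro!: floor_mono divide_right_mono)
      ultimately show "x \<in> (\<Union>k\<in>?K. ?C k)" by blast
    qed
  qed simp
qed

text \<open>Two applications of the Fatou lemma replace weak compactness. For a fixed step, the
  difference quotients of \<open>g m\<close> converge pointwise, and with the zeroth-order term
  their integral is bounded by the energy of \<open>g m\<close>; this bounds the difference
  quotients of \<open>G\<close>. As \<open>G\<close> is absolutely continuous, these tend to its
  derivative almost everywhere when the step tends to 0.\<close>

lemma energy_lsc:
  assumes g: "\<And>m::nat. g m \<in> P" and B: "\<And>m. energy_form (g m) (g m) \<le> B" and lim: "\<And>x. (\<lambda>m. g m x) \<longlonglongrightarrow> G x"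
  shows "G \<in> P" "energy_form G G \<le> B"
proof -
  have gH: "g m \<in> H1_loc" for m using g by (rule P_H1)
  have "dirichlet (g m) \<le> B" for m using energy_ge_deriv(1)[OF gH, of m] B[of m] by linarith
  then have AC: "G \<in> AC_loc" by (rule AC_of_bounded_limit[OF g _ lim])
  have cG: "continuous_on UNIV G" using AC by (rule AC_loc_continuous)
  have Gs: "G (x + l) = s * G x" for x
  proof -
    have "g m (x + l) = s * g m x" for m using g[of m] by (simp add: P_def)
    then have "(\<lambda>m. g m (x + l)) \<longlonglongrightarrow> s * G x" using tendsto_mult_left[OF lim[of x], of s] by simp
    then show ?thesis using lim[of "x + l"] LIMSEQ_unique by blast
  qed
  \<comment> \<open>Steps that tend to 0 without ever exceeding a period, as the contraction
    estimate demands.\<close>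
  define d where "d k = l * inverse (real (Suc k))" for k
  have d: "0 < d k" "d k \<le> l" for k
  proof -
    show "0 < d k" using l by (simp add: d_def)
    have "inverse (real (Suc k)) \<le> 1" by (simp add: inverse_le_1_iff)
    then show "d k \<le> l" unfolding d_def using l mult_left_mono[of "inverse (real (Suc k))" 1 l] by simp
  qed
  have d0: "d \<longlonglongrightarrow> 0" unfolding d_def using tendsto_mult_right_zero[OF LIMSEQ_inverse_real_of_nat] .
  let ?w = "\<lambda>f k x. ((f (x + d k) - f x) / d k)\<^sup>2 + 1/4 * (f x)\<^sup>2"
  have wL: "?w f k \<in> borel_measurable lebesgue" if "continuous_on UNIV f" for f :: "real \<Rightarrow> real" and k
  proof (intro borel_imp_lebesgue_measurable borel_measurable_continuous_onI)
    have "continuous_on UNIV (\<lambda>x. f (x + d k))"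
      by (rule continuous_on_compose2[OF that]) (auto intro!: continuous_intros)
    then show "continuous_on UNIV (?w f k)" using that d(1)[of k] by (intro continuous_intros) auto
  qed
  have w_le: "set_integrable lebesgue I0 (?w (g m) k)" "(LINT x:I0|lebesgue. ?w (g m) k x) \<le> B" for m k
  proof -
    have i1: "set_integrable lebesgue I0 (\<lambda>x. (g m (x + d k) - g m x)\<^sup>2)"
      by (intro I0_integrable L2_loc_square H1_L2 H1_diff H1_shift gH)
    have i2: "set_integrable lebesgue I0 (\<lambda>x. 1/4 * (g m x)\<^sup>2)"
      by (intro set_integrable_mult_right I0_integrable L2_loc_square H1_L2 gH)
    have eq: "?w (g m) k = (\<lambda>x. 1 / (d k)\<^sup>2 * (g m (x + d k) - g m x)\<^sup>2 + 1/4 * (g m x)\<^sup>2)"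
      by (simp add: power_divide)
    have i1': "set_integrable lebesgue I0 (\<lambda>x. 1 / (d k)\<^sup>2 * (g m (x + d k) - g m x)\<^sup>2)"
      by (rule set_integrable_mult_right) (rule i1)
    show "set_integrable lebesgue I0 (?w (g m) k)" unfolding eq by (rule set_integral_add(1)[OF i1' i2])
    have i3: "set_integrable lebesgue I0 (\<lambda>x. (vderiv (g m) x)\<^sup>2)"
      by (intro I0_integrable L2_loc_square H1_vderiv_L2 gH)
    have "(LINT x:I0|lebesgue. ?w (g m) k x) = 1 / (d k)\<^sup>2 * (LINT x:I0|lebesgue. (g m (x + d k) - g m x)\<^sup>2) + (LINT x:I0|lebesgue. 1/4 * (g m x)\<^sup>2)"
      unfolding eq by (simp only: set_integral_add(2)[OF i1' i2] set_integral_mult_right)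
    also have "\<dots> \<le> 1 / (d k)\<^sup>2 * ((d k)\<^sup>2 * dirichlet (g m)) + (LINT x:I0|lebesgue. 1/4 * (g m x)\<^sup>2)"
      by (intro add_right_mono mult_left_mono difference_quotient_contraction g d) auto
    also have "\<dots> = dirichlet (g m) + (LINT x:I0|lebesgue. 1/4 * (g m x)\<^sup>2)"
      using d(1)[of k] by simp
    also have "\<dots> = energy_form (g m) (g m)"
      unfolding energy_form_def set_integral_add(2)[OF i3 i2, symmetric] by (simp only: power2_eq_square)
    also have "\<dots> \<le> B" by (rule B)
    finally show "(LINT x:I0|lebesgue. ?w (g m) k x) \<le> B" .
  qed
  have GB: "set_integrable lebesgue I0 (?w G k)" "(LINT x:I0|lebesgue. ?w G k x) \<le> B" for k
  proof -
    have l: "AE x in lebesgue. (\<lambda>m. ?w (g m) k x) \<longlonglongrightarrow> ?w G k x"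
      using d(1)[of k] by (intro AE_I2 tendsto_intros lim) auto
    show "set_integrable lebesgue I0 (?w G k)" "(LINT x:I0|lebesgue. ?w G k x) \<le> B"
      by (rule set_integral_Fatou[OF _ wL[OF H1_loc_continuous[OF gH]] _ w_le wL[OF cG] _ l]; simp)+
  qed
  let ?v = "\<lambda>x. (vderiv G x)\<^sup>2 + 1/4 * (G x)\<^sup>2"
  have vm: "vderiv G \<in> borel_measurable lebesgue" by (rule AC_loc_vderiv_measurable[OF AC])
  have vvm: "?v \<in> borel_measurable lebesgue"
    using vm L2_loc_measurable[OF continuous_L2_loc[OF cG]] by measurable
  have vl: "AE x in lebesgue. (\<lambda>k. ?w G k x) \<longlonglongrightarrow> ?v x"
    using AC_loc_AE_differentiable[OF AC]
  proof eventually_elim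
    case (elim x)
    have "filterlim d (at 0) sequentially"
      using d0 d(1) by (intro filterlim_atI) (auto simp: less_imp_neq[symmetric] intro!: always_eventually less_imp_neq[THEN not_sym])
    then have "(\<lambda>k. (G (x + d k) - G x) / d k) \<longlonglongrightarrow> vderiv G x"
      using elim unfolding DERIV_def by (rule filterlim_compose[rotated])
    then show ?case by (intro tendsto_intros)
  qed
  have vI: "set_integrable lebesgue I0 ?v" "(LINT x:I0|lebesgue. ?v x) \<le> B"
    by (rule set_integral_Fatou[OF _ wL[OF cG] _ GB vvm _ vl]; simp)+
  then show "energy_form G G \<le> B" unfolding energy_form_def by (simp only: power2_eq_square)
  have v2m: "(\<lambda>x. (vderiv G x)\<^sup>2) \<in> borel_measurable lebesgue" using vm by measurable
  have v2: "set_integrable lebesgue I0 (\<lambda>x. (vderiv G x)\<^sup>2)"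
    by (rule set_integrable_dominated[OF vI(1) v2m]) auto
  have "vderiv G \<in> L2_loc"
    unfolding L2_loc_def
  proof (intro CollectI conjI allI vm set_integrable_of_period v2 v2m)
    fix k :: int
    show "AE x in lebesgue. (vderiv G (x + of_int k * l))\<^sup>2 = (vderiv G x)\<^sup>2"
      using AC_loc_AE_differentiable[OF AC]
    proof eventually_elim
      case (elim x)
      have "vderiv G (x + of_int k * l) = vderiv (\<lambda>x. sgpow s k * G x) x"
        using vderiv_shift[of G "of_int k * l" x] shift_int[of G, OF Gs] by simp
      also have "\<dots> = sgpow s k * vderiv G x" by (intro vderiv_eqI DERIV_cmult elim)
      finally show ?case using s by (auto simp: sgpow_def)
    qed
  qed
  then have "G \<in> H1_loc" using AC by (simp add: H1_real_iff)
  then show "G \<in> P" using Gs by (simp add: P_def)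
qed


section \<open>Nonnegative forms, null vectors and minimising sequences\<close>

lemma form_zero: "h \<in> H1_loc \<Longrightarrow> form z (\<lambda>_. 0) h = 0"
  using form_add_cmult[OF H1_const[of 0] H1_const[of 0], of h z 1] by simp

lemma form_cmult_square:
  assumes f: "f \<in> H1_loc"
  shows "form z (\<lambda>x. c * f x) (\<lambda>x. c * f x) = c\<^sup>2 * form z f f"
  using form_square[OF H1_const[of 0] f, of z c] form_zero[OF H1_const[of 0]] form_zero[OF f] by simp

lemma energy_cmult_square:
  assumes f: "f \<in> H1_loc"
  shows "energy_form (\<lambda>x. c * f x) (\<lambda>x. c * f x) = c\<^sup>2 * energy_form f f"
proof -
  have H: "(\<lambda>x. c * f x) \<in> H1_loc" by (rule H1_cmult(1)[OF f])
  show ?thesis unfolding energy_eq_form[OF H H] energy_eq_form[OF f f] by (rule form_cmult_square[OF f])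
qed

lemma P_add_cmult: "f \<in> P \<Longrightarrow> g \<in> P \<Longrightarrow> (\<lambda>x. f x + c * g x) \<in> P"
  by (auto simp: P_def algebra_simps intro!: H1_add(1) H1_cmult(1))

lemma P_cmult: "f \<in> P \<Longrightarrow> (\<lambda>x. c * f x) \<in> P"
  by (auto simp: P_def algebra_simps intro!: H1_cmult(1))

text \<open>The parallelogram law. The choice of c as 1 or -1 selects the square to be bounded, the
  other one being nonnegative.\<close>

lemma form_sum_le:
  assumes f: "f \<in> H1_loc" and g: "g \<in> H1_loc" and c: "c\<^sup>2 = 1"
    and nn: "0 \<le> form z (\<lambda>x. f x + (- c) * g x) (\<lambda>x. f x + (- c) * g x)"
  shows "form z (\<lambda>x. f x + c * g x) (\<lambda>x. f x + c * g x) \<le> 2 * form z f f + 2 * form z g g"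
  using nn unfolding form_square[OF f g] by (simp add: c)

lemma energy_sum_le:
  assumes f: "f \<in> H1_loc" and g: "g \<in> H1_loc" and c: "c\<^sup>2 = 1"
  shows "energy_form (\<lambda>x. f x + c * g x) (\<lambda>x. f x + c * g x) \<le> 2 * energy_form f f + 2 * energy_form g g"
proof -
  have H: "(\<lambda>x. f x + c * g x) \<in> H1_loc" for c by (intro H1_add H1_cmult f g)
  show ?thesis
    using form_sum_le[OF f g c, of 0] energy_nonneg[OF H] by (simp only: energy_eq_form[OF H H] energy_eq_form[OF f f] energy_eq_form[OF g g])
qed

text \<open>Along the line f + c h the form is the polynomial 2 c b + c^2 q in c; being nonnegative
  without a constant term, it has no linear term either.\<close>

lemma form_null_orthogonal:
  assumes f: "f \<in> P" and h: "h \<in> P" and nn: "\<And>h. h \<in> P \<Longrightarrow> 0 \<le> form z h h" and null: "form z f f = 0"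
  shows "form z f h = 0"
proof -
  define b q where "b = form z f h" and "q = form z h h"
  have q: "q \<ge> 0" using nn[OF h] by (simp add: q_def)
  have "0 \<le> form z (\<lambda>x. f x + c * h x) (\<lambda>x. f x + c * h x)" for c by (intro nn P_add_cmult f h)
  then have *: "0 \<le> 2 * c * b + c\<^sup>2 * q" for c
    unfolding form_square[OF P_H1[OF f] P_H1[OF h]] null b_def q_def by simp
  \<comment> \<open>Evaluating at c = -b / (q + 1) avoids a division by \<open>q\<close>, which may
    be 0.\<close>
  define w where "w = q + 1"
  have w: "w > 0" using q by (simp add: w_def)
  have "0 \<le> w\<^sup>2 * (2 * (- b / w) * b + (- b / w)\<^sup>2 * q)" by (intro mult_nonneg_nonneg * zero_le_power2)
  also have "\<dots> = b\<^sup>2 * q - 2 * b\<^sup>2 * w" using w by (simp add: field_simps power2_eq_square)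
  finally have "b\<^sup>2 * (q + 2) \<le> 0" by (simp add: w_def algebra_simps)
  then have "b\<^sup>2 = 0" using q by (simp add: mult_le_0_iff)
  then show ?thesis by (simp add: b_def)
qed

lemma P_bound:
  assumes "h \<in> P"
  shows "\<bar>h x\<bar> \<le> sqrt (Csob * energy_form h h)"
  using real_sqrt_le_mono[OF sobolev_P[OF assms, of x]] by simp

lemma energy_from_form:
  assumes h: "h \<in> H1_loc"
  shows "energy_form h h = form (-t) h h - t * omega_form h h + t\<^sup>2 * upsilon_form h h"
  using form_eq[OF h h, of "-t"] by simp

text \<open>For differences of members of a uniformly convergent subsequence, the form is small by
  the parallelogram law, and the \<omega> and \<upsilon> parts are small because the sup norm is. So
  the energy of the differences is small as well: the subsequence converges in energy, and the
  normalisation to energy 1 keeps the limit away from 0.\<close>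

lemma minimizing_limit:
  assumes t: "t \<ge> 0" and nn: "\<And>h. h \<in> P \<Longrightarrow> 0 \<le> form (-t) h h"
    and h: "\<And>n::nat. h n \<in> P" "\<And>n. energy_form (h n) (h n) = 1" and q0: "(\<lambda>n. form (-t) (h n) (h n)) \<longlonglongrightarrow> 0"
  obtains f where "f \<in> P" "f \<noteq> (\<lambda>_. 0)" "\<And>h. h \<in> P \<Longrightarrow> form (-t) f h = 0"
proof -
  have hH: "h n \<in> H1_loc" for n using h(1) by (rule P_H1)
  have hb: "\<bar>h n x\<bar> \<le> sqrt Csob" for n x using P_bound[OF h(1), of n x] h(2) by simp
  \<comment> \<open>Hoelder continuity of exponent 1/2 with constant 1, since one period carries
    Dirichlet energy at most 1.\<close>
  have hc: "(h n y - h n x)\<^sup>2 \<le> y - x" if "x \<le> y" "y \<le> x + l" for n x y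
  proof -
    have "cumulative (h n) y - cumulative (h n) x \<le> real 1 * dirichlet (h n)"
      by (rule cumulative_bound[OF h(1)]) (use that in simp)
    also have "\<dots> \<le> 1" using energy_ge_deriv(1)[OF hH, of n] h(2) by simp
    finally have "(y - x) * (cumulative (h n) y - cumulative (h n) x) \<le> (y - x) * 1"
      using that by (intro mult_left_mono) auto
    then show ?thesis using cumulative_increment_square[OF hH that(1), of n] by simp
  qed
  have equi: "\<bar>h n x - h n y\<bar> < e" if "x \<in> {a..a + l}" "y \<in> {a..a + l}" "\<bar>x - y\<bar> < e\<^sup>2" "e > 0" for n x y e
  proof -
    have "(h n x - h n y)\<^sup>2 \<le> \<bar>x - y\<bar>"
      using hc[of x y n] hc[of y x n] that by (cases "x \<le> y") (auto simp: power2_commute)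
    also have "\<dots> < e\<^sup>2" by (rule that)
    finally have "\<bar>h n x - h n y\<bar>\<^sup>2 < e\<^sup>2" by simp
    then show ?thesis by (rule power2_less_imp_less) (use that(4) in simp)
  qed
  obtain g k where k: "strict_mono (k :: nat \<Rightarrow> nat)"
    and unif: "\<And>e. 0 < e \<Longrightarrow> \<exists>N. \<forall>n x. n \<ge> N \<and> x \<in> {a..a + l} \<longrightarrow> norm (h (k n) x - g x) < e"
  proof (rule Arzela_Ascoli[of "{a..a + l}" h "sqrt Csob"])
    show "\<exists>d>0. \<forall>n y. y \<in> {a..a + l} \<and> norm (x - y) < d \<longrightarrow> norm (h n x - h n y) < e"
      if "x \<in> {a..a + l}" "0 < e" for x e
    proof (intro exI[of _ "e\<^sup>2"] conjI allI impI)
      show "0 < e\<^sup>2" using that by simp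
      show "norm (h n x - h n y) < e" if "y \<in> {a..a + l} \<and> norm (x - y) < e\<^sup>2" for n y
        using equi[of x y e n] that \<open>x \<in> {a..a + l}\<close> \<open>0 < e\<close> by simp
    qed
  qed (use hb in auto)
  \<comment> \<open>Arzela-Ascoli provides the limit on one period; elsewhere convergence is
    inherited through the translation rule of \<open>P\<close>.\<close>
  define f where "f x = lim (\<lambda>n. h (k n) x)" for x
  have lim: "(\<lambda>n. h (k n) x) \<longlonglongrightarrow> f x" for x
  proof -
    obtain j where j: "x + of_int j * l \<in> I0" by (rule shift_to_I0)
    have "(\<lambda>n. h (k n) (x + of_int j * l)) \<longlonglongrightarrow> g (x + of_int j * l)"
    proof (rule LIMSEQ_I)
      fix r :: real assume "0 < r"
      obtain N where N: "\<forall>n x. n \<ge> N \<and> x \<in> {a..a + l} \<longrightarrow> norm (h (k n) x - g x) < r"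
        using unif[OF \<open>0 < r\<close>] by blast
      have "x + of_int j * l \<in> {a..a + l}" using j by simp
      then show "\<exists>no. \<forall>n\<ge>no. norm (h (k n) (x + of_int j * l) - g (x + of_int j * l)) < r"
        using N by blast
    qed
    then have "(\<lambda>n. sgpow s j * h (k n) (x + of_int j * l)) \<longlonglongrightarrow> sgpow s j * g (x + of_int j * l)"
      by (intro tendsto_intros)
    moreover have "sgpow s j * h (k n) (x + of_int j * l) = h (k n) x" for n
      by (simp only: P_shift[OF h(1)] sgpow_mult_self)
    ultimately have "(\<lambda>n. h (k n) x) \<longlonglongrightarrow> sgpow s j * g (x + of_int j * l)" by simp
    then show ?thesis unfolding f_def by (metis limI)
  qed
  define U1 U2 V1 where "U1 = (LINT x:I0|lebesgue. \<bar>u x\<bar>)" and "U2 = (LINT x:I0|lebesgue. (vderiv u x)\<^sup>2)"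
    and "V1 = (LINT x:I0|\<upsilon>. 1::real)"
  let ?d = "\<lambda>m n x. h (k m) x + (-1) * h (k n) x"
  have dP: "?d m n \<in> P" for m n by (intro P_add_cmult h)
  have cauchy: "\<exists>N. \<forall>m\<ge>N. \<forall>n\<ge>N. energy_form (?d m n) (?d m n) \<le> \<epsilon>" if \<epsilon>: "\<epsilon> > 0" for \<epsilon>
  proof -
    have "((\<lambda>e. t * (e\<^sup>2 * U1 + 2 * e * (U2 + 4)) + t\<^sup>2 * (e\<^sup>2 * V1)) \<longlongrightarrow> t * (0\<^sup>2 * U1 + 2 * 0 * (U2 + 4)) + t\<^sup>2 * (0\<^sup>2 * V1)) (at_right 0)"
      by (intro tendsto_intros)
    then have "eventually (\<lambda>e. t * (e\<^sup>2 * U1 + 2 * e * (U2 + 4)) + t\<^sup>2 * (e\<^sup>2 * V1) < \<epsilon> / 2) (at_right 0)"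
      using \<epsilon> by (intro order_tendstoD(2)) auto
    then have "eventually (\<lambda>e. t * (e\<^sup>2 * U1 + 2 * e * (U2 + 4)) + t\<^sup>2 * (e\<^sup>2 * V1) < \<epsilon> / 2 \<and> 0 < e) (at_right 0)"
      using eventually_at_right_less by (rule eventually_conj)
    then obtain e where e: "t * (e\<^sup>2 * U1 + 2 * e * (U2 + 4)) + t\<^sup>2 * (e\<^sup>2 * V1) < \<epsilon> / 2" "e > 0"
      using eventually_happens'[OF trivial_limit_at_right_real] by blast
    obtain N1 where N1: "\<And>n x. n \<ge> N1 \<Longrightarrow> x \<in> {a..a + l} \<Longrightarrow> \<bar>h (k n) x - g x\<bar> < e / 2"
      using unif[of "e / 2"] e(2) by auto
    have "(\<lambda>n. form (-t) (h (k n)) (h (k n))) \<longlonglongrightarrow> 0"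
      using LIMSEQ_subseq_LIMSEQ[OF q0 k] by (simp add: o_def)
    then have "eventually (\<lambda>n. form (-t) (h (k n)) (h (k n)) < \<epsilon> / 8) sequentially"
      using \<epsilon> by (intro order_tendstoD(2)) auto
    then obtain N2 where N2: "\<And>n. n \<ge> N2 \<Longrightarrow> form (-t) (h (k n)) (h (k n)) < \<epsilon> / 8"
      unfolding eventually_sequentially by blast
    show ?thesis
    proof (intro exI[of _ "max N1 N2"] allI impI)
      fix m n assume mn: "max N1 N2 \<le> m" "max N1 N2 \<le> n"
      have dH: "?d m n \<in> H1_loc" using dP by (rule P_H1)
      have de: "\<bar>?d m n x\<bar> \<le> e" if "x \<in> I0" for x
      proof -
        have "\<bar>h (k m) x - g x\<bar> < e / 2" "\<bar>h (k n) x - g x\<bar> < e / 2" using N1[of m x] N1[of n x] mn that by auto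
        then show ?thesis by (simp only: abs_less_iff abs_le_iff) linarith
      qed
      \<comment> \<open>The parallelogram bound for two functions of energy 1.\<close>
      have N4: "energy_form (?d m n) (?d m n) \<le> 4"
        using energy_sum_le[OF hH[of "k m"] hH[of "k n"], of "-1"] h(2) by simp
      have K: "\<bar>omega_form (?d m n) (?d m n)\<bar> \<le> e\<^sup>2 * U1 + 2 * e * (U2 + 4)"
      proof -
        have "\<bar>omega_form (?d m n) (?d m n)\<bar> \<le> e\<^sup>2 * U1 + 2 * e * (U2 + energy_form (?d m n) (?d m n))"
          unfolding U1_def U2_def by (rule omega_form_bound[OF dH _ de]) (use e in simp)
        also have "\<dots> \<le> e\<^sup>2 * U1 + 2 * e * (U2 + 4)"
          using N4 e by (intro add_left_mono mult_left_mono) auto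
        finally show ?thesis .
      qed
      have V: "upsilon_form (?d m n) (?d m n) \<le> e\<^sup>2 * V1"
        unfolding V1_def by (rule upsilon_form_bound(2)[OF dH _ de]) (use e in simp)
      have Q: "form (-t) (?d m n) (?d m n) \<le> \<epsilon> / 2"
      proof -
        have "form (-t) (?d m n) (?d m n) \<le> 2 * form (-t) (h (k m)) (h (k m)) + 2 * form (-t) (h (k n)) (h (k n))"
          by (rule form_sum_le[OF hH hH _ nn[OF P_add_cmult[OF h(1) h(1)]]]) simp
        also have "\<dots> \<le> \<epsilon> / 2" using N2[of m] N2[of n] mn by simp
        finally show ?thesis .
      qed
      have "energy_form (?d m n) (?d m n) = form (-t) (?d m n) (?d m n) - t * omega_form (?d m n) (?d m n) + t\<^sup>2 * upsilon_form (?d m n) (?d m n)"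
        by (rule energy_from_form[OF dH])
      also have "\<dots> \<le> \<epsilon> / 2 + t * (e\<^sup>2 * U1 + 2 * e * (U2 + 4)) + t\<^sup>2 * (e\<^sup>2 * V1)"
      proof -
        have "- (t * omega_form (?d m n) (?d m n)) = t * (- omega_form (?d m n) (?d m n))" by simp
        also have "\<dots> \<le> t * (e\<^sup>2 * U1 + 2 * e * (U2 + 4))" using K t by (intro mult_left_mono) auto
        finally have 1: "- (t * omega_form (?d m n) (?d m n)) \<le> t * (e\<^sup>2 * U1 + 2 * e * (U2 + 4))" .
        have 2: "t\<^sup>2 * upsilon_form (?d m n) (?d m n) \<le> t\<^sup>2 * (e\<^sup>2 * V1)" using V by (intro mult_left_mono) auto
        show ?thesis using 1 2 Q by linarith
      qed
      also have "\<dots> \<le> \<epsilon>" using e(1) by linarith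
      finally show "energy_form (?d m n) (?d m n) \<le> \<epsilon>" .
    qed
  qed
  let ?D = "\<lambda>n x. f x + (-1) * h (k n) x"
  \<comment> \<open>Lower semicontinuity in the first index turns the Cauchy property into
    convergence in energy, and shows at the same time that the difference belongs to
    \<open>P\<close>.\<close>
  have D: "\<exists>N. \<forall>n\<ge>N. ?D n \<in> P \<and> energy_form (?D n) (?D n) \<le> \<epsilon>" if \<epsilon>: "\<epsilon> > 0" for \<epsilon>
  proof -
    obtain N where N: "\<And>m n. m \<ge> N \<Longrightarrow> n \<ge> N \<Longrightarrow> energy_form (?d m n) (?d m n) \<le> \<epsilon>" using cauchy[OF \<epsilon>] by blast
    have "?D n \<in> P \<and> energy_form (?D n) (?D n) \<le> \<epsilon>" if n: "n \<ge> N" for n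
    proof -
      have l: "(\<lambda>m. ?d (m + N) n x) \<longlonglongrightarrow> ?D n x" for x
        by (intro tendsto_intros LIMSEQ_ignore_initial_segment[OF lim])
      have b: "energy_form (?d (m + N) n) (?d (m + N) n) \<le> \<epsilon>" for m by (rule N) (use n in auto)
      show ?thesis using energy_lsc[of "\<lambda>m. ?d (m + N) n", OF dP b l] by blast
    qed
    then show ?thesis by blast
  qed
  obtain N where N: "?D N \<in> P" using D[of 1] by auto
  have "(\<lambda>x. ?D N x + 1 * h (k N) x) \<in> P" by (rule P_add_cmult[OF N h(1)])
  then have fP: "f \<in> P" by simp
  have DP: "?D n \<in> P" for n by (rule P_add_cmult[OF fP h(1)])
  have DH: "?D n \<in> H1_loc" for n using DP by (rule P_H1)
  have ND: "(\<lambda>n. energy_form (?D n) (?D n)) \<longlonglongrightarrow> 0"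
  proof (rule LIMSEQ_I)
    fix r :: real assume "r > 0"
    then obtain N where "\<forall>n\<ge>N. energy_form (?D n) (?D n) \<le> r / 2" using D[of "r / 2"] by auto
    then show "\<exists>no. \<forall>n\<ge>no. norm (energy_form (?D n) (?D n) - 0) < r"
      using \<open>r > 0\<close> energy_nonneg[OF DH] by (intro exI[of _ N]) fastforce
  qed
  have nz: "f \<noteq> (\<lambda>_. 0)"
  proof
    assume f0: "f = (\<lambda>_. 0)"
    have "1 \<le> energy_form (?D n) (?D n)" for n
    proof -
      have "?D n = (\<lambda>x. (-1) * h (k n) x)" by (simp add: f0)
      then have "energy_form (?D n) (?D n) = (-1)\<^sup>2 * energy_form (h (k n)) (h (k n))"
        by (simp only: energy_cmult_square[OF hH])
      then show ?thesis using h(2) by simp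
    qed
    then have "(1::real) \<le> 0" by (intro LIMSEQ_le_const[OF ND]) blast
    then show False by simp
  qed
  have null: "form (-t) f f = 0"
  proof -
    let ?M = "\<lambda>n. sqrt (Csob * energy_form (?D n) (?D n))"
    \<comment> \<open>An upper bound of the form in terms of the energy alone: the \<upsilon> part
      enters with a favourable sign and is dropped, and the sup norm in the \<omega> part is
      estimated by the Sobolev inequality.\<close>
    let ?R = "\<lambda>n. energy_form (?D n) (?D n) + t * ((?M n)\<^sup>2 * U1 + 2 * ?M n * (U2 + energy_form (?D n) (?D n)))"
    have QD: "form (-t) (?D n) (?D n) \<le> ?R n" for n
    proof -
      have "\<bar>omega_form (?D n) (?D n)\<bar> \<le> (?M n)\<^sup>2 * U1 + 2 * ?M n * (U2 + energy_form (?D n) (?D n))"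
        unfolding U1_def U2_def
        by (rule omega_form_bound[OF DH _ P_bound[OF DP]]) (use Csob_pos(1) energy_nonneg[OF DH] in simp)
      then have "t * omega_form (?D n) (?D n) \<le> t * ((?M n)\<^sup>2 * U1 + 2 * ?M n * (U2 + energy_form (?D n) (?D n)))"
        using t by (intro mult_left_mono) auto
      moreover have "0 \<le> t\<^sup>2 * upsilon_form (?D n) (?D n)"
        using upsilon_form_bound(1)[OF DH _ P_bound[OF DP]] Csob_pos(1) energy_nonneg[OF DH] by simp
      ultimately show ?thesis using energy_from_form[OF DH, of n t] by linarith
    qed
    have "(\<lambda>n. 2 * ?R n + 2 * form (-t) (h (k n)) (h (k n))) \<longlonglongrightarrow>
        2 * (0 + t * ((sqrt (Csob * 0))\<^sup>2 * U1 + 2 * sqrt (Csob * 0) * (U2 + 0))) + 2 * 0"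
      using LIMSEQ_subseq_LIMSEQ[OF q0 k] unfolding o_def by (intro tendsto_intros ND)
    then have L: "(\<lambda>n. 2 * ?R n + 2 * form (-t) (h (k n)) (h (k n))) \<longlonglongrightarrow> 0" by simp
    have "form (-t) f f \<le> 2 * ?R n + 2 * form (-t) (h (k n)) (h (k n))" for n
    proof -
      have "(\<lambda>x. ?D n x + 1 * h (k n) x) = f" by auto
      moreover have "form (-t) (\<lambda>x. ?D n x + 1 * h (k n) x) (\<lambda>x. ?D n x + 1 * h (k n) x)
          \<le> 2 * form (-t) (?D n) (?D n) + 2 * form (-t) (h (k n)) (h (k n))"
        by (rule form_sum_le[OF DH hH _ nn[OF P_add_cmult[OF DP h(1)]]]) simp
      ultimately show ?thesis using QD[of n] by simp
    qed
    then have "form (-t) f f \<le> 0" by (intro LIMSEQ_le_const[OF L]) blast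
    then show ?thesis using nn[OF fP] by simp
  qed
  have "form (-t) f w = 0" if "w \<in> P" for w by (rule form_null_orthogonal[OF fP that nn null])
  then show ?thesis using that[OF fP nz] by blast
qed

lemma nonpositive_eigenfunction:
  assumes neg: "t1 \<ge> 0" "h1 \<in> P" "form (-t1) h1 h1 < 0"
  obtains t f where "t \<ge> 0" "f \<in> P" "f \<noteq> (\<lambda>_. 0)" "real_solution u \<upsilon> (-t) f"
proof -
  define T where "T = {t. t \<ge> 0 \<and> (\<exists>h\<in>P. form (-t) h h < 0)}"
  have T: "T \<noteq> {}" "bdd_below T" using neg by (auto simp: T_def)
  define t where "t = Inf T"
  have t: "t \<ge> 0" unfolding t_def using T(1) by (intro cInf_greatest) (auto simp: T_def)
  have tT: "t \<le> r" if "r \<in> T" for r unfolding t_def by (rule cInf_lower[OF that T(2)])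
  have fe: "form (-r) h h = energy_form h h + r * omega_form h h - r\<^sup>2 * upsilon_form h h" if "h \<in> P" for r h
    using form_eq[OF P_H1[OF that] P_H1[OF that], of "-r"] by simp
  \<comment> \<open>A negative value at t would persist slightly below t, against the choice of t as
    an infimum; at t = 0 the form is the energy.\<close>
  have nn: "0 \<le> form (-t) h h" if hP: "h \<in> P" for h
  proof (rule ccontr)
    assume "\<not> 0 \<le> form (-t) h h"
    then have lt: "form (-t) h h < 0" by simp
    have "t \<noteq> 0"
    proof
      assume "t = 0"
      then have "form (-t) h h = energy_form h h" using fe[OF hP, of t] by simp
      then show False using lt energy_nonneg[OF P_H1[OF hP]] by linarith
    qed
    then have tp: "t > 0" using t by simp
    have "((\<lambda>r. form (-r) h h) \<longlongrightarrow> form (-t) h h) (at_left t)"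
      unfolding fe[OF hP] by (intro tendsto_intros)
    then have "eventually (\<lambda>r. form (-r) h h < 0) (at_left t)" by (rule order_tendstoD(2)[OF _ lt])
    moreover have "eventually (\<lambda>r. r \<in> {0<..<t}) (at_left t)" by (rule eventually_at_left_real[OF tp])
    ultimately have "eventually (\<lambda>r. form (-r) h h < 0 \<and> r \<in> {0<..<t}) (at_left t)" by (rule eventually_conj)
    then obtain r where "form (-r) h h < 0" "r \<in> {0<..<t}"
      using eventually_happens'[OF trivial_limit_at_left_real] by blast
    then show False using tT[of r] hP by (auto simp: T_def)
  qed
  \<comment> \<open>Parameters close to t whose forms are negative at some function of energy 1.
    Normalisation is possible because zero energy would force the zero function, at which the form
    is not negative.\<close>
  have "\<exists>r h. r \<in> T \<and> r < t + inverse (real (Suc n)) \<and> h \<in> P \<and> energy_form h h = 1 \<and> form (-r) h h < 0" for n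
  proof -
    obtain r where r: "r \<in> T" "r < t + inverse (real (Suc n))"
      using cInf_lessD[OF T(1), of "t + inverse (real (Suc n))"] by (auto simp: t_def)
    then obtain w where w: "w \<in> P" "form (-r) w w < 0" by (auto simp: T_def)
    have wH: "w \<in> H1_loc" using w(1) by (rule P_H1)
    have pos: "energy_form w w > 0"
    proof (rule ccontr)
      assume "\<not> energy_form w w > 0"
      then have "energy_form w w = 0" using energy_nonneg[OF wH] by simp
      then have "w = (\<lambda>_. 0)" using P_bound[OF w(1)] by auto
      then show False using w(2) form_zero[OF wH] by simp
    qed
    define c where "c = 1 / sqrt (energy_form w w)"
    have c2: "c\<^sup>2 = 1 / energy_form w w" using pos by (simp add: c_def power_divide)
    have cw: "(\<lambda>x. c * w x) \<in> P" by (rule P_cmult[OF w(1)])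
    have "energy_form (\<lambda>x. c * w x) (\<lambda>x. c * w x) = c\<^sup>2 * energy_form w w"
      by (rule energy_cmult_square[OF wH])
    also have "\<dots> = 1" using pos by (simp add: c2)
    finally have "energy_form (\<lambda>x. c * w x) (\<lambda>x. c * w x) = 1" .
    moreover have "form (-r) (\<lambda>x. c * w x) (\<lambda>x. c * w x) < 0"
      unfolding form_cmult_square[OF wH] c2 using w(2) pos by (simp add: divide_less_0_iff)
    ultimately show ?thesis using r cw by blast
  qed
  then obtain r h where r: "\<And>n. r n \<in> T" "\<And>n. r n < t + inverse (real (Suc n))"
    and h: "\<And>n. h n \<in> P" "\<And>n. energy_form (h n) (h n) = 1" "\<And>n. form (- r n) (h n) (h n) < 0"
    by metis
  have rt: "r \<longlonglongrightarrow> t"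
  proof (rule real_tendsto_sandwich[OF _ _ tendsto_const])
    show "\<forall>\<^sub>F n in sequentially. t \<le> r n" using tT r(1) by simp
    show "\<forall>\<^sub>F n in sequentially. r n \<le> t + inverse (real (Suc n))" using r(2) by (simp add: less_imp_le)
    show "(\<lambda>n. t + inverse (real (Suc n))) \<longlonglongrightarrow> t"
      using tendsto_add[OF tendsto_const LIMSEQ_inverse_real_of_nat, of t] by simp
  qed
  define K0 where "K0 = (sqrt Csob)\<^sup>2 * (LINT x:I0|lebesgue. \<bar>u x\<bar>) + 2 * sqrt Csob * ((LINT x:I0|lebesgue. (vderiv u x)\<^sup>2) + 1)"
  define V0 where "V0 = (sqrt Csob)\<^sup>2 * (LINT x:I0|\<upsilon>. 1::real)"
  have hb: "\<bar>h n x\<bar> \<le> sqrt Csob" for n x using P_bound[OF h(1), of n x] h(2) by simp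
  have sC: "sqrt Csob \<ge> 0" using Csob_pos(1) by simp
  have K: "\<bar>omega_form (h n) (h n)\<bar> \<le> K0" for n
    using omega_form_bound[OF P_H1[OF h(1)] sC hb, of n] h(2)[of n] by (simp add: K0_def)
  have V: "0 \<le> upsilon_form (h n) (h n)" "upsilon_form (h n) (h n) \<le> V0" for n
    using upsilon_form_bound[OF P_H1[OF h(1)] sC hb, of n] by (simp_all add: V0_def)
  have q0: "(\<lambda>n. form (-t) (h n) (h n)) \<longlonglongrightarrow> 0"
  proof (rule real_tendsto_sandwich[OF _ _ tendsto_const])
    show "\<forall>\<^sub>F n in sequentially. 0 \<le> form (-t) (h n) (h n)" using nn h(1) by simp
    show "\<forall>\<^sub>F n in sequentially. form (-t) (h n) (h n) \<le> (r n - t) * K0 + ((r n)\<^sup>2 - t\<^sup>2) * V0"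
    proof (intro always_eventually allI)
      fix n
      have rn: "t \<le> r n" by (rule tT[OF r(1)])
      \<comment> \<open>Passing from \<open>r n\<close> to t costs multiples of r n - t and of (r
        n)^2 - t^2, with coefficients that are bounded on functions of energy 1.\<close>
      have "form (-t) (h n) (h n) = form (- r n) (h n) (h n) + (r n - t) * (- omega_form (h n) (h n)) + ((r n)\<^sup>2 - t\<^sup>2) * upsilon_form (h n) (h n)"
        unfolding fe[OF h(1)] by (simp add: algebra_simps)
      also have "\<dots> \<le> 0 + (r n - t) * K0 + ((r n)\<^sup>2 - t\<^sup>2) * V0"
      proof (intro add_mono mult_left_mono)
        show "- omega_form (h n) (h n) \<le> K0" using K[of n] by linarith
        show "0 \<le> (r n)\<^sup>2 - t\<^sup>2" using rn t by (simp add: power_mono)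
      qed (use h(3)[of n] V[of n] rn in auto)
      finally show "form (-t) (h n) (h n) \<le> (r n - t) * K0 + ((r n)\<^sup>2 - t\<^sup>2) * V0" by simp
    qed
    have "(\<lambda>n. (r n - t) * K0 + ((r n)\<^sup>2 - t\<^sup>2) * V0) \<longlonglongrightarrow> (t - t) * K0 + (t\<^sup>2 - t\<^sup>2) * V0"
      by (intro tendsto_intros rt)
    then show "(\<lambda>n. (r n - t) * K0 + ((r n)\<^sup>2 - t\<^sup>2) * V0) \<longlonglongrightarrow> 0" by simp
  qed
  show ?thesis
  proof (rule minimizing_limit[OF t nn h(1,2) q0])
    fix f assume f: "f \<in> P" "f \<noteq> (\<lambda>_. 0)" "\<And>h. h \<in> P \<Longrightarrow> form (-t) f h = 0"
    show ?thesis by (rule that[OF t f(1,2) real_solutionI[OF f(1,3)]])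
  qed
qed

end

subsection \<open>The eigenvalue bound for real eigenfunctions\<close>

text \<open>If the values at x were different, left-continuity would separate the functions on a
  whole interval to the left of x, which is not a null set. This pins down the quasi-derivative at
  every single point.\<close>

lemma left_continuous_AE_unique:
  fixes f g :: "real \<Rightarrow> 'a::t2_space"
  assumes f: "\<And>x. continuous (at_left x) f" and g: "\<And>x. continuous (at_left x) g"
    and ae: "AE x in lebesgue. f x = g x"
  shows "f = g"
proof
  fix x
  show "f x = g x"
  proof (rule ccontr)
    assume "f x \<noteq> g x"
    from hausdorff[OF this] obtain U V where UV: "open U" "open V" "f x \<in> U" "g x \<in> V" "U \<inter> V = {}"
      by (elim exE conjE)
    have "eventually (\<lambda>y. f y \<in> U) (at_left x)"
      by (rule topological_tendstoD[OF f[unfolded continuous_within] UV(1,3)])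
    moreover have "eventually (\<lambda>y. g y \<in> V) (at_left x)"
      by (rule topological_tendstoD[OF g[unfolded continuous_within] UV(2,4)])
    ultimately have "eventually (\<lambda>y. f y \<noteq> g y) (at_left x)"
    proof eventually_elim
      case (elim y)
      then show ?case using UV(5) by auto
    qed
    then obtain b where b: "b < x" "\<And>y. b < y \<Longrightarrow> y < x \<Longrightarrow> f y \<noteq> g y"
      unfolding eventually_at_left_field by blast
    obtain N where N: "negligible N" "{x. f x \<noteq> g x} \<subseteq> N"
      using ae unfolding eventually_ae_filter_negligible by blast
    have "{b<..<x} \<subseteq> N" using b N(2) by auto
    then have "negligible {b<..<x}" using N(1) negligible_subset by blast
    then have "negligible (box b x)" by simp
    then have "box b x = {}" using open_not_negligible[OF open_box] by blast
    then show False using b(1) by simp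
  qed
qed

section \<open>Consequences of the positivity of all eigenvalues\<close>

context periodic_data
begin

lemma nonneg_forms:
  assumes pos: "\<And>t f. t \<ge> 0 \<Longrightarrow> f \<in> P \<Longrightarrow> f \<noteq> (\<lambda>_. 0) \<Longrightarrow> \<not> real_solution u \<upsilon> (-t) f" and h: "h \<in> P"
  shows "upsilon_form h h = 0" "0 \<le> omega_form h h"
proof -
  have hH: "h \<in> H1_loc" using h by (rule P_H1)
  define n k v where "n = energy_form h h" and "k = omega_form h h" and "v = upsilon_form h h"
  have n: "n \<ge> 0" using energy_nonneg[OF hH] by (simp add: n_def)
  have v: "v \<ge> 0" using upsilon_form_bound(1)[OF hH _ P_bound[OF h]] Csob_pos(1) n by (simp add: v_def n_def)
  have q: "0 \<le> n + t * k - t\<^sup>2 * v" if "t \<ge> 0" for t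
  proof (rule ccontr)
    assume "\<not> ?thesis"
    then have "form (-t) h h < 0" using form_eq[OF hH hH, of "-t"] by (simp add: n_def k_def v_def)
    then show False using nonpositive_eigenfunction[OF that h] pos by metis
  qed
  have v0: "v = 0"
  proof (rule ccontr)
    assume "v \<noteq> 0"
    then have vp: "v > 0" using v by simp
    \<comment> \<open>For this t the product t v exceeds n + |k|, and since t \<ge> 1 the quadratic
      term outweighs the other two.\<close>
    define t where "t = (n + \<bar>k\<bar>) / v + 1"
    have t: "t \<ge> 1" using n vp by (simp add: t_def)
    have "t * v = n + \<bar>k\<bar> + v" using vp by (simp add: t_def field_simps)
    then have "t\<^sup>2 * v = t * (n + \<bar>k\<bar> + v)" by (simp add: power2_eq_square mult.assoc)
    moreover have "n \<le> t * n" using t n mult_right_mono[of 1 t n] by simp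
    moreover have "t * k \<le> t * \<bar>k\<bar>" using t by (intro mult_left_mono) auto
    moreover have "0 < t * v" using t vp by simp
    ultimately have "n + t * k - t\<^sup>2 * v < 0" by (simp add: algebra_simps)
    then show False using q[of t] t by simp
  qed
  then show "upsilon_form h h = 0" by (simp add: v_def)
  show "0 \<le> omega_form h h"
  proof (rule ccontr)
    assume "\<not> ?thesis"
    then have k: "k < 0" by (simp add: k_def)
    \<comment> \<open>At this t the remaining linear expression equals -1.\<close>
    have "0 \<le> n + ((n + 1) / (- k)) * k" using q[of "(n + 1) / (- k)"] v0 n k by (simp add: divide_nonneg_neg)
    then show False using k by simp
  qed
qed

text \<open>\<omega> over one period as a linear functional, so that it can be applied to a
  difference of a constant and a square.\<close>

definition omega_lin :: "(real \<Rightarrow> real) \<Rightarrow> real" where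
  "omega_lin \<psi> = (LINT x:I0|lebesgue. u x * \<psi> x + vderiv u x * vderiv \<psi> x)"

lemma omega_lin_integrable:
  assumes "\<psi> \<in> H1_loc"
  shows "set_integrable lebesgue I0 (\<lambda>x. u x * \<psi> x + vderiv u x * vderiv \<psi> x)"
    "(\<lambda>x. u x * \<psi> x + vderiv u x * vderiv \<psi> x) \<in> borel_measurable lebesgue"
proof -
  show "set_integrable lebesgue I0 (\<lambda>x. u x * \<psi> x + vderiv u x * vderiv \<psi> x)"
    by (intro I0_integrable set_integral_add L2_loc_mult_integrable H1_L2 H1_vderiv_L2 u assms)
  note [measurable] = L2_loc_measurable[OF H1_L2[OF u]] L2_loc_measurable[OF H1_L2[OF assms]]
    L2_loc_measurable[OF H1_vderiv_L2[OF u]] L2_loc_measurable[OF H1_vderiv_L2[OF assms]]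
  show "(\<lambda>x. u x * \<psi> x + vderiv u x * vderiv \<psi> x) \<in> borel_measurable lebesgue" by measurable
qed

lemma omega_lin_add_cmult:
  assumes f: "f \<in> H1_loc" and g: "g \<in> H1_loc"
  shows "omega_lin (\<lambda>x. f x + c * g x) = omega_lin f + c * omega_lin g"
proof -
  let ?k = "\<lambda>x. f x + c * g x" and ?w = "\<lambda>\<psi> x. u x * \<psi> x + vderiv u x * vderiv \<psi> x"
  have k: "?k \<in> H1_loc" by (intro H1_add H1_cmult f g)
  have ig: "set_integrable lebesgue I0 (\<lambda>x. c * ?w g x)"
    by (rule set_integrable_mult_right) (rule omega_lin_integrable(1)[OF g])
  have "omega_lin ?k = (LINT x:I0|lebesgue. ?w f x + c * ?w g x)"
    unfolding omega_lin_def
  proof (rule set_lebesgue_integral_cong_AE)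
    show "AE x\<in>I0 in lebesgue. ?w ?k x = ?w f x + c * ?w g x"
      using H1_add(2)[OF f H1_cmult(1)[OF g, of c]] H1_cmult(2)[OF g, of c]
    proof eventually_elim
      case (elim x)
      show ?case unfolding elim by (simp add: algebra_simps)
    qed
    show "(\<lambda>x. ?w f x + c * ?w g x) \<in> borel_measurable lebesgue"
      using omega_lin_integrable(2)[OF f] omega_lin_integrable(2)[OF g] by measurable
  qed (use omega_lin_integrable(2)[OF k] in auto)
  also have "\<dots> = omega_lin f + c * omega_lin g"
    unfolding omega_lin_def by (simp only: set_integral_add(2)[OF omega_lin_integrable(1)[OF f] ig] set_integral_mult_right)
  finally show ?thesis .
qed

lemma omega_lin_const: "omega_lin (\<lambda>_. c) = c * (LINT x:I0|lebesgue. u x)"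
  unfolding omega_lin_def by (simp add: vderiv_eqI mult.commute)

lemma omega_form_eq_lin:
  assumes h: "h \<in> H1_loc"
  shows "omega_form h h = omega_lin (\<lambda>x. h x * h x)"
  unfolding omega_form_def omega_lin_def
proof (rule set_lebesgue_integral_cong_AE)
  show "AE x\<in>I0 in lebesgue. u x * (h x * h x) + vderiv u x * (h x * vderiv h x + h x * vderiv h x)
      = u x * (h x * h x) + vderiv u x * vderiv (\<lambda>x. h x * h x) x"
    using H1_mult(2)[OF h h] by eventually_elim simp
  note [measurable] = L2_loc_measurable[OF H1_L2[OF u]] L2_loc_measurable[OF H1_L2[OF h]]
    L2_loc_measurable[OF H1_vderiv_L2[OF u]] L2_loc_measurable[OF H1_vderiv_L2[OF h]]
  show "(\<lambda>x. u x * (h x * h x) + vderiv u x * (h x * vderiv h x + h x * vderiv h x)) \<in> borel_measurable lebesgue"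
    by measurable
qed (use omega_lin_integrable(2)[OF H1_mult(1)[OF h h]] in auto)

text \<open>On [e, \<infinity>) the square root has Lipschitz constant 1 / (2 sqrt e); the bound
  degenerates as e tends to 0, which is the reason for the regularisation.\<close>

lemma H1_sqrt:
  fixes G :: "real \<Rightarrow> real"
  assumes G: "G \<in> H1_loc" and e: "e > 0" "\<And>x. e \<le> G x"
  shows "(\<lambda>x. sqrt (G x)) \<in> H1_loc"
proof (rule H1_compose(1)[OF G, where \<phi>' = "\<lambda>y. inverse (sqrt y) / 2"])
  have pos: "G x > 0" for x using e(1) e(2)[of x] by linarith
  show "(sqrt has_real_derivative inverse (sqrt (G x)) / 2) (at (G x))" for x
    by (rule DERIV_real_sqrt[OF pos])
  show "continuous_on UNIV (\<lambda>x. inverse (sqrt (G x)) / 2)"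
  proof -
    have "continuous_on UNIV (\<lambda>x. sqrt (G x))" by (intro continuous_on_real_sqrt H1_loc_continuous G)
    moreover have "\<forall>x\<in>UNIV. sqrt (G x) \<noteq> 0" using pos by (simp add: less_imp_neq[THEN not_sym])
    ultimately show ?thesis by (intro continuous_on_divide[OF continuous_on_inverse continuous_on_const]) auto
  qed
  show "\<bar>sqrt (G x) - sqrt (G y)\<bar> \<le> inverse (2 * sqrt e) * \<bar>G x - G y\<bar>" for x y
  proof -
    have se: "sqrt e > 0" "sqrt e \<le> sqrt (G x)" "sqrt e \<le> sqrt (G y)" using e by auto
    have "G x - G y = (sqrt (G x) - sqrt (G y)) * (sqrt (G x) + sqrt (G y))"
    proof -
      have "sqrt (G x) * sqrt (G x) = G x" "sqrt (G y) * sqrt (G y) = G y" using pos[of x] pos[of y] by auto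
      then show ?thesis by (simp add: algebra_simps)
    qed
    then have "\<bar>G x - G y\<bar> = \<bar>sqrt (G x) - sqrt (G y)\<bar> * (sqrt (G x) + sqrt (G y))"
      using se by (simp add: abs_mult)
    also have "\<dots> \<ge> \<bar>sqrt (G x) - sqrt (G y)\<bar> * (2 * sqrt e)"
      using add_mono[OF se(2,3)] by (intro mult_left_mono) auto
    finally have "\<bar>sqrt (G x) - sqrt (G y)\<bar> \<le> \<bar>G x - G y\<bar> / (2 * sqrt e)"
      using se(1) by (subst pos_le_divide_eq) auto
    then show ?thesis by (simp only: divide_inverse mult.commute)
  qed
qed

text \<open>Positivity of the quadratic form extends to the nonnegative function \<open>M - \<phi>\<^sup>2\<close>, regularised so
  that its square root is weakly differentiable; in the antiperiodic case the square root is split by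
  means of \<open>cos\<^sup>2 + sin\<^sup>2 = 1\<close>.\<close>

lemma omega_form_le:
  assumes nn: "\<And>h. h \<in> P \<Longrightarrow> 0 \<le> omega_form h h" and \<phi>: "\<phi> \<in> P" and M: "\<And>x. (\<phi> x)\<^sup>2 \<le> M"
  shows "omega_form \<phi> \<phi> \<le> M * (LINT x:I0|lebesgue. u x)"
proof -
  let ?U = "LINT x:I0|lebesgue. u x"
  have \<phi>H: "\<phi> \<in> H1_loc" using \<phi> by (rule P_H1)
  have \<phi>2: "(\<lambda>x. \<phi> x * \<phi> x) \<in> H1_loc" by (intro H1_mult \<phi>H)
  have e: "0 \<le> (e + M) * ?U - omega_form \<phi> \<phi>" if e: "e > 0" for e
  proof -
    define G where "G x = (e + M) + (-1) * (\<phi> x * \<phi> x)" for x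
    have G: "G \<in> H1_loc" unfolding G_def[abs_def] by (intro H1_add H1_cmult H1_const \<phi>2)
    have Ge: "e \<le> G x" for x using M[of x] by (simp add: G_def power2_eq_square)
    define r where "r x = sqrt (G x)" for x
    have r: "r \<in> H1_loc" unfolding r_def[abs_def] by (rule H1_sqrt[OF G e Ge])
    have rr: "r x * r x = G x" for x using Ge[of x] e by (simp add: r_def)
    have rper: "r (x + l) = r x" for x
    proof -
      have "\<phi> (x + l) * \<phi> (x + l) = \<phi> x * \<phi> x" using \<phi> s by (auto simp: P_def)
      then show ?thesis by (simp add: r_def G_def)
    qed
    have "0 \<le> omega_lin G"
      using s
    proof
      assume "s = 1"
      then have "r \<in> P" unfolding P_def using r rper by simp
      then have "0 \<le> omega_form r r" by (rule nn)
      then show ?thesis using omega_form_eq_lin[OF r] by (simp add: rr)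
    next
      assume sm: "s = -1"
      \<comment> \<open>The frequency pi / l makes both multipliers change sign under translation by
        l, so their products with the periodic \<open>r\<close> belong to \<open>P\<close>.\<close>
      let ?c = "\<lambda>x. cos (pi / l * x)" and ?s = "\<lambda>x. sin (pi / l * x)"
      have c: "?c \<in> H1_loc"
        by (rule H1_C1(1)[where f' = "\<lambda>x. - sin (pi / l * x) * (pi / l)"]) (use l in \<open>auto intro!: derivative_eq_intros continuous_intros\<close>)
      have sn: "?s \<in> H1_loc"
        by (rule H1_C1(1)[where f' = "\<lambda>x. cos (pi / l * x) * (pi / l)"]) (use l in \<open>auto intro!: derivative_eq_intros continuous_intros\<close>)
      have arg: "pi / l * (x + l) = pi / l * x + pi" for x using l by (simp add: field_simps)
      have h1: "(\<lambda>x. ?c x * r x) \<in> P"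
        unfolding P_def mem_Collect_eq
        by (intro conjI allI H1_mult c r) (simp only: arg cos_periodic_pi rper sm mult_minus_left mult_1)
      have h2: "(\<lambda>x. ?s x * r x) \<in> P"
        unfolding P_def mem_Collect_eq
        by (intro conjI allI H1_mult sn r) (simp only: arg sin_periodic_pi rper sm mult_minus_left mult_1)
      have "omega_lin (\<lambda>x. (?c x * r x) * (?c x * r x) + 1 * ((?s x * r x) * (?s x * r x)))
        = omega_lin (\<lambda>x. (?c x * r x) * (?c x * r x)) + 1 * omega_lin (\<lambda>x. (?s x * r x) * (?s x * r x))"
        by (intro omega_lin_add_cmult H1_mult c sn r)
      moreover have "(?c x * r x) * (?c x * r x) + 1 * ((?s x * r x) * (?s x * r x)) = G x" for x
      proof -
        have "(?c x * r x) * (?c x * r x) + 1 * ((?s x * r x) * (?s x * r x)) = ((?s x)\<^sup>2 + (?c x)\<^sup>2) * (r x * r x)"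
          by algebra
        then show ?thesis by (simp only: sin_cos_squared_add rr mult_1)
      qed
      ultimately show ?thesis
        using nn[OF h1] nn[OF h2] omega_form_eq_lin[OF P_H1[OF h1]] omega_form_eq_lin[OF P_H1[OF h2]] by simp
    qed
    also have "omega_lin G = omega_lin (\<lambda>_. e + M) + (-1) * omega_lin (\<lambda>x. \<phi> x * \<phi> x)"
      unfolding G_def[abs_def] by (rule omega_lin_add_cmult[OF H1_const \<phi>2])
    also have "\<dots> = (e + M) * ?U - omega_form \<phi> \<phi>"
      unfolding omega_lin_const omega_form_eq_lin[OF \<phi>H] by simp
    finally show ?thesis .
  qed
  have "((\<lambda>e. (e + M) * ?U - omega_form \<phi> \<phi>) \<longlongrightarrow> (0 + M) * ?U - omega_form \<phi> \<phi>) (at_right 0)"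
    by (intro tendsto_intros)
  moreover have "eventually (\<lambda>e. 0 \<le> (e + M) * ?U - omega_form \<phi> \<phi>) (at_right 0)"
    using eventually_at_right_less[of "0::real"] by eventually_elim (rule e)
  ultimately have "0 \<le> (0 + M) * ?U - omega_form \<phi> \<phi>"
    by (rule tendsto_lowerbound) simp
  then show ?thesis by simp
qed

lemma eigenvalue_bound:
  assumes pos: "\<And>t f. t \<ge> 0 \<Longrightarrow> f \<in> P \<Longrightarrow> f \<noteq> (\<lambda>_. 0) \<Longrightarrow> \<not> real_solution u \<upsilon> (-t) f"
    and \<phi>: "\<phi> \<in> P" "\<phi> \<noteq> (\<lambda>_. 0)" "real_solution u \<upsilon> z \<phi>" and z: "z > 0"
  shows "1 / z \<le> Csob * (LINT x:I0|lebesgue. u x)"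
proof -
  let ?U = "LINT x:I0|lebesgue. u x"
  have \<phi>H: "\<phi> \<in> H1_loc" using \<phi>(1) by (rule P_H1)
  define n where "n = energy_form \<phi> \<phi>"
  have n: "n > 0"
  proof (rule ccontr)
    assume "\<not> n > 0"
    then have "n = 0" using energy_nonneg[OF \<phi>H] by (simp add: n_def)
    then have "\<phi> = (\<lambda>_. 0)" using P_bound[OF \<phi>(1)] by (auto simp: n_def)
    then show False using \<phi>(2) by simp
  qed
  have "form z \<phi> \<phi> = 0" by (rule real_solutionD[OF \<phi>(1,3,1)])
  then have nk: "n = z * omega_form \<phi> \<phi>"
    using form_eq[OF \<phi>H \<phi>H, of z] nonneg_forms(1)[OF pos \<phi>(1)] by (simp add: n_def)
  have "omega_form \<phi> \<phi> \<le> (Csob * n) * ?U"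
    unfolding n_def using nonneg_forms(2)[OF pos] \<phi>(1) by (intro omega_form_le sobolev_P)
  then have "z * omega_form \<phi> \<phi> \<le> z * ((Csob * n) * ?U)" using z by (intro mult_left_mono) auto
  then have "n * 1 \<le> n * (z * (Csob * ?U))" using nk by (simp add: mult_ac)
  then have "1 \<le> z * (Csob * ?U)" using n by (simp only: mult_le_cancel_left_pos)
  then show ?thesis using z by (simp add: divide_le_eq mult.commute)
qed

section \<open>From boundary conditions at one point to membership in P\<close>

text \<open>The residual of the weak equation over the whole line. Its additivity in f shows that
  linear combinations of solutions are solutions.\<close>

definition defect :: "real \<Rightarrow> (real \<Rightarrow> real) \<Rightarrow> (real \<Rightarrow> real) \<Rightarrow> real" where
  "defect z f h = (LINT x|lebesgue. flux u z f x * vderiv h x + source u z f x * h x) - z\<^sup>2 * (LINT x|\<upsilon>. f x * h x)"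

lemma real_solution_iff: "real_solution u \<upsilon> z f \<longleftrightarrow> f \<in> H1_loc \<and> (\<forall>h\<in>H1_c. defect z f h = 0)"
  by (auto simp: real_solution_def defect_def)

lemma H1_c_support:
  fixes h :: "real \<Rightarrow> real"
  assumes "h \<in> H1_c"
  obtains p q where "\<And>x. x \<notin> {p..q} \<Longrightarrow> h x = 0"
proof -
  have "compact (closure {x. h x \<noteq> 0})" using assms by (simp add: H1_c_def)
  then have "bounded {x. h x \<noteq> 0}"
    by (intro bounded_subset[OF compact_imp_bounded closure_subset])
  then obtain R where R: "\<And>x. h x \<noteq> 0 \<Longrightarrow> \<bar>x\<bar> \<le> R" by (auto simp: bounded_iff)
  have "h x = 0" if "x \<notin> {-R..R}" for x
  proof (rule ccontr)
    assume "h x \<noteq> 0"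
    then have "\<bar>x\<bar> \<le> R" by (rule R)
    with that show False by (simp add: abs_le_iff)
  qed
  then show ?thesis by (rule that)
qed

lemma defect_integrable:
  assumes f: "f \<in> H1_loc" and h: "h \<in> H1_c"
  shows "integrable lebesgue (\<lambda>x. flux u z f x * vderiv h x + source u z f x * h x)" "integrable \<upsilon> (\<lambda>x. f x * h x)"
proof -
  have hH: "h \<in> H1_loc" using h by (simp add: H1_c_def)
  obtain p q where pq: "\<And>x. x \<notin> {p..q} \<Longrightarrow> h x = 0" using H1_c_support[OF h] by blast
  show "integrable lebesgue (\<lambda>x. flux u z f x * vderiv h x + source u z f x * h x)"
    by (rule integrable_of_support[OF form_integrable[OF f hH, of p q]]) (use pq vderiv_zero_outside[OF pq] in simp)
  have c: "continuous_on UNIV (\<lambda>x. f x * h x)" by (intro continuous_on_mult H1_loc_continuous f hH)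
  have "set_integrable \<upsilon> {p..q} (\<lambda>x. f x * h x)" by (rule borel_measure_integrable[OF \<upsilon> c]) auto
  then show "integrable \<upsilon> (\<lambda>x. f x * h x)" by (rule integrable_of_support) (use pq in simp)
qed

lemma defect_add_cmult:
  assumes f: "f \<in> H1_loc" and g: "g \<in> H1_loc" and h: "h \<in> H1_c"
  shows "defect z (\<lambda>x. f x + c * g x) h = defect z f h + c * defect z g h"
proof -
  let ?k = "\<lambda>x. f x + c * g x"
  let ?L = "\<lambda>f x. flux u z f x * vderiv h x + source u z f x * h x"
  have k: "?k \<in> H1_loc" by (intro H1_add H1_cmult f g)
  note i = defect_integrable[OF _ h]
  have "(LINT x|lebesgue. ?L ?k x) = (LINT x|lebesgue. ?L f x + c * ?L g x)"
  proof (rule integral_cong_AE)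
    show "AE x in lebesgue. ?L ?k x = ?L f x + c * ?L g x"
      using H1_add(2)[OF f H1_cmult(1)[OF g, of c]] H1_cmult(2)[OF g, of c]
    proof eventually_elim
      case (elim x)
      have 1: "flux u z ?k x = flux u z f x + c * flux u z g x"
        unfolding flux_def elim by algebra
      have 2: "source u z ?k x = source u z f x + c * source u z g x"
        unfolding source_def elim by algebra
      show ?case unfolding 1 2 by algebra
    qed
    show "?L ?k \<in> borel_measurable lebesgue" by (rule borel_measurable_integrable[OF i(1)[OF k]])
    show "(\<lambda>x. ?L f x + c * ?L g x) \<in> borel_measurable lebesgue"
      using borel_measurable_integrable[OF i(1)[OF f]] borel_measurable_integrable[OF i(1)[OF g]] by measurable
  qed
  also have "\<dots> = (LINT x|lebesgue. ?L f x) + c * (LINT x|lebesgue. ?L g x)"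
    by (simp only: Bochner_Integration.integral_add[OF i(1)[OF f] integrable_mult_right[OF i(1)[OF g]]] integral_mult_right_zero)
  finally have 1: "(LINT x|lebesgue. ?L ?k x) = (LINT x|lebesgue. ?L f x) + c * (LINT x|lebesgue. ?L g x)" .
  have "(LINT x|\<upsilon>. ?k x * h x) = (LINT x|\<upsilon>. f x * h x + c * (g x * h x))"
    by (simp only: distrib_right mult.assoc)
  also have "\<dots> = (LINT x|\<upsilon>. f x * h x) + c * (LINT x|\<upsilon>. g x * h x)"
    by (simp only: Bochner_Integration.integral_add[OF i(2)[OF f] integrable_mult_right[OF i(2)[OF g]]] integral_mult_right_zero)
  finally have 2: "(LINT x|\<upsilon>. ?k x * h x) = (LINT x|\<upsilon>. f x * h x) + c * (LINT x|\<upsilon>. g x * h x)" .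
  show ?thesis unfolding defect_def 1 2 by algebra
qed

lemma flux_shift: "flux u z (\<lambda>x. f (x + l)) x = flux u z f (x + l)"
  using u_vderiv_shift[of x 1] by (simp add: flux_def vderiv_shift)

lemma source_shift: "source u z (\<lambda>x. f (x + l)) x = source u z f (x + l)"
  using u_vderiv_shift[of x 1] u_per[of x] by (simp add: source_def vderiv_shift)

text \<open>By periodicity of u and \<upsilon>, translating \<open>f\<close> has the same effect as
  translating the test function back; translates of solutions are therefore solutions.\<close>

lemma defect_shift:
  assumes f: "f \<in> H1_loc" and h: "h \<in> H1_c"
  shows "defect z (\<lambda>x. f (x + l)) h = defect z f (\<lambda>x. h (x + (- l)))" "(\<lambda>x. h (x + (- l))) \<in> H1_c"
proof -
  have hH: "h \<in> H1_loc" using h by (simp add: H1_c_def)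
  obtain p q where pq: "\<And>x. x \<notin> {p..q} \<Longrightarrow> h x = 0" using H1_c_support[OF h] by blast
  show k: "(\<lambda>x. h (x + (- l))) \<in> H1_c"
    by (rule H1_c_realI[OF H1_shift[OF hH], of "p + l" "q + l"]) (use pq in auto)
  let ?G = "\<lambda>y. flux u z f y * vderiv (\<lambda>x. h (x + (- l))) y + source u z f y * h (y + (- l))"
  have "?G (x + l) = flux u z (\<lambda>x. f (x + l)) x * vderiv h x + source u z (\<lambda>x. f (x + l)) x * h x" for x
    using vderiv_shift[of h "- l" "x + l"] by (simp add: flux_shift source_shift)
  then have 1: "(LINT x|lebesgue. flux u z (\<lambda>x. f (x + l)) x * vderiv h x + source u z (\<lambda>x. f (x + l)) x * h x) = (LINT x|lebesgue. ?G x)"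
    using lebesgue_integral_shift[of ?G l] by simp
  have "(LINT x|\<upsilon>. f (x + of_int 1 * l) * h (x + of_int 1 * l + (- l))) = (LINT x|\<upsilon>. f x * h (x + (- l)))"
    using shift_invariant_\<upsilon> defect_integrable(2)[OF f k] unfolding shift_invariant_def by blast
  then have 2: "(LINT x|\<upsilon>. f (x + l) * h x) = (LINT x|\<upsilon>. f x * h (x + (- l)))" by simp
  show "defect z (\<lambda>x. f (x + l)) h = defect z f (\<lambda>x. h (x + (- l)))"
    unfolding defect_def 1 2 ..
qed

lemma left_continuous_shift:
  fixes g :: "real \<Rightarrow> 'a::topological_space"
  assumes "continuous (at_left (x + c)) g"
  shows "continuous (at_left x) (\<lambda>x. g (x + c))"
proof -
  have "at_left (x + c) = filtermap (\<lambda>y. y + c) (at_left x)"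
    using filtermap_at_left_shift[of "-c" x] by (simp add: add.commute)
  then show ?thesis using assms unfolding continuous_within by (simp add: filterlim_filtermap)
qed

text \<open>The function \<open>d\<close> solves the equation, and the two boundary conditions say
  that \<open>d\<close> and its quasi-derivative vanish at \<open>a\<close>, because s is its own
  inverse. Uniqueness for the initial value problem then gives d = 0.\<close>

lemma solution_in_P:
  assumes f: "real_solution u \<upsilon> z f" and \<gamma>1: "\<And>x. continuous (at_left x) \<gamma>" and \<gamma>2: "AE x in lebesgue. \<gamma> x = flux u z f x"
    and bc: "f a = s * f (a + l)" "\<gamma> a = s * \<gamma> (a + l)"
  shows "f \<in> P"
proof -
  have fH: "f \<in> H1_loc" using f by (simp add: real_solution_def)
  define d where "d x = f (x + l) + (- s) * f x" for x
  have dH: "d \<in> H1_loc" unfolding d_def[abs_def] by (intro H1_add H1_cmult H1_shift fH)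
  have ds: "real_solution u \<upsilon> z d"
    unfolding real_solution_iff
  proof (intro conjI ballI dH)
    fix h :: "real \<Rightarrow> real" assume h: "h \<in> H1_c"
    have "defect z d h = defect z (\<lambda>x. f (x + l)) h + (- s) * defect z f h"
      unfolding d_def[abs_def] by (rule defect_add_cmult[OF H1_shift[OF fH] fH h])
    also have "\<dots> = 0"
      unfolding defect_shift(1)[OF fH h] using f h defect_shift(2)[OF fH h] by (simp add: real_solution_iff)
    finally show "defect z d h = 0" .
  qed
  obtain \<gamma>' where g1: "\<And>x. continuous (at_left x) \<gamma>'" and g2: "AE x in lebesgue. \<gamma>' x = flux u z d x"
    and g3: "\<And>x y. x \<le> y \<Longrightarrow> \<gamma>' y - \<gamma>' x = (LINT s:{x..<y}|lebesgue. source u z d s) - z\<^sup>2 * (LINT s:{x..<y}|\<upsilon>. d s)"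
    using quasi_derivative_exists[OF u \<upsilon> ds] by blast
  \<comment> \<open>The equation determines the quasi-derivative of \<open>d\<close> only almost
    everywhere; left-continuity is what gives access to its value at \<open>a\<close>.\<close>
  have "\<gamma>' = (\<lambda>x. \<gamma> (x + l) + (- s) * \<gamma> x)"
  proof (rule left_continuous_AE_unique[OF g1])
    show "continuous (at_left x) (\<lambda>x. \<gamma> (x + l) + (- s) * \<gamma> x)" for x
      by (intro continuous_intros left_continuous_shift \<gamma>1)
    show "AE x in lebesgue. \<gamma>' x = \<gamma> (x + l) + (- s) * \<gamma> x"
      using g2 \<gamma>2 AE_lebesgue_shift[OF \<gamma>2, of l] H1_add(2)[OF H1_shift[OF fH, of l] H1_cmult(1)[OF fH, of "- s"]] H1_cmult(2)[OF fH, of "- s"]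
    proof eventually_elim
      case (elim x)
      have "flux u z d x = flux u z (\<lambda>x. f (x + l)) x + (- s) * flux u z f x"
        unfolding flux_def d_def[abs_def] elim(4) elim(5) by algebra
      then show ?case using elim(1-3) by (simp add: flux_shift)
    qed
  qed
  then have g0: "\<gamma>' a = 0" using bc(2) s by auto
  have d0: "d a = 0" using bc(1) s by (auto simp: d_def)
  have "d x = 0" for x by (rule solution_unique[OF u \<upsilon> ds g2 g3 d0 g0])
  then show ?thesis using fH by (simp add: P_def d_def)
qed

text \<open>The relation for \<open>flux\<close> holds almost everywhere; left-continuity carries it
  over to every point, in particular to the base point of the boundary condition.\<close>

lemma quasi_derivative_periodic:
  assumes f: "f \<in> P" and \<gamma>1: "\<And>x. continuous (at_left x) \<gamma>" and \<gamma>2: "AE x in lebesgue. \<gamma> x = flux u z f x"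
  shows "\<gamma> (x + l) = s * \<gamma> x"
proof -
  have "(\<lambda>x. \<gamma> (x + l)) = (\<lambda>x. s * \<gamma> x)"
  proof (rule left_continuous_AE_unique)
    show "continuous (at_left x) (\<lambda>x. \<gamma> (x + l))" "continuous (at_left x) (\<lambda>x. s * \<gamma> x)" for x
      by (intro continuous_intros left_continuous_shift \<gamma>1)+
    show "AE x in lebesgue. \<gamma> (x + l) = s * \<gamma> x"
      using \<gamma>2 AE_lebesgue_shift[OF \<gamma>2, of l] P_vderiv_shift[OF f, of 1]
    proof eventually_elim
      case (elim x)
      have "flux u z f (x + l) = s * flux u z f x"
        using elim(3) P_shift[OF f, of x 1] u_vderiv_shift[of x 1] sgpow_simps(2)[of 0]
        by (simp add: flux_def algebra_simps)
      then show ?case using elim by simp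
    qed
  qed
  then show ?thesis by (rule fun_cong)
qed

end

subsection \<open>Complex solutions\<close>

text \<open>Completeness of Lebesgue measure. It makes derivatives of complex functions usable,
  which are identified only off a null set.\<close>

lemma lebesgue_measurable_AE:
  fixes f g :: "real \<Rightarrow> 'a::topological_space"
  assumes f: "f \<in> borel_measurable lebesgue" and ae: "AE x in lebesgue. g x = f x"
  shows "g \<in> borel_measurable lebesgue"
proof (rule borel_measurableI)
  obtain N where N: "negligible N" "{x. g x \<noteq> f x} \<subseteq> N"
    using ae unfolding eventually_ae_filter_negligible by blast
  fix S :: "'a set" assume S: "open S"
  have "f -` S \<in> sets lebesgue" using measurable_sets[OF f, of S] S by simp
  moreover have "N \<in> sets lebesgue" "g -` S \<inter> N \<in> sets lebesgue"
    using N(1) by (auto intro!: negligible_imp_sets intro: negligible_subset)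
  ultimately have "(f -` S - N) \<union> (g -` S \<inter> N) \<in> sets lebesgue" by blast
  moreover have "(f -` S - N) \<union> (g -` S \<inter> N) = g -` S" using N(2) by auto
  ultimately show "g -` S \<inter> space lebesgue \<in> sets lebesgue" by simp
qed

lemma integral_Complex:
  assumes A: "integrable M A" and B: "integrable M B"
  shows "integrable M (\<lambda>x. Complex (A x) (B x))"
    and "(LINT x|M. Complex (A x) (B x)) = Complex (LINT x|M. A x) (LINT x|M. B x)"
proof -
  have i: "integrable M (\<lambda>x. complex_of_real (A x))" "integrable M (\<lambda>x. \<i> * complex_of_real (B x))"
    using A B by (auto intro: integrable_of_real)
  show "integrable M (\<lambda>x. Complex (A x) (B x))"
    unfolding Complex_eq by (rule Bochner_Integration.integrable_add[OF i])
  show "(LINT x|M. Complex (A x) (B x)) = Complex (LINT x|M. A x) (LINT x|M. B x)"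
    unfolding Complex_eq Bochner_Integration.integral_add[OF i] by simp
qed

lemma lebesgue_integral_Complex_AE:
  fixes A B :: "real \<Rightarrow> real" and F :: "real \<Rightarrow> complex"
  assumes A: "integrable lebesgue A" and B: "integrable lebesgue B" and F: "AE x in lebesgue. F x = Complex (A x) (B x)"
  shows "integrable lebesgue F" and "(LINT x|lebesgue. F x) = Complex (LINT x|lebesgue. A x) (LINT x|lebesgue. B x)"
proof -
  note C = integral_Complex[OF A B]
  have m: "F \<in> borel_measurable lebesgue"
    by (rule lebesgue_measurable_AE[OF borel_measurable_integrable[OF C(1)] F])
  show "integrable lebesgue F"
    using integrable_cong_AE[OF m borel_measurable_integrable[OF C(1)] F] C(1) by blast
  show "(LINT x|lebesgue. F x) = Complex (LINT x|lebesgue. A x) (LINT x|lebesgue. B x)"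
    using integral_cong_AE[OF m borel_measurable_integrable[OF C(1)] F] C(2) by (rule trans)
qed

lemma AC_loc_complex_deriv:
  fixes f :: "real \<Rightarrow> complex"
  assumes "(\<lambda>x. Re (f x)) \<in> AC_loc" "(\<lambda>x. Im (f x)) \<in> AC_loc"
  shows "AE x in lebesgue. (f has_vector_derivative Complex (vderiv (\<lambda>x. Re (f x)) x) (vderiv (\<lambda>x. Im (f x)) x)) (at x)"
  using AC_loc_AE_differentiable[OF assms(1)] AC_loc_AE_differentiable[OF assms(2)]
  by eventually_elim (simp add: has_vector_derivative_complex_iff)

lemma AC_loc_complex_iff:
  fixes f :: "real \<Rightarrow> complex"
  shows "f \<in> AC_loc \<longleftrightarrow> (\<lambda>x. Re (f x)) \<in> AC_loc \<and> (\<lambda>x. Im (f x)) \<in> AC_loc"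
proof (intro iffI conjI)
  assume f: "f \<in> AC_loc"
  have "norm (Re w - Re v) \<le> 1 * (norm (w - v) + norm (w - v))"
    "norm (Im w - Im v) \<le> 1 * (norm (w - v) + norm (w - v))" for w v
    using abs_Re_le_cmod[of "w - v"] abs_Im_le_cmod[of "w - v"] norm_ge_zero[of "w - v"] by auto
  then show "(\<lambda>x. Re (f x)) \<in> AC_loc" "(\<lambda>x. Im (f x)) \<in> AC_loc"
    by (intro AC_loc_dominated[OF f f] exI[of _ 1] ballI; blast)+
next
  assume f: "(\<lambda>x. Re (f x)) \<in> AC_loc \<and> (\<lambda>x. Im (f x)) \<in> AC_loc"
  have "norm (w - v) \<le> 1 * (norm (Re w - Re v) + norm (Im w - Im v))" for w v
    using cmod_le[of "w - v"] by simp
  then show "f \<in> AC_loc"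
    using f by (elim conjE) (rule AC_loc_dominated, assumption, assumption, blast)
qed

text \<open>Off a null set, the squared modulus of the derivative is the sum of the squares of two
  real derivatives, each of which it dominates.\<close>

lemma H1_complex_iff:
  fixes f :: "real \<Rightarrow> complex"
  shows "f \<in> H1_loc \<longleftrightarrow> (\<lambda>x. Re (f x)) \<in> H1_loc \<and> (\<lambda>x. Im (f x)) \<in> H1_loc"
proof (cases "f \<in> AC_loc")
  case False
  then show ?thesis using H1_AC[of f] H1_AC[of "\<lambda>x. Re (f x)"] H1_AC[of "\<lambda>x. Im (f x)"] AC_loc_complex_iff[of f] by blast
next
  case True
  let ?r = "\<lambda>x. Re (f x)" and ?i = "\<lambda>x. Im (f x)"
  have ac: "?r \<in> AC_loc" "?i \<in> AC_loc" using True AC_loc_complex_iff[of f] by auto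
  have m [measurable]: "vderiv ?r \<in> borel_measurable lebesgue" "vderiv ?i \<in> borel_measurable lebesgue"
    by (intro AC_loc_vderiv_measurable ac)+
  have ae: "AE x in lebesgue. (norm (vderiv f x))\<^sup>2 = (vderiv ?r x)\<^sup>2 + (vderiv ?i x)\<^sup>2"
    using AC_loc_complex_deriv[OF ac]
  proof eventually_elim
    case (elim x)
    show ?case unfolding vector_derivative_at[OF elim] by (simp add: cmod_power2)
  qed
  have rm: "(\<lambda>x. (vderiv ?r x)\<^sup>2 + (vderiv ?i x)\<^sup>2) \<in> borel_measurable lebesgue" by measurable
  have vm: "(\<lambda>x. (norm (vderiv f x))\<^sup>2) \<in> borel_measurable lebesgue"
    by (rule lebesgue_measurable_AE[OF rm ae])
  have eq: "set_integrable lebesgue {p..q} (\<lambda>x. (norm (vderiv f x))\<^sup>2)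
      \<longleftrightarrow> set_integrable lebesgue {p..q} (\<lambda>x. (vderiv ?r x)\<^sup>2 + (vderiv ?i x)\<^sup>2)" for p q
    by (rule set_integrable_cong_AE[OF vm rm]) (use ae in auto)
  show ?thesis
  proof (intro iffI conjI)
    assume "f \<in> H1_loc"
    then have i: "set_integrable lebesgue {p..q} (\<lambda>x. (vderiv ?r x)\<^sup>2 + (vderiv ?i x)\<^sup>2)" for p q
      using eq by (simp add: H1_loc_def)
    have "set_integrable lebesgue {p..q} (\<lambda>x. (vderiv ?r x)\<^sup>2)" "set_integrable lebesgue {p..q} (\<lambda>x. (vderiv ?i x)\<^sup>2)" for p q
      by (rule set_integrable_dominated[OF i]; simp)+
    then show "?r \<in> H1_loc" "?i \<in> H1_loc" by (simp_all add: H1_real_iff L2_loc_def ac m)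
  next
    assume "?r \<in> H1_loc \<and> ?i \<in> H1_loc"
    then have "vderiv ?r \<in> L2_loc" "vderiv ?i \<in> L2_loc" using H1_vderiv_L2 by auto
    then have "set_integrable lebesgue {p..q} (\<lambda>x. (vderiv ?r x)\<^sup>2 + (vderiv ?i x)\<^sup>2)" for p q
      by (intro set_integral_add L2_loc_square)
    then show "f \<in> H1_loc" using True unfolding H1_loc_def AC_loc_def mem_Collect_eq eq by simp
  qed
qed

lemma H1_complex_deriv:
  fixes f :: "real \<Rightarrow> complex"
  assumes "f \<in> H1_loc"
  shows "AE x in lebesgue. (f has_vector_derivative Complex (vderiv (\<lambda>x. Re (f x)) x) (vderiv (\<lambda>x. Im (f x)) x)) (at x)"
  using assms unfolding H1_complex_iff by (intro AC_loc_complex_deriv H1_AC) auto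

lemma H1_c_mono_support:
  fixes h :: "real \<Rightarrow> 'a::real_normed_vector" and k :: "real \<Rightarrow> 'b::real_normed_vector"
  assumes "h \<in> H1_c" "k \<in> H1_loc" "\<And>x. h x = 0 \<Longrightarrow> k x = 0"
  shows "k \<in> H1_c"
proof -
  have "{x. k x \<noteq> 0} \<subseteq> {x. h x \<noteq> 0}" using assms(3) by blast
  then have sub: "closure {x. k x \<noteq> 0} \<subseteq> closure {x. h x \<noteq> 0}" by (rule closure_mono)
  have c: "compact (closure {x. h x \<noteq> 0})" using assms(1) unfolding H1_c_def by blast
  have "compact (closure {x. k x \<noteq> 0})"
    using compact_Int_closed[OF c closed_closure[of "{x. k x \<noteq> 0}"]] unfolding inf.absorb2[OF sub] .
  then show ?thesis using assms(2) by (simp add: H1_c_def)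
qed

lemma H1_c_Re: "h \<in> H1_c \<Longrightarrow> (\<lambda>x. Re (h x)) \<in> H1_c"
  and H1_c_Im: "h \<in> H1_c \<Longrightarrow> (\<lambda>x. Im (h x)) \<in> H1_c"
  by (rule H1_c_mono_support[of h]; simp add: H1_c_def H1_complex_iff)+

lemma H1_of_real: "h \<in> H1_loc \<Longrightarrow> (\<lambda>x. complex_of_real (h x)) \<in> H1_loc"
  by (simp add: H1_complex_iff H1_const)

lemma H1_c_of_real: "h \<in> H1_c \<Longrightarrow> (\<lambda>x. complex_of_real (h x)) \<in> H1_c"
  by (rule H1_c_mono_support[of h]) (simp_all add: H1_of_real H1_c_def)

context periodic_data
begin

text \<open>The definition of a solution keeps its integrals separate, whereas \<open>defect\<close>
  collects the Lebesgue terms under one integral; to pass between them, each term must be integrable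
  on its own.\<close>

lemma pair_integrable:
  assumes f: "f \<in> H1_loc" and h: "h \<in> H1_c"
  shows "integrable lebesgue (\<lambda>x. vderiv f x * vderiv h x)" "integrable lebesgue (\<lambda>x. f x * h x)"
    "integrable lebesgue (\<lambda>x. u x * (f x * h x))"
    "integrable lebesgue (\<lambda>x. vderiv u x * (f x * vderiv h x + h x * vderiv f x))"
proof -
  have hH: "h \<in> H1_loc" using h by (simp add: H1_c_def)
  obtain p q where pq: "\<And>x. x \<notin> {p..q} \<Longrightarrow> h x = 0" using H1_c_support[OF h] by blast
  note z = pq vderiv_zero_outside[OF pq]
  have c: "continuous_on UNIV (\<lambda>x. f x * h x)" by (intro continuous_on_mult H1_loc_continuous f hH)
  show "integrable lebesgue (\<lambda>x. vderiv f x * vderiv h x)"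
    by (rule integrable_of_support[OF L2_loc_mult_integrable[OF H1_vderiv_L2[OF f] H1_vderiv_L2[OF hH], of p q]])
      (use z in simp)
  show "integrable lebesgue (\<lambda>x. f x * h x)"
    by (rule integrable_of_support[OF L2_loc_mult_integrable[OF H1_L2[OF f] H1_L2[OF hH], of p q]])
      (use z in simp)
  show "integrable lebesgue (\<lambda>x. u x * (f x * h x))"
    by (rule integrable_of_support[OF L2_loc_mult_integrable[OF H1_L2[OF u] continuous_L2_loc[OF c], of p q]])
      (use z in simp)
  have "(\<lambda>x. f x * vderiv h x + h x * vderiv f x) \<in> L2_loc"
    by (intro L2_loc_add L2_loc_cont_mult H1_loc_continuous H1_vderiv_L2 f hH)
  then show "integrable lebesgue (\<lambda>x. vderiv u x * (f x * vderiv h x + h x * vderiv f x))"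
    by (rule integrable_of_support[OF L2_loc_mult_integrable[OF H1_vderiv_L2[OF u], of _ p q]])
      (use z in simp)
qed

text \<open>For real z the coefficients are real, so by bilinearity the equation splits into four
  real pairings, arranged like the product of two complex numbers.\<close>

lemma solution_defect:
  fixes f h :: "real \<Rightarrow> complex"
  assumes f: "f \<in> H1_loc" and h: "h \<in> H1_c"
  defines "\<phi> \<equiv> \<lambda>x. Re (f x)" and "\<psi> \<equiv> \<lambda>x. Im (f x)" and "p \<equiv> \<lambda>x. Re (h x)" and "q \<equiv> \<lambda>x. Im (h x)"
  shows "(LINT x|lebesgue. vderiv f x * vderiv h x) + 1/4 * (LINT x|lebesgue. f x * h x)
      - (of_real z * omega u (\<lambda>x. f x * h x) + (of_real z)\<^sup>2 * (LINT x|\<upsilon>. f x * h x))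
    = Complex (defect z \<phi> p - defect z \<psi> q) (defect z \<phi> q + defect z \<psi> p)"
proof -
  have H: "\<phi> \<in> H1_loc" "\<psi> \<in> H1_loc" using f unfolding H1_complex_iff \<phi>_def \<psi>_def by auto
  have C: "p \<in> H1_c" "q \<in> H1_c" unfolding p_def q_def by (intro H1_c_Re H1_c_Im h)+
  have hH: "h \<in> H1_loc" using h by (simp add: H1_c_def)
  have fx: "f x = Complex (\<phi> x) (\<psi> x)" and hx: "h x = Complex (p x) (q x)" for x
    by (simp_all add: \<phi>_def \<psi>_def p_def q_def)
  have ae: "AE x in lebesgue. vderiv f x = Complex (vderiv \<phi> x) (vderiv \<psi> x) \<and> vderiv h x = Complex (vderiv p x) (vderiv q x)
      \<and> vderiv (\<lambda>x. f x * h x) x = f x * vderiv h x + h x * vderiv f x"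
    using H1_complex_deriv[OF f] H1_complex_deriv[OF hH]
  proof eventually_elim
    case (elim x)
    have "vderiv (\<lambda>x. f x * h x) x = f x * vderiv h x + vderiv f x * h x"
      unfolding vector_derivative_at[OF elim(1)] vector_derivative_at[OF elim(2)]
      by (rule vector_derivative_at[OF has_vector_derivative_mult[OF elim]])
    then show ?case
      using vector_derivative_at[OF elim(1)] vector_derivative_at[OF elim(2)]
      by (simp add: \<phi>_def \<psi>_def p_def q_def mult.commute)
  qed
  \<comment> \<open>Sixteen facts in groups of four: 1-4 for \<phi> and p, 5-8 for \<phi> and q,
    9-12 for \<psi> and p, 13-16 for \<psi> and q.\<close>
  note i = pair_integrable[OF H(1) C(1)] pair_integrable[OF H(1) C(2)] pair_integrable[OF H(2) C(1)] pair_integrable[OF H(2) C(2)]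
  have 1: "integrable lebesgue (\<lambda>x. vderiv f x * vderiv h x)"
    by (rule lebesgue_integral_Complex_AE(1)[OF Bochner_Integration.integrable_diff[OF i(1) i(13)]
          Bochner_Integration.integrable_add[OF i(5) i(9)]])
      (use ae in \<open>eventually_elim, simp add: complex_eq_iff\<close>)
  have 2: "integrable lebesgue (\<lambda>x. f x * h x)"
    by (rule lebesgue_integral_Complex_AE(1)[OF Bochner_Integration.integrable_diff[OF i(2) i(14)]
          Bochner_Integration.integrable_add[OF i(6) i(10)]])
      (simp add: complex_eq_iff fx hx)
  have 3: "integrable lebesgue (\<lambda>x. of_real (u x) * (f x * h x))"
    by (rule lebesgue_integral_Complex_AE(1)[OF Bochner_Integration.integrable_diff[OF i(3) i(15)]
          Bochner_Integration.integrable_add[OF i(7) i(11)]])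
      (simp add: complex_eq_iff fx hx algebra_simps)
  have 4: "integrable lebesgue (\<lambda>x. of_real (vderiv u x) * vderiv (\<lambda>x. f x * h x) x)"
  proof (rule lebesgue_integral_Complex_AE(1)[OF Bochner_Integration.integrable_diff[OF i(4) i(16)]
        Bochner_Integration.integrable_add[OF i(8) i(12)]])
    show "AE x in lebesgue. of_real (vderiv u x) * vderiv (\<lambda>x. f x * h x) x
      = Complex (vderiv u x * (\<phi> x * vderiv p x + p x * vderiv \<phi> x) - vderiv u x * (\<psi> x * vderiv q x + q x * vderiv \<psi> x))
          (vderiv u x * (\<phi> x * vderiv q x + q x * vderiv \<phi> x) + vderiv u x * (\<psi> x * vderiv p x + p x * vderiv \<psi> x))"
      using ae
    proof eventually_elim
      case (elim x)
      note e = elim[THEN conjunct1] elim[THEN conjunct2, THEN conjunct1] elim[THEN conjunct2, THEN conjunct2]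
      show ?case
        unfolding e(3) unfolding e(1,2) fx hx by (simp add: complex_eq_iff algebra_simps)
    qed
  qed
  let ?F = "\<lambda>x. (vderiv f x * vderiv h x + 1/4 * (f x * h x))
    - of_real z * (of_real (u x) * (f x * h x) + of_real (vderiv u x) * vderiv (\<lambda>x. f x * h x) x)"
  let ?L = "\<lambda>f h x. flux u z f x * vderiv h x + source u z f x * h x"
  have "(LINT x|lebesgue. vderiv f x * vderiv h x) + 1/4 * (LINT x|lebesgue. f x * h x) - of_real z * omega u (\<lambda>x. f x * h x)
      = (LINT x|lebesgue. ?F x)"
    unfolding omega_def
    by (simp only: Bochner_Integration.integral_diff[OF Bochner_Integration.integrable_add[OF 1 integrable_mult_right[OF 2]]
          integrable_mult_right[OF Bochner_Integration.integrable_add[OF 3 4]]]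
        Bochner_Integration.integral_add[OF 1 integrable_mult_right[OF 2]]
        Bochner_Integration.integral_add[OF 3 4] integral_mult_right_zero)
  also have "\<dots> = Complex (LINT x|lebesgue. ?L \<phi> p x - ?L \<psi> q x) (LINT x|lebesgue. ?L \<phi> q x + ?L \<psi> p x)"
  proof (rule lebesgue_integral_Complex_AE(2))
    show "integrable lebesgue (\<lambda>x. ?L \<phi> p x - ?L \<psi> q x)" "integrable lebesgue (\<lambda>x. ?L \<phi> q x + ?L \<psi> p x)"
      by (intro Bochner_Integration.integrable_diff Bochner_Integration.integrable_add defect_integrable H C)+
    show "AE x in lebesgue. ?F x = Complex (?L \<phi> p x - ?L \<psi> q x) (?L \<phi> q x + ?L \<psi> p x)"
      using ae
    proof eventually_elim
      case (elim x)
      note e = elim[THEN conjunct1] elim[THEN conjunct2, THEN conjunct1] elim[THEN conjunct2, THEN conjunct2]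
      show ?case
        unfolding e(3) unfolding e(1,2) fx hx
        by (simp add: complex_eq_iff flux_def source_def algebra_simps add_divide_distrib diff_divide_distrib)
    qed
  qed
  also have "\<dots> = Complex ((LINT x|lebesgue. ?L \<phi> p x) - (LINT x|lebesgue. ?L \<psi> q x)) ((LINT x|lebesgue. ?L \<phi> q x) + (LINT x|lebesgue. ?L \<psi> p x))"
    by (simp only: Bochner_Integration.integral_diff[OF defect_integrable(1)[OF H(1) C(1)] defect_integrable(1)[OF H(2) C(2)]]
        Bochner_Integration.integral_add[OF defect_integrable(1)[OF H(1) C(2)] defect_integrable(1)[OF H(2) C(1)]])
  finally have L: "(LINT x|lebesgue. vderiv f x * vderiv h x) + 1/4 * (LINT x|lebesgue. f x * h x) - of_real z * omega u (\<lambda>x. f x * h x)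
      = Complex ((LINT x|lebesgue. ?L \<phi> p x) - (LINT x|lebesgue. ?L \<psi> q x)) ((LINT x|lebesgue. ?L \<phi> q x) + (LINT x|lebesgue. ?L \<psi> p x))" .
  have "(LINT x|\<upsilon>. f x * h x) = (LINT x|\<upsilon>. Complex (\<phi> x * p x - \<psi> x * q x) (\<phi> x * q x + \<psi> x * p x))"
    by (simp add: fx hx complex_mult)
  also have "\<dots> = Complex (LINT x|\<upsilon>. \<phi> x * p x - \<psi> x * q x) (LINT x|\<upsilon>. \<phi> x * q x + \<psi> x * p x)"
    by (intro integral_Complex Bochner_Integration.integrable_diff Bochner_Integration.integrable_add defect_integrable H C)
  also have "\<dots> = Complex ((LINT x|\<upsilon>. \<phi> x * p x) - (LINT x|\<upsilon>. \<psi> x * q x)) ((LINT x|\<upsilon>. \<phi> x * q x) + (LINT x|\<upsilon>. \<psi> x * p x))"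
    by (simp only: Bochner_Integration.integral_diff[OF defect_integrable(2)[OF H(1) C(1)] defect_integrable(2)[OF H(2) C(2)]]
        Bochner_Integration.integral_add[OF defect_integrable(2)[OF H(1) C(2)] defect_integrable(2)[OF H(2) C(1)]])
  finally have V: "(LINT x|\<upsilon>. f x * h x) = Complex ((LINT x|\<upsilon>. \<phi> x * p x) - (LINT x|\<upsilon>. \<psi> x * q x)) ((LINT x|\<upsilon>. \<phi> x * q x) + (LINT x|\<upsilon>. \<psi> x * p x))" .
  have "(LINT x|lebesgue. vderiv f x * vderiv h x) + 1/4 * (LINT x|lebesgue. f x * h x)
      - (of_real z * omega u (\<lambda>x. f x * h x) + (of_real z)\<^sup>2 * (LINT x|\<upsilon>. f x * h x))
    = ((LINT x|lebesgue. vderiv f x * vderiv h x) + 1/4 * (LINT x|lebesgue. f x * h x) - of_real z * omega u (\<lambda>x. f x * h x))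
      - of_real (z\<^sup>2) * (LINT x|\<upsilon>. f x * h x)"
    by (simp only: of_real_power diff_diff_eq)
  also have "\<dots> = Complex (defect z \<phi> p - defect z \<psi> q) (defect z \<phi> q + defect z \<psi> p)"
    unfolding L V defect_def by (simp only: complex_of_real_mult_Complex complex_diff) (simp add: algebra_simps)
  finally show ?thesis .
qed

text \<open>Real test functions isolate the real and imaginary parts of \<open>f\<close>.
  Conversely, the real and imaginary parts of a complex test function are real test
  functions.\<close>

lemma is_solution_iff:
  fixes f :: "real \<Rightarrow> complex"
  assumes \<mu>: "\<upsilon> = upsilon u \<mu>"
  shows "is_solution u \<mu> (of_real z) f \<longleftrightarrow>
    real_solution u \<upsilon> z (\<lambda>x. Re (f x)) \<and> real_solution u \<upsilon> z (\<lambda>x. Im (f x))"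
proof -
  let ?\<phi> = "\<lambda>x. Re (f x)" and ?\<psi> = "\<lambda>x. Im (f x)"
  have *: "is_solution u \<mu> (of_real z) f \<longleftrightarrow> f \<in> H1_loc \<and> (\<forall>h\<in>H1_c.
      Complex (defect z ?\<phi> (\<lambda>x. Re (h x)) - defect z ?\<psi> (\<lambda>x. Im (h x)))
        (defect z ?\<phi> (\<lambda>x. Im (h x)) + defect z ?\<psi> (\<lambda>x. Re (h x))) = 0)"
    unfolding is_solution_def
    by (intro conj_cong refl ball_cong) (simp only: solution_defect[symmetric] \<mu>[symmetric] right_minus_eq)
  have z0: "defect z g (\<lambda>_. 0) = 0" for g by (simp add: defect_def vderiv_eqI)
  show ?thesis
    unfolding *
  proof (intro iffI)
    assume f: "f \<in> H1_loc \<and> (\<forall>h\<in>H1_c.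
      Complex (defect z ?\<phi> (\<lambda>x. Re (h x)) - defect z ?\<psi> (\<lambda>x. Im (h x)))
        (defect z ?\<phi> (\<lambda>x. Im (h x)) + defect z ?\<psi> (\<lambda>x. Re (h x))) = 0)"
    have "defect z ?\<phi> h = 0 \<and> defect z ?\<psi> h = 0" if "h \<in> H1_c" for h
      using f[THEN conjunct2, rule_format, OF H1_c_of_real[OF that]] by (simp add: z0 complex_eq_iff)
    then show "real_solution u \<upsilon> z ?\<phi> \<and> real_solution u \<upsilon> z ?\<psi>"
      using f unfolding real_solution_iff H1_complex_iff by simp
  next
    assume r: "real_solution u \<upsilon> z ?\<phi> \<and> real_solution u \<upsilon> z ?\<psi>"
    then have "defect z ?\<phi> h = 0" "defect z ?\<psi> h = 0" if "h \<in> H1_c" for h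
      using that by (simp_all add: real_solution_iff)
    then show "f \<in> H1_loc \<and> (\<forall>h\<in>H1_c.
      Complex (defect z ?\<phi> (\<lambda>x. Re (h x)) - defect z ?\<psi> (\<lambda>x. Im (h x)))
        (defect z ?\<phi> (\<lambda>x. Im (h x)) + defect z ?\<psi> (\<lambda>x. Re (h x))) = 0)"
      using r H1_c_Re H1_c_Im by (simp add: real_solution_iff H1_complex_iff complex_eq_iff)
  qed
qed

end

text \<open>This resolves the definite description: the two real quasi-derivatives provide
  existence, left-continuity provides uniqueness.\<close>

lemma quasi_deriv_eq:
  fixes f :: "real \<Rightarrow> complex"
  assumes f: "f \<in> H1_loc"
    and \<gamma>: "\<And>x. continuous (at_left x) \<gamma>" "AE x in lebesgue. \<gamma> x = flux u z (\<lambda>x. Re (f x)) x"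
    and \<delta>: "\<And>x. continuous (at_left x) \<delta>" "AE x in lebesgue. \<delta> x = flux u z (\<lambda>x. Im (f x)) x"
  shows "quasi_deriv u (of_real z) f = (\<lambda>x. Complex (\<gamma> x) (\<delta> x))"
  unfolding quasi_deriv_def
proof (rule the_equality)
  let ?E = "\<lambda>x. vderiv f x - of_real z * of_real (vderiv u x) * f x"
  have c: "continuous (at_left x) (\<lambda>x. Complex (\<gamma> x) (\<delta> x))" for x
    using \<gamma>(1)[of x] \<delta>(1)[of x] unfolding continuous_within by (rule tendsto_Complex)
  have e: "AE x in lebesgue. Complex (\<gamma> x) (\<delta> x) = ?E x"
    using \<gamma>(2) \<delta>(2) H1_complex_deriv[OF f]
  proof eventually_elim
    case (elim x)
    show ?case unfolding elim(1,2) vector_derivative_at[OF elim(3)] by (simp add: flux_def complex_eq_iff)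
  qed
  show "(\<forall>x. continuous (at_left x) (\<lambda>x. Complex (\<gamma> x) (\<delta> x))) \<and> (AE x in lebesgue. Complex (\<gamma> x) (\<delta> x) = ?E x)"
    using c e by blast
  fix g assume g: "(\<forall>x. continuous (at_left x) g) \<and> (AE x in lebesgue. g x = ?E x)"
  show "g = (\<lambda>x. Complex (\<gamma> x) (\<delta> x))"
  proof (rule left_continuous_AE_unique[OF _ c])
    show "continuous (at_left x) g" for x using g by blast
    show "AE x in lebesgue. g x = Complex (\<gamma> x) (\<delta> x)" using g[THEN conjunct2] e by eventually_elim simp
  qed
qed

section \<open>Periodicity of the singular part and the bound for complex eigenfunctions\<close>

lemma energy_shift:
  assumes u: "u \<in> H1_loc" and per: "\<And>x. u (x + l) = u x" and B: "B \<in> sets borel" "(\<lambda>x. x + l) ` B \<in> sets borel"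
  shows "energy u ((\<lambda>x. x + l) ` B) = energy u B"
proof -
  let ?w = "\<lambda>x. ennreal ((u x)\<^sup>2 + (vderiv u x)\<^sup>2)"
  have [measurable]: "u \<in> borel_measurable lebesgue" "vderiv u \<in> borel_measurable lebesgue"
    using L2_loc_measurable H1_L2[OF u] H1_vderiv_L2[OF u] by auto
  have [measurable]: "(\<lambda>x. x + l) ` B \<in> sets lebesgue" using B(2) by simp
  have m: "(\<lambda>x. ?w x * indicator ((\<lambda>x. x + l) ` B) x) \<in> borel_measurable (distr lebesgue lebesgue (\<lambda>x. x + l))"
    unfolding lebesgue_shift by measurable
  have v: "vderiv u (x + l) = vderiv u x" for x using vderiv_shift[of u l x] by (simp add: per)
  have "energy u ((\<lambda>x. x + l) ` B) = integral\<^sup>N (distr lebesgue lebesgue (\<lambda>x. x + l)) (\<lambda>x. ?w x * indicator ((\<lambda>x. x + l) ` B) x)"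
    unfolding lebesgue_shift energy_def ..
  also have "\<dots> = (\<integral>\<^sup>+x. ?w (x + l) * indicator ((\<lambda>x. x + l) ` B) (x + l) \<partial>lebesgue)"
    by (rule nn_integral_distr[OF lebesgue_shift_measurable m])
  also have "\<dots> = energy u B"
    unfolding energy_def by (intro nn_integral_cong) (auto simp: per v indicator_def)
  finally show ?thesis .
qed

text \<open>Since \<mu> and the energy are periodic, the translate of \<open>upsilon u \<mu>\<close>
  fits into the same decomposition of \<mu>, and that decomposition is unique.\<close>

lemma upsilon_periodic:
  assumes D: "(u, \<mu>) \<in> D_per l" and B: "B \<in> sets borel"
  shows "emeasure (upsilon u \<mu>) ((\<lambda>x. x + l) ` B) = emeasure (upsilon u \<mu>) B"
proof -
  have u: "u \<in> H1_loc" "\<And>x. u (x + l) = u x" and \<mu>: "borel_measure \<mu>"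
    and \<mu>_per: "\<And>B. B \<in> sets borel \<Longrightarrow> emeasure \<mu> ((\<lambda>x. x + l) ` B) = emeasure \<mu> B"
    using D by (auto simp: D_per_def)
  note \<upsilon> = upsilon[OF D]
  note sets = borel_measureD(1)[OF \<upsilon>(1)] and space = borel_measureD(2)[OF \<upsilon>(1)]
  define \<upsilon>' where "\<upsilon>' = distr (upsilon u \<mu>) borel (\<lambda>x. x - l)"
  have img: "(\<lambda>x. x + l) ` B = (\<lambda>x. x - l) -` B" for B :: "real set"
    by (auto intro!: image_eqI[of _ "\<lambda>x. x + l" "_ - l"])
  have meas: "(\<lambda>x. x - l) \<in> measurable (upsilon u \<mu>) borel" using sets by (simp cong: measurable_cong_sets)
  have imgm: "(\<lambda>x. x + l) ` B \<in> sets borel" if "B \<in> sets borel" for B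
    using measurable_sets[OF meas that] by (simp add: img sets space)
  have \<upsilon>': "emeasure \<upsilon>' B = emeasure (upsilon u \<mu>) ((\<lambda>x. x + l) ` B)" if "B \<in> sets borel" for B
    unfolding \<upsilon>'_def emeasure_distr[OF meas that] by (simp add: img space)
  have "\<upsilon>' = upsilon u \<mu>"
  proof (rule upsilon_unique[OF \<mu> _ _ \<upsilon>])
    show "borel_measure \<upsilon>'"
      unfolding borel_measure_def
    proof (intro conjI allI impI)
      show "sets \<upsilon>' = sets borel" by (simp add: \<upsilon>'_def)
      fix K :: "real set" assume K: "compact K"
      have "(\<lambda>x. x + l) ` K = (+) l ` K" by (simp add: add.commute)
      then have "compact ((\<lambda>x. x + l) ` K)" using compact_translation[OF K, of l] by simp
      then show "emeasure \<upsilon>' K < \<infinity>"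
        using \<upsilon>(1) \<upsilon>'[OF borel_compact[OF K]] by (simp add: borel_measure_def)
    qed
    show "emeasure \<mu> B = energy u B + emeasure \<upsilon>' B" if B: "B \<in> sets borel" for B
      using \<upsilon>(2)[OF imgm[OF B]] unfolding \<mu>_per[OF B] \<upsilon>'[OF B] energy_shift[OF u B imgm[OF B]] .
  qed
  then show ?thesis using \<upsilon>'[OF B] by simp
qed

context periodic_data
begin

text \<open>Both directions between \<open>P\<close> and the spectrum are used: a real eigenfunction
  in \<open>P\<close> for -t with t \<ge> 0 would put -t into the spectrum, while a complex
  eigenfunction for \<open>lam\<close> must yield a real one in \<open>P\<close>.\<close>

lemma spectrum_bound:
  assumes \<mu>: "\<upsilon> = upsilon u \<mu>" and sub: "spectrum_pm s a l u \<mu> \<subseteq> complex_of_real ` {0<..}"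
    and lam: "complex_of_real lam \<in> spectrum_pm s a l u \<mu>"
  shows "1 / lam \<le> Csob * (LINT x:{a..a+l}|lebesgue. u x)"
proof -
  note sol = is_solution_iff[OF \<mu>]
  have no_eigenfunction: "\<not> real_solution u \<upsilon> (-t) f" if t: "t \<ge> 0" and f: "f \<in> P" "f \<noteq> (\<lambda>_. 0)" for t f
  proof
    assume r: "real_solution u \<upsilon> (-t) f"
    obtain \<gamma> where \<gamma>: "\<And>x. continuous (at_left x) \<gamma>" "AE x in lebesgue. \<gamma> x = flux u (-t) f x"
      by (rule quasi_derivative_exists[OF u \<upsilon> r]) (rule that)
    \<comment> \<open>The imaginary part of the real function regarded as complex-valued.\<close>
    have r0: "real_solution u \<upsilon> (-t) (\<lambda>_. 0)"
      by (simp add: real_solution_def flux_def source_def H1_const vderiv_eqI)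
    let ?f = "\<lambda>x. complex_of_real (f x)"
    have f1: "is_solution u \<mu> (of_real (-t)) ?f" unfolding sol using r r0 by simp
    have f2: "quasi_deriv u (of_real (-t)) ?f = (\<lambda>x. Complex (\<gamma> x) 0)"
      by (rule quasi_deriv_eq) (use \<gamma> P_H1[OF f(1)] in \<open>simp_all add: H1_of_real flux_def vderiv_eqI\<close>)
    have f3: "\<exists>x. ?f x \<noteq> 0" using f(2) by auto
    have f4: "?f a = of_real s * ?f (a + l)"
      using f(1) ss by (simp add: P_def flip: of_real_mult mult.assoc)
    have "\<gamma> a = s * \<gamma> (a + l)"
      using quasi_derivative_periodic[OF f(1) \<gamma>, of a] ss by (simp flip: mult.assoc)
    then have "quasi_deriv u (of_real (-t)) ?f a = of_real s * quasi_deriv u (of_real (-t)) ?f (a + l)"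
      unfolding f2 by (simp add: complex_eq_iff)
    then have "complex_of_real (-t) \<in> spectrum_pm s a l u \<mu>"
      unfolding spectrum_pm_def using f1 f3 f4 by blast
    then have "complex_of_real (-t) \<in> complex_of_real ` {0<..}" using sub by blast
    then show False using t by auto
  qed
  obtain f where f: "is_solution u \<mu> (of_real lam) f" and nz: "\<exists>x. f x \<noteq> 0"
    and bc: "f a = of_real s * f (a + l)" "quasi_deriv u (of_real lam) f a = of_real s * quasi_deriv u (of_real lam) f (a + l)"
    using lam unfolding spectrum_pm_def by blast
  have pos: "lam > 0" using sub lam by auto
  have fH: "f \<in> H1_loc" using f by (simp add: is_solution_def)
  have r: "real_solution u \<upsilon> lam (\<lambda>x. Re (f x))" "real_solution u \<upsilon> lam (\<lambda>x. Im (f x))"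
    using f unfolding sol by auto
  obtain \<gamma> where \<gamma>: "\<And>x. continuous (at_left x) \<gamma>" "AE x in lebesgue. \<gamma> x = flux u lam (\<lambda>x. Re (f x)) x"
    by (rule quasi_derivative_exists[OF u \<upsilon> r(1)]) (rule that)
  obtain \<delta> where \<delta>: "\<And>x. continuous (at_left x) \<delta>" "AE x in lebesgue. \<delta> x = flux u lam (\<lambda>x. Im (f x)) x"
    by (rule quasi_derivative_exists[OF u \<upsilon> r(2)]) (rule that)
  have q: "\<gamma> a = s * \<gamma> (a + l)" "\<delta> a = s * \<delta> (a + l)"
    using bc(2) unfolding quasi_deriv_eq[OF fH \<gamma> \<delta>] by (simp_all add: complex_eq_iff)
  have P: "(\<lambda>x. Re (f x)) \<in> P" "(\<lambda>x. Im (f x)) \<in> P"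
    by (rule solution_in_P[OF r(1) \<gamma> _ q(1)], simp add: bc(1))
      (rule solution_in_P[OF r(2) \<delta> _ q(2)], simp add: bc(1))
  \<comment> \<open>Whichever of the real and imaginary parts does not vanish identically serves as
    a real eigenfunction.\<close>
  obtain g where g: "g \<in> P" "g \<noteq> (\<lambda>_. 0)" "real_solution u \<upsilon> lam g"
  proof (cases "(\<lambda>x. Re (f x)) = (\<lambda>_. 0)")
    case True
    then have "(\<lambda>x. Im (f x)) \<noteq> (\<lambda>_. 0)" using nz by (metis complex_eq_iff zero_complex.simps)
    then show ?thesis using that P(2) r(2) by blast
  next
    case False
    then show ?thesis using that P(1) r(1) by blast
  qed
  have "1 / lam \<le> Csob * (LINT x:I0|lebesgue. u x)"
    by (rule eigenvalue_bound[OF no_eigenfunction g pos])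
  also have "(LINT x:I0|lebesgue. u x) = (LINT x:{a..a+l}|lebesgue. u x)"
    by (rule lebesgue_integral_interval_ends[of _ _ _ a "a + l"])
      (use l L2_loc_measurable[OF H1_L2[OF u]] in auto)
  finally show ?thesis .
qed

end

theorem corollary4p3:
  fixes l a s lam :: real and u :: "real \<Rightarrow> real" and \<mu> :: "real measure"
  assumes "l > 0"
    and "(u, \<mu>) \<in> D_per l"
    and "s = 1 \<or> s = -1"
    and "spectrum_pm s a l u \<mu> \<subseteq> complex_of_real ` {0<..}"
    and "complex_of_real lam \<in> spectrum_pm s a l u \<mu>"
  shows "1 / lam \<le> sinh (l/2) / (cosh (l/2) - s) * (LINT x:{a..a+l}|lebesgue. u x)"
proof -
  have u: "u \<in> H1_loc" "\<And>x. u (x + l) = u x" using assms(2) by (auto simp: D_per_def)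
  have D: "periodic_data u (upsilon u \<mu>) l s"
    by (rule periodic_data.intro[OF assms(1) u upsilon(1)[OF assms(2)] upsilon_periodic[OF assms(2)] assms(3)])
  show ?thesis
    using periodic_data.spectrum_bound[OF D refl assms(4,5)] unfolding periodic_data.Csob_def[OF D] .
qed

end
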